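(* Let ${\mathfrak A}=\langle {\mathfrak F}_n \,\|\, u_l=0\ (l\in L),\ w_t^-=0\ (t\in T)\rangle$ be the quotient of ${\mathfrak F}_n$ by the ideal generated by a family of polynomials $u_l$ in $x_1,\dots,x_n$ and a family of polynomials $w_t^-$ in $x_1^-,\dots,x_n^-$, all homogeneous in each variable and of total degree $>1$, and assume that ${\mathfrak A}^+=\langle G\langle X\rangle \,\|\, u_l=0\rangle$ and ${\mathfrak A}^-=\langle F\langle X^-\rangle \,\|\, w_t^-=0\rangle$ are Hopf algebras. Then every $\Gamma$-homogeneous right coideal subalgebra $U\supset H$ of ${\mathfrak A}$ has a decomposition $$U=U^-\otimes_{\mathbf k[F]}\mathbf k[H]\otimes_{\mathbf k[G]}U^+,$$ where $U^-\supset F$ and $U^+\supset G$ are homogeneous right coideal subalgebras of ${\mathfrak A}^-$ and ${\mathfrak A}^+$, respectively.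
   Context: Let $\mathbf k$ be a field, $X=\{x_1,\dots,x_n\}$, $X^-=\{x_1^-,\dots,x_n^-\}$, and $0\neq p_{ij}\in\mathbf k$ for $1\le i,j\le n$. Let $g_j$ be the linear map $x_i\mapsto p_{ij}x_i$ on the span of $X$, $G$ the group generated by $g_1,\dots,g_n$; let $f_j$ be the linear map $x_i^-\mapsto p_{ji}^{-1}x_i^-$ on the span of $X^-$, $F$ the group generated by $f_1,\dots,f_n$. Let $\chi^i$ be the character of $G\times F$ with $\chi^i(g_j)=p_{ij}$, $\chi^i(f_j)=p_{ji}$. Let $H=(G\times F)/N$, where $N$ is a subgroup with $\chi^i(N)=1$ for all $i$; it is assumed that $G,F\subseteq H$. $H\langle X\cup X^-\rangle$ is the skew group algebra generated by $H$ and the free algebra on $X\cup X^-$ with $x_ih=\chi^i(h)hx_i$, $x_i^-h=\chi^i(h)^{-1}hx_i^-$ ($h\in H$). The algebra ${\mathfrak F}_n$ is the quotient of $H\langle X\cup X^-\rangle$ by the relations $x_ix_j^--p_{ji}x_j^-x_i=\delta_i^j(1-g_if_i)$, $1\le i,j\le n$. It is a Hopf algebra with $\Delta(x_i)=x_i\otimes1+g_i\otimes x_i$, $\Delta(x_i^-)=x_i^-\otimes1+f_i\otimes x_i^-$, and with $g_i,f_i$ group-like. $G\langle X\rangle$ and $F\langle X^-\rangle$ are its Hopf subalgebras generated by $G\cup X$ and by $F\cup X^-$, respectively. Under the stated hypotheses ${\mathfrak A}$ is a Hopf algebra and has the known triangular decomposition ${\mathfrak A}={\mathfrak A}^-\otimes_{\mathbf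 k[F]}\mathbf k[H]\otimes_{\mathbf k[G]}{\mathfrak A}^+$ (multiplication is a linear isomorphism); the decomposition of $U$ is understood in the same sense (as a subspace of this tensor product, via multiplication). $\Gamma$ is the free abelian group on $x_1,\dots,x_n$; ${\mathfrak F}_n$ and ${\mathfrak A}$ are $\Gamma$-graded by $\deg x_i=x_i$, $\deg x_i^-=-x_i$, $\deg h=0$ for $h\in H$. A subalgebra is $\Gamma$-homogeneous if it is spanned by its $\Gamma$-homogeneous elements; for ${\mathfrak A}^{\pm}$ "homogeneous" means homogeneous in each $x_i$ (resp. $x_i^-$). A right coideal subalgebra of a Hopf algebra $A$ is a subalgebra $U$ with $\Delta(U)\subseteq U\otimes A$. *)

theory Defs
  imports
    "HOL-Algebra.QuotRing" "HOL-Algebra.Subrings" "HOL-Algebra.Bij"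
    "HOL-Algebra.Generated_Groups" "HOL-Library.Poly_Mapping"
begin

section \<open>Algebras over a field\<close>

text \<open>
  A \<open>k\<close>-algebra is a record of type \<^typ>\<open>('k, 'a) module\<close>: a ring in the sense of HOL-Algebra
  together with a scalar multiplication by the elements of a field \<open>'k\<close>, where the field is a type.
  (The locale \<open>algebra\<close> of HOL-Algebra only covers commutative algebras.)
\<close>

locale k_algebra = ring A for A :: "('k::field, 'a) module" (structure) +
  assumes smult_closed: "x \<in> carrier A \<Longrightarrow> c \<odot> x \<in> carrier A"
    and smult_l_distr: "x \<in> carrier A \<Longrightarrow> (c + d) \<odot> x = c \<odot> x \<oplus> d \<odot> x"
    and smult_r_distr: "x \<in> carrier A \<Longrightarrow> y \<in> carrier A \<Longrightarrow> c \<odot> (x \<oplus> y) = c \<odot> x \<oplus> c \<odot> y"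
    and smult_assoc: "x \<in> carrier A \<Longrightarrow> (c * d) \<odot> x = c \<odot> (d \<odot> x)"
    and smult_one: "x \<in> carrier A \<Longrightarrow> 1 \<odot> x = x"
    and smult_mult_l: "x \<in> carrier A \<Longrightarrow> y \<in> carrier A \<Longrightarrow> (c \<odot> x) \<otimes> y = c \<odot> (x \<otimes> y)"
    and smult_mult_r: "x \<in> carrier A \<Longrightarrow> y \<in> carrier A \<Longrightarrow> x \<otimes> (c \<odot> y) = c \<odot> (x \<otimes> y)"

definition alg_hom :: "('k::field, 'a) module \<Rightarrow> ('k, 'b) module \<Rightarrow> ('a \<Rightarrow> 'b) set" where
  "alg_hom A B = {\<phi> \<in> ring_hom A B. \<forall>c. \<forall>x\<in>carrier A. \<phi> (c \<odot>\<^bsub>A\<^esub> x) = c \<odot>\<^bsub>B\<^esub> \<phi> x}"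

definition lin_subspace :: "'a set \<Rightarrow> ('k::field, 'a) module \<Rightarrow> bool" where
  "lin_subspace W A \<longleftrightarrow> subgroup W (add_monoid A) \<and> (\<forall>c. \<forall>x\<in>W. c \<odot>\<^bsub>A\<^esub> x \<in> W)"

definition lin_span :: "('k::field, 'a) module \<Rightarrow> 'a set \<Rightarrow> 'a set" where
  "lin_span A S = \<Inter>{W. lin_subspace W A \<and> S \<subseteq> W}"

definition k_subalgebra :: "'a set \<Rightarrow> ('k::field, 'a) module \<Rightarrow> bool" where
  "k_subalgebra U A \<longleftrightarrow> subring U A \<and> (\<forall>c. \<forall>x\<in>U. c \<odot>\<^bsub>A\<^esub> x \<in> U)"

definition gen_subalgebra :: "('k::field, 'a) module \<Rightarrow> 'a set \<Rightarrow> 'a set" where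
  "gen_subalgebra A S = \<Inter>{U. k_subalgebra U A \<and> S \<subseteq> U}"

definition quot_alg :: "('k::field, 'a) module \<Rightarrow> 'a set \<Rightarrow> ('k, 'a set) module" where
  "quot_alg A I = ring.extend (A Quot I)
     (module.fields (\<lambda>c X. set_add A I ((\<lambda>x. c \<odot>\<^bsub>A\<^esub> x) ` X)))"

text \<open>
  The algebra with basis the monoid \<open>M\<close> and multiplication \<open>s \<cdot> t = \<tau>(s,t) st\<close> of basis elements.
  For \<open>\<tau> = 1\<close> it is the monoid (group) algebra \<open>k[M]\<close>.
\<close>

definition twisted_alg ::
  "('b, 'm) monoid_scheme \<Rightarrow> ('b \<Rightarrow> 'b \<Rightarrow> 'k::field) \<Rightarrow> ('k, 'b \<Rightarrow>\<^sub>0 'k) module" where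
  "twisted_alg M \<tau> =
     \<lparr>carrier = {a. Poly_Mapping.keys a \<subseteq> carrier M},
      mult = (\<lambda>a b. \<Sum>s\<in>Poly_Mapping.keys a. \<Sum>t\<in>Poly_Mapping.keys b.
                Poly_Mapping.single (s \<otimes>\<^bsub>M\<^esub> t)
                  (Poly_Mapping.lookup a s * Poly_Mapping.lookup b t * \<tau> s t)),
      one = Poly_Mapping.single \<one>\<^bsub>M\<^esub> 1,
      zero = 0,
      add = (+),
      smult = (\<lambda>c. Poly_Mapping.map (\<lambda>x. c * x))\<rparr>"

definition monoid_alg :: "('b, 'm) monoid_scheme \<Rightarrow> ('k::field, 'b \<Rightarrow>\<^sub>0 'k) module" where
  "monoid_alg M = twisted_alg M (\<lambda>_ _. 1)"

abbreviation bas :: "'b \<Rightarrow> ('b \<Rightarrow>\<^sub>0 'k::field)" where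
  "bas s \<equiv> Poly_Mapping.single s 1"

text \<open>The linear extension of a map \<open>\<beta>\<close> from a basis, and the map that it induces on cosets.\<close>

definition lin_ext :: "('k::field, 'a) module \<Rightarrow> ('b \<Rightarrow> 'a) \<Rightarrow> ('b \<Rightarrow>\<^sub>0 'k) \<Rightarrow> 'a" where
  "lin_ext A \<beta> \<phi> =
     finsum A (\<lambda>s. Poly_Mapping.lookup \<phi> s \<odot>\<^bsub>A\<^esub> \<beta> s) (Poly_Mapping.keys \<phi>)"

definition coset_lift :: "('k::field, 'a) module \<Rightarrow> ('b \<Rightarrow> 'a) \<Rightarrow> ('b \<Rightarrow>\<^sub>0 'k) set \<Rightarrow> 'a" where
  "coset_lift A \<beta> C = the_elem (lin_ext A \<beta> ` C)"


section \<open>Tensor products\<close>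

text \<open>
  Every tensor product is the free vector space on a product set modulo the usual relations.  The
  free vector space on \<open>A \<times> B\<close> is the monoid algebra of the multiplicative monoid \<open>A \<times> B\<close>, so
  that its quotient \<open>A \<otimes> B\<close> gets the multiplication \<open>(a \<otimes> b)(a' \<otimes> b') = aa' \<otimes> bb'\<close>.
\<close>

definition tensor_rel ::
  "('k::field, 'a) module \<Rightarrow> ('k, 'b) module \<Rightarrow> ('a \<times> 'b \<Rightarrow>\<^sub>0 'k) set" where
  "tensor_rel A B = lin_span (monoid_alg (A \<times>\<times> B))
    ({bas (a \<oplus>\<^bsub>A\<^esub> a', b) - bas (a, b) - bas (a', b) | a a' b.
        a \<in> carrier A \<and> a' \<in> carrier A \<and> b \<in> carrier B} \<union>
     {bas (a, b \<oplus>\<^bsub>B\<^esub> b') - bas (a, b) - bas (a, b') | a b b'.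
        a \<in> carrier A \<and> b \<in> carrier B \<and> b' \<in> carrier B} \<union>
     {bas (c \<odot>\<^bsub>A\<^esub> a, b) - Poly_Mapping.single (a, b) c | c a b.
        a \<in> carrier A \<and> b \<in> carrier B} \<union>
     {bas (a, c \<odot>\<^bsub>B\<^esub> b) - Poly_Mapping.single (a, b) c | c a b.
        a \<in> carrier A \<and> b \<in> carrier B})"

definition tensor ::
  "('k::field, 'a) module \<Rightarrow> ('k, 'b) module \<Rightarrow> ('k, ('a \<times> 'b \<Rightarrow>\<^sub>0 'k) set) module" where
  "tensor A B = quot_alg (monoid_alg (A \<times>\<times> B)) (tensor_rel A B)"

definition tens ::
  "('k::field, 'a) module \<Rightarrow> ('k, 'b) module \<Rightarrow> 'a \<Rightarrow> 'b \<Rightarrow> ('a \<times> 'b \<Rightarrow>\<^sub>0 'k) set" where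
  "tens A B a b = tensor_rel A B +>\<^bsub>monoid_alg (A \<times>\<times> B)\<^esub> bas (a, b)"

text \<open>
  The balanced tensor product \<open>M \<otimes>\<^sub>R P \<otimes>\<^sub>S Q\<close> for subalgebras \<open>R, S\<close> of \<open>P\<close>, where \<open>R\<close> acts on \<open>M\<close>
  from the right through \<open>\<rho> : R \<rightarrow> M\<close>, and \<open>S\<close> acts on \<open>Q\<close> from the left through \<open>\<sigma> : S \<rightarrow> Q\<close>.
  Only the vector space structure of the free space on \<open>M \<times> P \<times> Q\<close> is used.
\<close>

definition tensor3_rel ::
  "('k::field, 'a) module \<Rightarrow> ('p \<Rightarrow> 'a) \<Rightarrow> 'p set \<Rightarrow> ('k, 'p) module \<Rightarrow> 'p set \<Rightarrow> ('p \<Rightarrow> 'b) \<Rightarrow>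
   ('k, 'b) module \<Rightarrow> ('a \<times> 'p \<times> 'b \<Rightarrow>\<^sub>0 'k) set" where
  "tensor3_rel M \<rho> R P S \<sigma> Q = lin_span (monoid_alg (M \<times>\<times> P \<times>\<times> Q))
    ({bas (m \<oplus>\<^bsub>M\<^esub> m', x, y) - bas (m, x, y) - bas (m', x, y) | m m' x y.
        m \<in> carrier M \<and> m' \<in> carrier M \<and> x \<in> carrier P \<and> y \<in> carrier Q} \<union>
     {bas (m, x \<oplus>\<^bsub>P\<^esub> x', y) - bas (m, x, y) - bas (m, x', y) | m x x' y.
        m \<in> carrier M \<and> x \<in> carrier P \<and> x' \<in> carrier P \<and> y \<in> carrier Q} \<union>
     {bas (m, x, y \<oplus>\<^bsub>Q\<^esub> y') - bas (m, x, y) - bas (m, x, y') | m x y y'.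
        m \<in> carrier M \<and> x \<in> carrier P \<and> y \<in> carrier Q \<and> y' \<in> carrier Q} \<union>
     {bas (c \<odot>\<^bsub>M\<^esub> m, x, y) - Poly_Mapping.single (m, x, y) c | c m x y.
        m \<in> carrier M \<and> x \<in> carrier P \<and> y \<in> carrier Q} \<union>
     {bas (m, c \<odot>\<^bsub>P\<^esub> x, y) - Poly_Mapping.single (m, x, y) c | c m x y.
        m \<in> carrier M \<and> x \<in> carrier P \<and> y \<in> carrier Q} \<union>
     {bas (m, x, c \<odot>\<^bsub>Q\<^esub> y) - Poly_Mapping.single (m, x, y) c | c m x y.
        m \<in> carrier M \<and> x \<in> carrier P \<and> y \<in> carrier Q} \<union>
     {bas (m \<otimes>\<^bsub>M\<^esub> \<rho> r, x, y) - bas (m, r \<otimes>\<^bsub>P\<^esub> x, y) | m r x y.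
        m \<in> carrier M \<and> r \<in> R \<and> x \<in> carrier P \<and> y \<in> carrier Q} \<union>
     {bas (m, x \<otimes>\<^bsub>P\<^esub> s, y) - bas (m, x, \<sigma> s \<otimes>\<^bsub>Q\<^esub> y) | m x s y.
        m \<in> carrier M \<and> x \<in> carrier P \<and> s \<in> S \<and> y \<in> carrier Q})"

definition tensor3 ::
  "('k::field, 'a) module \<Rightarrow> ('p \<Rightarrow> 'a) \<Rightarrow> 'p set \<Rightarrow> ('k, 'p) module \<Rightarrow> 'p set \<Rightarrow> ('p \<Rightarrow> 'b) \<Rightarrow>
   ('k, 'b) module \<Rightarrow> ('a \<times> 'p \<times> 'b \<Rightarrow>\<^sub>0 'k) set set" where
  "tensor3 M \<rho> R P S \<sigma> Q =
     a_rcosets\<^bsub>monoid_alg (M \<times>\<times> P \<times>\<times> Q)\<^esub> (tensor3_rel M \<rho> R P S \<sigma> Q)"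


section \<open>Hopf algebras and coideal subalgebras\<close>

definition hopf_algebra ::
  "('k::field, 'a) module \<Rightarrow> ('a \<Rightarrow> ('a \<times> 'a \<Rightarrow>\<^sub>0 'k) set) \<Rightarrow> ('a \<Rightarrow> 'k) \<Rightarrow> ('a \<Rightarrow> 'a) \<Rightarrow> bool" where
  "hopf_algebra A \<Delta> \<epsilon> S \<longleftrightarrow>
     k_algebra A \<and>
     \<Delta> \<in> alg_hom A (tensor A A) \<and>
     (\<forall>x\<in>carrier A. \<forall>y\<in>carrier A. \<epsilon> (x \<otimes>\<^bsub>A\<^esub> y) = \<epsilon> x * \<epsilon> y \<and> \<epsilon> (x \<oplus>\<^bsub>A\<^esub> y) = \<epsilon> x + \<epsilon> y) \<and>
     (\<forall>c. \<forall>x\<in>carrier A. \<epsilon> (c \<odot>\<^bsub>A\<^esub> x) = c * \<epsilon> x) \<and> \<epsilon> \<one>\<^bsub>A\<^esub> = 1 \<and>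
     S \<in> carrier A \<rightarrow> carrier A \<and>
     (\<forall>x\<in>carrier A. \<forall>y\<in>carrier A. S (x \<oplus>\<^bsub>A\<^esub> y) = S x \<oplus>\<^bsub>A\<^esub> S y) \<and>
     (\<forall>c. \<forall>x\<in>carrier A. S (c \<odot>\<^bsub>A\<^esub> x) = c \<odot>\<^bsub>A\<^esub> S x) \<and>
     (\<forall>x\<in>carrier A.
        (let AA = tensor A A; AAA = tensor AA A in
          coset_lift AAA (\<lambda>(a, b). tens AA A (\<Delta> a) b) (\<Delta> x) =
          coset_lift AAA (\<lambda>(a, b).
            coset_lift AAA (\<lambda>(b1, b2). tens AA A (tens A A a b1) b2) (\<Delta> b)) (\<Delta> x)) \<and>
        coset_lift A (\<lambda>(a, b). \<epsilon> a \<odot>\<^bsub>A\<^esub> b) (\<Delta> x) = x \<and>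
        coset_lift A (\<lambda>(a, b). \<epsilon> b \<odot>\<^bsub>A\<^esub> a) (\<Delta> x) = x \<and>
        coset_lift A (\<lambda>(a, b). S a \<otimes>\<^bsub>A\<^esub> b) (\<Delta> x) = \<epsilon> x \<odot>\<^bsub>A\<^esub> \<one>\<^bsub>A\<^esub> \<and>
        coset_lift A (\<lambda>(a, b). a \<otimes>\<^bsub>A\<^esub> S b) (\<Delta> x) = \<epsilon> x \<odot>\<^bsub>A\<^esub> \<one>\<^bsub>A\<^esub>)"

text \<open>
  \<open>\<Delta>\<close> is a coproduct for which the elements of \<open>\<G>\<close> are group-like and for which
  \<open>\<Delta>(x) = x \<otimes> 1 + g \<otimes> x\<close> for all \<open>(x, g) \<in> \<X>\<close>.  If \<open>A\<close> is generated by \<open>\<G>\<close>, the inverses of its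
  elements and the first components of \<open>\<X>\<close>, there is at most one such map.
\<close>

definition is_coproduct ::
  "('k::field, 'a) module \<Rightarrow> 'a set \<Rightarrow> ('a \<times> 'a) set \<Rightarrow> ('a \<Rightarrow> ('a \<times> 'a \<Rightarrow>\<^sub>0 'k) set) \<Rightarrow> bool" where
  "is_coproduct A \<G> \<X> \<Delta> \<longleftrightarrow>
     \<Delta> \<in> alg_hom A (tensor A A) \<and> \<Delta> \<in> extensional (carrier A) \<and>
     (\<forall>g\<in>\<G>. \<Delta> g = tens A A g g) \<and>
     (\<forall>(x, g)\<in>\<X>. \<Delta> x = tens A A x \<one>\<^bsub>A\<^esub> \<oplus>\<^bsub>tensor A A\<^esub> tens A A g x)"

definition coproduct ::
  "('k::field, 'a) module \<Rightarrow> 'a set \<Rightarrow> ('a \<times> 'a) set \<Rightarrow> ('a \<Rightarrow> ('a \<times> 'a \<Rightarrow>\<^sub>0 'k) set)" where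
  "coproduct A \<G> \<X> = (THE \<Delta>. is_coproduct A \<G> \<X> \<Delta>)"

definition is_hopf_algebra ::
  "('k::field, 'a) module \<Rightarrow> 'a set \<Rightarrow> ('a \<times> 'a) set \<Rightarrow> bool" where
  "is_hopf_algebra A \<G> \<X> \<longleftrightarrow> (\<exists>\<Delta> \<epsilon> S. is_coproduct A \<G> \<X> \<Delta> \<and> hopf_algebra A \<Delta> \<epsilon> S)"

definition right_coideal_subalgebra ::
  "('k::field, 'a) module \<Rightarrow> ('a \<Rightarrow> ('a \<times> 'a \<Rightarrow>\<^sub>0 'k) set) \<Rightarrow> 'a set \<Rightarrow> bool" where
  "right_coideal_subalgebra A \<Delta> U \<longleftrightarrow>
     k_subalgebra U A \<and>
     (\<forall>x\<in>U. \<Delta> x \<in> lin_span (tensor A A) {tens A A a b | a b. a \<in> U \<and> b \<in> carrier A})"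

text \<open>
  \<open>U\<close> is spanned by the homogeneous elements that it contains, the homogeneous elements of
  degree \<open>d\<close> being those of \<open>C d\<close>.
\<close>

definition spanned_by_homogeneous ::
  "('k::field, 'a) module \<Rightarrow> ('d \<Rightarrow> 'a set) \<Rightarrow> 'a set \<Rightarrow> bool" where
  "spanned_by_homogeneous A C U \<longleftrightarrow> lin_span A (\<Union>d. U \<inter> C d) = U"


section \<open>The groups \<open>G\<close>, \<open>F\<close> and \<open>H\<close>\<close>

text \<open>
  The index set of the variables is a finite type \<open>'n\<close>.  The span of \<open>X\<close>, and likewise that of
  \<open>X\<^sup>-\<close>, is identified with the space \<^typ>\<open>'n \<Rightarrow> 'k\<close> of coordinate vectors.
\<close>

type_synonym ('k, 'n) lin = "('n \<Rightarrow> 'k) \<Rightarrow> ('n \<Rightarrow> 'k)"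
type_synonym ('k, 'n) hgrp = "(('k, 'n) lin \<times> ('k, 'n) lin) set"

definition g_op :: "('n \<Rightarrow> 'n \<Rightarrow> 'k::field) \<Rightarrow> 'n \<Rightarrow> ('k, 'n) lin" where
  "g_op p j v = (\<lambda>i. p i j * v i)"

definition f_op :: "('n \<Rightarrow> 'n \<Rightarrow> 'k::field) \<Rightarrow> 'n \<Rightarrow> ('k, 'n) lin" where
  "f_op p j v = (\<lambda>i. inverse (p j i) * v i)"

definition G_grp :: "('n \<Rightarrow> 'n \<Rightarrow> 'k::field) \<Rightarrow> ('k, 'n) lin monoid" where
  "G_grp p = subgroup_generated (BijGroup UNIV) (range (g_op p))"

definition F_grp :: "('n \<Rightarrow> 'n \<Rightarrow> 'k::field) \<Rightarrow> ('k, 'n) lin monoid" where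
  "F_grp p = subgroup_generated (BijGroup UNIV) (range (f_op p))"

abbreviation GF_grp :: "('n \<Rightarrow> 'n \<Rightarrow> 'k::field) \<Rightarrow> (('k, 'n) lin \<times> ('k, 'n) lin) monoid" where
  "GF_grp p \<equiv> G_grp p \<times>\<times> F_grp p"

text \<open>
  \<open>\<chi>\<^sup>i(g, f)\<close> is the eigenvalue of \<open>g\<close> at \<open>x\<^sub>i\<close> divided by that of \<open>f\<close> at \<open>x\<^sub>i\<^sup>-\<close>; this is the
  character of \<open>G \<times> F\<close> with the prescribed values on the generators, see the two lemmas below.
\<close>

definition chi :: "'n \<Rightarrow> ('k::field, 'n) lin \<times> ('k, 'n) lin \<Rightarrow> 'k" where
  "chi i = (\<lambda>(g, f). let e = (\<lambda>j. if j = i then 1 else 0) in g e i * inverse (f e i))"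

lemma chi_g_op: "chi i (g_op p j, \<one>\<^bsub>F_grp p\<^esub>) = p i j"
  by (simp add: chi_def g_op_def F_grp_def subgroup_generated_def BijGroup_def)

lemma chi_f_op: "chi i (\<one>\<^bsub>G_grp p\<^esub>, f_op p j) = p j i"
  by (simp add: chi_def f_op_def G_grp_def subgroup_generated_def BijGroup_def)

definition H_grp ::
  "('n \<Rightarrow> 'n \<Rightarrow> 'k::field) \<Rightarrow> (('k, 'n) lin \<times> ('k, 'n) lin) set \<Rightarrow> ('k, 'n) hgrp monoid" where
  "H_grp p N = GF_grp p Mod N"

definition G_to_H ::
  "('n \<Rightarrow> 'n \<Rightarrow> 'k::field) \<Rightarrow> (('k, 'n) lin \<times> ('k, 'n) lin) set \<Rightarrow> ('k, 'n) lin \<Rightarrow> ('k, 'n) hgrp" where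
  "G_to_H p N g = N #>\<^bsub>GF_grp p\<^esub> (g, \<one>\<^bsub>F_grp p\<^esub>)"

definition F_to_H ::
  "('n \<Rightarrow> 'n \<Rightarrow> 'k::field) \<Rightarrow> (('k, 'n) lin \<times> ('k, 'n) lin) set \<Rightarrow> ('k, 'n) lin \<Rightarrow> ('k, 'n) hgrp" where
  "F_to_H p N f = N #>\<^bsub>GF_grp p\<^esub> (\<one>\<^bsub>G_grp p\<^esub>, f)"

definition G_in_H ::
  "('n \<Rightarrow> 'n \<Rightarrow> 'k::field) \<Rightarrow> (('k, 'n) lin \<times> ('k, 'n) lin) set \<Rightarrow> ('k, 'n) hgrp set" where
  "G_in_H p N = G_to_H p N ` carrier (G_grp p)"

definition F_in_H ::
  "('n \<Rightarrow> 'n \<Rightarrow> 'k::field) \<Rightarrow> (('k, 'n) lin \<times> ('k, 'n) lin) set \<Rightarrow> ('k, 'n) hgrp set" where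
  "F_in_H p N = F_to_H p N ` carrier (F_grp p)"

text \<open>\<open>N\<close> lies in the kernel of every \<open>\<chi>\<^sup>i\<close>, so that \<open>\<chi>\<^sup>i\<close> is constant on each coset.\<close>

definition chiH :: "'n \<Rightarrow> ('k::field, 'n) hgrp \<Rightarrow> 'k" where
  "chiH i h = the_elem (chi i ` h)"

definition admissible ::
  "('n \<Rightarrow> 'n \<Rightarrow> 'k::field) \<Rightarrow> (('k, 'n) lin \<times> ('k, 'n) lin) set \<Rightarrow> bool" where
  "admissible p N \<longleftrightarrow>
     (\<forall>i j. p i j \<noteq> 0) \<and>
     subgroup N (GF_grp p) \<and>
     (\<forall>i. \<forall>z\<in>N. chi i z = 1) \<and>
     inj_on (G_to_H p N) (carrier (G_grp p)) \<and>
     inj_on (F_to_H p N) (carrier (F_grp p))"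


section \<open>The algebra \<open>F\<^sub>n\<close>\<close>

text \<open>The letters \<open>x\<^sub>i\<close> (\<open>Xp i\<close>) and \<open>x\<^sub>i\<^sup>-\<close> (\<open>Xm i\<close>).\<close>

datatype 'n letter = Xp 'n | Xm 'n

type_synonym ('k, 'n) sk = "('k, 'n) hgrp \<times> 'n letter list \<Rightarrow>\<^sub>0 'k"

definition word_monoid :: "'a list monoid" where
  "word_monoid = \<lparr>carrier = UNIV, mult = (@), one = []\<rparr>"

fun chi_letter :: "'n letter \<Rightarrow> ('k::field, 'n) hgrp \<Rightarrow> 'k" where
  "chi_letter (Xp i) h = chiH i h"
| "chi_letter (Xm i) h = inverse (chiH i h)"

definition chi_word :: "'n letter list \<Rightarrow> ('k::field, 'n) hgrp \<Rightarrow> 'k" where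
  "chi_word v h = prod_list (map (\<lambda>x. chi_letter x h) v)"

text \<open>
  The skew group algebra has the basis \<open>h v\<close> (\<open>h \<in> H\<close>, \<open>v\<close> a word in \<open>X \<union> X\<^sup>-\<close>).  Moving \<open>h'\<close> to the
  left past the letters of \<open>v\<close> gives \<open>(h v)(h' v') = \<chi>\<^sup>v(h') (hh')(vv')\<close>.
\<close>

definition skew_alg ::
  "('n \<Rightarrow> 'n \<Rightarrow> 'k::field) \<Rightarrow> (('k, 'n) lin \<times> ('k, 'n) lin) set \<Rightarrow> ('k, ('k, 'n) sk) module" where
  "skew_alg p N = twisted_alg (H_grp p N \<times>\<times> word_monoid) (\<lambda>(h, v) (h', v'). chi_word v h')"

definition Fn_ideal ::
  "('n \<Rightarrow> 'n \<Rightarrow> 'k::field) \<Rightarrow> (('k, 'n) lin \<times> ('k, 'n) lin) set \<Rightarrow> ('k, 'n) sk set" where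
  "Fn_ideal p N = Idl\<^bsub>skew_alg p N\<^esub>
     {bas (\<one>\<^bsub>H_grp p N\<^esub>, [Xp i, Xm j])
        - Poly_Mapping.single (\<one>\<^bsub>H_grp p N\<^esub>, [Xm j, Xp i]) (p j i)
        - (if i = j
           then bas (\<one>\<^bsub>H_grp p N\<^esub>, [])
                - bas (G_to_H p N (g_op p i) \<otimes>\<^bsub>H_grp p N\<^esub> F_to_H p N (f_op p i), [])
           else 0) | i j. True}"

definition Fn ::
  "('n \<Rightarrow> 'n \<Rightarrow> 'k::field) \<Rightarrow> (('k, 'n) lin \<times> ('k, 'n) lin) set \<Rightarrow> ('k, ('k, 'n) sk set) module" where
  "Fn p N = quot_alg (skew_alg p N) (Fn_ideal p N)"

definition Fn_cls ::
  "('n \<Rightarrow> 'n \<Rightarrow> 'k::field) \<Rightarrow> (('k, 'n) lin \<times> ('k, 'n) lin) set \<Rightarrow> ('k, 'n) sk \<Rightarrow> ('k, 'n) sk set" where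
  "Fn_cls p N a = Fn_ideal p N +>\<^bsub>skew_alg p N\<^esub> a"

definition GX_alg ::
  "('n \<Rightarrow> 'n \<Rightarrow> 'k::field) \<Rightarrow> (('k, 'n) lin \<times> ('k, 'n) lin) set \<Rightarrow> ('k, ('k, 'n) sk set) module" where
  "GX_alg p N = (Fn p N)\<lparr>carrier := gen_subalgebra (Fn p N)
     ({Fn_cls p N (bas (h, [])) | h. h \<in> G_in_H p N} \<union>
      {Fn_cls p N (bas (\<one>\<^bsub>H_grp p N\<^esub>, [Xp i])) | i. True})\<rparr>"

definition FX_alg ::
  "('n \<Rightarrow> 'n \<Rightarrow> 'k::field) \<Rightarrow> (('k, 'n) lin \<times> ('k, 'n) lin) set \<Rightarrow> ('k, ('k, 'n) sk set) module" where
  "FX_alg p N = (Fn p N)\<lparr>carrier := gen_subalgebra (Fn p N)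
     ({Fn_cls p N (bas (h, [])) | h. h \<in> F_in_H p N} \<union>
      {Fn_cls p N (bas (\<one>\<^bsub>H_grp p N\<^esub>, [Xm i])) | i. True})\<rparr>"


section \<open>The quotients \<open>A\<close>, \<open>A\<^sup>+\<close> and \<open>A\<^sup>-\<close>\<close>

text \<open>
  A noncommutative polynomial in \<open>n\<close> variables is a linear combination of words over \<open>'n\<close>.  The
  same type serves for the polynomials in the \<open>x\<^sub>i\<close> (\<open>X = Xp\<close>) and in the \<open>x\<^sub>i\<^sup>-\<close> (\<open>X = Xm\<close>).
\<close>

type_synonym ('k, 'n) npoly = "'n list \<Rightarrow>\<^sub>0 'k"

definition homogeneous_npoly :: "('k::field, 'n) npoly \<Rightarrow> bool" where
  "homogeneous_npoly q \<longleftrightarrow>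
     (\<forall>v\<in>Poly_Mapping.keys q. \<forall>v'\<in>Poly_Mapping.keys q. \<forall>i. count_list v i = count_list v' i)"

definition npoly_Fn ::
  "('n \<Rightarrow> 'n \<Rightarrow> 'k::field) \<Rightarrow> (('k, 'n) lin \<times> ('k, 'n) lin) set \<Rightarrow> ('n \<Rightarrow> 'n letter) \<Rightarrow>
   ('k, 'n) npoly \<Rightarrow> ('k, 'n) sk set" where
  "npoly_Fn p N X q =
     lin_ext (Fn p N) (\<lambda>v. Fn_cls p N (bas (\<one>\<^bsub>H_grp p N\<^esub>, map X v))) q"

type_synonym ('k, 'n) quo = "('k, 'n) sk set set"

context
  fixes p :: "'n \<Rightarrow> 'n \<Rightarrow> 'k::field"
    and N :: "(('k, 'n) lin \<times> ('k, 'n) lin) set"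
    and u :: "'l \<Rightarrow> ('k, 'n) npoly" and L :: "'l set"
    and w :: "'t \<Rightarrow> ('k, 'n) npoly" and T :: "'t set"
begin

definition A_ideal :: "('k, 'n) sk set set" where
  "A_ideal = Idl\<^bsub>Fn p N\<^esub>
     ({npoly_Fn p N Xp (u l) | l. l \<in> L} \<union> {npoly_Fn p N Xm (w t) | t. t \<in> T})"

definition A_alg :: "('k, ('k, 'n) quo) module" where
  "A_alg = quot_alg (Fn p N) A_ideal"

definition A_cls :: "('k, 'n) sk \<Rightarrow> ('k, 'n) quo" where
  "A_cls a = A_ideal +>\<^bsub>Fn p N\<^esub> Fn_cls p N a"

definition Ap_ideal :: "('k, 'n) sk set set" where
  "Ap_ideal = Idl\<^bsub>GX_alg p N\<^esub> {npoly_Fn p N Xp (u l) | l. l \<in> L}"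

definition Ap_alg :: "('k, ('k, 'n) quo) module" where
  "Ap_alg = quot_alg (GX_alg p N) Ap_ideal"

definition Ap_cls :: "('k, 'n) sk \<Rightarrow> ('k, 'n) quo" where
  "Ap_cls a = Ap_ideal +>\<^bsub>GX_alg p N\<^esub> Fn_cls p N a"

definition Am_ideal :: "('k, 'n) sk set set" where
  "Am_ideal = Idl\<^bsub>FX_alg p N\<^esub> {npoly_Fn p N Xm (w t) | t. t \<in> T}"

definition Am_alg :: "('k, ('k, 'n) quo) module" where
  "Am_alg = quot_alg (FX_alg p N) Am_ideal"

definition Am_cls :: "('k, 'n) sk \<Rightarrow> ('k, 'n) quo" where
  "Am_cls a = Am_ideal +>\<^bsub>FX_alg p N\<^esub> Fn_cls p N a"

text \<open>
  The canonical maps \<open>A\<^sup>\<plusminus> \<rightarrow> A\<close>, which send the class of an element of \<open>F\<^sub>n\<close> modulo the smaller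
  ideal to its class modulo the larger one.
\<close>

definition to_A :: "('k, 'n) quo \<Rightarrow> ('k, 'n) quo" where
  "to_A C = set_add (Fn p N) A_ideal C"

subsection \<open>Coproducts and Hopf algebra structures\<close>

definition A_grouplikes :: "('k, 'n) quo set" where
  "A_grouplikes = {A_cls (bas (G_to_H p N (g_op p i), [])) | i. True} \<union>
                  {A_cls (bas (F_to_H p N (f_op p i), [])) | i. True}"

definition A_skew_primitives :: "(('k, 'n) quo \<times> ('k, 'n) quo) set" where
  "A_skew_primitives =
     {(A_cls (bas (\<one>\<^bsub>H_grp p N\<^esub>, [Xp i])), A_cls (bas (G_to_H p N (g_op p i), []))) | i. True} \<union>
     {(A_cls (bas (\<one>\<^bsub>H_grp p N\<^esub>, [Xm i])), A_cls (bas (F_to_H p N (f_op p i), []))) | i. True}"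

definition A_coproduct where
  "A_coproduct = coproduct A_alg A_grouplikes A_skew_primitives"

definition Ap_grouplikes :: "('k, 'n) quo set" where
  "Ap_grouplikes = {Ap_cls (bas (G_to_H p N (g_op p i), [])) | i. True}"

definition Ap_skew_primitives :: "(('k, 'n) quo \<times> ('k, 'n) quo) set" where
  "Ap_skew_primitives =
     {(Ap_cls (bas (\<one>\<^bsub>H_grp p N\<^esub>, [Xp i])), Ap_cls (bas (G_to_H p N (g_op p i), []))) | i. True}"

definition Ap_coproduct where
  "Ap_coproduct = coproduct Ap_alg Ap_grouplikes Ap_skew_primitives"

definition Ap_is_hopf :: bool where
  "Ap_is_hopf \<longleftrightarrow> is_hopf_algebra Ap_alg Ap_grouplikes Ap_skew_primitives"

definition Am_grouplikes :: "('k, 'n) quo set" where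
  "Am_grouplikes = {Am_cls (bas (F_to_H p N (f_op p i), [])) | i. True}"

definition Am_skew_primitives :: "(('k, 'n) quo \<times> ('k, 'n) quo) set" where
  "Am_skew_primitives =
     {(Am_cls (bas (\<one>\<^bsub>H_grp p N\<^esub>, [Xm i])), Am_cls (bas (F_to_H p N (f_op p i), []))) | i. True}"

definition Am_coproduct where
  "Am_coproduct = coproduct Am_alg Am_grouplikes Am_skew_primitives"

definition Am_is_hopf :: bool where
  "Am_is_hopf \<longleftrightarrow> is_hopf_algebra Am_alg Am_grouplikes Am_skew_primitives"

subsection \<open>Gradings\<close>

text \<open>\<open>\<Gamma>\<close> is the group \<^typ>\<open>'n \<Rightarrow> int\<close>; \<open>h v\<close> has the \<open>\<Gamma>\<close>-degree of the word \<open>v\<close>.\<close>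

definition Gamma_deg :: "'n letter list \<Rightarrow> 'n \<Rightarrow> int" where
  "Gamma_deg v i = int (count_list v (Xp i)) - int (count_list v (Xm i))"

definition A_component :: "('n \<Rightarrow> int) \<Rightarrow> ('k, 'n) quo set" where
  "A_component \<gamma> =
     {A_cls a | a. Poly_Mapping.keys a \<subseteq> carrier (H_grp p N) \<times> {v. Gamma_deg v = \<gamma>}}"

text \<open>The homogeneous elements of \<open>A\<^sup>\<plusminus>\<close> of degree \<open>d i\<close> in each variable \<open>i\<close>.\<close>

definition Ap_component :: "('n \<Rightarrow> nat) \<Rightarrow> ('k, 'n) quo set" where
  "Ap_component d =
     {Ap_cls a | a. Poly_Mapping.keys a \<subseteq> G_in_H p N \<times> {map Xp v | v. count_list v = d}}"

definition Am_component :: "('n \<Rightarrow> nat) \<Rightarrow> ('k, 'n) quo set" where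
  "Am_component d =
     {Am_cls a | a. Poly_Mapping.keys a \<subseteq> F_in_H p N \<times> {map Xm v | v. count_list v = d}}"

subsection \<open>The triangular decomposition\<close>

definition H_in_A :: "('k, 'n) quo set" where
  "H_in_A = {A_cls (bas (h, [])) | h. h \<in> carrier (H_grp p N)}"

definition G_in_Ap :: "('k, 'n) quo set" where
  "G_in_Ap = {Ap_cls (bas (h, [])) | h. h \<in> G_in_H p N}"

definition F_in_Am :: "('k, 'n) quo set" where
  "F_in_Am = {Am_cls (bas (h, [])) | h. h \<in> F_in_H p N}"

definition kH :: "('k, ('k, 'n) hgrp \<Rightarrow>\<^sub>0 'k) module" where
  "kH = monoid_alg (H_grp p N)"

definition kG :: "(('k, 'n) hgrp \<Rightarrow>\<^sub>0 'k) set" where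
  "kG = {r. Poly_Mapping.keys r \<subseteq> G_in_H p N}"

definition kF :: "(('k, 'n) hgrp \<Rightarrow>\<^sub>0 'k) set" where
  "kF = {r. Poly_Mapping.keys r \<subseteq> F_in_H p N}"

definition kF_to_Am :: "(('k, 'n) hgrp \<Rightarrow>\<^sub>0 'k) \<Rightarrow> ('k, 'n) quo" where
  "kF_to_Am = lin_ext Am_alg (\<lambda>h. Am_cls (bas (h, [])))"

definition kG_to_Ap :: "(('k, 'n) hgrp \<Rightarrow>\<^sub>0 'k) \<Rightarrow> ('k, 'n) quo" where
  "kG_to_Ap = lin_ext Ap_alg (\<lambda>h. Ap_cls (bas (h, [])))"

definition kH_to_A :: "(('k, 'n) hgrp \<Rightarrow>\<^sub>0 'k) \<Rightarrow> ('k, 'n) quo" where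
  "kH_to_A = lin_ext A_alg (\<lambda>h. A_cls (bas (h, [])))"

definition triangular_tensor where
  "triangular_tensor Um Up =
     tensor3 (Am_alg\<lparr>carrier := Um\<rparr>) kF_to_Am kF kH kG kG_to_Ap (Ap_alg\<lparr>carrier := Up\<rparr>)"

definition triangular_mult where
  "triangular_mult = coset_lift A_alg
     (\<lambda>(a, x, b). to_A a \<otimes>\<^bsub>A_alg\<^esub> kH_to_A x \<otimes>\<^bsub>A_alg\<^esub> to_A b)"

text \<open>
  \<open>U = U\<^sup>- \<otimes>\<^bsub>k[F]\<^esub> k[H] \<otimes>\<^bsub>k[G]\<^esub> U\<^sup>+\<close>: multiplication is a (linear) bijection of the tensor product
  onto \<open>U\<close>.
\<close>

definition triangular_decomposition ::
  "('k, 'n) quo set \<Rightarrow> ('k, 'n) quo set \<Rightarrow> ('k, 'n) quo set \<Rightarrow> bool" where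
  "triangular_decomposition U Um Up \<longleftrightarrow> bij_betw triangular_mult (triangular_tensor Um Up) U"

end

end

theory Submission
  imports Defs
begin

text \<open>
  The skew group algebra acts on the space with basis the triangular monomials \<open>x\<^sup>-\<^sub>a h x\<^sub>c\<close>, in the way in
  which it would act on \<open>F\<^sub>n\<close>.  As \<open>A\<^sup>\<plusminus>\<close> are Hopf algebras, the ideals of their relations are stable under
  skew derivatives.  Hence the relations of \<open>A\<close> act by zero modulo these ideals, and the monomials with
  \<open>a\<close> and \<open>c\<close> in normal form are a basis of \<open>A\<close>.

  For \<open>y \<in> U\<close> and a linear functional \<open>\<psi>\<close> the slice \<open>(id \<otimes> \<psi>)(\<Delta> y)\<close> lies in \<open>U\<close>.  If \<open>\<psi>\<close> is the coordinate at
  \<open>h\<^sub>0\<close>, this is the part of \<open>y\<close> in \<open>A\<^sup>- h\<^sub>0 A\<^sup>+\<close>.  If \<open>\<psi>\<close> is the coordinate at \<open>x\<^sup>-\<^sub>a h\<^sub>0\<close> with \<open>a\<close> of maximal length,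
  it is, up to a group element, a row of the coordinate matrix of \<open>y\<close>, and likewise for the columns.
  So these rows and columns belong to \<open>U \<inter> A\<^sup>\<plusminus>\<close>, and Gaussian elimination expresses \<open>y\<close> by their products.
\<close>

section \<open>Finitely supported functions\<close>

text \<open>The obstacle is the linear independence of the triangular monomials in A, since the
  ideal of A mixes the relations of the two halves with the commutation rules. In the
  representation, moving x_i to the right past a polynomial in the x^-_j produces one skew
  derivative of that polynomial, and g_i f_i together with another one (\<open>op_formula\<close>);
  symmetrically for x^-_j and a polynomial in the x_i (\<open>Ow_Om\<close>). So ideals stable under
  both derivatives stay in place under all operators. The derivatives are slices of the coproduct of
  A^+ or A^- at functionals of degree one. These functionals exist because the relations have degree
  > 1, and the slices preserve the ideal because the coproduct is defined on the quotient.
  Injectivity of multiplication on the tensor product formed with U^- and U^+ is not inherited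
  formally from A^- and A^+. Slicing also separates the group elements: U^- = S^- k[F] and U^+ =
  k[G] S^+, where S^- and S^+ consist of the elements of U that are polynomials in the x^-_i and in
  the x_i alone. Balancing moves the group elements into k[H], and what remains is linear
  independence over k.\<close>

abbreviation "lookup \<equiv> Poly_Mapping.lookup"
abbreviation "supp \<equiv> Poly_Mapping.keys"
abbreviation "sgl \<equiv> Poly_Mapping.single"

text \<open>This is the scalar multiplication inside \<open>twisted_alg\<close>, named so that
  finitely supported functions can be registered as a vector space; spans, independence and bases
  then come from the library.\<close>

definition scl :: "'k::field \<Rightarrow> ('b \<Rightarrow>\<^sub>0 'k) \<Rightarrow> ('b \<Rightarrow>\<^sub>0 'k)" where
  "scl c = Poly_Mapping.map (\<lambda>x. c * x)"

lemma lookup_scl [simp]: "lookup (scl c t) k = c * lookup t k"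
  by (simp add: scl_def Poly_Mapping.map.rep_eq when_def)

interpretation pm: vector_space "scl :: 'k::field \<Rightarrow> ('b \<Rightarrow>\<^sub>0 'k) \<Rightarrow> ('b \<Rightarrow>\<^sub>0 'k)"
  by standard (auto intro!: poly_mapping_eqI simp: lookup_add algebra_simps)

lemma supp_scl: "supp (scl c t) \<subseteq> supp t"
  by (auto simp: in_keys_iff)

lemma scl_single [simp]: "scl c (sgl k d) = sgl k (c * d)"
  by (rule poly_mapping_eqI) (simp add: lookup_single when_def)

text \<open>The counterpart of \<open>lin_ext\<close> for maps between spaces of coordinates. No
  carrier has to be respected there, so that composition (\<open>plin_plin\<close>) and exchange of
  two extensions (\<open>plin_commute\<close>) hold without side conditions.\<close>

definition plin :: "('a \<Rightarrow> ('b \<Rightarrow>\<^sub>0 'k::field)) \<Rightarrow> ('a \<Rightarrow>\<^sub>0 'k) \<Rightarrow> ('b \<Rightarrow>\<^sub>0 'k)" where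
  "plin f t = (\<Sum>k\<in>supp t. scl (lookup t k) (f k))"

lemma plin_superset:
  assumes "finite K" "supp t \<subseteq> K"
  shows "plin f t = (\<Sum>k\<in>K. scl (lookup t k) (f k))"
  unfolding plin_def using assms
  by (intro sum.mono_neutral_left) (auto simp: in_keys_iff)

lemma plin_zero [simp]: "plin f 0 = 0"
  by (simp add: plin_def)

lemma plin_single [simp]: "plin f (sgl k c) = scl c (f k)"
  by (simp add: plin_superset[of "{k}"])

lemma plin_add: "plin f (s + t) = plin f s + plin f t"
proof -
  let ?K = "supp s \<union> supp t"
  have "supp (s + t) \<subseteq> ?K" by (rule Poly_Mapping.keys_add)
  then show ?thesis
    by (simp add: plin_superset[of ?K] lookup_add pm.scale_left_distrib sum.distrib)
qed

lemma plin_scl: "plin f (scl c t) = scl c (plin f t)"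
  using supp_scl[of c t] by (simp add: plin_superset[of "supp t"] pm.scale_sum_right)

lemma plin_uminus: "plin f (- t) = - plin f t"
  by (simp add: plin_def sum_negf)

lemma plin_diff: "plin f (s - t) = plin f s - plin f t"
  using plin_add[of f s "-t"] by (simp add: plin_uminus)

lemma plin_sum: "plin f (sum g K) = (\<Sum>x\<in>K. plin f (g x))"
  by (induction K rule: infinite_finite_induct) (auto simp: plin_add)

lemma plin_cong: "(\<And>k. k \<in> supp t \<Longrightarrow> f k = g k) \<Longrightarrow> plin f t = plin g t"
  by (simp add: plin_def)

lemma plin_fun_add: "plin (\<lambda>k. f k + g k) t = plin f t + plin g t"
  by (simp add: plin_def pm.scale_right_distrib sum.distrib)

lemma plin_fun_diff: "plin (\<lambda>k. f k - g k) t = plin f t - plin g t"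
  by (simp add: plin_def pm.scale_right_diff_distrib sum_subtractf)

lemma plin_fun_scl: "plin (\<lambda>k. scl c (f k)) t = scl c (plin f t)"
  by (simp add: plin_def pm.scale_sum_right mult.commute)

lemma plin_fun_zero [simp]: "plin (\<lambda>k. 0) t = 0"
  by (simp add: plin_def)

lemma plin_plin: "plin f (plin g t) = plin (\<lambda>k. plin f (g k)) t"
  unfolding plin_def[of g] by (simp add: plin_sum plin_scl) (simp add: plin_def)

lemma lookup_plin: "lookup (plin f t) k = (\<Sum>x\<in>supp t. lookup t x * lookup (f x) k)"
  by (simp add: plin_def lookup_sum)

lemma plin_bas [simp]: "plin bas t = t"
  by (rule poly_mapping_eqI)
    (simp add: lookup_plin lookup_single when_def if_distrib sum.delta' in_keys_iff cong: if_cong)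

text \<open>Most maps of basis elements below let a single basis element \<open>j\<close> contribute
  to the coordinate \<open>k\<close>; the sum in \<open>lookup_plin\<close> then collapses.\<close>

lemma lookup_plin_at:
  assumes "\<And>x. x \<in> supp t \<Longrightarrow> lookup (f x) k = (if x = j then c else 0)"
  shows "lookup (plin f t) k = lookup t j * c"
proof -
  have "lookup (plin f t) k = (\<Sum>x\<in>supp t. if x = j then lookup t j * c else 0)"
    unfolding lookup_plin by (rule sum.cong) (auto simp: assms)
  then show ?thesis by (auto simp: in_keys_iff)
qed

text \<open>The projection onto the span of the basis elements with property \<open>P\<close>. It
  later cuts elements into homogeneous components and into the parts that belong to one group
  element.\<close>

definition rst :: "('b \<Rightarrow> bool) \<Rightarrow> ('b \<Rightarrow>\<^sub>0 'k::field) \<Rightarrow> ('b \<Rightarrow>\<^sub>0 'k)" where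
  "rst P = plin (\<lambda>k. if P k then bas k else 0)"

lemma lookup_rst: "lookup (rst P t) k = (if P k then lookup t k else 0)"
  unfolding rst_def by (subst lookup_plin_at[where j = k and c = "if P k then 1 else 0"]) (auto simp: lookup_single when_def)

lemma supp_rst: "supp (rst P t) = {k \<in> supp t. P k}"
  by (auto simp: in_keys_iff lookup_rst split: if_splits)

lemma rst_all: "(\<And>k. k \<in> supp t \<Longrightarrow> P k) \<Longrightarrow> rst P t = t"
  by (rule poly_mapping_eqI) (auto simp: lookup_rst in_keys_iff)

lemma rst_none: "(\<And>k. k \<in> supp t \<Longrightarrow> \<not> P k) \<Longrightarrow> rst P t = 0"
  by (rule poly_mapping_eqI) (auto simp: lookup_rst in_keys_iff)

lemma rst_linear: "rst P (s + t) = rst P s + rst P t" "rst P (scl c t) = scl c (rst P t)" "rst P 0 = 0"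
  by (simp_all add: rst_def plin_add plin_scl)

lemma sum_rst_fibres: "(\<Sum>d\<in>f ` supp t. rst (\<lambda>k. f k = d) t) = t"
  by (rule poly_mapping_eqI) (auto simp: lookup_sum lookup_rst in_keys_iff)

lemma supp_plin: "supp (plin f t) \<subseteq> (\<Union>k\<in>supp t. supp (f k))"
proof
  fix x assume "x \<in> supp (plin f t)"
  then have "(\<Sum>y\<in>supp t. lookup t y * lookup (f y) x) \<noteq> 0"
    by (simp add: in_keys_iff lookup_plin)
  then obtain y where "y \<in> supp t" "lookup t y * lookup (f y) x \<noteq> 0"
    by (meson sum.not_neutral_contains_not_neutral)
  then show "x \<in> (\<Union>k\<in>supp t. supp (f k))" by (auto simp: in_keys_iff)
qed

lemma plin_commute: "plin (\<lambda>x. plin (f x) t) s = plin (\<lambda>y. plin (\<lambda>x. f x y) s) t"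
  by (rule poly_mapping_eqI)
    (simp add: lookup_plin sum_distrib_left mult.left_commute sum.swap[of _ "supp s"])

lemma pm_induct [consumes 1, case_names zero single add]:
  fixes t :: "'a \<Rightarrow>\<^sub>0 'k::field"
  assumes "supp t \<subseteq> S" "P 0" "\<And>k c. k \<in> S \<Longrightarrow> P (sgl k c)"
    and "\<And>s t. supp s \<subseteq> S \<Longrightarrow> supp t \<subseteq> S \<Longrightarrow> P s \<Longrightarrow> P t \<Longrightarrow> P (s + t)"
  shows "P t"
proof -
  have "supp (\<Sum>k\<in>K. sgl k (lookup t k)) \<subseteq> S \<and> P (\<Sum>k\<in>K. sgl k (lookup t k))"
    if "finite K" "K \<subseteq> S" for K
    using that
  proof (induction K)
    case (insert k K)
    have "supp (sgl k (lookup t k)) \<subseteq> S" using insert.prems by auto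
    moreover have "supp (sgl k (lookup t k) + (\<Sum>k\<in>K. sgl k (lookup t k))) \<subseteq>
        supp (sgl k (lookup t k)) \<union> supp (\<Sum>k\<in>K. sgl k (lookup t k))"
      by (rule Poly_Mapping.keys_add)
    ultimately show ?case using insert assms(3,4) by auto
  qed (use assms(2) in auto)
  from this[of "supp t"] assms(1) have "P (\<Sum>k\<in>supp t. sgl k (lookup t k))" by auto
  moreover have "(\<Sum>k\<in>supp t. sgl k (lookup t k)) = t"
    using plin_bas[of t] by (simp add: plin_def del: plin_bas)
  ultimately show ?thesis by simp
qed

lemma supp_diff: "supp (s - t) \<subseteq> supp s \<union> supp t"
  by (auto simp: in_keys_iff lookup_minus)

text \<open>Since f(t) = 0, the element t is t - f(t), a combination of the differences
  \<open>bas k - f k\<close>. This describes the kernel of a normal form map by generators.\<close>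

lemma bas_diff_span:
  assumes "plin f t = 0" "supp t \<subseteq> S" "\<And>k. k \<in> S \<Longrightarrow> bas k - f k \<in> W" "pm.subspace W"
  shows "t \<in> W"
proof -
  have "t = plin (\<lambda>k. bas k - f k) t" using assms(1) by (simp add: plin_fun_diff)
  moreover have "plin (\<lambda>k. bas k - f k) t \<in> W"
    unfolding plin_def using assms by (intro pm.subspace_sum pm.subspace_scale) auto
  ultimately show ?thesis by simp
qed

lemma pm_subspace_supp: "pm.subspace {t :: 'a \<Rightarrow>\<^sub>0 'b::field. supp t \<subseteq> S}"
proof (rule pm.subspaceI)
  show "s + t \<in> {t. supp t \<subseteq> S}" if "s \<in> {t. supp t \<subseteq> S}" "t \<in> {t. supp t \<subseteq> S}" for s t :: "'a \<Rightarrow>\<^sub>0 'b"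
    using that Poly_Mapping.keys_add[of s t] by blast
  show "scl c t \<in> {t. supp t \<subseteq> S}" if "t \<in> {t. supp t \<subseteq> S}" for c and t :: "'a \<Rightarrow>\<^sub>0 'b"
    using that supp_scl[of c t] by blast
qed simp


section \<open>Algebras, subspaces and linear maps\<close>

definition klin :: "('k::field, 'a) module \<Rightarrow> ('k, 'b) module \<Rightarrow> ('a \<Rightarrow> 'b) \<Rightarrow> bool" where
  "klin A B f \<longleftrightarrow> f \<in> carrier A \<rightarrow> carrier B \<and>
     (\<forall>x\<in>carrier A. \<forall>y\<in>carrier A. f (x \<oplus>\<^bsub>A\<^esub> y) = f x \<oplus>\<^bsub>B\<^esub> f y) \<and>
     (\<forall>c. \<forall>x\<in>carrier A. f (c \<odot>\<^bsub>A\<^esub> x) = c \<odot>\<^bsub>B\<^esub> f x)"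

lemma klinI:
  assumes "\<And>x. x \<in> carrier A \<Longrightarrow> f x \<in> carrier B"
    and "\<And>x y. x \<in> carrier A \<Longrightarrow> y \<in> carrier A \<Longrightarrow> f (x \<oplus>\<^bsub>A\<^esub> y) = f x \<oplus>\<^bsub>B\<^esub> f y"
    and "\<And>c x. x \<in> carrier A \<Longrightarrow> f (c \<odot>\<^bsub>A\<^esub> x) = c \<odot>\<^bsub>B\<^esub> f x"
  shows "klin A B f"
  using assms by (auto simp: klin_def)

lemma klinD:
  assumes "klin A B f"
  shows "x \<in> carrier A \<Longrightarrow> f x \<in> carrier B"
    and "x \<in> carrier A \<Longrightarrow> y \<in> carrier A \<Longrightarrow> f (x \<oplus>\<^bsub>A\<^esub> y) = f x \<oplus>\<^bsub>B\<^esub> f y"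
    and "x \<in> carrier A \<Longrightarrow> f (c \<odot>\<^bsub>A\<^esub> x) = c \<odot>\<^bsub>B\<^esub> f x"
  using assms by (auto simp: klin_def)

lemma alg_homD:
  assumes "f \<in> alg_hom A B"
  shows "klin A B f" "x \<in> carrier A \<Longrightarrow> f x \<in> carrier B"
    and "x \<in> carrier A \<Longrightarrow> y \<in> carrier A \<Longrightarrow> f (x \<oplus>\<^bsub>A\<^esub> y) = f x \<oplus>\<^bsub>B\<^esub> f y"
    and "x \<in> carrier A \<Longrightarrow> f (c \<odot>\<^bsub>A\<^esub> x) = c \<odot>\<^bsub>B\<^esub> f x"
    and "x \<in> carrier A \<Longrightarrow> y \<in> carrier A \<Longrightarrow> f (x \<otimes>\<^bsub>A\<^esub> y) = f x \<otimes>\<^bsub>B\<^esub> f y"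
    and "f \<one>\<^bsub>A\<^esub> = \<one>\<^bsub>B\<^esub>"
  using assms by (auto simp: alg_hom_def klin_def ring_hom_def)

lemma alg_homI:
  assumes "klin A B f"
    and "\<And>x y. x \<in> carrier A \<Longrightarrow> y \<in> carrier A \<Longrightarrow> f (x \<otimes>\<^bsub>A\<^esub> y) = f x \<otimes>\<^bsub>B\<^esub> f y"
    and "f \<one>\<^bsub>A\<^esub> = \<one>\<^bsub>B\<^esub>"
  shows "f \<in> alg_hom A B"
  using assms by (auto simp: alg_hom_def klin_def ring_hom_def)

lemma klin_comp: "klin A B f \<Longrightarrow> klin B C g \<Longrightarrow> klin A C (\<lambda>x. g (f x))"
  by (auto simp: klin_def Pi_iff)

lemma alg_hom_comp: "f \<in> alg_hom A B \<Longrightarrow> g \<in> alg_hom B C \<Longrightarrow> (\<lambda>x. g (f x)) \<in> alg_hom A C"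
  by (auto simp: alg_hom_def ring_hom_def Pi_iff)

context k_algebra
begin

lemmas k_alg = k_algebra_axioms

declare smult_closed [simp, intro]

lemma smult_zero_left [simp]: "x \<in> carrier A \<Longrightarrow> 0 \<odot> x = \<zero>"
  using smult_l_distr[of x 0 0] smult_closed[of x 0] by simp

lemma smult_zero_right [simp]: "c \<odot> \<zero> = \<zero>"
  using smult_r_distr[of \<zero> \<zero> c] smult_closed[of \<zero> c] by simp

lemma smult_minus_one: "x \<in> carrier A \<Longrightarrow> (- 1) \<odot> x = \<ominus> x"
  using smult_l_distr[of x 1 "-1"] smult_one[of x] smult_closed[of x "-1"]
  by (metis a_comm add.left_inverse minus_equality right_minus smult_zero_left)

lemma smult_finsum:
  assumes "f \<in> F \<rightarrow> carrier A"
  shows "c \<odot> finsum A f F = finsum A (\<lambda>s. c \<odot> f s) F"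
  using assms
proof (induction F rule: infinite_finite_induct)
  case (insert x F)
  then have "f \<in> F \<rightarrow> carrier A" "f x \<in> carrier A" by auto
  with insert show ?case
    by (simp add: finsum_insert smult_r_distr smult_closed Pi_iff)
qed auto

lemma lin_subspaceI:
  assumes "W \<subseteq> carrier A" "\<zero> \<in> W" "\<And>x y. x \<in> W \<Longrightarrow> y \<in> W \<Longrightarrow> x \<oplus> y \<in> W"
    and "\<And>c x. x \<in> W \<Longrightarrow> c \<odot> x \<in> W"
  shows "lin_subspace W A"
proof -
  have "\<ominus> x \<in> W" if "x \<in> W" for x
    using that assms(1) assms(4)[of x "-1"] smult_minus_one[of x] by auto
  then have "subgroup W (add_monoid A)"
    using assms by (intro add.subgroupI) (auto simp: a_inv_def)
  then show ?thesis using assms by (auto simp: lin_subspace_def)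
qed

lemma lin_subspaceD:
  assumes "lin_subspace W A"
  shows "W \<subseteq> carrier A" "\<zero> \<in> W" "x \<in> W \<Longrightarrow> y \<in> W \<Longrightarrow> x \<oplus> y \<in> W" "x \<in> W \<Longrightarrow> c \<odot> x \<in> W"
    "x \<in> W \<Longrightarrow> \<ominus> x \<in> W"
  using assms subgroup.subset[of W "add_monoid A"] subgroup.one_closed[of W "add_monoid A"]
    subgroup.m_closed[of W "add_monoid A"] subgroup.m_inv_closed[of W "add_monoid A"]
  by (auto simp: lin_subspace_def a_inv_def)

lemma lin_subspace_finsum:
  assumes "lin_subspace W A" "\<And>s. s \<in> F \<Longrightarrow> f s \<in> W"
  shows "finsum A f F \<in> W"
  using assms(2)
proof (induction F rule: infinite_finite_induct)
  case (insert x F)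
  then have "f \<in> F \<rightarrow> carrier A" "f x \<in> carrier A"
    using lin_subspaceD(1)[OF assms(1)] by auto
  with insert lin_subspaceD[OF assms(1)] show ?case by (simp add: finsum_insert)
qed (use lin_subspaceD[OF assms(1)] in auto)

lemma lin_subspace_carrier: "lin_subspace (carrier A) A"
  by (rule lin_subspaceI) (auto simp: Pi_iff)

lemma lin_span_least: "lin_subspace W A \<Longrightarrow> S \<subseteq> W \<Longrightarrow> lin_span A S \<subseteq> W"
  by (auto simp: lin_span_def)

lemma lin_span_superset: "S \<subseteq> lin_span A S"
  by (auto simp: lin_span_def)

lemma lin_subspace_lin_span:
  assumes "S \<subseteq> carrier A"
  shows "lin_subspace (lin_span A S) A"
proof (rule lin_subspaceI)
  show "lin_span A S \<subseteq> carrier A"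
    by (rule lin_span_least[OF lin_subspace_carrier assms])
qed (auto simp: lin_span_def dest: lin_subspaceD)

lemma lin_span_induct [consumes 2, case_names zero base add smult]:
  assumes "x \<in> lin_span A S" "S \<subseteq> carrier A" "P \<zero>" "\<And>s. s \<in> S \<Longrightarrow> P s"
    and "\<And>x y. x \<in> lin_span A S \<Longrightarrow> y \<in> lin_span A S \<Longrightarrow> P x \<Longrightarrow> P y \<Longrightarrow> P (x \<oplus> y)"
    and "\<And>c x. x \<in> lin_span A S \<Longrightarrow> P x \<Longrightarrow> P (c \<odot> x)"
  shows "P x"
proof -
  note D = lin_subspaceD[OF lin_subspace_lin_span[OF assms(2)]]
  have "lin_subspace {x \<in> lin_span A S. P x} A"
    using D assms(3,5,6) by (intro lin_subspaceI) auto
  moreover have "S \<subseteq> {x \<in> lin_span A S. P x}"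
    using lin_span_superset assms(4) by blast
  ultimately have "lin_span A S \<subseteq> {x \<in> lin_span A S. P x}"
    by (rule lin_span_least)
  with assms(1) show ?thesis by blast
qed

lemma lin_ext_superset:
  assumes "finite F" "supp t \<subseteq> F" "\<beta> \<in> F \<rightarrow> carrier A"
  shows "lin_ext A \<beta> t = finsum A (\<lambda>s. lookup t s \<odot> \<beta> s) F"
  unfolding lin_ext_def
  by (rule add.finprod_mono_neutral_cong_left) (use assms in \<open>auto simp: in_keys_iff Pi_iff\<close>)

lemma lin_ext_closed: "\<beta> \<in> supp t \<rightarrow> carrier A \<Longrightarrow> lin_ext A \<beta> t \<in> carrier A"
  unfolding lin_ext_def by (intro finsum_closed) (auto simp: Pi_iff)

lemma lin_ext_zero [simp]: "lin_ext A \<beta> 0 = \<zero>"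
  by (simp add: lin_ext_def)

lemma lin_ext_single: "\<beta> k \<in> carrier A \<Longrightarrow> lin_ext A \<beta> (sgl k c) = c \<odot> \<beta> k"
  by (simp add: lin_ext_superset[of "{k}"] smult_closed)

lemma lin_ext_add:
  assumes "\<beta> \<in> supp s \<union> supp t \<rightarrow> carrier A"
  shows "lin_ext A \<beta> (s + t) = lin_ext A \<beta> s \<oplus> lin_ext A \<beta> t"
proof -
  let ?K = "supp s \<union> supp t"
  have cl: "(\<lambda>k. c k \<odot> \<beta> k) \<in> ?K \<rightarrow> carrier A" for c
    using assms by (auto simp: Pi_iff)
  have "supp (s + t) \<subseteq> ?K" by (rule Poly_Mapping.keys_add)
  then have "lin_ext A \<beta> (s + t) = finsum A (\<lambda>k. lookup (s + t) k \<odot> \<beta> k) ?K"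
    using assms by (intro lin_ext_superset) auto
  also have "\<dots> = finsum A (\<lambda>k. lookup s k \<odot> \<beta> k \<oplus> lookup t k \<odot> \<beta> k) ?K"
    using assms by (intro finsum_cong') (auto simp: lookup_add smult_l_distr Pi_iff)
  also have "\<dots> = lin_ext A \<beta> s \<oplus> lin_ext A \<beta> t"
    using assms cl by (simp add: lin_ext_superset[of ?K] finsum_addf)
  finally show ?thesis .
qed

lemma lin_ext_scl:
  assumes "\<beta> \<in> supp t \<rightarrow> carrier A"
  shows "lin_ext A \<beta> (scl c t) = c \<odot> lin_ext A \<beta> t"
proof -
  have "lin_ext A \<beta> (scl c t) = finsum A (\<lambda>k. c \<odot> (lookup t k \<odot> \<beta> k)) (supp t)"
    using assms supp_scl[of c t]
    by (subst lin_ext_superset[of "supp t"])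
      (auto simp: smult_assoc smult_closed Pi_iff intro!: finsum_cong')
  also have "\<dots> = c \<odot> lin_ext A \<beta> t"
    unfolding lin_ext_def using assms by (intro smult_finsum[symmetric]) (auto simp: Pi_iff)
  finally show ?thesis .
qed

lemma lin_ext_diff:
  assumes "\<beta> \<in> supp s \<union> supp t \<rightarrow> carrier A"
  shows "lin_ext A \<beta> (s - t) = lin_ext A \<beta> s \<ominus> lin_ext A \<beta> t"
proof -
  have "s - t = s + scl (-1) t" by (rule poly_mapping_eqI) (simp add: lookup_minus lookup_add)
  moreover have "\<beta> \<in> supp s \<union> supp (scl (-1) t) \<rightarrow> carrier A"
    using assms supp_scl[of "-1" t] by blast
  moreover have "lin_ext A \<beta> (scl (-1) t) = \<ominus> lin_ext A \<beta> t"
    using assms by (subst lin_ext_scl) (auto intro!: smult_minus_one lin_ext_closed)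
  ultimately show ?thesis by (metis lin_ext_add a_minus_def)
qed

lemma lin_ext_cong:
  assumes "\<And>k. k \<in> supp t \<Longrightarrow> \<beta> k = \<beta>' k" "\<beta>' \<in> supp t \<rightarrow> carrier A"
  shows "lin_ext A \<beta> t = lin_ext A \<beta>' t"
  unfolding lin_ext_def using assms by (intro finsum_cong') (auto simp: Pi_iff)

lemma lin_ext_subspace:
  assumes "lin_subspace W A" "\<And>k. k \<in> supp t \<Longrightarrow> \<beta> k \<in> W"
  shows "lin_ext A \<beta> t \<in> W"
  unfolding lin_ext_def using assms by (intro lin_subspace_finsum) (auto dest: lin_subspaceD)

end

lemma klin_zero: "k_algebra A \<Longrightarrow> k_algebra B \<Longrightarrow> klin A B f \<Longrightarrow> f \<zero>\<^bsub>A\<^esub> = \<zero>\<^bsub>B\<^esub>"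
proof -
  assume "k_algebra A" "k_algebra B" and f: "klin A B f"
  then interpret A: k_algebra A + B: k_algebra B by auto
  show "f \<zero>\<^bsub>A\<^esub> = \<zero>\<^bsub>B\<^esub>"
    using klinD(3)[OF f, of "\<zero>\<^bsub>A\<^esub>" 0] klinD(1)[OF f, of "\<zero>\<^bsub>A\<^esub>"] by simp
qed

lemma klin_minus:
  assumes "k_algebra A" "k_algebra B" "klin A B f" "x \<in> carrier A"
  shows "f (\<ominus>\<^bsub>A\<^esub> x) = \<ominus>\<^bsub>B\<^esub> f x"
proof -
  interpret A: k_algebra A + B: k_algebra B using assms by auto
  show ?thesis
    using klinD(3)[OF assms(3,4), of "-1"] klinD(1)[OF assms(3,4)] assms(4)
    by (simp add: A.smult_minus_one B.smult_minus_one)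
qed

lemma klin_lin_ext:
  assumes "k_algebra A" "k_algebra B" "klin A B f" "\<beta> \<in> supp t \<rightarrow> carrier A"
  shows "f (lin_ext A \<beta> t) = lin_ext B (\<lambda>s. f (\<beta> s)) t"
proof -
  interpret A: k_algebra A + B: k_algebra B using assms by auto
  note f = klinD[OF assms(3)]
  have "supp t \<subseteq> {s. \<beta> s \<in> carrier A}" using assms(4) by auto
  then show ?thesis
  proof (induction rule: pm_induct)
    case (add s t)
    then show ?case
      by (subst A.lin_ext_add, blast, subst B.lin_ext_add)
        (auto simp: f A.lin_ext_closed Pi_iff subset_iff)
  qed (auto simp: klin_zero[OF assms(1,2,3)] A.lin_ext_single B.lin_ext_single f)
qed

lemma klin_eq_on_span:
  assumes "k_algebra A" "k_algebra B" "klin A B f" "klin A B g" "S \<subseteq> carrier A"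
    and "\<And>s. s \<in> S \<Longrightarrow> f s = g s" "x \<in> lin_span A S"
  shows "f x = g x"
proof -
  interpret A: k_algebra A + B: k_algebra B using assms by auto
  have "x \<in> lin_span A S \<Longrightarrow> x \<in> carrier A" for x
    using A.lin_subspaceD(1)[OF A.lin_subspace_lin_span[OF assms(5)]] by blast
  with assms(7,5) show ?thesis
    by (induction rule: A.lin_span_induct)
      (auto simp: assms(6) klin_zero[OF assms(1,2)] assms klinD[OF assms(3)] klinD[OF assms(4)])
qed

lemma klin_vimage:
  assumes "k_algebra A" "k_algebra B" "klin A B f" "lin_subspace W B"
  shows "lin_subspace {x \<in> carrier A. f x \<in> W} A"
proof -
  interpret A: k_algebra A + B: k_algebra B using assms by auto
  show ?thesis
    using B.lin_subspaceD[OF assms(4)]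
    by (intro A.lin_subspaceI)
      (auto simp: klin_zero[OF assms(1,2)] assms klinD[OF assms(3)] A.smult_closed)
qed

lemma klin_span_into:
  assumes "k_algebra A" "k_algebra B" "klin A B f" "lin_subspace W B"
    and "S \<subseteq> carrier A" "\<And>s. s \<in> S \<Longrightarrow> f s \<in> W" "x \<in> lin_span A S"
  shows "f x \<in> W"
proof -
  interpret A: k_algebra A by fact
  show ?thesis
    using A.lin_span_least[OF klin_vimage[OF assms(1-4)], of S] assms(5-7) by auto
qed

section \<open>Quotient algebras and subalgebras\<close>

lemma quot_alg_simps:
  "carrier (quot_alg A I) = a_rcosets\<^bsub>A\<^esub> I"
  "mult (quot_alg A I) = rcoset_mult A I"
  "one (quot_alg A I) = I +>\<^bsub>A\<^esub> \<one>\<^bsub>A\<^esub>"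
  "zero (quot_alg A I) = I"
  "add (quot_alg A I) = set_add A"
  "smult (quot_alg A I) = (\<lambda>c X. set_add A I ((\<lambda>x. c \<odot>\<^bsub>A\<^esub> x) ` X))"
  by (simp_all add: quot_alg_def FactRing_def ring.extend_def module.fields_def)

text \<open>\<open>quot_alg\<close> extends the factor ring by a scalar multiplication and so has
  another record type; the ring axioms have to be carried over field by field.\<close>

lemma ring_cong_fields:
  assumes "ring R" "carrier S = carrier R" "mult S = mult R" "one S = one R"
    "zero S = zero R" "add S = add R"
  shows "ring S"
proof -
  interpret R: ring R by fact
  show ?thesis
  proof (rule ringI)
    show "abelian_group S"
    proof (rule abelian_groupI)
      fix x assume "x \<in> carrier S"
      then show "\<exists>y\<in>carrier S. y \<oplus>\<^bsub>S\<^esub> x = \<zero>\<^bsub>S\<^esub>"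
        using R.l_neg[of x] R.a_inv_closed[of x] assms by auto
    qed (use assms R.a_assoc R.a_comm in auto)
    show "Group.monoid S"
      by (rule monoidI) (use assms R.m_assoc in auto)
  qed (use assms R.l_distr R.r_distr in auto)
qed

context k_algebra
begin

text \<open>c x = (c 1) x, so a ring ideal is a subspace.\<close>

lemma ideal_smult: "ideal I A \<Longrightarrow> x \<in> I \<Longrightarrow> c \<odot> x \<in> I"
  using ideal.I_l_closed[of I A x "c \<odot> \<one>"] ideal.Icarr[of I A x] smult_mult_l[of \<one> x c]
  by auto

lemma ideal_lin_subspace: "ideal I A \<Longrightarrow> lin_subspace I A"
  by (auto simp: lin_subspace_def ideal_smult ideal.axioms(1) additive_subgroup.a_subgroup)

text \<open>\<open>quot_alg\<close> adds I again after scaling, because for c = 0 the scaled coset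
  alone is {0} rather than I.\<close>

lemma coset_smult:
  assumes "ideal I A" "x \<in> carrier A"
  shows "set_add A I ((\<lambda>x. c \<odot> x) ` (I +> x)) = I +> (c \<odot> x)"
proof -
  interpret I: ideal I A by fact
  have a: "I +> y = (\<lambda>i. i \<oplus> y) ` I" for y by (auto simp: a_r_coset_def r_coset_def)
  have b: "set_add A I Y = {i \<oplus> y | i y. i \<in> I \<and> y \<in> Y}" for Y by (auto simp: set_add_def set_mult_def)
  have 1: "i \<oplus> c \<odot> (j \<oplus> x) = (i \<oplus> c \<odot> j) \<oplus> c \<odot> x" if "i \<in> I" "j \<in> I" for i j
    using that assms(2) by (simp add: smult_r_distr a_assoc I.Icarr)
  show ?thesis unfolding a b
  proof (intro equalityI subsetI)
    fix z assume "z \<in> {i \<oplus> y | i y. i \<in> I \<and> y \<in> (\<lambda>x. c \<odot> x) ` (\<lambda>i. i \<oplus> x) ` I}"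
    then obtain i j where "i \<in> I" "j \<in> I" "z = i \<oplus> c \<odot> (j \<oplus> x)" by blast
    then show "z \<in> (\<lambda>i. i \<oplus> c \<odot> x) ` I"
      by (intro image_eqI[of _ _ "i \<oplus> c \<odot> j"]) (auto simp: 1 assms(1) ideal_smult I.a_closed)
  next
    fix z assume "z \<in> (\<lambda>i. i \<oplus> c \<odot> x) ` I"
    then obtain i where i: "i \<in> I" "z = i \<oplus> c \<odot> x" by blast
    have "z = i \<oplus> c \<odot> (\<zero> \<oplus> x)" "\<zero> \<in> I" using i assms(2) by (simp_all add: I.zero_closed)
    with i(1) show "z \<in> {i \<oplus> y | i y. i \<in> I \<and> y \<in> (\<lambda>x. c \<odot> x) ` (\<lambda>i. i \<oplus> x) ` I}" by blast
  qed
qed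

lemma quot_alg_ops:
  assumes "ideal I A" "x \<in> carrier A"
  shows "I +> x \<in> carrier (quot_alg A I)"
    and "y \<in> carrier A \<Longrightarrow> (I +> x) \<otimes>\<^bsub>quot_alg A I\<^esub> (I +> y) = I +> (x \<otimes> y)"
    and "y \<in> carrier A \<Longrightarrow> (I +> x) \<oplus>\<^bsub>quot_alg A I\<^esub> (I +> y) = I +> (x \<oplus> y)"
    and "c \<odot>\<^bsub>quot_alg A I\<^esub> (I +> x) = I +> (c \<odot> x)"
proof -
  interpret I: ideal I A by fact
  show "I +> x \<in> carrier (quot_alg A I)"
    "y \<in> carrier A \<Longrightarrow> (I +> x) \<otimes>\<^bsub>quot_alg A I\<^esub> (I +> y) = I +> (x \<otimes> y)"
    "y \<in> carrier A \<Longrightarrow> (I +> x) \<oplus>\<^bsub>quot_alg A I\<^esub> (I +> y) = I +> (x \<oplus> y)"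
    "c \<odot>\<^bsub>quot_alg A I\<^esub> (I +> x) = I +> (c \<odot> x)"
    using assms coset_smult
    by (auto simp: quot_alg_simps I.rcoset_mult_add I.a_rcos_sum a_rcosetsI I.a_subset)
qed

lemma quot_alg_carrier: "carrier (quot_alg A I) = (\<lambda>x. I +> x) ` carrier A"
  by (auto simp: quot_alg_simps A_RCOSETS_def')

lemma quot_alg_eq_iff:
  assumes "ideal I A" "x \<in> carrier A" "y \<in> carrier A"
  shows "I +> x = I +> y \<longleftrightarrow> x \<ominus> y \<in> I"
  using quotient_eq_iff_same_a_r_cos[OF assms] by simp

lemma quot_alg_eq_zero_iff:
  assumes "ideal I A" "x \<in> carrier A"
  shows "I +> x = I \<longleftrightarrow> x \<in> I"
proof -
  interpret I: ideal I A by fact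
  show ?thesis using quot_alg_eq_iff[OF assms(1,2), of \<zero>] assms(2)
    by (simp add: a_minus_def) (metis I.a_rcos_const I.zero_closed)
qed

lemma k_algebra_quot:
  assumes "ideal I A"
  shows "k_algebra (quot_alg A I)"
proof -
  interpret I: ideal I A by fact
  have "ring (quot_alg A I)"
    by (rule ring_cong_fields[OF I.quotient_is_ring]) (simp_all add: quot_alg_simps FactRing_def)
  then show ?thesis
    by (intro k_algebra.intro k_algebra_axioms.intro)
      (auto simp: quot_alg_carrier quot_alg_ops[OF assms] smult_l_distr smult_r_distr
        smult_assoc smult_one smult_mult_l smult_mult_r)
qed

lemma proj_hom: "ideal I A \<Longrightarrow> (\<lambda>x. I +> x) \<in> alg_hom A (quot_alg A I)"
  by (intro alg_homI klinI) (simp_all only: quot_alg_ops quot_alg_simps(3) one_closed)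

lemma k_algebra_subalgebra:
  assumes "k_subalgebra U A"
  shows "k_algebra (A\<lparr>carrier := U\<rparr>)"
proof -
  have U: "subring U A" "\<And>c x. x \<in> U \<Longrightarrow> c \<odot> x \<in> U" using assms by (auto simp: k_subalgebra_def)
  then have "U \<subseteq> carrier A" using subringE(1) by blast
  then show ?thesis
    using subring_is_ring[OF U(1)] U(2)
    by (intro k_algebra.intro k_algebra_axioms.intro)
      (auto simp: smult_l_distr smult_r_distr smult_assoc smult_one smult_mult_l smult_mult_r subset_iff)
qed

lemma k_subalgebraI:
  assumes "U \<subseteq> carrier A" "\<one> \<in> U" "\<And>x y. x \<in> U \<Longrightarrow> y \<in> U \<Longrightarrow> x \<otimes> y \<in> U"
    "\<And>x y. x \<in> U \<Longrightarrow> y \<in> U \<Longrightarrow> x \<oplus> y \<in> U" "\<And>c x. x \<in> U \<Longrightarrow> c \<odot> x \<in> U"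
  shows "k_subalgebra U A"
proof -
  have "\<ominus> x \<in> U" if "x \<in> U" for x
    using that assms(1) assms(5)[of x "-1"] smult_minus_one[of x] by auto
  then have "subring U A" using assms by (intro subringI) auto
  then show ?thesis using assms by (auto simp: k_subalgebra_def)
qed

lemma k_subalgebraD:
  assumes "k_subalgebra U A"
  shows "U \<subseteq> carrier A" "\<one> \<in> U" "x \<in> U \<Longrightarrow> y \<in> U \<Longrightarrow> x \<otimes> y \<in> U" "x \<in> U \<Longrightarrow> y \<in> U \<Longrightarrow> x \<oplus> y \<in> U"
    "x \<in> U \<Longrightarrow> c \<odot> x \<in> U"
  using assms subringE[of U A] by (auto simp: k_subalgebra_def)

lemma k_subalgebra_lin_subspace: "k_subalgebra U A \<Longrightarrow> lin_subspace U A"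
proof -
  assume "k_subalgebra U A"
  then have "subring U A" "\<And>c x. x \<in> U \<Longrightarrow> c \<odot> x \<in> U" by (auto simp: k_subalgebra_def)
  then show ?thesis
    using subringE[of U A] by (intro lin_subspaceI) auto
qed

lemma k_subalgebra_gen:
  assumes "S \<subseteq> carrier A"
  shows "k_subalgebra (gen_subalgebra A S) A"
proof -
  have "k_subalgebra (carrier A) A" by (rule k_subalgebraI) auto
  then have "gen_subalgebra A S \<subseteq> carrier A" using assms by (auto simp: gen_subalgebra_def)
  then show ?thesis
    by (rule k_subalgebraI) (auto simp: gen_subalgebra_def dest: k_subalgebraD)
qed

end

lemma gen_subalgebra_least: "k_subalgebra U A \<Longrightarrow> S \<subseteq> U \<Longrightarrow> gen_subalgebra A S \<subseteq> U"
  by (auto simp: gen_subalgebra_def)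

lemma gen_subalgebra_superset: "S \<subseteq> gen_subalgebra A S"
  by (auto simp: gen_subalgebra_def)

lemma k_subalgebra_vimage:
  assumes "k_algebra A" "k_algebra B" "f \<in> alg_hom A B" "k_subalgebra U B"
  shows "k_subalgebra {x \<in> carrier A. f x \<in> U} A"
proof -
  interpret A: k_algebra A + B: k_algebra B using assms by auto
  note f = alg_homD[OF assms(3)]
  have "subring U B" "\<And>c x. x \<in> U \<Longrightarrow> c \<odot>\<^bsub>B\<^esub> x \<in> U" using assms by (auto simp: k_subalgebra_def)
  then show ?thesis
    using subringE[of U] by (intro A.k_subalgebraI) (auto simp: f)
qed

lemma k_subalgebra_image:
  assumes "k_algebra A" "k_algebra B" "f \<in> alg_hom A B" "k_subalgebra U A"
  shows "k_subalgebra (f ` U) B"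
proof -
  interpret A: k_algebra A + B: k_algebra B using assms by auto
  note f = alg_homD[OF assms(3)]
  have U: "subring U A" "\<And>c x. x \<in> U \<Longrightarrow> c \<odot>\<^bsub>A\<^esub> x \<in> U" using assms by (auto simp: k_subalgebra_def)
  note E = subringE[OF U(1)]
  show ?thesis
  proof (rule B.k_subalgebraI)
    show "f ` U \<subseteq> carrier B" using E(1) f(2) by auto
    show "\<one>\<^bsub>B\<^esub> \<in> f ` U" using image_eqI[of "\<one>\<^bsub>B\<^esub>" f, OF f(6)[symmetric] E(3)] .
  next
    fix x y assume "x \<in> f ` U" "y \<in> f ` U"
    then obtain a b where ab: "a \<in> U" "b \<in> U" "x = f a" "y = f b" by auto
    have "a \<in> carrier A" "b \<in> carrier A" using ab E(1) by auto
    then have "x \<otimes>\<^bsub>B\<^esub> y = f (a \<otimes>\<^bsub>A\<^esub> b)" "x \<oplus>\<^bsub>B\<^esub> y = f (a \<oplus>\<^bsub>A\<^esub> b)" by (auto simp: f ab)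
    then show "x \<otimes>\<^bsub>B\<^esub> y \<in> f ` U" "x \<oplus>\<^bsub>B\<^esub> y \<in> f ` U" using E(6,7) ab by auto
  next
    fix c x assume "x \<in> f ` U"
    then obtain a where "a \<in> U" "x = f a" by auto
    moreover from this have "a \<in> carrier A" using E(1) by auto
    ultimately have "c \<odot>\<^bsub>B\<^esub> x = f (c \<odot>\<^bsub>A\<^esub> a)" "c \<odot>\<^bsub>A\<^esub> a \<in> U" using U(2) by (auto simp: f)
    then show "c \<odot>\<^bsub>B\<^esub> x \<in> f ` U" by auto
  qed
qed

lemma ideal_hom_vimage:
  assumes "k_algebra A" "k_algebra B" "f \<in> alg_hom A B" "ideal J B"
  shows "ideal {x \<in> carrier A. f x \<in> J} A"
proof -
  interpret A: k_algebra A + B: k_algebra B using assms by auto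
  interpret J: ideal J B by fact
  note f = alg_homD[OF assms(3)]
  have "lin_subspace {x \<in> carrier A. f x \<in> J} A"
    by (rule klin_vimage[OF assms(1,2) f(1) B.ideal_lin_subspace[OF assms(4)]])
  then show ?thesis
    by (intro idealI) (auto simp: lin_subspace_def A.ring_axioms f J.I_l_closed J.I_r_closed)
qed

lemma zero_ideal_vimage:
  assumes "k_algebra A" "k_algebra B" "f \<in> alg_hom A B"
  shows "ideal {x \<in> carrier A. f x = \<zero>\<^bsub>B\<^esub>} A"
proof -
  interpret B: k_algebra B by fact
  show ?thesis using ideal_hom_vimage[OF assms B.zeroideal] by simp
qed

lemma ideal_hom_image:
  assumes "k_algebra A" "k_algebra B" "f \<in> alg_hom A B" "f ` carrier A = carrier B" "ideal J A"
  shows "ideal (f ` J) B"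
proof -
  interpret A: k_algebra A + B: k_algebra B using assms by auto
  interpret J: ideal J A by fact
  note f = alg_homD[OF assms(3)]
  note D = A.lin_subspaceD[OF A.ideal_lin_subspace[OF assms(5)]]
  have "lin_subspace (f ` J) B"
  proof (rule B.lin_subspaceI)
    show "f ` J \<subseteq> carrier B" using D(1) f(2) by auto
    show "\<zero>\<^bsub>B\<^esub> \<in> f ` J" using image_eqI[of "\<zero>\<^bsub>B\<^esub>" f, OF klin_zero[OF assms(1,2) f(1), symmetric] D(2)] .
  next
    fix x y assume "x \<in> f ` J" "y \<in> f ` J"
    then obtain a b where ab: "a \<in> J" "b \<in> J" "x = f a" "y = f b" by auto
    then have "x \<oplus>\<^bsub>B\<^esub> y = f (a \<oplus>\<^bsub>A\<^esub> b)" using D(1) by (auto simp: f)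
    then show "x \<oplus>\<^bsub>B\<^esub> y \<in> f ` J" using D(3) ab by auto
  next
    fix c x assume "x \<in> f ` J"
    then obtain a where a: "a \<in> J" "x = f a" by auto
    then have "c \<odot>\<^bsub>B\<^esub> x = f (c \<odot>\<^bsub>A\<^esub> a)" using D(1) by (auto simp: f)
    then show "c \<odot>\<^bsub>B\<^esub> x \<in> f ` J" using D(4) a by auto
  qed
  moreover have "b \<otimes>\<^bsub>B\<^esub> x \<in> f ` J \<and> x \<otimes>\<^bsub>B\<^esub> b \<in> f ` J" if "x \<in> f ` J" "b \<in> carrier B" for x b
  proof -
    from that(1) obtain a where a: "a \<in> J" "x = f a" by blast
    have a': "a \<in> carrier A" using a D(1) by blast
    from that(2) obtain b' where b: "b' \<in> carrier A" "b = f b'" unfolding assms(4)[symmetric] by blast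
    have "b \<otimes>\<^bsub>B\<^esub> x = f (b' \<otimes>\<^bsub>A\<^esub> a)" "x \<otimes>\<^bsub>B\<^esub> b = f (a \<otimes>\<^bsub>A\<^esub> b')" by (simp_all add: f(5) a(2) a' b)
    then show ?thesis using J.I_l_closed J.I_r_closed a b by auto
  qed
  ultimately show ?thesis by (intro idealI) (auto simp: lin_subspace_def B.ring_axioms)
qed


section \<open>Twisted monoid algebras\<close>

lemma twisted_alg_simps [simp]:
  "carrier (twisted_alg M \<tau>) = {a. supp a \<subseteq> carrier M}"
  "one (twisted_alg M \<tau>) = bas \<one>\<^bsub>M\<^esub>"
  "zero (twisted_alg M \<tau>) = 0"
  "add (twisted_alg M \<tau>) = (+)"
  "smult (twisted_alg M \<tau>) = scl"
  by (auto simp: twisted_alg_def scl_def)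

lemma twisted_alg_mult:
  "a \<otimes>\<^bsub>twisted_alg M \<tau>\<^esub> b = plin (\<lambda>s. plin (\<lambda>t. sgl (s \<otimes>\<^bsub>M\<^esub> t) (\<tau> s t)) b) a"
  by (simp add: twisted_alg_def plin_def pm.scale_sum_right mult.assoc)

text \<open>\<tau> is a normalized 2-cocycle: \<open>cocycle\<close> is associativity on basis
  elements, \<open>tau_one\<close> the unit law.\<close>

locale twisted = M: Group.monoid M for M :: "('b, 'm) monoid_scheme" (structure) +
  fixes \<tau> :: "'b \<Rightarrow> 'b \<Rightarrow> 'k::field"
  assumes cocycle: "\<And>s t u. s \<in> carrier M \<Longrightarrow> t \<in> carrier M \<Longrightarrow> u \<in> carrier M \<Longrightarrow>
      \<tau> s t * \<tau> (s \<otimes> t) u = \<tau> t u * \<tau> s (t \<otimes> u)"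
    and tau_one: "\<And>s. s \<in> carrier M \<Longrightarrow> \<tau> \<one> s = 1" "\<And>s. s \<in> carrier M \<Longrightarrow> \<tau> s \<one> = 1"
begin

abbreviation "TA \<equiv> twisted_alg M \<tau>"

lemma supp_mult: "supp a \<subseteq> carrier M \<Longrightarrow> supp b \<subseteq> carrier M \<Longrightarrow> supp (a \<otimes>\<^bsub>TA\<^esub> b) \<subseteq> carrier M"
  unfolding twisted_alg_mult
  using supp_plin[of "\<lambda>s. plin (\<lambda>t. sgl (s \<otimes> t) (\<tau> s t)) b" a]
    supp_plin[of "\<lambda>t. sgl (s \<otimes> t) (\<tau> s t)" b for s]
  by (fastforce simp: subset_iff split: if_splits)

lemma k_algebra_twisted: "k_algebra TA"
proof -
  have "ring TA"
  proof (rule ringI)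
    show "abelian_group TA"
    proof (rule abelian_groupI)
      fix x assume "x \<in> carrier TA"
      then show "\<exists>y\<in>carrier TA. y \<oplus>\<^bsub>TA\<^esub> x = \<zero>\<^bsub>TA\<^esub>"
        by (intro bexI[of _ "- x"]) auto
    next
      fix x y assume "x \<in> carrier TA" "y \<in> carrier TA"
      then show "x \<oplus>\<^bsub>TA\<^esub> y \<in> carrier TA"
        using Poly_Mapping.keys_add[of x y] by auto
    qed (simp_all add: add.assoc add.commute)
    show "Group.monoid TA"
    proof (rule monoidI)
      fix x y z assume "x \<in> carrier TA" "y \<in> carrier TA" "z \<in> carrier TA"
      then show "x \<otimes>\<^bsub>TA\<^esub> y \<otimes>\<^bsub>TA\<^esub> z = x \<otimes>\<^bsub>TA\<^esub> (y \<otimes>\<^bsub>TA\<^esub> z)"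
        unfolding twisted_alg_mult
        by (simp add: plin_plin plin_fun_scl[symmetric] subset_iff M.m_assoc cocycle mult.commute
            cong: plin_cong) 
    next
      fix x assume "x \<in> carrier TA"
      then have "plin (\<lambda>t. sgl (\<one> \<otimes> t) (\<tau> \<one> t)) x = plin bas x" "plin (\<lambda>t. sgl (t \<otimes> \<one>) (\<tau> t \<one>)) x = plin bas x"
        by (intro plin_cong; auto simp: tau_one subset_iff)+
      then show "\<one>\<^bsub>TA\<^esub> \<otimes>\<^bsub>TA\<^esub> x = x" "x \<otimes>\<^bsub>TA\<^esub> \<one>\<^bsub>TA\<^esub> = x"
        unfolding twisted_alg_mult by simp_all
    qed (use supp_mult in auto)
  qed (simp_all add: twisted_alg_mult plin_add plin_fun_add)
  then show ?thesis
    using supp_scl by (intro k_algebra.intro k_algebra_axioms.intro)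
      (fastforce simp: twisted_alg_mult plin_scl plin_fun_scl pm.scale_left_distrib
        pm.scale_right_distrib)+
qed

lemma mult_bas: "sgl s c \<otimes>\<^bsub>TA\<^esub> sgl t d = sgl (s \<otimes> t) (c * d * \<tau> s t)"
  by (simp add: twisted_alg_mult mult.assoc)

lemma klin_lin_ext_twisted:
  assumes "k_algebra B" "\<beta> \<in> carrier M \<rightarrow> carrier B"
  shows "klin TA B (lin_ext B \<beta>)"
proof -
  interpret B: k_algebra B by fact
  have "\<beta> \<in> S \<rightarrow> carrier B" if "S \<subseteq> carrier M" for S using that assms(2) by blast
  then show ?thesis
    by (intro klinI) (auto simp: B.lin_ext_add B.lin_ext_scl B.lin_ext_closed)
qed

text \<open>The universal property of the twisted algebra. It yields the maps of the skew algebras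
  into F_n (\<open>\<theta>_hom\<close>) and into the tensor square of A
  (\<open>\<phi>_hom\<close>), and that of k[H] into A (\<open>\<kappa>_hom\<close>).\<close>

lemma lin_ext_hom:
  assumes "k_algebra B" "\<beta> \<in> carrier M \<rightarrow> carrier B" "\<beta> \<one> = \<one>\<^bsub>B\<^esub>"
    and mult: "\<And>s t. s \<in> carrier M \<Longrightarrow> t \<in> carrier M \<Longrightarrow> \<beta> s \<otimes>\<^bsub>B\<^esub> \<beta> t = \<tau> s t \<odot>\<^bsub>B\<^esub> \<beta> (s \<otimes> t)"
  shows "lin_ext B \<beta> \<in> alg_hom TA B"
proof (rule alg_homI)
  interpret B: k_algebra B by fact
  interpret TA: k_algebra TA by (rule k_algebra_twisted)
  show lin: "klin TA B (lin_ext B \<beta>)" by (rule klin_lin_ext_twisted) fact+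
  note L = klinD[OF lin]
  have \<beta>: "s \<in> carrier M \<Longrightarrow> \<beta> s \<in> carrier B" for s using assms(2) by blast
  have S: "sgl s c \<in> carrier TA" if "s \<in> carrier M" for s c using that by auto
  show "lin_ext B \<beta> \<one>\<^bsub>TA\<^esub> = \<one>\<^bsub>B\<^esub>"
    using \<beta>[of \<one>] assms(3) by (simp add: B.lin_ext_single B.smult_one)
  have hom_single: "lin_ext B \<beta> (sgl s c \<otimes>\<^bsub>TA\<^esub> b) = lin_ext B \<beta> (sgl s c) \<otimes>\<^bsub>B\<^esub> lin_ext B \<beta> b"
    if s: "s \<in> carrier M" and b: "supp b \<subseteq> carrier M" for s c b
    using b
  proof (induction rule: pm_induct)
    case zero
    then show ?case using s \<beta> by (simp add: twisted_alg_mult B.lin_ext_single)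
  next
    case (single t d)
    have "lin_ext B \<beta> (sgl s c) \<otimes>\<^bsub>B\<^esub> lin_ext B \<beta> (sgl t d) = c \<odot>\<^bsub>B\<^esub> (d \<odot>\<^bsub>B\<^esub> (\<beta> s \<otimes>\<^bsub>B\<^esub> \<beta> t))"
      using s single \<beta> by (simp add: B.lin_ext_single B.smult_mult_l[of "\<beta> s"] B.smult_mult_r[of "\<beta> s"])
    then show ?case using s single \<beta>
      by (simp add: mult_bas B.lin_ext_single mult mult.assoc flip: B.smult_assoc)
  next
    case (add b b')
    have "sgl s c \<otimes>\<^bsub>TA\<^esub> (b + b') = (sgl s c \<otimes>\<^bsub>TA\<^esub> b) \<oplus>\<^bsub>TA\<^esub> (sgl s c \<otimes>\<^bsub>TA\<^esub> b')"
      using TA.r_distr[of b b' "sgl s c"] S[OF s] add(1,2) by simp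
    moreover have "lin_ext B \<beta> (b + b') = lin_ext B \<beta> b \<oplus>\<^bsub>B\<^esub> lin_ext B \<beta> b'"
      using L(2)[of b b'] add by simp
    moreover have "lin_ext B \<beta> b \<in> carrier B" "lin_ext B \<beta> b' \<in> carrier B" "lin_ext B \<beta> (sgl s c) \<in> carrier B"
      using L(1) add(1,2) S[OF s] by auto
    moreover have "sgl s c \<otimes>\<^bsub>TA\<^esub> b \<in> carrier TA" "sgl s c \<otimes>\<^bsub>TA\<^esub> b' \<in> carrier TA"
      using TA.m_closed[OF S[OF s]] add(1,2) by (metis (no_types) mem_Collect_eq twisted_alg_simps(1))+
    ultimately show ?case using add by (simp only: L(2) B.r_distr)
  qed
  fix a b assume "a \<in> carrier TA" and b: "b \<in> carrier TA"
  then have "supp a \<subseteq> carrier M" by simp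
  then show "lin_ext B \<beta> (a \<otimes>\<^bsub>TA\<^esub> b) = lin_ext B \<beta> a \<otimes>\<^bsub>B\<^esub> lin_ext B \<beta> b"
  proof (induction rule: pm_induct)
    case zero
    then show ?case using L(1)[OF b] by (simp add: twisted_alg_mult)
  next
    case (single s c)
    then show ?case using b by (intro hom_single) auto
  next
    case (add s t)
    then have st: "s \<in> carrier TA" "t \<in> carrier TA" by auto
    have "(s + t) \<otimes>\<^bsub>TA\<^esub> b = s \<otimes>\<^bsub>TA\<^esub> b \<oplus>\<^bsub>TA\<^esub> t \<otimes>\<^bsub>TA\<^esub> b" using TA.l_distr[OF st b] by simp
    moreover have "lin_ext B \<beta> (s + t) = lin_ext B \<beta> s \<oplus>\<^bsub>B\<^esub> lin_ext B \<beta> t" using L(2)[OF st] by simp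
    ultimately show ?case
      using add.IH L(1) st b by (simp only: L(2) TA.m_closed B.l_distr)
  qed
qed

end

section \<open>Monoid algebras, the case of the trivial cocycle\<close>

lemma twisted_one: "Group.monoid M \<Longrightarrow> twisted M (\<lambda>_ _. 1)"
  by (simp add: twisted_def twisted_axioms_def)

lemma monoid_alg_simps [simp]:
  "carrier (monoid_alg M) = {a. supp a \<subseteq> carrier M}"
  "one (monoid_alg M) = bas \<one>\<^bsub>M\<^esub>"
  "zero (monoid_alg M) = 0"
  "add (monoid_alg M) = (+)"
  "smult (monoid_alg M) = scl"
  by (simp_all add: monoid_alg_def)

lemma k_algebra_monoid_alg: "Group.monoid M \<Longrightarrow> k_algebra (monoid_alg M)"
  using twisted.k_algebra_twisted[OF twisted_one] by (simp add: monoid_alg_def)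

lemma monoid_alg_mult_bas: "Group.monoid M \<Longrightarrow>
    sgl s c \<otimes>\<^bsub>monoid_alg M\<^esub> sgl t d = sgl (s \<otimes>\<^bsub>M\<^esub> t) (c * d)"
  using twisted.mult_bas[OF twisted_one] by (simp add: monoid_alg_def)

lemma klin_lin_ext_monoid_alg: "Group.monoid M \<Longrightarrow> k_algebra B \<Longrightarrow> \<beta> \<in> carrier M \<rightarrow> carrier B \<Longrightarrow>
    klin (monoid_alg M) B (lin_ext B \<beta>)"
  using twisted.klin_lin_ext_twisted[OF twisted_one] by (simp add: monoid_alg_def)

lemma monoid_alg_minus:
  assumes "Group.monoid M" "supp s \<subseteq> carrier M" "supp t \<subseteq> carrier M"
  shows "\<ominus>\<^bsub>monoid_alg M\<^esub> t = - t" "s \<ominus>\<^bsub>monoid_alg M\<^esub> t = s - t"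
proof -
  interpret k_algebra "monoid_alg M" by (rule k_algebra_monoid_alg) fact
  show "\<ominus>\<^bsub>monoid_alg M\<^esub> t = - t" using smult_minus_one[of t] assms by simp
  then show "s \<ominus>\<^bsub>monoid_alg M\<^esub> t = s - t" by (simp add: a_minus_def)
qed

lemma lin_subspace_monoid_alg:
  assumes "Group.monoid M"
  shows "lin_subspace W (monoid_alg M) \<longleftrightarrow> pm.subspace W \<and> (\<forall>t\<in>W. supp t \<subseteq> carrier M)"
proof -
  interpret k_algebra "monoid_alg M" by (rule k_algebra_monoid_alg) fact
  show ?thesis
  proof
    assume "lin_subspace W (monoid_alg M)"
    from lin_subspaceD[OF this] show "pm.subspace W \<and> (\<forall>t\<in>W. supp t \<subseteq> carrier M)"
      by (auto simp: pm.subspace_def)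
  next
    assume "pm.subspace W \<and> (\<forall>t\<in>W. supp t \<subseteq> carrier M)"
    then show "lin_subspace W (monoid_alg M)" by (intro lin_subspaceI) (auto simp: pm.subspace_def)
  qed
qed

text \<open>The span in terms of algebra records agrees with that of the vector space library; the
  relations of tensor products can therefore be handled by \<open>pm.span_minimal\<close> and
  \<open>pm.span_base\<close>.\<close>

lemma lin_span_monoid_alg:
  assumes "Group.monoid M" "\<And>t. t \<in> S \<Longrightarrow> supp t \<subseteq> carrier M"
  shows "lin_span (monoid_alg M) S = pm.span S"
proof
  interpret k_algebra "monoid_alg M" by (rule k_algebra_monoid_alg) fact
  have "pm.span S \<subseteq> {t. supp t \<subseteq> carrier M}"
    using assms(2) by (intro pm.span_minimal pm_subspace_supp) auto
  then show "lin_span (monoid_alg M) S \<subseteq> pm.span S"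
    using assms(1) pm.span_superset by (intro lin_span_least) (auto simp: lin_subspace_monoid_alg)
  have "lin_subspace (lin_span (monoid_alg M) S) (monoid_alg M)"
    using assms(2) by (intro lin_subspace_lin_span) auto
  then show "pm.span S \<subseteq> lin_span (monoid_alg M) S"
    using assms(1) lin_span_superset by (intro pm.span_minimal) (auto simp: lin_subspace_monoid_alg)
qed

lemma monoid_alg_coset:
  "R +>\<^bsub>monoid_alg M\<^esub> t = (\<lambda>r. r + t) ` R"
  by (auto simp: a_r_coset_def r_coset_def)

text \<open>\<open>coset_lift\<close> takes the only element of the image of a coset. The extension
  vanishes on R, hence is constant on cosets, and the choice is legitimate.\<close>

lemma coset_lift_eq:
  assumes "Group.monoid M" "k_algebra B" "\<beta> \<in> carrier M \<rightarrow> carrier B"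
    and "lin_subspace R (monoid_alg M)" "\<And>r. r \<in> R \<Longrightarrow> lin_ext B \<beta> r = \<zero>\<^bsub>B\<^esub>" "supp t \<subseteq> carrier M"
  shows "coset_lift B \<beta> (R +>\<^bsub>monoid_alg M\<^esub> t) = lin_ext B \<beta> t"
proof -
  interpret B: k_algebra B by fact
  note L = klinD[OF klin_lin_ext_monoid_alg[OF assms(1-3)]]
  have R: "pm.subspace R" "\<And>t. t \<in> R \<Longrightarrow> supp t \<subseteq> carrier M"
    using assms(4) lin_subspace_monoid_alg[OF assms(1)] by auto
  have "lin_ext B \<beta> (r + t) = lin_ext B \<beta> t" if "r \<in> R" for r
    using L(2)[of r t] L(1)[of t] assms(5)[OF that] R(2)[OF that] assms(6) by simp
  then have "lin_ext B \<beta> ` (R +>\<^bsub>monoid_alg M\<^esub> t) = {lin_ext B \<beta> t}"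
    using pm.subspace_0[OF R(1)] by (auto simp: monoid_alg_coset image_image)
  then show ?thesis by (simp add: coset_lift_def)
qed

lemma klin_mult_left: "k_algebra A \<Longrightarrow> a \<in> carrier A \<Longrightarrow> klin A A (\<lambda>x. a \<otimes>\<^bsub>A\<^esub> x)"
  by (intro klinI) (auto simp: k_algebra.smult_mult_r monoid.m_closed ring.ring_simprules(5) k_algebra_def ring.ring_simprules)

lemma klin_mult_right: "k_algebra A \<Longrightarrow> a \<in> carrier A \<Longrightarrow> klin A A (\<lambda>x. x \<otimes>\<^bsub>A\<^esub> a)"
  by (intro klinI) (auto simp: k_algebra.smult_mult_l k_algebra_def ring.ring_simprules)

text \<open>Both sides of multiplicativity are linear in each factor, so first the right factor and
  then the left one passes from S to the whole carrier.\<close>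

lemma alg_hom_of_span:
  assumes "k_algebra A" "k_algebra B" "klin A B F" "S \<subseteq> carrier A" "carrier A = lin_span A S"
    and mult: "\<And>s t. s \<in> S \<Longrightarrow> t \<in> S \<Longrightarrow> F (s \<otimes>\<^bsub>A\<^esub> t) = F s \<otimes>\<^bsub>B\<^esub> F t"
    and one: "F \<one>\<^bsub>A\<^esub> = \<one>\<^bsub>B\<^esub>"
  shows "F \<in> alg_hom A B"
proof (rule alg_homI)
  note F = klinD(1)[OF assms(3)]
  note L = klin_comp[OF klin_mult_left[OF assms(1)] assms(3)] klin_comp[OF assms(3) klin_mult_left[OF assms(2)]]
    klin_comp[OF klin_mult_right[OF assms(1)] assms(3)] klin_comp[OF assms(3) klin_mult_right[OF assms(2)]]
  have 1: "F (s \<otimes>\<^bsub>A\<^esub> y) = F s \<otimes>\<^bsub>B\<^esub> F y" if "s \<in> S" "y \<in> carrier A" for s y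
  proof -
    have "s \<in> carrier A" using that(1) assms(4) by blast
    then show ?thesis
      using klin_eq_on_span[OF assms(1,2) L(1,2) assms(4)] mult that F assms(5) by blast
  qed
  fix x y assume xy: "x \<in> carrier A" "y \<in> carrier A"
  show "F (x \<otimes>\<^bsub>A\<^esub> y) = F x \<otimes>\<^bsub>B\<^esub> F y"
    using klin_eq_on_span[OF assms(1,2) L(3,4) assms(4)] 1 xy F assms(5) by blast
qed fact+

lemma plin_span_into:
  assumes "\<And>g. g \<in> S \<Longrightarrow> plin f g \<in> W" "pm.subspace W" "r \<in> pm.span S"
  shows "plin f r \<in> W"
proof -
  have "pm.subspace {r. plin f r \<in> W}"
    using assms(2) by (auto simp: pm.subspace_def plin_add plin_scl)
  then have "pm.span S \<subseteq> {r. plin f r \<in> W}" using assms(1) by (intro pm.span_minimal) auto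
  then show ?thesis using assms(3) by blast
qed

lemma supp_diff_subset: "supp s \<subseteq> S \<Longrightarrow> supp t \<subseteq> S \<Longrightarrow> supp (s - t) \<subseteq> S"
  using supp_diff[of s t] by blast

lemma supp_add_subset: "supp s \<subseteq> S \<Longrightarrow> supp t \<subseteq> S \<Longrightarrow> supp (s + t) \<subseteq> S"
  using Poly_Mapping.keys_add[of s t] by blast

section \<open>The tensor product of two algebras\<close>

definition kbilin :: "('k::field, 'a) module \<Rightarrow> ('k, 'b) module \<Rightarrow> ('k, 'c) module \<Rightarrow> ('a \<Rightarrow> 'b \<Rightarrow> 'c) \<Rightarrow> bool" where
  "kbilin A B C f \<longleftrightarrow> (\<forall>a\<in>carrier A. klin B C (f a)) \<and> (\<forall>b\<in>carrier B. klin A C (\<lambda>a. f a b))"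

lemma kbilinD:
  assumes "kbilin A B C f" "a \<in> carrier A" "b \<in> carrier B"
  shows "f a b \<in> carrier C"
    and "a' \<in> carrier A \<Longrightarrow> f (a \<oplus>\<^bsub>A\<^esub> a') b = f a b \<oplus>\<^bsub>C\<^esub> f a' b"
    and "b' \<in> carrier B \<Longrightarrow> f a (b \<oplus>\<^bsub>B\<^esub> b') = f a b \<oplus>\<^bsub>C\<^esub> f a b'"
    and "f (c \<odot>\<^bsub>A\<^esub> a) b = c \<odot>\<^bsub>C\<^esub> f a b" "f a (c \<odot>\<^bsub>B\<^esub> b) = c \<odot>\<^bsub>C\<^esub> f a b"
  using assms by (auto simp: kbilin_def klin_def)

definition tlift :: "('k::field, 'c) module \<Rightarrow> ('a \<Rightarrow> 'b \<Rightarrow> 'c) \<Rightarrow> ('a \<times> 'b \<Rightarrow>\<^sub>0 'k) set \<Rightarrow> 'c" where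
  "tlift C f = coset_lift C (\<lambda>(a, b). f a b)"

locale tensor_pair = A: k_algebra A + B: k_algebra B
  for A :: "('k::field, 'a) module" and B :: "('k, 'b) module"
begin

abbreviation "FM \<equiv> monoid_alg (A \<times>\<times> B)"
abbreviation "TT \<equiv> tensor A B"

lemma monoid_prod: "Group.monoid (A \<times>\<times> B)"
  by (intro DirProd_monoid A.monoid_axioms B.monoid_axioms)

sublocale FM: k_algebra FM by (rule k_algebra_monoid_alg[OF monoid_prod])

text \<open>The four families of \<open>tensor_rel\<close> as an inductive set: the proofs below
  distinguish cases by the family instead of taking apart a union of comprehensions.\<close>

inductive_set gens :: "('a \<times> 'b \<Rightarrow>\<^sub>0 'k) set" where
  addl: "a \<in> carrier A \<Longrightarrow> a' \<in> carrier A \<Longrightarrow> b \<in> carrier B \<Longrightarrow>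
    bas (a \<oplus>\<^bsub>A\<^esub> a', b) - bas (a, b) - bas (a', b) \<in> gens"
| addr: "a \<in> carrier A \<Longrightarrow> b \<in> carrier B \<Longrightarrow> b' \<in> carrier B \<Longrightarrow>
    bas (a, b \<oplus>\<^bsub>B\<^esub> b') - bas (a, b) - bas (a, b') \<in> gens"
| smultl: "a \<in> carrier A \<Longrightarrow> b \<in> carrier B \<Longrightarrow> bas (c \<odot>\<^bsub>A\<^esub> a, b) - sgl (a, b) c \<in> gens"
| smultr: "a \<in> carrier A \<Longrightarrow> b \<in> carrier B \<Longrightarrow> bas (a, c \<odot>\<^bsub>B\<^esub> b) - sgl (a, b) c \<in> gens"

lemma supp_gens: "g \<in> gens \<Longrightarrow> supp g \<subseteq> carrier (A \<times>\<times> B)"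
  by (erule gens.cases) (simp_all add: supp_diff_subset)

lemma tensor_rel_span: "tensor_rel A B = pm.span gens"
proof -
  have "tensor_rel A B = lin_span FM gens"
    unfolding tensor_rel_def
  proof (rule arg_cong[where f = "lin_span FM"], intro equalityI subsetI)
    fix g assume "g \<in> gens"
    then show "g \<in> {bas (a \<oplus>\<^bsub>A\<^esub> a', b) - bas (a, b) - bas (a', b) | a a' b.
        a \<in> carrier A \<and> a' \<in> carrier A \<and> b \<in> carrier B} \<union>
     {bas (a, b \<oplus>\<^bsub>B\<^esub> b') - bas (a, b) - bas (a, b') | a b b'.
        a \<in> carrier A \<and> b \<in> carrier B \<and> b' \<in> carrier B} \<union>
     {bas (c \<odot>\<^bsub>A\<^esub> a, b) - sgl (a, b) c | c a b. a \<in> carrier A \<and> b \<in> carrier B} \<union>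
     {bas (a, c \<odot>\<^bsub>B\<^esub> b) - sgl (a, b) c | c a b. a \<in> carrier A \<and> b \<in> carrier B}"
      by cases blast+
  qed (elim UnE CollectE exE conjE, simp_all add: gens.intros)
  then show ?thesis using lin_span_monoid_alg[OF monoid_prod, of gens] supp_gens by simp
qed

text \<open>Multiplication by a basis element turns a generator into a generator of the same family.
  Hence the relations span a two-sided ideal, and the tensor product is an algebra.\<close>

lemma gens_mult:
  assumes "g \<in> gens" "s \<in> carrier (A \<times>\<times> B)"
  shows "plin (\<lambda>t. bas (s \<otimes>\<^bsub>A \<times>\<times> B\<^esub> t)) g \<in> gens" "plin (\<lambda>t. bas (t \<otimes>\<^bsub>A \<times>\<times> B\<^esub> s)) g \<in> gens"
proof -
  obtain x y where s: "s = (x, y)" "x \<in> carrier A" "y \<in> carrier B" using assms(2) by auto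
  from assms(1) show "plin (\<lambda>t. bas (s \<otimes>\<^bsub>A \<times>\<times> B\<^esub> t)) g \<in> gens"
    by (cases rule: gens.cases)
      (simp_all add: s plin_diff A.r_distr B.r_distr A.smult_mult_r B.smult_mult_r gens.intros)
  from assms(1) show "plin (\<lambda>t. bas (t \<otimes>\<^bsub>A \<times>\<times> B\<^esub> s)) g \<in> gens"
    by (cases rule: gens.cases)
      (simp_all add: s plin_diff A.l_distr B.l_distr A.smult_mult_l B.smult_mult_l gens.intros)
qed

lemma tensor_rel_ideal: "ideal (tensor_rel A B) FM"
proof -
  let ?W = "pm.span gens"
  have W: "pm.subspace ?W" by (rule pm.subspace_span)
  have sub: "lin_subspace ?W FM"
    using lin_span_monoid_alg[OF monoid_prod, of gens] FM.lin_subspace_lin_span[of gens] supp_gens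
    by auto
  have "x \<otimes>\<^bsub>FM\<^esub> r \<in> ?W \<and> r \<otimes>\<^bsub>FM\<^esub> x \<in> ?W" if "r \<in> ?W" "supp x \<subseteq> carrier (A \<times>\<times> B)" for r x
    using that(2)
  proof (induction rule: pm_induct)
    case zero
    then show ?case using W by (simp add: monoid_alg_def twisted_alg_mult pm.subspace_0)
  next
    case (single s c)
    have "plin (\<lambda>t. bas (s \<otimes>\<^bsub>A \<times>\<times> B\<^esub> t)) r \<in> ?W" "plin (\<lambda>t. bas (t \<otimes>\<^bsub>A \<times>\<times> B\<^esub> s)) r \<in> ?W"
      by (rule plin_span_into[OF pm.span_base[OF gens_mult(1)] W], assumption, rule single, rule that(1))
        (rule plin_span_into[OF pm.span_base[OF gens_mult(2)] W], assumption, rule single, rule that(1))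
    moreover have "sgl s c \<otimes>\<^bsub>FM\<^esub> r = scl c (plin (\<lambda>t. bas (s \<otimes>\<^bsub>A \<times>\<times> B\<^esub> t)) r)"
      "r \<otimes>\<^bsub>FM\<^esub> sgl s c = scl c (plin (\<lambda>t. bas (t \<otimes>\<^bsub>A \<times>\<times> B\<^esub> s)) r)"
      by (simp_all add: monoid_alg_def twisted_alg_mult plin_fun_scl[symmetric])
    ultimately show ?case using W by (simp add: pm.subspace_scale)
  next
    case (add s t)
    then show ?case using W
      by (simp add: monoid_alg_def twisted_alg_mult plin_add plin_fun_add pm.subspace_add)
  qed
  then show ?thesis unfolding tensor_rel_span
    by (intro idealI) (use sub FM.ring_axioms in \<open>auto simp: lin_subspace_def\<close>)
qed

sublocale TT: k_algebra TT
  unfolding tensor_def by (rule FM.k_algebra_quot[OF tensor_rel_ideal])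

lemma bas_carrier: "a \<in> carrier A \<Longrightarrow> b \<in> carrier B \<Longrightarrow> sgl (a, b) c \<in> carrier FM"
  by simp

lemma tens_closed [simp, intro]: "a \<in> carrier A \<Longrightarrow> b \<in> carrier B \<Longrightarrow> tens A B a b \<in> carrier TT"
  unfolding tens_def tensor_def by (rule FM.quot_alg_ops[OF tensor_rel_ideal bas_carrier])

lemma tens_mult:
  assumes "a \<in> carrier A" "b \<in> carrier B" "a' \<in> carrier A" "b' \<in> carrier B"
  shows "tens A B a b \<otimes>\<^bsub>TT\<^esub> tens A B a' b' = tens A B (a \<otimes>\<^bsub>A\<^esub> a') (b \<otimes>\<^bsub>B\<^esub> b')"
  unfolding tens_def tensor_def using assms
  by (simp add: FM.quot_alg_ops(2)[OF tensor_rel_ideal bas_carrier bas_carrier]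
      monoid_alg_mult_bas[OF monoid_prod])

lemma tens_one: "\<one>\<^bsub>TT\<^esub> = tens A B \<one>\<^bsub>A\<^esub> \<one>\<^bsub>B\<^esub>"
  by (simp add: tens_def tensor_def quot_alg_simps)

lemma coset_eqI:
  assumes "s - t \<in> gens" "supp s \<subseteq> carrier (A \<times>\<times> B)" "supp t \<subseteq> carrier (A \<times>\<times> B)"
  shows "tensor_rel A B +>\<^bsub>FM\<^esub> s = tensor_rel A B +>\<^bsub>FM\<^esub> t"
  using assms pm.span_superset[of gens] 
  by (subst FM.quot_alg_eq_iff[OF tensor_rel_ideal])
    (auto simp: monoid_alg_minus[OF monoid_prod] tensor_rel_span)

lemma tens_add_left:
  assumes "a \<in> carrier A" "a' \<in> carrier A" "b \<in> carrier B"
  shows "tens A B (a \<oplus>\<^bsub>A\<^esub> a') b = tens A B a b \<oplus>\<^bsub>TT\<^esub> tens A B a' b"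
proof -
  have "tens A B a b \<oplus>\<^bsub>TT\<^esub> tens A B a' b = tensor_rel A B +>\<^bsub>FM\<^esub> (bas (a, b) + bas (a', b))"
    unfolding tens_def tensor_def using assms
    by (subst FM.quot_alg_ops(3)[OF tensor_rel_ideal bas_carrier bas_carrier]) auto
  also have "\<dots> = tens A B (a \<oplus>\<^bsub>A\<^esub> a') b"
    unfolding tens_def using assms gens.addl[OF assms] Poly_Mapping.keys_add[of "bas (a, b)" "bas (a', b)"]
    by (intro coset_eqI[symmetric]) (auto simp: diff_diff_eq)
  finally show ?thesis by simp
qed

lemma tens_add_right:
  assumes "a \<in> carrier A" "b \<in> carrier B" "b' \<in> carrier B"
  shows "tens A B a (b \<oplus>\<^bsub>B\<^esub> b') = tens A B a b \<oplus>\<^bsub>TT\<^esub> tens A B a b'"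
proof -
  have "tens A B a b \<oplus>\<^bsub>TT\<^esub> tens A B a b' = tensor_rel A B +>\<^bsub>FM\<^esub> (bas (a, b) + bas (a, b'))"
    unfolding tens_def tensor_def using assms
    by (subst FM.quot_alg_ops(3)[OF tensor_rel_ideal bas_carrier bas_carrier]) auto
  also have "\<dots> = tens A B a (b \<oplus>\<^bsub>B\<^esub> b')"
    unfolding tens_def using assms gens.addr[OF assms] Poly_Mapping.keys_add[of "bas (a, b)" "bas (a, b')"]
    by (intro coset_eqI[symmetric]) (auto simp: diff_diff_eq)
  finally show ?thesis by simp
qed

lemma tens_smult:
  assumes "a \<in> carrier A" "b \<in> carrier B"
  shows "tens A B (c \<odot>\<^bsub>A\<^esub> a) b = c \<odot>\<^bsub>TT\<^esub> tens A B a b" "tens A B a (c \<odot>\<^bsub>B\<^esub> b) = c \<odot>\<^bsub>TT\<^esub> tens A B a b"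
proof -
  have *: "c \<odot>\<^bsub>TT\<^esub> tens A B a b = tensor_rel A B +>\<^bsub>FM\<^esub> sgl (a, b) c"
    unfolding tens_def tensor_def using assms
    by (subst FM.quot_alg_ops(4)[OF tensor_rel_ideal bas_carrier]) auto
  show "tens A B (c \<odot>\<^bsub>A\<^esub> a) b = c \<odot>\<^bsub>TT\<^esub> tens A B a b" "tens A B a (c \<odot>\<^bsub>B\<^esub> b) = c \<odot>\<^bsub>TT\<^esub> tens A B a b"
    unfolding * unfolding tens_def using assms
    by (intro coset_eqI gens.smultl gens.smultr; simp)+
qed

lemma kbilin_tens: "kbilin A B TT (tens A B)"
  by (auto simp: kbilin_def tens_add_left tens_add_right tens_smult intro!: klinI)

lemma tensor_carrier: "carrier TT = lin_span TT {tens A B a b | a b. a \<in> carrier A \<and> b \<in> carrier B}"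
    (is "_ = lin_span TT ?S")
proof
  have sub: "lin_subspace (lin_span TT ?S) TT" by (rule TT.lin_subspace_lin_span) auto
  show "lin_span TT ?S \<subseteq> carrier TT" using TT.lin_subspaceD(1)[OF sub] .
  note hom = alg_homD(1)[OF FM.proj_hom[OF tensor_rel_ideal], folded tensor_def]
  have "tensor_rel A B +>\<^bsub>FM\<^esub> t \<in> lin_span TT ?S" if "supp t \<subseteq> carrier (A \<times>\<times> B)" for t
    using that
  proof (induction rule: pm_induct)
    case zero
    have "tensor_rel A B +>\<^bsub>FM\<^esub> 0 = \<zero>\<^bsub>TT\<^esub>"
      using klin_zero[OF FM.k_alg TT.k_alg hom] by simp
    then show ?case using TT.lin_subspaceD(2)[OF sub] by simp
  next
    case (single s c)
    then obtain a b where s: "s = (a, b)" "a \<in> carrier A" "b \<in> carrier B" by auto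
    then have "tensor_rel A B +>\<^bsub>FM\<^esub> sgl s c = c \<odot>\<^bsub>TT\<^esub> tens A B a b"
      unfolding tens_def tensor_def
      by (subst FM.quot_alg_ops(4)[OF tensor_rel_ideal bas_carrier]) auto
    moreover have "tens A B a b \<in> lin_span TT ?S" using s TT.lin_span_superset[of ?S] by blast
    ultimately show ?case using TT.lin_subspaceD(4)[OF sub] by simp
  next
    case (add s t)
    then show ?case using klinD(2)[OF hom, of s t] TT.lin_subspaceD(3)[OF sub] by simp
  qed
  then show "carrier TT \<subseteq> lin_span TT ?S"
    unfolding tensor_def FM.quot_alg_carrier by auto
qed

text \<open>The universal property of A \<otimes> B for bilinear maps: bilinearity makes the
  extension of f vanish on each of the four families in \<open>gens\<close>.\<close>

lemma tlift:
  assumes "k_algebra C" "kbilin A B C f"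
  shows "klin TT C (tlift C f)"
    and "a \<in> carrier A \<Longrightarrow> b \<in> carrier B \<Longrightarrow> tlift C f (tens A B a b) = f a b"
proof -
  interpret C: k_algebra C by fact
  note f = kbilinD[OF assms(2)]
  let ?\<beta> = "\<lambda>(a, b). f a b"
  have \<beta>: "?\<beta> \<in> carrier (A \<times>\<times> B) \<rightarrow> carrier C" using f(1) by auto
  note lin = klin_lin_ext_monoid_alg[OF monoid_prod assms(1) \<beta>]
  note L = klinD[OF lin]
  have sgl: "lin_ext C ?\<beta> (sgl (a, b) c) = c \<odot>\<^bsub>C\<^esub> f a b" if "a \<in> carrier A" "b \<in> carrier B" for a b c
    using that f(1) by (simp add: C.lin_ext_single)
  have gens: "lin_ext C ?\<beta> g = \<zero>\<^bsub>C\<^esub>" if "g \<in> gens" for g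
  proof -
    have D: "lin_ext C ?\<beta> (s - t) = lin_ext C ?\<beta> s \<ominus>\<^bsub>C\<^esub> lin_ext C ?\<beta> t"
      if "supp s \<subseteq> carrier (A \<times>\<times> B)" "supp t \<subseteq> carrier (A \<times>\<times> B)" for s t
      using that \<beta> by (intro C.lin_ext_diff) blast
    have E: "x \<oplus>\<^bsub>C\<^esub> y \<ominus>\<^bsub>C\<^esub> x \<ominus>\<^bsub>C\<^esub> y = \<zero>\<^bsub>C\<^esub>" if "x \<in> carrier C" "y \<in> carrier C" for x y
      using that by algebra
    from that show ?thesis
      by (cases rule: gens.cases)
        (simp_all add: D supp_diff_subset sgl f E C.smult_one C.r_right_minus_eq)
  qed
  have sub: "lin_subspace (tensor_rel A B) FM"
    by (rule FM.ideal_lin_subspace[OF tensor_rel_ideal])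
  have "pm.span gens \<subseteq> {r. supp r \<subseteq> carrier (A \<times>\<times> B) \<and> lin_ext C ?\<beta> r = \<zero>\<^bsub>C\<^esub>}"
  proof (rule pm.span_minimal)
    have "lin_subspace {r \<in> carrier FM. lin_ext C ?\<beta> r \<in> {\<zero>\<^bsub>C\<^esub>}} FM"
      by (rule klin_vimage[OF FM.k_alg assms(1) lin]) (rule C.lin_subspaceI, auto)
    then show "pm.subspace {r. supp r \<subseteq> carrier (A \<times>\<times> B) \<and> lin_ext C ?\<beta> r = \<zero>\<^bsub>C\<^esub>}"
      unfolding lin_subspace_monoid_alg[OF monoid_prod] by simp
  qed (use gens supp_gens in auto)
  then have kill: "r \<in> tensor_rel A B \<Longrightarrow> lin_ext C ?\<beta> r = \<zero>\<^bsub>C\<^esub>" for r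
    unfolding tensor_rel_span by blast
  have eq: "tlift C f (tensor_rel A B +>\<^bsub>FM\<^esub> t) = lin_ext C ?\<beta> t" if "t \<in> carrier FM" for t
    unfolding tlift_def using that by (intro coset_lift_eq[OF monoid_prod assms(1) \<beta> sub kill]) auto
  show "klin TT C (tlift C f)"
  proof (rule klinI)
    fix x assume "x \<in> carrier TT"
    then obtain s where s: "s \<in> carrier FM" "x = tensor_rel A B +>\<^bsub>FM\<^esub> s"
      unfolding tensor_def FM.quot_alg_carrier by blast
    show "tlift C f x \<in> carrier C" using eq[OF s(1)] L(1)[OF s(1)] s(2) by simp
    show "tlift C f (c \<odot>\<^bsub>TT\<^esub> x) = c \<odot>\<^bsub>C\<^esub> tlift C f x" for c
      using eq[OF s(1)] L(3)[OF s(1)] s(2) eq[OF FM.smult_closed[OF s(1)]]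
      unfolding tensor_def by (simp only: FM.quot_alg_ops(4)[OF tensor_rel_ideal s(1)])
    fix y assume "y \<in> carrier TT"
    then obtain t where t: "t \<in> carrier FM" "y = tensor_rel A B +>\<^bsub>FM\<^esub> t"
      unfolding tensor_def FM.quot_alg_carrier by blast
    show "tlift C f (x \<oplus>\<^bsub>TT\<^esub> y) = tlift C f x \<oplus>\<^bsub>C\<^esub> tlift C f y"
      using eq[OF s(1)] eq[OF t(1)] L(2)[OF s(1) t(1)] s(2) t(2) eq[OF FM.a_closed[OF s(1) t(1)]]
      unfolding tensor_def by (simp only: FM.quot_alg_ops(3)[OF tensor_rel_ideal s(1) t(1)])
  qed
  show "tlift C f (tens A B a b) = f a b" if "a \<in> carrier A" "b \<in> carrier B"
    using eq[OF bas_carrier[OF that, of 1]] sgl[OF that, of 1] f(1)[OF that]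
    by (simp add: tens_def C.smult_one)
qed

lemma tensor_klin_eqI:
  assumes "k_algebra C" "klin TT C F" "klin TT C F'"
    and "\<And>a b. a \<in> carrier A \<Longrightarrow> b \<in> carrier B \<Longrightarrow> F (tens A B a b) = F' (tens A B a b)"
    and "z \<in> carrier TT"
  shows "F z = F' z"
  by (rule klin_eq_on_span[OF TT.k_alg assms(1-3)])
    (use assms(4,5) tensor_carrier in auto)

lemma tensor_alg_homI:
  assumes "k_algebra C" "klin TT C F"
    and "\<And>a b a' b'. a \<in> carrier A \<Longrightarrow> b \<in> carrier B \<Longrightarrow> a' \<in> carrier A \<Longrightarrow> b' \<in> carrier B \<Longrightarrow>
      F (tens A B (a \<otimes>\<^bsub>A\<^esub> a') (b \<otimes>\<^bsub>B\<^esub> b')) = F (tens A B a b) \<otimes>\<^bsub>C\<^esub> F (tens A B a' b')"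
    and "F (tens A B \<one>\<^bsub>A\<^esub> \<one>\<^bsub>B\<^esub>) = \<one>\<^bsub>C\<^esub>"
  shows "F \<in> alg_hom TT C"
  by (rule alg_hom_of_span[OF TT.k_alg assms(1,2) _ tensor_carrier])
    (use assms(3,4) in \<open>auto simp: tens_mult tens_one\<close>)

end

section \<open>The groups\<close>

definition diag :: "('n \<Rightarrow> 'k::field) \<Rightarrow> ('k, 'n) lin" where
  "diag c = (\<lambda>v i. c i * v i)"

definition diags :: "('k::field, 'n) lin set" where
  "diags = {diag c | c. \<forall>i. c i \<noteq> 0}"

lemma diagsE: "h \<in> diags \<Longrightarrow> (\<And>c. (\<forall>i. c i \<noteq> 0) \<Longrightarrow> h = diag c \<Longrightarrow> thesis) \<Longrightarrow> thesis"
  by (auto simp: diags_def)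

lemma BijGroup_UNIV: "carrier (BijGroup UNIV) = {f. bij f}" "\<one>\<^bsub>BijGroup UNIV\<^esub> = id"
  "bij f \<Longrightarrow> bij g \<Longrightarrow> f \<otimes>\<^bsub>BijGroup UNIV\<^esub> g = f \<circ> g"
  by (auto simp: BijGroup_def Bij_def compose_def id_def fun_eq_iff)

lemma diag_comp: "diag c \<circ> diag d = diag (\<lambda>i. c i * d i)"
  by (auto simp: diag_def fun_eq_iff mult.assoc)

lemma diag_one: "diag (\<lambda>i. 1) = id"
  by (auto simp: diag_def fun_eq_iff)

lemma bij_diag: "\<forall>i. c i \<noteq> 0 \<Longrightarrow> bij (diag c)"
  by (rule o_bij[of "diag (\<lambda>i. inverse (c i))"]) (auto simp: diag_comp diag_one)

lemma diags_subgroup: "subgroup (diags :: ('k::field, 'n) lin set) (BijGroup UNIV)"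
proof -
  interpret B: Group.group "BijGroup (UNIV :: ('n \<Rightarrow> 'k) set)" by (rule group_BijGroup)
  show ?thesis
  proof (rule B.subgroupI)
    show "diags \<subseteq> carrier (BijGroup (UNIV :: ('n \<Rightarrow> 'k) set))"
      by (auto simp: diags_def BijGroup_UNIV bij_diag)
    show "diags \<noteq> ({} :: ('k, 'n) lin set)" by (auto simp: diags_def intro: exI[of _ "\<lambda>i. 1"])
  next
    fix a :: "('k, 'n) lin" assume "a \<in> diags"
    then obtain c where c: "\<forall>i. c i \<noteq> 0" "a = diag c" by (rule diagsE)
    then have c': "\<forall>i. inverse (c i) \<noteq> 0" by auto
    have "inv\<^bsub>BijGroup UNIV\<^esub> a = diag (\<lambda>i. inverse (c i))"
      using c c' by (intro B.inv_equality)
        (simp_all add: BijGroup_UNIV bij_diag diag_comp diag_one)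
    then show "inv\<^bsub>BijGroup UNIV\<^esub> a \<in> diags" using c' by (auto simp: diags_def)
  next
    fix a b :: "('k, 'n) lin" assume "a \<in> diags" "b \<in> diags"
    then obtain c d where "\<forall>i. c i \<noteq> 0" "a = diag c" "\<forall>i. d i \<noteq> 0" "b = diag d" by (auto simp: diags_def)
    then show "a \<otimes>\<^bsub>BijGroup UNIV\<^esub> b \<in> diags"
      by (auto simp: BijGroup_UNIV bij_diag diag_comp diags_def intro: exI[of _ "\<lambda>i. c i * d i"])
  qed
qed

text \<open>The facts needed about G and F come from their lying in the commutative group of
  invertible diagonal operators; there the characters are quotients of diagonal entries, hence
  multiplicative (\<open>chi_mult\<close>).\<close>

lemma diag_subgroup_facts:
  fixes S :: "('k::field, 'n) lin set"
  assumes "S \<subseteq> diags"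
  defines "K \<equiv> subgroup_generated (BijGroup UNIV) S"
  shows "comm_group K" "carrier K \<subseteq> diags" "a \<in> diags \<Longrightarrow> b \<in> diags \<Longrightarrow> a \<otimes>\<^bsub>K\<^esub> b = a \<circ> b"
    "S \<subseteq> carrier K" "\<one>\<^bsub>K\<^esub> = id" "carrier K = generate K S"
proof -
  interpret B: Group.group "BijGroup (UNIV :: ('n \<Rightarrow> 'k) set)" by (rule group_BijGroup)
  show sub: "carrier K \<subseteq> diags"
    unfolding K_def by (rule B.subgroup_generated_minimal[OF diags_subgroup assms(1)])
  show m: "a \<otimes>\<^bsub>K\<^esub> b = a \<circ> b" if "a \<in> diags" "b \<in> diags" for a b
    using that by (auto simp: K_def diags_def BijGroup_UNIV bij_diag)
  have g: "Group.group K" by (simp add: K_def)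
  show "comm_group K"
  proof (rule group.group_comm_groupI[OF g])
    fix a b assume "a \<in> carrier K" "b \<in> carrier K"
    then have "a \<in> diags" "b \<in> diags" using sub by auto
    then show "a \<otimes>\<^bsub>K\<^esub> b = b \<otimes>\<^bsub>K\<^esub> a"
      by (auto simp: m elim!: diagsE) (simp add: diag_comp mult.commute)
  qed
  have "S \<subseteq> carrier (BijGroup UNIV)"
    using assms(1) by (auto simp: diags_def BijGroup_UNIV bij_diag dest!: subsetD)
  then show SK: "S \<subseteq> carrier K"
    unfolding K_def carrier_subgroup_generated by (auto intro: generate.incl)
  show "\<one>\<^bsub>K\<^esub> = id" by (simp add: K_def BijGroup_UNIV)
  have "carrier K = carrier (subgroup_generated K S)" by (simp add: K_def)
  also have "\<dots> = generate K S" using SK by (simp add: carrier_subgroup_generated Int_absorb1)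
  finally show "carrier K = generate K S" .
qed

section \<open>The group H and its characters\<close>

locale adm =
  fixes p :: "'n::finite \<Rightarrow> 'n \<Rightarrow> 'k::field" and N :: "(('k, 'n) lin \<times> ('k, 'n) lin) set"
  assumes adm: "admissible p N"
begin

abbreviation "HH \<equiv> H_grp p N"
abbreviation mult_H (infixl "\<otimes>\<^sub>H" 70) where "(\<otimes>\<^sub>H) \<equiv> mult HH"
abbreviation one_H ("\<one>\<^sub>H") where "\<one>\<^sub>H \<equiv> one HH"
definition "gg i = G_to_H p N (g_op p i)"
definition "ff i = F_to_H p N (f_op p i)"

lemma p_nz [simp]: "p i j \<noteq> 0" using adm by (simp add: admissible_def)

lemma ops_diag: "g_op p i = diag (\<lambda>j. p j i)" "f_op p i = diag (\<lambda>j. inverse (p i j))"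
  by (auto simp: g_op_def f_op_def diag_def)

lemma range_ops: "range (g_op p) \<subseteq> diags" "range (f_op p) \<subseteq> diags"
  by (auto simp: ops_diag diags_def)

lemmas G_facts = diag_subgroup_facts[OF range_ops(1), folded G_grp_def]
lemmas F_facts = diag_subgroup_facts[OF range_ops(2), folded F_grp_def]

lemma GF_comm: "comm_group (GF_grp p)"
proof -
  interpret G: comm_group "G_grp p" by (rule G_facts)
  interpret F: comm_group "F_grp p" by (rule F_facts)
  show ?thesis
    by (rule group.group_comm_groupI)
      (auto simp: DirProd_group G.group_axioms F.group_axioms G.m_comm F.m_comm)
qed

sublocale GF: comm_group "GF_grp p" by (rule GF_comm)

lemma N_subgroup: "subgroup N (GF_grp p)" using adm by (simp add: admissible_def)

sublocale N: normal N "GF_grp p"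
  using N_subgroup by (simp add: GF.normal_iff_subgroup)

sublocale H: comm_group HH
  unfolding H_grp_def by (rule GF.abelian_FactGroup[OF N_subgroup])

lemma H_carrier: "carrier HH = (\<lambda>z. N #>\<^bsub>GF_grp p\<^esub> z) ` carrier (GF_grp p)"
  by (auto simp: H_grp_def FactGroup_def RCOSETS_def)

lemma H_mult: "z \<in> carrier (GF_grp p) \<Longrightarrow> z' \<in> carrier (GF_grp p) \<Longrightarrow>
    (N #>\<^bsub>GF_grp p\<^esub> z) \<otimes>\<^sub>H (N #>\<^bsub>GF_grp p\<^esub> z') = N #>\<^bsub>GF_grp p\<^esub> (z \<otimes>\<^bsub>GF_grp p\<^esub> z')"
  by (simp add: H_grp_def FactGroup_def N.rcos_sum)

lemma chi_diag: "chi i (diag c, diag d) = c i * inverse (d i)"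
  by (simp add: chi_def diag_def)

lemma GF_diags: "z \<in> carrier (GF_grp p) \<Longrightarrow> \<exists>c d. z = (diag c, diag d) \<and> (\<forall>i. c i \<noteq> 0) \<and> (\<forall>i. d i \<noteq> 0)"
  using G_facts(2) F_facts(2) by (auto simp: diags_def dest!: subsetD)

lemma chi_mult:
  assumes "z \<in> carrier (GF_grp p)" "z' \<in> carrier (GF_grp p)"
  shows "chi i (z \<otimes>\<^bsub>GF_grp p\<^esub> z') = chi i z * chi i z'" "chi i z \<noteq> 0"
proof -
  obtain c d where z: "z = (diag c, diag d)" "\<forall>i. c i \<noteq> 0" "\<forall>i. d i \<noteq> 0" using GF_diags[OF assms(1)] by blast
  obtain c' d' where z': "z' = (diag c', diag d')" "\<forall>i. c' i \<noteq> 0" "\<forall>i. d' i \<noteq> 0" using GF_diags[OF assms(2)] by blast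
  have "diag c \<in> diags" "diag d \<in> diags" "diag c' \<in> diags" "diag d' \<in> diags" using z z' by (auto simp: diags_def)
  then have "z \<otimes>\<^bsub>GF_grp p\<^esub> z' = (diag (\<lambda>i. c i * c' i), diag (\<lambda>i. d i * d' i))"
    by (simp add: z z' G_facts(3) F_facts(3) diag_comp)
  then show "chi i (z \<otimes>\<^bsub>GF_grp p\<^esub> z') = chi i z * chi i z'" by (simp add: z z' chi_diag)
  show "chi i z \<noteq> 0" using z by (simp add: chi_diag)
qed

lemma chiH_coset:
  assumes "z \<in> carrier (GF_grp p)"
  shows "chiH i (N #>\<^bsub>GF_grp p\<^esub> z) = chi i z"
proof -
  have "chi i (n \<otimes>\<^bsub>GF_grp p\<^esub> z) = chi i z" if "n \<in> N" for n
    using that adm chi_mult[OF N.mem_carrier[OF that] assms] by (simp add: admissible_def)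
  then have "\<forall>y \<in> N #>\<^bsub>GF_grp p\<^esub> z. chi i y = chi i z"
    unfolding r_coset_def by blast
  moreover have "z \<in> N #>\<^bsub>GF_grp p\<^esub> z" by (rule GF.rcos_self[OF assms N_subgroup])
  ultimately have "chi i ` (N #>\<^bsub>GF_grp p\<^esub> z) = {chi i z}" by blast
  then show ?thesis by (simp add: chiH_def)
qed

lemma chiH_mult: "h \<in> carrier HH \<Longrightarrow> h' \<in> carrier HH \<Longrightarrow> chiH i (h \<otimes>\<^sub>H h') = chiH i h * chiH i h'"
  unfolding H_carrier
  by (elim imageE) (simp only: H_mult chiH_coset GF.m_closed chi_mult)

lemma chiH_nz: "h \<in> carrier HH \<Longrightarrow> chiH i h \<noteq> 0"
  unfolding H_carrier using chi_mult(2) by (auto simp: chiH_coset simp del: carrier_DirProd)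

lemma chiH_one: "chiH i \<one>\<^sub>H = 1"
  using chiH_mult[of "\<one>\<^sub>H" "\<one>\<^sub>H" i] chiH_nz[of "\<one>\<^sub>H" i] by simp

lemma G_to_H_hom: "G_to_H p N \<in> hom (G_grp p) HH"
proof -
  interpret G: comm_group "G_grp p" by (rule G_facts)
  interpret F: comm_group "F_grp p" by (rule F_facts)
  show ?thesis
    by (rule homI) (simp_all add: G_to_H_def H_mult, simp add: H_carrier image_iff, blast)
qed

lemma F_to_H_hom: "F_to_H p N \<in> hom (F_grp p) HH"
proof -
  interpret G: comm_group "G_grp p" by (rule G_facts)
  interpret F: comm_group "F_grp p" by (rule F_facts)
  show ?thesis
    by (rule homI) (simp_all add: F_to_H_def H_mult, simp add: H_carrier image_iff, blast)
qed

text \<open>A coproduct of A^+ is prescribed only at the generators g_i, one of A^- only at the f_i.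
  Presenting the images of G and F in H as generated subgroups lets its values on all group elements
  be found by induction (\<open>coproduct_group\<close>).\<close>

lemma G_in_H_generate: "G_in_H p N = generate HH (range gg)"
proof -
  interpret G: comm_group "G_grp p" by (rule G_facts)
  interpret h: group_hom "G_grp p" HH "G_to_H p N"
    by unfold_locales (rule G_to_H_hom)
  have "range gg = G_to_H p N ` range (g_op p)" by (auto simp: gg_def)
  then show ?thesis
    using h.generate_img[OF G_facts(4)] G_facts(6) by (simp add: G_in_H_def)
qed

lemma F_in_H_generate: "F_in_H p N = generate HH (range ff)"
proof -
  interpret F: comm_group "F_grp p" by (rule F_facts)
  interpret h: group_hom "F_grp p" HH "F_to_H p N"
    by unfold_locales (rule F_to_H_hom)
  have "range ff = F_to_H p N ` range (f_op p)" by (auto simp: ff_def)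
  then show ?thesis
    using h.generate_img[OF F_facts(4)] F_facts(6) by (simp add: F_in_H_def)
qed

lemma gg_closed [simp]: "gg i \<in> carrier HH"
  using G_to_H_hom G_facts(4) by (auto simp: gg_def hom_def)

lemma ff_closed [simp]: "ff i \<in> carrier HH"
  using F_to_H_hom F_facts(4) by (auto simp: ff_def hom_def)

lemma chiH_gg [simp]: "chiH i (gg j) = p i j"
proof -
  interpret F: comm_group "F_grp p" by (rule F_facts)
  have "g_op p j \<in> carrier (G_grp p)" using G_facts(4) by auto
  then show ?thesis
    by (simp add: gg_def G_to_H_def chiH_coset chi_g_op)
qed

lemma chiH_ff [simp]: "chiH i (ff j) = p j i"
proof -
  interpret G: comm_group "G_grp p" by (rule G_facts)
  have "f_op p j \<in> carrier (F_grp p)" using F_facts(4) by auto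
  then show ?thesis
    by (simp add: ff_def F_to_H_def chiH_coset chi_f_op)
qed

lemma G_sub: "subgroup (G_in_H p N) HH" and F_sub: "subgroup (F_in_H p N) HH"
  unfolding G_in_H_generate F_in_H_generate by (auto intro!: H.generate_is_subgroup)

text \<open>(g, f) = (g, 1) (1, f), so the images of G and F together generate H; this plays for A
  the role that \<open>G_in_H_generate\<close> plays for A^+.\<close>

lemma H_generate: "carrier HH = generate HH (range gg \<union> range ff)"
proof
  interpret G: comm_group "G_grp p" by (rule G_facts)
  interpret F: comm_group "F_grp p" by (rule F_facts)
  show "carrier HH \<subseteq> generate HH (range gg \<union> range ff)"
  proof
    fix h assume "h \<in> carrier HH"
    then obtain g f where gf: "g \<in> carrier (G_grp p)" "f \<in> carrier (F_grp p)" "h = N #>\<^bsub>GF_grp p\<^esub> (g, f)"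
      unfolding H_carrier by auto
    then have "h = G_to_H p N g \<otimes>\<^sub>H F_to_H p N f" by (simp add: G_to_H_def F_to_H_def H_mult)
    moreover have "G_to_H p N g \<in> generate HH (range gg)" "F_to_H p N f \<in> generate HH (range ff)"
      using gf by (auto simp: G_in_H_generate[symmetric] F_in_H_generate[symmetric] G_in_H_def F_in_H_def)
    ultimately show "h \<in> generate HH (range gg \<union> range ff)"
      using H.mono_generate[of "range gg" "range gg \<union> range ff"]
        H.mono_generate[of "range ff" "range gg \<union> range ff"] by (auto intro: generate.eng)
  qed
  show "generate HH (range gg \<union> range ff) \<subseteq> carrier HH" by (intro H.generate_incl) auto
qed

lemma chi_letter_mult: "h \<in> carrier HH \<Longrightarrow> h' \<in> carrier HH \<Longrightarrow>
    chi_letter x (h \<otimes>\<^sub>H h') = chi_letter x h * chi_letter x h'"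
  by (cases x) (auto simp: chiH_mult)

lemma chi_letter_nz: "h \<in> carrier HH \<Longrightarrow> chi_letter x h \<noteq> 0"
  by (cases x) (auto simp: chiH_nz)

lemma chi_letter_one: "chi_letter x \<one>\<^sub>H = 1"
  by (cases x) (auto simp: chiH_one)

end

section \<open>Slicing a tensor product with linear functionals\<close>

definition kfun :: "('k::field, 'a) module \<Rightarrow> ('a \<Rightarrow> 'k) \<Rightarrow> bool" where
  "kfun B \<psi> \<longleftrightarrow> (\<forall>x\<in>carrier B. \<forall>y\<in>carrier B. \<psi> (x \<oplus>\<^bsub>B\<^esub> y) = \<psi> x + \<psi> y) \<and>
     (\<forall>c. \<forall>x\<in>carrier B. \<psi> (c \<odot>\<^bsub>B\<^esub> x) = c * \<psi> x)"

lemma kfunD: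
  assumes "kfun B \<psi>" "x \<in> carrier B"
  shows "y \<in> carrier B \<Longrightarrow> \<psi> (x \<oplus>\<^bsub>B\<^esub> y) = \<psi> x + \<psi> y" "\<psi> (c \<odot>\<^bsub>B\<^esub> x) = c * \<psi> x"
  using assms by (auto simp: kfun_def)

lemma kfun_zero: "k_algebra B \<Longrightarrow> kfun B \<psi> \<Longrightarrow> \<psi> \<zero>\<^bsub>B\<^esub> = 0"
proof -
  assume "k_algebra B" and \<psi>: "kfun B \<psi>"
  then interpret k_algebra B by auto
  show ?thesis using kfunD(2)[OF \<psi> zero_closed, of 0] by simp
qed

lemma kfun_comp: "klin A B f \<Longrightarrow> kfun B \<psi> \<Longrightarrow> kfun A (\<lambda>x. \<psi> (f x))"
  by (auto simp: kfun_def klin_def Pi_iff)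

lemma klin_finsum:
  assumes "k_algebra A" "k_algebra B" "klin A B f" "g \<in> F \<rightarrow> carrier A"
  shows "f (finsum A g F) = finsum B (\<lambda>x. f (g x)) F"
proof -
  interpret A: k_algebra A + B: k_algebra B using assms by auto
  note f = klinD[OF assms(3)]
  from assms(4) show ?thesis
  proof (induction F rule: infinite_finite_induct)
    case (insert x F)
    then have "g \<in> F \<rightarrow> carrier A" "g x \<in> carrier A" "(\<lambda>x. f (g x)) \<in> F \<rightarrow> carrier B" using f(1) by auto
    then show ?case using insert f by (simp add: A.finsum_insert B.finsum_insert)
  qed (auto simp: klin_zero[OF assms(1-3)])
qed

locale square = B: k_algebra B for B :: "('k::field, 'a) module"
begin

sublocale TP: tensor_pair B B by unfold_locales

abbreviation "BB \<equiv> tensor B B"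
abbreviation mult_B (infixl "\<otimes>\<^sub>B" 70) where "(\<otimes>\<^sub>B) \<equiv> mult B"
abbreviation add_B (infixl "\<oplus>\<^sub>B" 65) where "(\<oplus>\<^sub>B) \<equiv> add B"
abbreviation smult_B (infixl "\<odot>\<^sub>B" 70) where "(\<odot>\<^sub>B) \<equiv> smult B"
abbreviation one_B ("\<one>\<^sub>B") where "\<one>\<^sub>B \<equiv> one B"
abbreviation zero_B ("\<zero>\<^sub>B") where "\<zero>\<^sub>B \<equiv> zero B"
abbreviation mult_2 (infixl "\<otimes>\<^sub>2" 70) where "(\<otimes>\<^sub>2) \<equiv> mult BB"
abbreviation add_2 (infixl "\<oplus>\<^sub>2" 65) where "(\<oplus>\<^sub>2) \<equiv> add BB"
abbreviation smult_2 (infixl "\<odot>\<^sub>2" 70) where "(\<odot>\<^sub>2) \<equiv> smult BB"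
abbreviation one_2 ("\<one>\<^sub>2") where "\<one>\<^sub>2 \<equiv> one BB"
abbreviation zero_2 ("\<zero>\<^sub>2") where "\<zero>\<^sub>2 \<equiv> zero BB"

lemma smult_commute: "x \<in> carrier B \<Longrightarrow> c \<odot>\<^sub>B (d \<odot>\<^sub>B x) = d \<odot>\<^sub>B (c \<odot>\<^sub>B x)"
  using B.smult_assoc[of x c d] B.smult_assoc[of x d c] by (simp add: mult.commute)

text \<open>\<open>RE \<psi>\<close> is id \<otimes> \<psi> and \<open>LE \<psi>\<close> is \<psi>
  \<otimes> id, with B \<otimes> k and k \<otimes> B identified with B.\<close>

definition RE :: "('a \<Rightarrow> 'k) \<Rightarrow> ('a \<times> 'a \<Rightarrow>\<^sub>0 'k) set \<Rightarrow> 'a" where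
  "RE \<psi> = tlift B (\<lambda>a b. \<psi> b \<odot>\<^sub>B a)"

definition LE :: "('a \<Rightarrow> 'k) \<Rightarrow> ('a \<times> 'a \<Rightarrow>\<^sub>0 'k) set \<Rightarrow> 'a" where
  "LE \<psi> = tlift B (\<lambda>a b. \<psi> a \<odot>\<^sub>B b)"

lemma RE:
  assumes "kfun B \<psi>"
  shows "klin BB B (RE \<psi>)"
    and "a \<in> carrier B \<Longrightarrow> b \<in> carrier B \<Longrightarrow> RE \<psi> (tens B B a b) = \<psi> b \<odot>\<^sub>B a"
proof -
  have "kbilin B B B (\<lambda>a b. \<psi> b \<odot>\<^sub>B a)"
    unfolding kbilin_def
    by (intro conjI ballI klinI) (simp_all add: kfunD[OF assms] B.smult_l_distr B.smult_r_distr B.smult_assoc smult_commute)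
  note T = TP.tlift[OF B.k_alg this, folded RE_def]
  show "klin BB B (RE \<psi>)" by (rule T(1))
  show "a \<in> carrier B \<Longrightarrow> b \<in> carrier B \<Longrightarrow> RE \<psi> (tens B B a b) = \<psi> b \<odot>\<^sub>B a" by (rule T(2))
qed

lemma LE:
  assumes "kfun B \<psi>"
  shows "klin BB B (LE \<psi>)"
    and "a \<in> carrier B \<Longrightarrow> b \<in> carrier B \<Longrightarrow> LE \<psi> (tens B B a b) = \<psi> a \<odot>\<^sub>B b"
proof -
  have "kbilin B B B (\<lambda>a b. \<psi> a \<odot>\<^sub>B b)"
    unfolding kbilin_def
    by (intro conjI ballI klinI) (simp_all add: kfunD[OF assms] B.smult_l_distr B.smult_r_distr B.smult_assoc smult_commute)
  note T = TP.tlift[OF B.k_alg this, folded LE_def]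
  show "klin BB B (LE \<psi>)" by (rule T(1))
  show "a \<in> carrier B \<Longrightarrow> b \<in> carrier B \<Longrightarrow> LE \<psi> (tens B B a b) = \<psi> a \<odot>\<^sub>B b" by (rule T(2))
qed

lemmas RE_closed = klinD(1)[OF RE(1)]
lemmas LE_closed = klinD(1)[OF LE(1)]

lemma RE_cong:
  assumes "kfun B \<psi>" "\<And>y. y \<in> carrier B \<Longrightarrow> \<psi> y = \<psi>' y" "z \<in> carrier BB"
  shows "RE \<psi> z = RE \<psi>' z"
proof -
  have "kfun B \<psi>'" using assms(1,2) by (simp add: kfun_def)
  note k = assms(1) this
  show ?thesis
    by (rule TP.tensor_klin_eqI[OF B.k_alg RE(1)[OF k(1)] RE(1)[OF k(2)] _ assms(3)])
      (simp add: RE(2)[OF k(1)] RE(2)[OF k(2)] assms(2))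
qed

lemma LE_cong:
  assumes "kfun B \<psi>" "\<And>y. y \<in> carrier B \<Longrightarrow> \<psi> y = \<psi>' y" "z \<in> carrier BB"
  shows "LE \<psi> z = LE \<psi>' z"
proof -
  have "kfun B \<psi>'" using assms(1,2) by (simp add: kfun_def)
  note k = assms(1) this
  show ?thesis
    by (rule TP.tensor_klin_eqI[OF B.k_alg LE(1)[OF k(1)] LE(1)[OF k(2)] _ assms(3)])
      (simp add: LE(2)[OF k(1)] LE(2)[OF k(2)] assms(2))
qed

lemma kfun_mult_left: "kfun B \<psi> \<Longrightarrow> b \<in> carrier B \<Longrightarrow> kfun B (\<lambda>y. \<psi> (b \<otimes>\<^sub>B y))"
  by (rule kfun_comp[OF klin_mult_left[OF B.k_alg]])

text \<open>The second factor b is absorbed into the functional. This makes slices of a product of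
  coproducts computable letter by letter.\<close>

lemma RE_mult_left:
  assumes "kfun B \<psi>" "a \<in> carrier B" "b \<in> carrier B" "z \<in> carrier BB"
  shows "RE \<psi> (tens B B a b \<otimes>\<^sub>2 z) = a \<otimes>\<^sub>B RE (\<lambda>y. \<psi> (b \<otimes>\<^sub>B y)) z"
proof -
  note k = kfun_mult_left[OF assms(1,3)]
  have t: "tens B B a b \<in> carrier BB" using assms by simp
  show ?thesis
  proof (rule TP.tensor_klin_eqI[OF B.k_alg _ _ _ assms(4)])
    show "klin BB B (\<lambda>z. RE \<psi> (tens B B a b \<otimes>\<^sub>2 z))"
      by (rule klin_comp[OF klin_mult_left[OF TP.TT.k_alg t] RE(1)[OF assms(1)]])
    show "klin BB B (\<lambda>z. a \<otimes>\<^sub>B RE (\<lambda>y. \<psi> (b \<otimes>\<^sub>B y)) z)"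
      by (rule klin_comp[OF RE(1)[OF k] klin_mult_left[OF B.k_alg assms(2)]])
  qed (simp_all add: assms TP.tens_mult RE(2) k B.smult_mult_r)
qed

lemma LE_mult_left:
  assumes "kfun B \<psi>" "a \<in> carrier B" "b \<in> carrier B" "z \<in> carrier BB"
  shows "LE \<psi> (tens B B a b \<otimes>\<^sub>2 z) = b \<otimes>\<^sub>B LE (\<lambda>y. \<psi> (a \<otimes>\<^sub>B y)) z"
proof -
  note k = kfun_mult_left[OF assms(1,2)]
  have t: "tens B B a b \<in> carrier BB" using assms by simp
  show ?thesis
  proof (rule TP.tensor_klin_eqI[OF B.k_alg _ _ _ assms(4)])
    show "klin BB B (\<lambda>z. LE \<psi> (tens B B a b \<otimes>\<^sub>2 z))"
      by (rule klin_comp[OF klin_mult_left[OF TP.TT.k_alg t] LE(1)[OF assms(1)]])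
    show "klin BB B (\<lambda>z. b \<otimes>\<^sub>B LE (\<lambda>y. \<psi> (a \<otimes>\<^sub>B y)) z)"
      by (rule klin_comp[OF LE(1)[OF k] klin_mult_left[OF B.k_alg assms(3)]])
  qed (simp_all add: assms TP.tens_mult LE(2) k B.smult_mult_r)
qed

text \<open>In a right coideal the first tensor factors remain in U, so every slice of the second
  factor stays there; this is the source of new elements of U below.\<close>

lemma RE_coideal:
  assumes "kfun B \<psi>" "lin_subspace U B" "z \<in> lin_span BB {tens B B a b | a b. a \<in> U \<and> b \<in> carrier B}"
  shows "RE \<psi> z \<in> U"
proof (rule klin_span_into[OF TP.TT.k_alg B.k_alg RE(1)[OF assms(1)] assms(2) _ _ assms(3)])
  have U: "U \<subseteq> carrier B" by (rule B.lin_subspaceD[OF assms(2)])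
  show "{tens B B a b | a b. a \<in> U \<and> b \<in> carrier B} \<subseteq> carrier BB" using U by auto
  fix s assume "s \<in> {tens B B a b | a b. a \<in> U \<and> b \<in> carrier B}"
  then obtain a b where "a \<in> U" "b \<in> carrier B" "s = tens B B a b" by blast
  then show "RE \<psi> s \<in> U" using U assms by (auto simp: RE(2) B.lin_subspaceD(4)[OF assms(2)] subset_iff)
qed

text \<open>The tensors with second factors in the span of S. Error terms of coproducts are recorded
  in this form, since \<open>RE\<close> evaluates its functional at second factors only.\<close>

definition RS :: "'a set \<Rightarrow> ('a \<times> 'a \<Rightarrow>\<^sub>0 'k) set set" where
  "RS S = lin_span BB {tens B B y s | y s. y \<in> carrier B \<and> s \<in> S}"

lemma RS_gens: "S \<subseteq> carrier B \<Longrightarrow> {tens B B y s | y s. y \<in> carrier B \<and> s \<in> S} \<subseteq> carrier BB"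
  by auto

lemma RS_subspace: "S \<subseteq> carrier B \<Longrightarrow> lin_subspace (RS S) BB"
  unfolding RS_def by (rule TP.TT.lin_subspace_lin_span[OF RS_gens])

lemma RS_base: "y \<in> carrier B \<Longrightarrow> s \<in> S \<Longrightarrow> tens B B y s \<in> RS S"
  unfolding RS_def using TP.TT.lin_span_superset[of "{tens B B y s | y s. y \<in> carrier B \<and> s \<in> S}"] by blast

lemma RS_mono: "S \<subseteq> S' \<Longrightarrow> S' \<subseteq> carrier B \<Longrightarrow> RS S \<subseteq> RS S'"
  unfolding RS_def[of S] using RS_base by (intro TP.TT.lin_span_least[OF RS_subspace]) auto

lemma RS_mult_left:
  assumes "S \<subseteq> carrier B" "S' \<subseteq> carrier B" "a \<in> carrier B" "b \<in> carrier B"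
    "\<And>s. s \<in> S \<Longrightarrow> b \<otimes>\<^sub>B s \<in> S'" "z \<in> RS S"
  shows "tens B B a b \<otimes>\<^sub>2 z \<in> RS S'"
proof (rule klin_span_into[OF TP.TT.k_alg TP.TT.k_alg
      klin_mult_left[OF TP.TT.k_alg] RS_subspace[OF assms(2)] RS_gens[OF assms(1)] _ assms(6)[unfolded RS_def]])
  show "tens B B a b \<in> carrier BB" using assms by simp
  fix s assume "s \<in> {tens B B y s | y s. y \<in> carrier B \<and> s \<in> S}"
  then obtain y t where "y \<in> carrier B" "t \<in> S" "s = tens B B y t" by blast
  moreover from this have "t \<in> carrier B" using assms(1) by blast
  ultimately show "tens B B a b \<otimes>\<^sub>2 s \<in> RS S'"
    using assms by (simp add: TP.tens_mult RS_base)
qed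

lemma RE_RS_zero:
  assumes \<psi>: "kfun B \<psi>" and S: "S \<subseteq> carrier B" "S' \<subseteq> carrier B" and h: "h \<in> carrier B"
    and van: "\<And>s s'. s \<in> S \<Longrightarrow> s' \<in> S' \<Longrightarrow> \<psi> (s \<otimes>\<^sub>B h \<otimes>\<^sub>B s') = 0"
    and w: "w \<in> RS S" "w' \<in> RS S'"
  shows "RE \<psi> (w \<otimes>\<^sub>2 tens B B h h \<otimes>\<^sub>2 w') = \<zero>\<^sub>B"
proof -
  let ?H = "tens B B h h"
  have zero: "lin_subspace {\<zero>\<^sub>B} B" by (rule B.lin_subspaceI) auto
  have H: "?H \<in> carrier BB" using h by simp
  note TA = TP.TT.k_alg
  have w': "w' \<in> carrier BB" using TP.TT.lin_subspaceD(1)[OF RS_subspace[OF S(2)]] w(2) by blast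
  have 1: "RE \<psi> (tens B B y s \<otimes>\<^sub>2 ?H \<otimes>\<^sub>2 w') \<in> {\<zero>\<^sub>B}" if "y \<in> carrier B" "s \<in> S" for y s
  proof (rule klin_span_into[OF TA B.k_alg
        klin_comp[OF klin_mult_left[OF TA] RE(1)[OF \<psi>]] zero RS_gens[OF S(2)] _ w(2)[unfolded RS_def]])
    show "tens B B y s \<otimes>\<^sub>2 ?H \<in> carrier BB" using that S h by blast
    fix t assume "t \<in> {tens B B y s | y s. y \<in> carrier B \<and> s \<in> S'}"
    then obtain y' s' where t: "t = tens B B y' s'" "y' \<in> carrier B" "s' \<in> S'" by blast
    have "s \<in> carrier B" "s' \<in> carrier B" using that t S by auto
    then show "RE \<psi> (tens B B y s \<otimes>\<^sub>2 ?H \<otimes>\<^sub>2 t) \<in> {\<zero>\<^sub>B}"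
      using that t h van[of s s'] by (simp add: TP.tens_mult RE(2)[OF \<psi>])
  qed
  have "RE \<psi> (w \<otimes>\<^sub>2 ?H \<otimes>\<^sub>2 w') \<in> {\<zero>\<^sub>B}"
  proof (rule klin_span_into[OF TA B.k_alg
        klin_comp[OF klin_comp[OF klin_mult_right[OF TA H] klin_mult_right[OF TA w']] RE(1)[OF \<psi>]]
        zero RS_gens[OF S(1)] _ w(1)[unfolded RS_def]])
    fix t assume "t \<in> {tens B B y s | y s. y \<in> carrier B \<and> s \<in> S}"
    then show "RE \<psi> (t \<otimes>\<^sub>2 ?H \<otimes>\<^sub>2 w') \<in> {\<zero>\<^sub>B}" using 1 by blast
  qed
  then show ?thesis by simp
qed

text \<open>Both coproducts are a main term plus an error term, with a group-like element in
  between. Of the four products only that of the main terms survives the slice: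
  \<open>van(1)\<close> removes the error on the left against everything on the right,
  \<open>van(2)\<close> the main term on the left against the error on the right.\<close>

lemma RE_prod:
  assumes \<psi>: "kfun B \<psi>" and S: "S \<subseteq> carrier B" "S' \<subseteq> carrier B"
    and c: "h \<in> carrier B" "a \<in> carrier B" "b \<in> carrier B" "a' \<in> carrier B" "b' \<in> carrier B"
    and van: "\<And>s s'. s \<in> S \<Longrightarrow> s' \<in> insert b' S' \<Longrightarrow> \<psi> (s \<otimes>\<^sub>B h \<otimes>\<^sub>B s') = 0"
      "\<And>s'. s' \<in> S' \<Longrightarrow> \<psi> (b \<otimes>\<^sub>B h \<otimes>\<^sub>B s') = 0"
    and w: "w \<in> RS S" "w' \<in> RS S'"
  shows "RE \<psi> ((tens B B a b \<oplus>\<^sub>2 w) \<otimes>\<^sub>2 tens B B h h \<otimes>\<^sub>2 (tens B B a' b' \<oplus>\<^sub>2 w')) =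
    \<psi> (b \<otimes>\<^sub>B h \<otimes>\<^sub>B b') \<odot>\<^sub>B (a \<otimes>\<^sub>B h \<otimes>\<^sub>B a')"
proof -
  let ?H = "tens B B h h" let ?t = "tens B B a b" let ?t' = "tens B B a' b'"
  have wc: "w \<in> carrier BB" "w' \<in> carrier BB"
    using TP.TT.lin_subspaceD(1)[OF RS_subspace[OF S(1)]] TP.TT.lin_subspaceD(1)[OF RS_subspace[OF S(2)]] w by auto
  have tc: "?t \<in> carrier BB" "?t' \<in> carrier BB" "?H \<in> carrier BB" using c by auto
  have S'': "insert b' S' \<subseteq> carrier B" using S c by simp
  have t'w': "?t' \<oplus>\<^sub>2 w' \<in> RS (insert b' S')"
    using TP.TT.lin_subspaceD(3)[OF RS_subspace[OF S'']] RS_base[OF c(4), of b' "insert b' S'"]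
      RS_mono[OF _ S'', of S'] w(2) by auto
  have e: "(?t \<oplus>\<^sub>2 w) \<otimes>\<^sub>2 ?H \<otimes>\<^sub>2 (?t' \<oplus>\<^sub>2 w') =
      ?t \<otimes>\<^sub>2 ?H \<otimes>\<^sub>2 ?t' \<oplus>\<^sub>2 ?t \<otimes>\<^sub>2 ?H \<otimes>\<^sub>2 w' \<oplus>\<^sub>2 w \<otimes>\<^sub>2 ?H \<otimes>\<^sub>2 (?t' \<oplus>\<^sub>2 w')"
  proof -
    have "(?t \<oplus>\<^sub>2 w) \<otimes>\<^sub>2 ?H \<otimes>\<^sub>2 X = ?t \<otimes>\<^sub>2 ?H \<otimes>\<^sub>2 X \<oplus>\<^sub>2 w \<otimes>\<^sub>2 ?H \<otimes>\<^sub>2 X"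
      if "X \<in> carrier BB" for X using wc tc that by (simp add: TP.TT.l_distr)
    from this[of "?t' \<oplus>\<^sub>2 w'"] show ?thesis using wc tc by (simp add: TP.TT.r_distr[of ?t' w' "?t \<otimes>\<^sub>2 ?H"])
  qed
  have 1: "RE \<psi> (w \<otimes>\<^sub>2 ?H \<otimes>\<^sub>2 (?t' \<oplus>\<^sub>2 w')) = \<zero>\<^sub>B"
    by (rule RE_RS_zero[OF \<psi> S(1) S'' c(1) van(1) w(1) t'w'])
  have 2: "RE \<psi> (?t \<otimes>\<^sub>2 ?H \<otimes>\<^sub>2 w') = \<zero>\<^sub>B"
    by (rule RE_RS_zero[OF \<psi> _ S(2) c(1) _ _ w(2), of "{b}"]) (use c van(2) RS_base in auto)
  have 3: "RE \<psi> (?t \<otimes>\<^sub>2 ?H \<otimes>\<^sub>2 ?t') = \<psi> (b \<otimes>\<^sub>B h \<otimes>\<^sub>B b') \<odot>\<^sub>B (a \<otimes>\<^sub>B h \<otimes>\<^sub>B a')"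
    using c by (simp add: TP.tens_mult RE(2)[OF \<psi>])
  show ?thesis
    unfolding e using wc tc c
    by (simp add: klinD[OF RE(1)[OF \<psi>]] 1 2 3)
qed

text \<open>The converse of \<open>RE_coideal\<close>. With coordinate functionals \<psi>_j and
  vectors \<beta>_j that expand every element of B, a tensor z is the sum of the terms
  RE(\<psi>_j)(z) \<otimes> \<beta>_j.\<close>

lemma coideal_of_slices:
  assumes U: "lin_subspace U B" and \<psi>: "\<And>j. kfun B (\<psi> j)" and \<beta>: "\<And>j. \<beta> j \<in> carrier B"
    and fin: "\<And>y. y \<in> carrier B \<Longrightarrow> \<exists>J. finite J \<and> (\<forall>J'. finite J' \<longrightarrow> J \<subseteq> J' \<longrightarrow> y = finsum B (\<lambda>j. \<psi> j y \<odot>\<^sub>B \<beta> j) J')"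
    and z: "z \<in> carrier BB" and slices: "\<And>j. RE (\<psi> j) z \<in> U"
  shows "z \<in> lin_span BB {tens B B a b | a b. a \<in> U \<and> b \<in> carrier B}" (is "_ \<in> lin_span BB ?S")
proof -
  note R = RE[OF \<psi>] and RL = klinD[OF RE(1)[OF \<psi>]]
  \<comment> \<open>The index set is arbitrary above a finite J, so that two such expansions can be
    brought to a common index set when they are added.\<close>
  let ?P = "\<lambda>z. \<exists>J. finite J \<and> (\<forall>J'. finite J' \<longrightarrow> J \<subseteq> J' \<longrightarrow> z = finsum BB (\<lambda>j. tens B B (RE (\<psi> j) z) (\<beta> j)) J')"
  have gens: "{tens B B a b | a b. a \<in> carrier B \<and> b \<in> carrier B} \<subseteq> carrier BB" by auto
  have "?P z"
    using z[unfolded TP.tensor_carrier] gens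
  proof (induction rule: TP.TT.lin_span_induct)
    case zero
    have "tens B B (RE (\<psi> j) \<zero>\<^sub>2) (\<beta> j) = \<zero>\<^sub>2" for j
      using TP.tens_smult(1)[OF B.zero_closed \<beta>, of 0 j]
      by (simp add: klin_zero[OF TP.TT.k_alg B.k_alg R(1)] \<beta>)
    then show ?case by (intro exI[of _ "{}"]) simp
  next
    case (base s)
    then obtain a b where s: "s = tens B B a b" "a \<in> carrier B" "b \<in> carrier B" by blast
    obtain J where J: "finite J" "\<And>J'. finite J' \<Longrightarrow> J \<subseteq> J' \<Longrightarrow> b = finsum B (\<lambda>j. \<psi> j b \<odot>\<^sub>B \<beta> j) J'"
      using fin[OF s(3)] by blast
    have "s = finsum BB (\<lambda>j. tens B B (RE (\<psi> j) s) (\<beta> j)) J'" if J': "finite J'" "J \<subseteq> J'" for J'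
    proof -
      have kl: "klin B BB (tens B B a)" using TP.kbilin_tens s(2) by (simp add: kbilin_def)
      have "s = tens B B a (finsum B (\<lambda>j. \<psi> j b \<odot>\<^sub>B \<beta> j) J')" using J(2)[OF J'] s(1) by simp
      also have "\<dots> = finsum BB (\<lambda>j. tens B B a (\<psi> j b \<odot>\<^sub>B \<beta> j)) J'"
        using \<beta> by (intro klin_finsum[OF B.k_alg TP.TT.k_alg kl]) auto
      also have "\<dots> = finsum BB (\<lambda>j. tens B B (RE (\<psi> j) s) (\<beta> j)) J'"
        using s \<beta> by (intro TP.TT.finsum_cong') (auto simp: R TP.tens_smult)
      finally show ?thesis .
    qed
    then show ?case using J(1) by blast
  next
    case (add x y)
    then have xy: "x \<in> carrier BB" "y \<in> carrier BB" using TP.tensor_carrier by auto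
    obtain J where J: "finite J" "\<And>J'. finite J' \<Longrightarrow> J \<subseteq> J' \<Longrightarrow> x = finsum BB (\<lambda>j. tens B B (RE (\<psi> j) x) (\<beta> j)) J'"
      using add.IH(1) by blast
    obtain K where K: "finite K" "\<And>J'. finite J' \<Longrightarrow> K \<subseteq> J' \<Longrightarrow> y = finsum BB (\<lambda>j. tens B B (RE (\<psi> j) y) (\<beta> j)) J'"
      using add.IH(2) by blast
    have "x \<oplus>\<^sub>2 y = finsum BB (\<lambda>j. tens B B (RE (\<psi> j) (x \<oplus>\<^sub>2 y)) (\<beta> j)) J'"
      if J': "finite J'" "J \<union> K \<subseteq> J'" for J'
    proof -
      have "finsum BB (\<lambda>j. tens B B (RE (\<psi> j) (x \<oplus>\<^sub>2 y)) (\<beta> j)) J' =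
        finsum BB (\<lambda>j. tens B B (RE (\<psi> j) x) (\<beta> j) \<oplus>\<^sub>2 tens B B (RE (\<psi> j) y) (\<beta> j)) J'"
        using xy \<beta> by (intro TP.TT.finsum_cong') (auto simp: RL TP.tens_add_left)
      also have "\<dots> = finsum BB (\<lambda>j. tens B B (RE (\<psi> j) x) (\<beta> j)) J' \<oplus>\<^sub>2 finsum BB (\<lambda>j. tens B B (RE (\<psi> j) y) (\<beta> j)) J'"
        using xy \<beta> by (intro TP.TT.finsum_addf) (auto simp: RL)
      finally show ?thesis using J(2)[of J'] K(2)[of J'] J' by simp
    qed
    then show ?case using J(1) K(1) by (intro exI[of _ "J \<union> K"]) simp
  next
    case (smult c x)
    then have x: "x \<in> carrier BB" using TP.tensor_carrier by auto
    obtain J where J: "finite J" "\<And>J'. finite J' \<Longrightarrow> J \<subseteq> J' \<Longrightarrow> x = finsum BB (\<lambda>j. tens B B (RE (\<psi> j) x) (\<beta> j)) J'"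
      using smult.IH by blast
    have "c \<odot>\<^sub>2 x = finsum BB (\<lambda>j. tens B B (RE (\<psi> j) (c \<odot>\<^sub>2 x)) (\<beta> j)) J'"
      if J': "finite J'" "J \<subseteq> J'" for J'
    proof -
      have "finsum BB (\<lambda>j. tens B B (RE (\<psi> j) (c \<odot>\<^sub>2 x)) (\<beta> j)) J' =
        finsum BB (\<lambda>j. c \<odot>\<^sub>2 tens B B (RE (\<psi> j) x) (\<beta> j)) J'"
        using x \<beta> by (intro TP.TT.finsum_cong') (auto simp: RL TP.tens_smult)
      also have "\<dots> = c \<odot>\<^sub>2 finsum BB (\<lambda>j. tens B B (RE (\<psi> j) x) (\<beta> j)) J'"
        using x \<beta> by (intro TP.TT.smult_finsum[symmetric]) (auto simp: RL)
      finally show ?thesis using J(2)[OF J'] by simp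
    qed
    then show ?case using J(1) by blast
  qed
  then obtain J where "z = finsum BB (\<lambda>j. tens B B (RE (\<psi> j) z) (\<beta> j)) J" by blast
  moreover have "lin_subspace (lin_span BB ?S) BB"
    using B.lin_subspaceD(1)[OF U] by (intro TP.TT.lin_subspace_lin_span) auto
  moreover have "tens B B (RE (\<psi> j) z) (\<beta> j) \<in> lin_span BB ?S" for j
    using slices \<beta> TP.TT.lin_span_superset[of ?S] by blast
  ultimately show ?thesis
    using TP.TT.lin_subspace_finsum[of "lin_span BB ?S" J "\<lambda>j. tens B B (RE (\<psi> j) z) (\<beta> j)"] by simp
qed

end

text \<open>\<theta> \<otimes> \<theta>, needed to compare the coproduct of A^+ or A^- with that of
  A along the canonical map.\<close>

lemma tensor_square_hom:
  assumes "k_algebra B" "k_algebra C" "\<theta> \<in> alg_hom B C"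
  defines "F \<equiv> tlift (tensor C C) (\<lambda>a b. tens C C (\<theta> a) (\<theta> b))"
  shows "F \<in> alg_hom (tensor B B) (tensor C C)"
    and "a \<in> carrier B \<Longrightarrow> b \<in> carrier B \<Longrightarrow> F (tens B B a b) = tens C C (\<theta> a) (\<theta> b)"
proof -
  interpret B: square B + C: square C using assms by (auto simp: square_def)
  note \<theta> = alg_homD[OF assms(3)]
  have bil: "kbilin B B (tensor C C) (\<lambda>a b. tens C C (\<theta> a) (\<theta> b))"
    unfolding kbilin_def
    by (auto intro!: klinI simp: \<theta> C.TP.tens_add_left C.TP.tens_add_right C.TP.tens_smult)
  note T = B.TP.tlift[OF C.TP.TT.k_alg bil, folded F_def]
  show "F (tens B B a b) = tens C C (\<theta> a) (\<theta> b)" if "a \<in> carrier B" "b \<in> carrier B"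
    using that by (rule T(2))
  show "F \<in> alg_hom (tensor B B) (tensor C C)"
    by (rule B.TP.tensor_alg_homI[OF C.TP.TT.k_alg T(1)])
      (simp_all add: T(2) \<theta> C.TP.tens_mult C.TP.tens_one)
qed

section \<open>Algebras spanned by monomials and their coproduct\<close>

lemma chi_word_Nil [simp]: "chi_word [] h = 1"
  by (simp add: chi_word_def)

lemma chi_word_Cons [simp]: "chi_word (x # v) h = chi_letter x h * chi_word v h"
  by (simp add: chi_word_def)

lemma chi_word_append [simp]: "chi_word (v @ w) h = chi_word v h * chi_word w h"
  by (simp add: chi_word_def)

context adm
begin

lemma chi_word_mult: "h \<in> carrier HH \<Longrightarrow> h' \<in> carrier HH \<Longrightarrow>
    chi_word v (h \<otimes>\<^sub>H h') = chi_word v h * chi_word v h'"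
  by (induction v) (auto simp: chi_letter_mult)

lemma chi_word_nz: "h \<in> carrier HH \<Longrightarrow> chi_word v h \<noteq> 0"
  by (induction v) (auto simp: chi_letter_nz)

lemma chi_word_one [simp]: "chi_word v \<one>\<^sub>H = 1"
  by (induction v) (auto simp: chi_letter_one)

end

text \<open>
  \<open>b g v\<close> is the monomial \<open>g v\<close> with \<open>g\<close> in the subgroup \<open>Ks\<close> of \<open>H\<close>.  The locale covers \<open>A\<close> as well
  as \<open>A\<^sup>\<plusminus>\<close>; the map \<open>l\<close> translates the variables into letters of \<open>F\<^sub>n\<close>.
\<close>

locale malg = adm p N + square B
  for p :: "'n::finite \<Rightarrow> 'n \<Rightarrow> 'k::field" and N :: "(('k, 'n) lin \<times> ('k, 'n) lin) set"
    and B :: "('k, 'a) module" +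
  fixes Ks :: "('k, 'n) hgrp set" and l :: "'x \<Rightarrow> 'n letter" and b :: "('k, 'n) hgrp \<Rightarrow> 'x list \<Rightarrow> 'a"
    and \<gamma> :: "'x \<Rightarrow> ('k, 'n) hgrp" and Gen :: "('k, 'n) hgrp set"
  assumes Gen: "Gen \<subseteq> carrier HH" and Ks: "Ks = generate HH Gen"
    and \<gamma>: "\<And>x. \<gamma> x \<in> Ks"
    and b_closed [simp, intro]: "\<And>g v. g \<in> Ks \<Longrightarrow> b g v \<in> carrier B"
    and b_mult: "\<And>g g' v v'. g \<in> Ks \<Longrightarrow> g' \<in> Ks \<Longrightarrow>
      b g v \<otimes>\<^sub>B b g' v' = chi_word (map l v) g' \<odot>\<^sub>B b (g \<otimes>\<^sub>H g') (v @ v')"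
    and b_one: "b \<one>\<^sub>H [] = \<one>\<^sub>B"
    and b_span: "carrier B = lin_span B {b g v | g v. g \<in> Ks}"
begin

lemma Ks_subgroup: "subgroup Ks HH"
  unfolding Ks by (rule H.generate_is_subgroup[OF Gen])

lemma Ks_carrier [simp]: "g \<in> Ks \<Longrightarrow> g \<in> carrier HH"
  using subgroup.subset[OF Ks_subgroup] by blast

lemma Ks_closed [simp]: "\<one>\<^sub>H \<in> Ks" "g \<in> Ks \<Longrightarrow> g' \<in> Ks \<Longrightarrow> g \<otimes>\<^sub>H g' \<in> Ks" "g \<in> Ks \<Longrightarrow> inv\<^bsub>HH\<^esub> g \<in> Ks"
  using subgroup.one_closed[OF Ks_subgroup] subgroup.m_closed[OF Ks_subgroup] subgroup.m_inv_closed[OF Ks_subgroup] by auto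

abbreviation "bg g \<equiv> b g []"
abbreviation "bw v \<equiv> b \<one>\<^sub>H v"

lemma b_split: "g \<in> Ks \<Longrightarrow> b g v = bg g \<otimes>\<^sub>B bw v"
  by (simp add: b_mult B.smult_one)

lemma bw_append: "bw (v @ w) = bw v \<otimes>\<^sub>B bw w"
  by (simp add: b_mult B.smult_one)

lemma bw_Cons: "bw (x # v) = bw [x] \<otimes>\<^sub>B bw v"
  by (simp add: b_mult B.smult_one)

lemma bg_mult: "g \<in> Ks \<Longrightarrow> g' \<in> Ks \<Longrightarrow> bg g \<otimes>\<^sub>B bg g' = bg (g \<otimes>\<^sub>H g')"
  by (simp add: b_mult B.smult_one)

lemma bg_inv: "g \<in> Ks \<Longrightarrow> bg g \<otimes>\<^sub>B bg (inv\<^bsub>HH\<^esub> g) = \<one>\<^sub>B" "g \<in> Ks \<Longrightarrow> bg (inv\<^bsub>HH\<^esub> g) \<otimes>\<^sub>B bg g = \<one>\<^sub>B"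
  by (simp_all add: bg_mult b_one)

lemma bw_bg: "g \<in> Ks \<Longrightarrow> bw v \<otimes>\<^sub>B bg g = chi_word (map l v) g \<odot>\<^sub>B (bg g \<otimes>\<^sub>B bw v)"
  by (simp add: b_mult B.smult_one)

abbreviation "gens_g \<equiv> {bg g | g. g \<in> Gen}"
abbreviation "gens_x \<equiv> {(bw [x], bg (\<gamma> x)) | x. True}"

text \<open>The value that a coproduct with the prescribed properties must take at a letter;
  \<open>dw\<close> multiplies these values along a word. Both make sense before a coproduct is
  known to exist.\<close>

definition dx :: "'x \<Rightarrow> ('a \<times> 'a \<Rightarrow>\<^sub>0 'k) set" where
  "dx x = tens B B (bw [x]) \<one>\<^sub>B \<oplus>\<^sub>2 tens B B (bg (\<gamma> x)) (bw [x])"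

primrec dw :: "'x list \<Rightarrow> ('a \<times> 'a \<Rightarrow>\<^sub>0 'k) set" where
  "dw [] = \<one>\<^sub>2"
| "dw (x # v) = dx x \<otimes>\<^sub>2 dw v"

lemma dx_closed [simp]: "dx x \<in> carrier BB"
  by (simp add: dx_def \<gamma>)

lemma dw_closed [simp]: "dw v \<in> carrier BB"
  by (induction v) auto

lemma coproduct_group:
  assumes "is_coproduct B gens_g gens_x \<Delta>" "g \<in> Ks"
  shows "\<Delta> (bg g) = tens B B (bg g) (bg g)"
proof -
  have hom: "\<Delta> \<in> alg_hom B BB" and gen: "\<And>g. g \<in> Gen \<Longrightarrow> \<Delta> (bg g) = tens B B (bg g) (bg g)"
    using assms(1) by (auto simp: is_coproduct_def)
  note \<Delta> = alg_homD[OF hom]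
  have K: "generate HH Gen = Ks" by (simp add: Ks)
  from assms(2)[unfolded Ks] show ?thesis
  proof induction
    case one
    then show ?case by (simp add: b_one \<Delta> TP.tens_one)
  next
    case (incl h)
    then show ?case by (rule gen)
  next
    \<comment> \<open>\<Delta>(h^-1) is a left inverse of h \<otimes> h, and h^-1 \<otimes> h^-1 is
      a right inverse of it.\<close>
    case (inv h)
    then have h: "h \<in> Ks" unfolding Ks by (rule generate.incl)
    let ?i = "inv\<^bsub>HH\<^esub> h"
    have "\<Delta> (bg ?i) \<otimes>\<^sub>2 tens B B (bg h) (bg h) = \<one>\<^sub>2"
      using \<Delta>(5)[of "bg ?i" "bg h"] h gen[OF inv] by (simp add: bg_inv \<Delta>(6))
    moreover have "tens B B (bg h) (bg h) \<otimes>\<^sub>2 tens B B (bg ?i) (bg ?i) = \<one>\<^sub>2"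
      using h by (simp add: TP.tens_mult bg_inv TP.tens_one)
    moreover have "tens B B (bg h) (bg h) \<in> carrier BB" "tens B B (bg ?i) (bg ?i) \<in> carrier BB" "\<Delta> (bg ?i) \<in> carrier BB"
      using h \<Delta>(2) by auto
    ultimately show ?case using TP.TT.inv_unique by blast
  next
    case (eng h h')
    then show ?case unfolding K
      using \<Delta>(5)[of "bg h" "bg h'"] by (simp add: bg_mult[symmetric] TP.tens_mult)
  qed
qed

lemma coproduct_word:
  assumes "is_coproduct B gens_g gens_x \<Delta>"
  shows "\<Delta> (bw v) = dw v"
proof -
  have hom: "\<Delta> \<in> alg_hom B BB"
    and "\<And>x y. (x, y) \<in> gens_x \<Longrightarrow> \<Delta> x = tens B B x \<one>\<^sub>B \<oplus>\<^sub>2 tens B B y x"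
    using assms unfolding is_coproduct_def by blast+
  then have gen: "\<Delta> (bw [x]) = dx x" for x
    unfolding dx_def by blast
  note \<Delta> = alg_homD[OF hom]
  show ?thesis
  proof (induction v)
    case (Cons x v)
    then show ?case using \<Delta>(5)[of "bw [x]" "bw v"] by (simp add: bw_Cons[symmetric] gen)
  qed (simp add: b_one \<Delta>)
qed

lemma coproduct_monomial:
  assumes "is_coproduct B gens_g gens_x \<Delta>" "g \<in> Ks"
  shows "\<Delta> (b g v) = tens B B (bg g) (bg g) \<otimes>\<^sub>2 dw v"
proof -
  have "\<Delta> \<in> alg_hom B BB" using assms(1) by (auto simp: is_coproduct_def)
  note \<Delta> = alg_homD(5)[OF this, of "bg g" "bw v"]
  show ?thesis using \<Delta> assms(2)
    by (simp add: coproduct_group[OF assms] coproduct_word[OF assms(1)] b_split[symmetric])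
qed

lemma monomials_closed: "{b g v | g v. g \<in> Ks} \<subseteq> carrier B" by auto

lemma klin_eq_on_monomials:
  assumes "k_algebra C" "klin B C f" "klin B C f'" "\<And>g v. g \<in> Ks \<Longrightarrow> f (b g v) = f' (b g v)" "y \<in> carrier B"
  shows "f y = f' y"
  by (rule klin_eq_on_span[OF B.k_alg assms(1-3) monomials_closed])
    (use assms(4,5) b_span in auto)

text \<open>Two such maps agree on monomials, hence on the carrier, and \<open>extensional\<close>
  fixes them elsewhere. This gives the description operator in \<open>coproduct\<close> its
  meaning.\<close>

lemma coproduct_eq:
  assumes "is_coproduct B gens_g gens_x \<Delta>"
  shows "coproduct B gens_g gens_x = \<Delta>"
  unfolding coproduct_def
proof (rule the_equality[where P = "is_coproduct B gens_g gens_x", OF assms])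
  fix \<Delta>' assume 1: "is_coproduct B gens_g gens_x \<Delta>'"
  have hom: "\<Delta> \<in> alg_hom B BB" "\<Delta>' \<in> alg_hom B BB"
    and e: "\<Delta> \<in> extensional (carrier B)" "\<Delta>' \<in> extensional (carrier B)"
    using assms 1 unfolding is_coproduct_def by simp_all
  have "\<Delta>' y = \<Delta> y" if "y \<in> carrier B" for y
    by (rule klin_eq_on_monomials[OF TP.TT.k_alg alg_homD(1)[OF hom(2)] alg_homD(1)[OF hom(1)] _ that])
      (simp add: coproduct_monomial[OF assms] coproduct_monomial[OF 1])
  then show "\<Delta>' = \<Delta>" by (rule extensionalityI[OF e(2,1)])
qed

text \<open>Multiplication by the coproduct of x on the left either keeps a second factor or
  prefixes x to it. This is the induction step for the error terms in \<open>dw_left\<close> and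
  \<open>dw_right\<close>.\<close>

lemma RS_dx:
  assumes "S \<subseteq> carrier B" "S' \<subseteq> carrier B" "S \<subseteq> S'" "\<And>s. s \<in> S \<Longrightarrow> bw [x] \<otimes>\<^sub>B s \<in> S'" "z \<in> RS S"
  shows "dx x \<otimes>\<^sub>2 z \<in> RS S'"
proof -
  have "z \<in> carrier BB" using TP.TT.lin_subspaceD(1)[OF RS_subspace[OF assms(1)]] assms(5) by blast
  then have "dx x \<otimes>\<^sub>2 z = tens B B (bw [x]) \<one>\<^sub>B \<otimes>\<^sub>2 z \<oplus>\<^sub>2 tens B B (bg (\<gamma> x)) (bw [x]) \<otimes>\<^sub>2 z"
    by (simp add: dx_def \<gamma> TP.TT.l_distr)
  moreover have "tens B B (bw [x]) \<one>\<^sub>B \<otimes>\<^sub>2 z \<in> RS S'"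
    by (rule RS_mult_left[OF assms(1,2) _ _ _ assms(5)]) (use assms(1,3) in \<open>auto simp: subset_iff\<close>)
  moreover have "tens B B (bg (\<gamma> x)) (bw [x]) \<otimes>\<^sub>2 z \<in> RS S'"
    by (rule RS_mult_left[OF assms(1,2) _ _ assms(4) assms(5)]) (simp_all add: \<gamma>)
  ultimately show ?thesis using TP.TT.lin_subspaceD(3)[OF RS_subspace[OF assms(2)]] by simp
qed

definition "words P = bw ` {v. P v}"

lemma words_closed [simp]: "words P \<subseteq> carrier B"
  by (auto simp: words_def)

lemma words_mono: "(\<And>v. P v \<Longrightarrow> Q v) \<Longrightarrow> words P \<subseteq> words Q"
  by (auto simp: words_def)

lemma words_Cons: "s \<in> words P \<Longrightarrow> (\<And>v. P v \<Longrightarrow> Q (x # v)) \<Longrightarrow> bw [x] \<otimes>\<^sub>B s \<in> words Q"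
  by (auto simp: words_def simp flip: bw_Cons)

text \<open>In the product of the factors x \<otimes> 1 + \<gamma>(x) \<otimes> x, the choice of the
  first summand throughout gives the main term; any other choice leaves a nonempty word in the
  second factor. The error is thus invisible to a coordinate at the empty word.\<close>

lemma dw_left:
  "\<exists>w \<in> RS (words (\<lambda>v'. v' \<noteq> [] \<and> set v' \<subseteq> set v)). dw v = tens B B (bw v) \<one>\<^sub>B \<oplus>\<^sub>2 w"
proof (induction v)
  case Nil
  have "\<zero>\<^sub>2 \<in> RS (words (\<lambda>v'. v' \<noteq> [] \<and> set v' \<subseteq> set []))"
    by (rule TP.TT.lin_subspaceD(2)[OF RS_subspace[OF words_closed]])
  then show ?case by (intro bexI[of _ "\<zero>\<^sub>2"]) (simp_all add: b_one TP.tens_one)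
next
  case (Cons x v)
  let ?P = "\<lambda>v v'. v' \<noteq> [] \<and> set v' \<subseteq> set v"
  obtain w where w: "w \<in> RS (words (?P v))" "dw v = tens B B (bw v) \<one>\<^sub>B \<oplus>\<^sub>2 w" using Cons by blast
  have wc: "w \<in> carrier BB" using TP.TT.lin_subspaceD(1)[OF RS_subspace[OF words_closed]] w(1) by blast
  have S: "dx x \<otimes>\<^sub>2 w \<in> RS (words (?P (x # v)))"
    by (rule RS_dx[OF words_closed words_closed _ _ w(1)], rule words_mono, force, erule words_Cons, auto)
  have "tens B B (bg (\<gamma> x) \<otimes>\<^sub>B bw v) (bw [x]) \<in> RS (words (?P (x # v)))"
    by (rule RS_base) (auto simp: words_def \<gamma>)
  then have "tens B B (bg (\<gamma> x) \<otimes>\<^sub>B bw v) (bw [x]) \<oplus>\<^sub>2 dx x \<otimes>\<^sub>2 w \<in> RS (words (?P (x # v)))"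
    using S by (rule TP.TT.lin_subspaceD(3)[OF RS_subspace[OF words_closed]])
  moreover have "dw (x # v) = tens B B (bw (x # v)) \<one>\<^sub>B \<oplus>\<^sub>2
      (tens B B (bg (\<gamma> x) \<otimes>\<^sub>B bw v) (bw [x]) \<oplus>\<^sub>2 dx x \<otimes>\<^sub>2 w)"
  proof -
    have "dx x \<otimes>\<^sub>2 tens B B (bw v) \<one>\<^sub>B = tens B B (bw (x # v)) \<one>\<^sub>B \<oplus>\<^sub>2 tens B B (bg (\<gamma> x) \<otimes>\<^sub>B bw v) (bw [x])"
      by (simp add: dx_def \<gamma> TP.TT.l_distr TP.tens_mult bw_Cons[of x v])
    then show ?thesis using wc
      by (simp add: w(2) TP.TT.r_distr TP.TT.a_assoc \<gamma>)
  qed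
  ultimately show ?case by blast
qed

primrec \<gamma>w :: "'x list \<Rightarrow> ('k, 'n) hgrp" where
  "\<gamma>w [] = \<one>\<^sub>H"
| "\<gamma>w (x # v) = \<gamma> x \<otimes>\<^sub>H \<gamma>w v"

lemma \<gamma>w_closed [simp]: "\<gamma>w v \<in> Ks"
  by (induction v) (auto simp: \<gamma>)

text \<open>Here the second summand is chosen throughout, which gives the word v itself with the
  group element \<open>\<gamma>w v\<close> in the first factor. Any other choice leaves a shorter
  word on the right, invisible to a coordinate at a word at least as long as v.\<close>

lemma dw_right:
  "\<exists>w \<in> RS (words (\<lambda>v'. length v' < length v \<and> set v' \<subseteq> set v)). dw v = tens B B (bg (\<gamma>w v)) (bw v) \<oplus>\<^sub>2 w"
proof (induction v)
  case Nil
  have "\<zero>\<^sub>2 \<in> RS (words (\<lambda>v'. length v' < length [] \<and> set v' \<subseteq> set []))"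
    by (rule TP.TT.lin_subspaceD(2)[OF RS_subspace[OF words_closed]])
  then show ?case by (intro bexI[of _ "\<zero>\<^sub>2"]) (simp_all add: b_one TP.tens_one)
next
  case (Cons x v)
  let ?P = "\<lambda>v v'. length v' < length v \<and> set v' \<subseteq> set v"
  obtain w where w: "w \<in> RS (words (?P v))" "dw v = tens B B (bg (\<gamma>w v)) (bw v) \<oplus>\<^sub>2 w" using Cons by blast
  have wc: "w \<in> carrier BB" using TP.TT.lin_subspaceD(1)[OF RS_subspace[OF words_closed]] w(1) by blast
  have S: "dx x \<otimes>\<^sub>2 w \<in> RS (words (?P (x # v)))"
    by (rule RS_dx[OF words_closed words_closed _ _ w(1)], rule words_mono, force, erule words_Cons, auto)
  have "tens B B (bw [x] \<otimes>\<^sub>B bg (\<gamma>w v)) (bw v) \<in> RS (words (?P (x # v)))"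
    by (rule RS_base) (auto simp: words_def)
  then have "tens B B (bw [x] \<otimes>\<^sub>B bg (\<gamma>w v)) (bw v) \<oplus>\<^sub>2 dx x \<otimes>\<^sub>2 w \<in> RS (words (?P (x # v)))"
    using S by (rule TP.TT.lin_subspaceD(3)[OF RS_subspace[OF words_closed]])
  moreover have "dw (x # v) = tens B B (bg (\<gamma>w (x # v))) (bw (x # v)) \<oplus>\<^sub>2
      (tens B B (bw [x] \<otimes>\<^sub>B bg (\<gamma>w v)) (bw v) \<oplus>\<^sub>2 dx x \<otimes>\<^sub>2 w)"
  proof -
    have "dx x \<otimes>\<^sub>2 tens B B (bg (\<gamma>w v)) (bw v) =
        tens B B (bw [x] \<otimes>\<^sub>B bg (\<gamma>w v)) (bw v) \<oplus>\<^sub>2 tens B B (bg (\<gamma>w (x # v))) (bw (x # v))"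
      by (simp add: dx_def \<gamma> TP.TT.l_distr TP.tens_mult bw_Cons[of x v] bg_mult)
    then show ?thesis using wc
      by (simp add: w(2) TP.TT.r_distr TP.TT.a_ac \<gamma>)
  qed
  ultimately show ?case by blast
qed

end

section \<open>Homogeneous ideals of the free algebra\<close>

text \<open>The two-sided ideal of the free algebra generated by R;
  \<open>plin (\<lambda>w. bas (a @ w @ b)) q\<close> is the product a q b.\<close>

definition word_ideal :: "('k::field, 'n) npoly set \<Rightarrow> ('k, 'n) npoly set" where
  "word_ideal R = pm.span {plin (\<lambda>w. bas (a @ w @ b)) q | a b q. q \<in> R}"

abbreviation pre :: "'n \<Rightarrow> ('k::field, 'n) npoly \<Rightarrow> ('k, 'n) npoly" where
  "pre i \<equiv> plin (\<lambda>w. bas (i # w))"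

abbreviation comp :: "('n \<Rightarrow> nat) \<Rightarrow> ('k::field, 'n) npoly \<Rightarrow> ('k, 'n) npoly" where
  "comp d \<equiv> rst (\<lambda>w. count_list w = d)"

lemma length_eq_count: "length (v :: 'n::finite list) = (\<Sum>i\<in>UNIV. count_list v i)"
proof (induction v)
  case (Cons x v)
  have "(\<Sum>i\<in>UNIV. count_list (x # v) i) = (\<Sum>i\<in>UNIV. count_list v i + (if x = i then 1 else 0))"
    by (intro sum.cong) auto
  then show ?case using Cons by (simp add: sum.distrib)
qed simp

lemma prod_list_count:
  fixes f :: "'n::finite \<Rightarrow> 'k::comm_monoid_mult"
  shows "prod_list (map f v) = (\<Prod>i\<in>UNIV. f i ^ count_list v i)"
proof (induction v)
  case (Cons x v)
  have "(\<Prod>i\<in>UNIV. f i ^ count_list (x # v) i) = (\<Prod>i\<in>UNIV. f i ^ count_list v i * (if x = i then f i else 1))"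
    by (intro prod.cong) (auto simp: mult.commute)
  then show ?case using Cons by (simp add: prod.distrib mult.commute)
qed simp

text \<open>A character of a word depends only on how often each letter occurs. So moving a group
  element past a polynomial that is homogeneous in each variable multiplies it by a single
  scalar.\<close>

lemma prod_list_cong_count:
  fixes f :: "'n::finite \<Rightarrow> 'k::comm_monoid_mult"
  shows "count_list v = count_list w \<Longrightarrow> prod_list (map f v) = prod_list (map f w)"
  by (simp add: prod_list_count)

lemma word_ideal_subspace: "pm.subspace (word_ideal R)"
  unfolding word_ideal_def by (rule pm.subspace_span)

lemma word_ideal_gen: "q \<in> R \<Longrightarrow> plin (\<lambda>w. bas (a @ w @ b)) q \<in> word_ideal R"
  unfolding word_ideal_def by (rule pm.span_base) blast

lemma word_ideal_superset: "q \<in> R \<Longrightarrow> q \<in> word_ideal R"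
  using word_ideal_gen[of q R "[]" "[]"] by simp

lemma word_ideal_least:
  assumes "pm.subspace W" "\<And>a b q. q \<in> R \<Longrightarrow> plin (\<lambda>w. bas (a @ w @ b)) q \<in> W" "s \<in> word_ideal R"
  shows "s \<in> W"
proof -
  have "word_ideal R \<subseteq> W"
    unfolding word_ideal_def using assms(1,2) by (intro pm.span_minimal) auto
  then show ?thesis using assms(3) by blast
qed

lemma word_ideal_mult:
  assumes "s \<in> word_ideal R"
  shows "plin (\<lambda>w. bas (a @ w @ b)) s \<in> word_ideal R"
proof -
  have "plin (\<lambda>w. bas (a @ w @ b)) (plin (\<lambda>w. bas (c @ w @ d)) q) \<in> word_ideal R" if "q \<in> R" for q c d
    using word_ideal_gen[OF that, of "a @ c" "d @ b"] by (simp add: plin_plin)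
  then show ?thesis
    by (intro plin_span_into[OF _ word_ideal_subspace assms[unfolded word_ideal_def]]) blast
qed

lemma word_ideal_left: "s \<in> word_ideal R \<Longrightarrow> plin (\<lambda>w. bas (a @ w)) s \<in> word_ideal R"
  using word_ideal_mult[of s R a "[]"] by simp

lemma word_ideal_pre: "s \<in> word_ideal R \<Longrightarrow> pre i s \<in> word_ideal R"
  using word_ideal_left[of s R "[i]"] by simp

lemma word_ideal_right: "s \<in> word_ideal R \<Longrightarrow> plin (\<lambda>w. bas (w @ b)) s \<in> word_ideal R"
  using word_ideal_mult[of s R "[]" b] by simp

text \<open>Multiplication by words only lengthens the relations. Hence the empty word and the
  letters remain independent modulo the ideal.\<close>

lemma word_ideal_length:
  assumes "\<And>q v. q \<in> R \<Longrightarrow> v \<in> supp q \<Longrightarrow> length v > 1" "s \<in> word_ideal R"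
  shows "supp s \<subseteq> {v. length v > 1}"
proof -
  have "supp (plin (\<lambda>w. bas (a @ w @ b)) q) \<subseteq> {v. length v > 1}" if "q \<in> R" for a b q
    using supp_plin[of "\<lambda>w. bas (a @ w @ b)" q] assms(1)[OF that] by fastforce
  then show ?thesis
    using word_ideal_least[OF pm_subspace_supp _ assms(2)] by auto
qed

text \<open>Each generator a q b has one multidegree, so a component of it is the generator itself
  or 0.\<close>

lemma word_ideal_comp:
  fixes R :: "('k::field, 'n::finite) npoly set"
  assumes "\<And>q. q \<in> R \<Longrightarrow> homogeneous_npoly q" "s \<in> word_ideal R"
  shows "comp d s \<in> word_ideal R"
proof -
  have gen: "comp d g \<in> word_ideal R" if "g \<in> {plin (\<lambda>w. bas (a @ w @ b)) q | a b q. q \<in> R}" for g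
  proof -
  from that obtain a b q where g: "g = plin (\<lambda>w. bas (a @ w @ b)) q" "q \<in> R" by blast
  have supp: "\<exists>v \<in> supp q. w = a @ v @ b" if "w \<in> supp g" for w
    using supp_plin[of "\<lambda>w. bas (a @ w @ b)" q] that unfolding g(1) by auto
  have same: "count_list w = count_list w'" if "w \<in> supp g" "w' \<in> supp g" for w w'
  proof -
    from supp[OF that(1)] obtain v where v: "v \<in> supp q" "w = a @ v @ b" by blast
    from supp[OF that(2)] obtain v' where v': "v' \<in> supp q" "w' = a @ v' @ b" by blast
    have "count_list v i = count_list v' i" for i
      using assms(1)[OF g(2)] v(1) v'(1) unfolding homogeneous_npoly_def by blast
    then show ?thesis by (simp add: fun_eq_iff v v')
  qed
  show "comp d g \<in> word_ideal R"
  proof (cases "\<exists>w \<in> supp g. count_list w = d")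
    case True
    then have "comp d g = g" using same by (intro rst_all) blast
    then show ?thesis using word_ideal_gen[OF g(2)] by (simp add: g(1))
  next
    case False
    then have "comp d g = 0" by (intro rst_none) blast
    then show ?thesis by (simp add: pm.subspace_0[OF word_ideal_subspace])
  qed
  qed
  show ?thesis unfolding rst_def
    by (rule plin_span_into[OF gen[unfolded rst_def] word_ideal_subspace assms(2)[unfolded word_ideal_def]])
qed

interpretation pmp: vector_space_pair "scl :: 'k::field \<Rightarrow> ('a \<Rightarrow>\<^sub>0 'k) \<Rightarrow> _" "scl :: 'k \<Rightarrow> ('b \<Rightarrow>\<^sub>0 'k) \<Rightarrow> _"
  by unfold_locales

text \<open>The set \<open>W\<close> is a basis of a complement of \<open>I\<close> that consists of words.\<close>

lemma normal_form_exists: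
  fixes I :: "('k::field, 'n) npoly set"
  assumes I: "pm.subspace I" and graded: "\<And>d s. s \<in> I \<Longrightarrow> comp d s \<in> I"
  obtains W redw where "\<And>v. supp (redw v) \<subseteq> {w \<in> W. count_list w = count_list v}"
    "\<And>v. bas v - redw v \<in> I" "\<And>s. s \<in> I \<Longrightarrow> plin redw s = 0" "\<And>w. w \<in> W \<Longrightarrow> redw w = bas w"
proof -
  obtain B1 where B1: "B1 \<subseteq> I" "pm.independent B1" "I \<subseteq> pm.span B1"
    using pm.basis_exists[of I] by metis
  \<comment> \<open>A basis of I is extended by words to a basis of the whole space. The added words
    form W, and r is the projection onto their span with kernel I.\<close>
  obtain B where B: "B1 \<subseteq> B" "B \<subseteq> B1 \<union> range bas" "pm.independent B" "B1 \<union> range bas \<subseteq> pm.span B"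
    using pm.maximal_independent_subset_extend[of B1 "B1 \<union> range bas"] B1(2) by blast
  have span_B: "t \<in> pm.span B" for t
  proof -
    have "plin bas t \<in> pm.span B"
      unfolding plin_def using B(4) by (intro pm.span_sum pm.span_scale) auto
    then show ?thesis by simp
  qed
  define W where "W = {v. (bas v :: ('k, 'n) npoly) \<in> B - B1}"
  define r where "r = pmp.construct B (\<lambda>c. if c \<in> B1 then 0 else c)"
  have lin: "Vector_Spaces.linear scl scl r" unfolding r_def by (rule pmp.linear_construct[OF B(3)])
  have r: "c \<in> B \<Longrightarrow> r c = (if c \<in> B1 then 0 else c)" for c
    unfolding r_def by (rule pmp.construct_basis[OF B(3)])
  interpret r: Vector_Spaces.linear scl scl r by (rule lin)
  have r_plin: "r t = plin (\<lambda>v. r (bas v)) t" for t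
  proof -
    have "r (plin bas t) = plin (\<lambda>v. r (bas v)) t"
      unfolding plin_def by (simp only: r.sum r.scale)
    then show ?thesis by simp
  qed
  have supp_r: "supp (r t) \<subseteq> W" for t
  proof -
    have "pm.subspace {t. supp (r t) \<subseteq> W}"
      by (simp add: pm.subspace_def r.zero r.add r.scale supp_add_subset subset_trans[OF supp_scl])
    moreover have "supp (r c) \<subseteq> W" if "c \<in> B" for c
      using r[OF that] that B(2) by (auto simp: W_def)
    ultimately have "pm.span B \<subseteq> {t. supp (r t) \<subseteq> W}" by (intro pm.span_minimal) auto
    then show ?thesis using span_B by blast
  qed
  have diff: "t - r t \<in> I" for t
  proof -
    have "pm.subspace {t. t - r t \<in> I}"
      using I by (auto simp: pm.subspace_def r.zero r.add r.scale add_diff_add simp flip: pm.scale_right_diff_distrib)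
    moreover have "c - r c \<in> I" if "c \<in> B" for c
      using r[OF that] B1(1) pm.subspace_0[OF I] by auto
    ultimately have "pm.span B \<subseteq> {t. t - r t \<in> I}" by (intro pm.span_minimal) auto
    then show ?thesis using span_B by blast
  qed
  have r_I: "r t = 0" if "t \<in> I" for t
  proof -
    have "pm.subspace {t. r t = 0}" by (auto simp: pm.subspace_def r.zero r.add r.scale)
    then have "pm.span B1 \<subseteq> {t. r t = 0}" using B(1) r by (intro pm.span_minimal) auto
    then show ?thesis using that B1(3) by blast
  qed
  \<comment> \<open>The projection r need not preserve degrees. Its truncation to the degree of v
    does, and because I is graded it still differs from v by an element of I.\<close>
  define redw where "redw v = comp (count_list v) (r (bas v))" for v
  have "supp (redw v) \<subseteq> {w \<in> W. count_list w = count_list v}" for v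
    using supp_r[of "bas v"] by (auto simp: redw_def in_keys_iff lookup_rst split: if_splits)
  moreover have "bas v - redw v \<in> I" for v
  proof -
    have "bas v - redw v = comp (count_list v) (bas v - r (bas v))"
      unfolding redw_def by (rule poly_mapping_eqI) (auto simp: lookup_rst lookup_minus lookup_single)
    then show ?thesis using graded[OF diff] by simp
  qed
  moreover have "plin redw s = 0" if "s \<in> I" for s
  proof (rule poly_mapping_eqI)
    fix w
    \<comment> \<open>The coefficient at w only sees the component of s of the degree of w, and that
      component lies in I as well.\<close>
    have "lookup (plin redw s) w = lookup (plin (\<lambda>v. r (bas v)) (comp (count_list w) s)) w"
      unfolding rst_def[of "\<lambda>v. count_list v = count_list w"] plin_plin
      by (auto simp: lookup_plin redw_def lookup_rst r.zero intro!: sum.cong)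
    also have "\<dots> = 0" using r_I[OF graded[OF that, of "count_list w"]] by (simp flip: r_plin)
    finally show "lookup (plin redw s) w = lookup 0 w" by simp
  qed
  moreover have "redw w = bas w" if "w \<in> W" for w
    using that r[of "bas w"] by (auto simp: W_def redw_def intro: rst_all)
  ultimately show ?thesis using that by blast
qed


section \<open>Skew derivatives\<close>

text \<open>In the coproduct of a word w, the terms with x_j as second factor add up to \<gamma>_j
  \<open>dl q j w\<close> \<otimes> x_j; the factor \<open>q i j\<close> arises when \<gamma>_j
  moves to the left past x_i. \<open>dr\<close> collects the second factors of the terms whose first
  factor contains the letter x_j and otherwise group elements; its scalar arises when x_j moves to
  the right past these.\<close>

primrec dl :: "('n \<Rightarrow> 'n \<Rightarrow> 'k::field) \<Rightarrow> 'n \<Rightarrow> 'n list \<Rightarrow> ('k, 'n) npoly" where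
  "dl q j [] = 0"
| "dl q j (i # v) = scl (q i j) (pre i (dl q j v)) + (if i = j then bas v else 0)"

primrec dr :: "('n \<Rightarrow> 'n \<Rightarrow> 'k::field) \<Rightarrow> 'n \<Rightarrow> 'n list \<Rightarrow> ('k, 'n) npoly" where
  "dr q j [] = 0"
| "dr q j (i # v) = (if i = j then sgl v (prod_list (map (q j) v)) else 0) + pre i (dr q j v)"

context malg
begin

definition evm :: "(('k, 'n) hgrp \<times> 'x list \<Rightarrow>\<^sub>0 'k) \<Rightarrow> 'a" where
  "evm = lin_ext B (\<lambda>(g, v). b g v)"

definition evw :: "('x list \<Rightarrow>\<^sub>0 'k) \<Rightarrow> 'a" where
  "evw = lin_ext B bw"

lemma evw_closed [simp]: "evw s \<in> carrier B"
  unfolding evw_def by (rule B.lin_ext_closed) auto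

lemma evw_simps [simp]:
  "evw 0 = \<zero>\<^sub>B" "evw (s + t) = evw s \<oplus>\<^sub>B evw t" "evw (scl c s) = c \<odot>\<^sub>B evw s"
  "evw (sgl v c) = c \<odot>\<^sub>B bw v"
  unfolding evw_def by (simp_all add: B.lin_ext_add B.lin_ext_scl B.lin_ext_single)

lemma evw_diff [simp]: "evw (s - t) = evw s \<ominus>\<^bsub>B\<^esub> evw t"
  unfolding evw_def by (rule B.lin_ext_diff) auto

lemma evm_closed [simp]: "supp t \<subseteq> Ks \<times> UNIV \<Longrightarrow> evm t \<in> carrier B"
  unfolding evm_def by (rule B.lin_ext_closed) auto

lemma evm_add: "supp s \<subseteq> Ks \<times> UNIV \<Longrightarrow> supp t \<subseteq> Ks \<times> UNIV \<Longrightarrow> evm (s + t) = evm s \<oplus>\<^sub>B evm t"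
  unfolding evm_def by (rule B.lin_ext_add) auto

lemma evm_diff: "supp s \<subseteq> Ks \<times> UNIV \<Longrightarrow> supp t \<subseteq> Ks \<times> UNIV \<Longrightarrow> evm (s - t) = evm s \<ominus>\<^bsub>B\<^esub> evm t"
  unfolding evm_def by (rule B.lin_ext_diff) auto

lemma evm_scl: "supp t \<subseteq> Ks \<times> UNIV \<Longrightarrow> evm (scl c t) = c \<odot>\<^sub>B evm t"
  unfolding evm_def by (rule B.lin_ext_scl) auto

lemma evm_single: "g \<in> Ks \<Longrightarrow> evm (sgl (g, v) c) = c \<odot>\<^sub>B b g v"
  unfolding evm_def by (simp add: B.lin_ext_single)

lemma evm_zero [simp]: "evm 0 = \<zero>\<^sub>B"
  by (simp add: evm_def)

lemma evm_surj:
  assumes "y \<in> carrier B"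
  obtains t where "supp t \<subseteq> Ks \<times> UNIV" "y = evm t"
proof -
  let ?W = "evm ` {t. supp t \<subseteq> Ks \<times> UNIV}"
  have "lin_subspace ?W B"
  proof (rule B.lin_subspaceI)
    show "\<zero>\<^sub>B \<in> ?W" by (rule image_eqI[of _ _ 0]) auto
    fix x y c assume "x \<in> ?W"
    then obtain s where s: "supp s \<subseteq> Ks \<times> UNIV" "x = evm s" by blast
    then show "c \<odot>\<^sub>B x \<in> ?W" using supp_scl[of c s] by (intro image_eqI[of _ _ "scl c s"]) (auto simp: evm_scl)
    assume "y \<in> ?W"
    then obtain t where t: "supp t \<subseteq> Ks \<times> UNIV" "y = evm t" by blast
    show "x \<oplus>\<^sub>B y \<in> ?W"
      using s t by (intro image_eqI[of _ _ "s + t"]) (simp_all add: evm_add supp_add_subset)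
  qed auto
  moreover have "{b g v | g v. g \<in> Ks} \<subseteq> ?W"
  proof
    fix y assume "y \<in> {b g v | g v. g \<in> Ks}"
    then obtain g v where "y = b g v" "g \<in> Ks" by blast
    then show "y \<in> ?W" by (intro image_eqI[of _ _ "bas (g, v)"]) (auto simp: evm_single B.smult_one)
  qed
  ultimately have "carrier B \<subseteq> ?W" unfolding b_span by (rule B.lin_span_least)
  then show ?thesis using assms that by blast
qed

text \<open>The linear extension of a scalar-valued f; the one-point index set turns scalars into
  coordinates, so that \<open>plin\<close> applies.\<close>

definition val :: "(('k, 'n) hgrp \<times> 'x list \<Rightarrow> 'k) \<Rightarrow> (('k, 'n) hgrp \<times> 'x list \<Rightarrow>\<^sub>0 'k) \<Rightarrow> 'k" where
  "val f t = lookup (plin (\<lambda>k. sgl () (f k)) t) ()"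

text \<open>B is the image of \<open>evm\<close>, so f descends to a functional on B once its
  extension vanishes on the kernel; \<psi> is defined through an arbitrary preimage.\<close>

lemma functional_exists:
  assumes "\<And>t. supp t \<subseteq> Ks \<times> UNIV \<Longrightarrow> evm t = \<zero>\<^sub>B \<Longrightarrow> val f t = 0"
  obtains \<psi> where "kfun B \<psi>" "\<And>g v. g \<in> Ks \<Longrightarrow> \<psi> (b g v) = f (g, v)"
proof -
  have v: "val f (s + t) = val f s + val f t" "val f (s - t) = val f s - val f t" "val f (scl c t) = c * val f t"
    "val f (bas k) = f k" for s t c k
    by (simp_all add: val_def plin_add plin_diff plin_scl lookup_add lookup_minus)
  define \<psi> where "\<psi> y = val f (SOME t. supp t \<subseteq> Ks \<times> UNIV \<and> y = evm t)" for y
  have \<psi>: "\<psi> (evm t) = val f t" if t: "supp t \<subseteq> Ks \<times> UNIV" for t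
  proof -
    let ?s = "SOME s. supp s \<subseteq> Ks \<times> UNIV \<and> evm t = evm s"
    have s: "supp ?s \<subseteq> Ks \<times> UNIV \<and> evm t = evm ?s" by (rule someI[of _ t]) (simp add: t)
    then have "evm (?s - t) = \<zero>\<^sub>B" using t by (simp add: evm_diff B.r_right_minus_eq)
    moreover have "supp (?s - t) \<subseteq> Ks \<times> UNIV" using s t by (intro supp_diff_subset) auto
    ultimately have "val f (?s - t) = 0" by (intro assms)
    then show ?thesis by (simp add: \<psi>_def v)
  qed
  have "kfun B \<psi>"
    unfolding kfun_def
  proof (intro conjI ballI allI)
    fix x y c assume "x \<in> carrier B"
    then obtain s where s: "supp s \<subseteq> Ks \<times> UNIV" "x = evm s" by (rule evm_surj)
    show "\<psi> (c \<odot>\<^sub>B x) = c * \<psi> x"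
      using s \<psi>[of "scl c s"] supp_scl[of c s] by (auto simp: evm_scl \<psi> v)
    assume "y \<in> carrier B"
    then obtain t where t: "supp t \<subseteq> Ks \<times> UNIV" "y = evm t" by (rule evm_surj)
    show "\<psi> (x \<oplus>\<^sub>B y) = \<psi> x + \<psi> y"
      using s t \<psi>[of "s + t"] supp_add_subset[OF s(1) t(1)] by (simp add: evm_add \<psi> v)
  qed
  moreover have "\<psi> (b g v) = f (g, v)" if "g \<in> Ks" for g v
    using \<psi>[of "bas (g, v)"] that by (simp add: evm_single B.smult_one v)
  ultimately show ?thesis using that by blast
qed

text \<open>The recursion for slices of \<open>dw\<close>: the first letter either stays in the
  first factor or is handed to the functional, leaving \<gamma>(i) behind.\<close>

lemma RE_dx:
  assumes "kfun B \<psi>" "z \<in> carrier BB"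
  shows "RE \<psi> (dx i \<otimes>\<^sub>2 z) = bw [i] \<otimes>\<^sub>B RE \<psi> z \<oplus>\<^sub>B bg (\<gamma> i) \<otimes>\<^sub>B RE (\<lambda>y. \<psi> (bw [i] \<otimes>\<^sub>B y)) z"
proof -
  have 1: "RE (\<lambda>y. \<psi> (\<one>\<^sub>B \<otimes>\<^sub>B y)) z = RE \<psi> z"
    using kfun_mult_left[OF assms(1) B.one_closed] assms(2) by (intro RE_cong) auto
  have "dx i \<otimes>\<^sub>2 z = tens B B (bw [i]) \<one>\<^sub>B \<otimes>\<^sub>2 z \<oplus>\<^sub>2 tens B B (bg (\<gamma> i)) (bw [i]) \<otimes>\<^sub>2 z"
    using assms(2) by (simp add: dx_def \<gamma> TP.TT.l_distr)
  then show ?thesis using assms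
    by (simp add: klinD[OF RE(1)[OF assms(1)]] \<gamma> RE_mult_left 1)
qed

lemma LE_dx:
  assumes "kfun B \<psi>" "z \<in> carrier BB"
  shows "LE \<psi> (dx i \<otimes>\<^sub>2 z) = LE (\<lambda>y. \<psi> (bw [i] \<otimes>\<^sub>B y)) z \<oplus>\<^sub>B bw [i] \<otimes>\<^sub>B LE (\<lambda>y. \<psi> (bg (\<gamma> i) \<otimes>\<^sub>B y)) z"
proof -
  have "dx i \<otimes>\<^sub>2 z = tens B B (bw [i]) \<one>\<^sub>B \<otimes>\<^sub>2 z \<oplus>\<^sub>2 tens B B (bg (\<gamma> i)) (bw [i]) \<otimes>\<^sub>2 z"
    using assms(2) by (simp add: dx_def \<gamma> TP.TT.l_distr)
  moreover have "LE (\<lambda>y. \<psi> (bw [i] \<otimes>\<^sub>B y)) z \<in> carrier B"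
    using assms by (intro LE_closed kfun_mult_left) auto
  ultimately show ?thesis using assms
    by (simp add: klinD[OF LE(1)[OF assms(1)]] \<gamma> LE_mult_left)
qed

lemma RE_zero: "z \<in> carrier BB \<Longrightarrow> RE (\<lambda>y. 0) z = \<zero>\<^sub>B"
  by (rule TP.tensor_klin_eqI[OF B.k_alg RE(1), where F' = "\<lambda>z. \<zero>\<^sub>B"])
    (auto simp: kfun_def RE(2) intro!: klinI)

lemma LE_zero: "z \<in> carrier BB \<Longrightarrow> LE (\<lambda>y. 0) z = \<zero>\<^sub>B"
  by (rule TP.tensor_klin_eqI[OF B.k_alg LE(1), where F' = "\<lambda>z. \<zero>\<^sub>B"])
    (auto simp: kfun_def LE(2) intro!: klinI)

lemma kfun_eq_on_monomials:
  assumes "kfun B \<psi>" "kfun B \<psi>'" "\<And>g v. g \<in> Ks \<Longrightarrow> \<psi> (b g v) = \<psi>' (b g v)" "y \<in> carrier B"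
  shows "\<psi> y = \<psi>' y"
proof -
  obtain t where t: "supp t \<subseteq> Ks \<times> UNIV" "y = evm t" using evm_surj[OF assms(4)] .
  from t(1) have "\<psi> (evm t) = \<psi>' (evm t)"
  proof (induction rule: pm_induct)
    case (single k c)
    then show ?case
      by (cases k) (simp add: evm_single kfunD(2)[OF assms(1)] kfunD(2)[OF assms(2)] assms(3))
  qed (simp_all add: evm_add kfun_zero[OF B.k_alg] assms kfunD(1)[OF assms(1)] kfunD(1)[OF assms(2)])
  then show ?thesis by (simp add: t)
qed

lemma bw_evw: "bw [i] \<otimes>\<^sub>B evw t = evw (plin (\<lambda>w. bas (i # w)) t)"
proof -
  have "supp t \<subseteq> UNIV" by simp
  then show ?thesis
    by (induction rule: pm_induct)
      (simp_all add: plin_add B.r_distr B.smult_mult_r B.smult_one flip: bw_Cons)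
qed

lemma klin_evw:
  assumes "klin B B f" "\<And>v. f (bw v) = evw (E v)"
  shows "f (evw s) = evw (plin E s)"
proof -
  have "supp s \<subseteq> UNIV" by simp
  then show ?thesis
    by (induction rule: pm_induct)
      (simp_all add: klinD[OF assms(1)] assms(2) plin_add klin_zero[OF B.k_alg B.k_alg assms(1)])
qed

end

text \<open>The algebras \<open>A\<^sup>\<plusminus>\<close>, as extensions of the quotients of the free algebra by \<open>word_ideal R\<close>.\<close>

locale half = malg p N B Ks l b \<gamma> "range \<gamma>"
  for p :: "'n::finite \<Rightarrow> 'n \<Rightarrow> 'k::field" and N :: "(('k, 'n) lin \<times> ('k, 'n) lin) set"
    and B :: "('k, 'a) module" and Ks :: "('k, 'n) hgrp set" and l :: "'n \<Rightarrow> 'n letter"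
    and b :: "('k, 'n) hgrp \<Rightarrow> 'n list \<Rightarrow> 'a" and \<gamma> :: "'n \<Rightarrow> ('k, 'n) hgrp" +
  fixes R :: "('k, 'n) npoly set"
  assumes R_hom: "\<And>q. q \<in> R \<Longrightarrow> homogeneous_npoly q"
    and R_len: "\<And>q v. q \<in> R \<Longrightarrow> v \<in> supp q \<Longrightarrow> length v > 1"
    and evw_ideal: "\<And>s. s \<in> word_ideal R \<Longrightarrow> evw s = \<zero>\<^sub>B"
    and evm_kernel: "\<And>t g. supp t \<subseteq> Ks \<times> UNIV \<Longrightarrow> evm t = \<zero>\<^sub>B \<Longrightarrow>
      plin (\<lambda>(g', v). if g' = g then bas v else 0) t \<in> word_ideal R"
begin

abbreviation "I \<equiv> word_ideal R"
definition "q i j = chi_letter (l i) (\<gamma> j)"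

lemma lookup_slice: "lookup (plin (\<lambda>(g', v). if g' = g then bas v else 0) t) v = lookup t (g, v)"
  by (subst lookup_plin_at[where j = "(g, v)" and c = 1]) (auto simp: lookup_single when_def split: if_splits)

lemma evw_zero_iff: "evw s = \<zero>\<^sub>B \<longleftrightarrow> s \<in> I"
proof
  assume s: "evw s = \<zero>\<^sub>B"
  let ?t = "plin (\<lambda>v. bas (\<one>\<^sub>H, v)) s"
  have sup: "supp (plin (\<lambda>v. bas (\<one>\<^sub>H, v)) s :: _ \<Rightarrow>\<^sub>0 'k) \<subseteq> Ks \<times> UNIV" for s
    using supp_plin[of "\<lambda>v. bas (\<one>\<^sub>H, v)" s] by auto
  have "supp s \<subseteq> UNIV" by simp
  then have "evm (plin (\<lambda>v. bas (\<one>\<^sub>H, v)) s) = evw s"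
    by (induction rule: pm_induct) (simp_all add: evm_single plin_add evm_add sup)
  with s sup have "plin (\<lambda>(g', v). if g' = \<one>\<^sub>H then bas v else 0) ?t \<in> I"
    by (intro evm_kernel) simp_all
  then show "s \<in> I" by (simp add: plin_plin)
qed (rule evw_ideal)

text \<open>The kernel of \<open>evm\<close> involves only words of length > 1, so every
  prescription on words of length at most 1 is compatible with the relations.\<close>

lemma low_degree_functional:
  assumes "\<And>g v. length v > 1 \<Longrightarrow> f (g, v) = 0"
  obtains \<psi> where "kfun B \<psi>" "\<And>g v. g \<in> Ks \<Longrightarrow> \<psi> (b g v) = f (g, v)"
proof (rule functional_exists[of f])
  fix t :: "('k, 'n) hgrp \<times> 'n list \<Rightarrow>\<^sub>0 'k" assume t: "supp t \<subseteq> Ks \<times> UNIV" "evm t = \<zero>\<^sub>B"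
  have "length v > 1" if "(g, v) \<in> supp t" for g v
  proof -
    have "v \<in> supp (plin (\<lambda>(g', v). if g' = g then bas v else 0) t)"
      using that by (simp add: in_keys_iff lookup_slice)
    moreover have "supp (plin (\<lambda>(g', v). if g' = g then bas v else 0) t) \<subseteq> {v. length v > 1}"
      by (rule word_ideal_length[of R]) (use R_len evm_kernel[OF t] in auto)
    ultimately show ?thesis by blast
  qed
  then have "f k = 0" if "k \<in> supp t" for k using that assms by (cases k) auto
  then show "val f t = 0" by (simp add: val_def lookup_plin)
qed (use that in blast)

lemma evw_twist: "j \<in> Ks \<Longrightarrow> bw [i] \<otimes>\<^sub>B (bg j \<otimes>\<^sub>B y) = chi_letter (l i) j \<odot>\<^sub>B (bg j \<otimes>\<^sub>B (bw [i] \<otimes>\<^sub>B y))"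
  if "y \<in> carrier B"
proof -
  assume j: "j \<in> Ks"
  have "bw [i] \<otimes>\<^sub>B (bg j \<otimes>\<^sub>B y) = (bw [i] \<otimes>\<^sub>B bg j) \<otimes>\<^sub>B y" using j that by (simp add: B.m_assoc)
  also have "\<dots> = (chi_letter (l i) j \<odot>\<^sub>B (bg j \<otimes>\<^sub>B bw [i])) \<otimes>\<^sub>B y" using bw_bg[OF j, of "[i]"] by simp
  finally show ?thesis using j that by (simp add: B.smult_mult_l B.m_assoc)
qed

context
  fixes \<Delta> assumes cop: "is_coproduct B gens_g gens_x \<Delta>"
begin

lemma cop_klin: "klin B BB \<Delta>"
  using cop alg_homD(1) unfolding is_coproduct_def by blast

text \<open>The slice of the coproduct at the coordinate of x_j is \<gamma>_j times
  \<open>dl q j\<close>. It is a linear map of B into itself and so sends the class 0 of s to 0; as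
  \<gamma>_j is invertible, the derivative of s is a relation again. This is how the coproduct of
  the quotient controls its ideal.\<close>

lemma dl_ideal:
  assumes "s \<in> I"
  shows "plin (dl q j) s \<in> I"
proof -
  obtain \<psi>0 where k0: "kfun B \<psi>0" and v0: "\<And>g v. g \<in> Ks \<Longrightarrow> \<psi>0 (b g v) = (if g = \<one>\<^sub>H \<and> v = [] then 1 else 0)"
    by (rule low_degree_functional[of "\<lambda>(g, v). if g = \<one>\<^sub>H \<and> v = [] then 1 else 0"]) auto
  obtain \<psi> where k: "kfun B \<psi>" and v: "\<And>g v. g \<in> Ks \<Longrightarrow> \<psi> (b g v) = (if g = \<one>\<^sub>H \<and> v = [j] then 1 else 0)"
    by (rule low_degree_functional[of "\<lambda>(g, v). if g = \<one>\<^sub>H \<and> v = [j] then 1 else 0"]) auto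
  have kz: "kfun B (\<lambda>y. 0)" by (simp add: kfun_def)
  have m: "bw [i] \<otimes>\<^sub>B b g v = chi_letter (l i) g \<odot>\<^sub>B b g (i # v)" if "g \<in> Ks" for i g v
    using that by (simp add: b_mult)
  have z0: "\<psi>0 (bw [i] \<otimes>\<^sub>B y) = 0" if "y \<in> carrier B" for i y
    by (rule kfun_eq_on_monomials[OF kfun_mult_left[OF k0] kz _ that]) (simp_all add: m kfunD(2)[OF k0] v0)
  have zj: "\<psi> (bw [i] \<otimes>\<^sub>B y) = (if i = j then \<psi>0 y else 0)" if "y \<in> carrier B" for i y
  proof (rule kfun_eq_on_monomials[OF kfun_mult_left[OF k] _ _ that])
    show "kfun B (\<lambda>y. if i = j then \<psi>0 y else 0)" using k0 by (auto simp: kfun_def)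
  qed (simp_all add: m kfunD(2)[OF k] v v0 chi_letter_one)
  \<comment> \<open>\<psi>0 is the coordinate at 1 and returns the main term of
    \<open>dw_left\<close>. It starts the recursion for \<psi>: when the first letter x_j is handed
    to \<psi>, the rest of the word is sliced with \<psi>0.\<close>
  have R0: "RE \<psi>0 (dw w) = bw w" for w
  proof (induction w)
    case (Cons i w)
    have "RE (\<lambda>y. \<psi>0 (bw [i] \<otimes>\<^sub>B y)) (dw w) = \<zero>\<^sub>B"
      using RE_cong[OF kfun_mult_left[OF k0], of "bw [i]" "\<lambda>y. 0" "dw w"] z0 by (simp add: RE_zero)
    then show ?case using Cons by (simp add: RE_dx[OF k0] \<gamma> flip: bw_Cons)
  qed (simp add: TP.tens_one RE(2)[OF k0] b_one[symmetric] v0 B.smult_one)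
  have Rj: "RE \<psi> (dw w) = bg (\<gamma> j) \<otimes>\<^sub>B evw (dl q j w)" for w
  proof (induction w)
    case (Cons i w)
    have "RE (\<lambda>y. \<psi> (bw [i] \<otimes>\<^sub>B y)) (dw w) = (if i = j then bw w else \<zero>\<^sub>B)"
    proof (cases "i = j")
      case True
      then show ?thesis
        using RE_cong[OF kfun_mult_left[OF k], of "bw [i]" "\<psi>0" "dw w"] zj by (simp add: R0)
    next
      case False
      then show ?thesis
        using RE_cong[OF kfun_mult_left[OF k], of "bw [i]" "\<lambda>y. 0" "dw w"] zj by (simp add: RE_zero)
    qed
    then have "RE \<psi> (dw (i # w)) = q i j \<odot>\<^sub>B (bg (\<gamma> j) \<otimes>\<^sub>B (bw [i] \<otimes>\<^sub>B evw (dl q j w))) \<oplus>\<^sub>B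
        bg (\<gamma> j) \<otimes>\<^sub>B (if i = j then bw w else \<zero>\<^sub>B)"
      by (auto simp: RE_dx[OF k] Cons evw_twist \<gamma> simp flip: q_def)
    then show ?case by (simp add: B.r_distr \<gamma> B.smult_mult_r bw_evw B.smult_one)
  qed (simp add: TP.tens_one RE(2)[OF k] b_one[symmetric] v \<gamma>)
  let ?g = "bg (inv\<^bsub>HH\<^esub> (\<gamma> j))"
  have f: "klin B B (\<lambda>y. ?g \<otimes>\<^sub>B RE \<psi> (\<Delta> y))"
    by (rule klin_comp[OF klin_comp[OF cop_klin RE(1)[OF k]] klin_mult_left[OF B.k_alg]]) (simp add: \<gamma>)
  have "?g \<otimes>\<^sub>B RE \<psi> (\<Delta> (evw s)) = evw (plin (dl q j) s)"
  proof (rule klin_evw[OF f])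
    fix v
    have "?g \<otimes>\<^sub>B (bg (\<gamma> j) \<otimes>\<^sub>B evw (dl q j v)) = (?g \<otimes>\<^sub>B bg (\<gamma> j)) \<otimes>\<^sub>B evw (dl q j v)"
      by (simp add: B.m_assoc \<gamma>)
    then show "?g \<otimes>\<^sub>B RE \<psi> (\<Delta> (bw v)) = evw (dl q j v)"
      by (simp add: coproduct_word[OF cop] Rj bg_inv \<gamma>)
  qed
  moreover have "?g \<otimes>\<^sub>B RE \<psi> (\<Delta> (evw s)) = \<zero>\<^sub>B"
    using evw_ideal[OF assms] klin_zero[OF B.k_alg B.k_alg f] by simp
  ultimately show ?thesis by (metis evw_zero_iff)
qed

lemma dr_ideal:
  assumes "s \<in> I"
  shows "plin (dr q j) s \<in> I"
proof -
  \<comment> \<open>\<psi> ignores the group element, and \<psi>0 weights it by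
    \<open>chi_letter (l j) g\<close>. This is the factor in x_j g = \<chi>(g) g x_j, so that
    \<psi>(x_j y) = \<psi>0(y).\<close>
  obtain \<psi>0 where k0: "kfun B \<psi>0" and v0: "\<And>g v. g \<in> Ks \<Longrightarrow> \<psi>0 (b g v) = (if v = [] then chi_letter (l j) g else 0)"
    by (rule low_degree_functional[of "\<lambda>(g, v). if v = [] then chi_letter (l j) g else 0"]) auto
  obtain \<psi> where k: "kfun B \<psi>" and v: "\<And>g v. g \<in> Ks \<Longrightarrow> \<psi> (b g v) = (if v = [j] then 1 else 0)"
    by (rule low_degree_functional[of "\<lambda>(g, v). if v = [j] then 1 else 0"]) auto
  have kz: "kfun B (\<lambda>y. 0)" by (simp add: kfun_def)
  have m: "bw [i] \<otimes>\<^sub>B b g v = chi_letter (l i) g \<odot>\<^sub>B b g (i # v)" if "g \<in> Ks" for i g v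
    using that by (simp add: b_mult)
  have m': "bg (\<gamma> i) \<otimes>\<^sub>B b g v = b (\<gamma> i \<otimes>\<^sub>H g) v" if "g \<in> Ks" for i g v
    using that by (simp add: b_mult B.smult_one \<gamma>)
  have \<gamma>c: "bg (\<gamma> i) \<in> carrier B" for i by (simp add: \<gamma>)
  have z0: "\<psi>0 (bw [i] \<otimes>\<^sub>B y) = 0" if "y \<in> carrier B" for i y
    by (rule kfun_eq_on_monomials[OF kfun_mult_left[OF k0] kz _ that]) (simp_all add: m kfunD(2)[OF k0] v0)
  have g0: "\<psi>0 (bg (\<gamma> i) \<otimes>\<^sub>B y) = q j i * \<psi>0 y" if "y \<in> carrier B" for i y
  proof (rule kfun_eq_on_monomials[OF kfun_mult_left[OF k0 \<gamma>c] _ _ that])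
    show "kfun B (\<lambda>y. q j i * \<psi>0 y)" using k0 by (auto simp: kfun_def algebra_simps)
  qed (simp_all add: m' v0 q_def chi_letter_mult \<gamma>)
  have zj: "\<psi> (bw [i] \<otimes>\<^sub>B y) = (if i = j then \<psi>0 y else 0)" if "y \<in> carrier B" for i y
  proof (rule kfun_eq_on_monomials[OF kfun_mult_left[OF k] _ _ that])
    show "kfun B (\<lambda>y. if i = j then \<psi>0 y else 0)" using k0 by (auto simp: kfun_def)
  qed (simp_all add: m kfunD(2)[OF k] v v0)
  have gj: "\<psi> (bg (\<gamma> i) \<otimes>\<^sub>B y) = \<psi> y" if "y \<in> carrier B" for i y
    by (rule kfun_eq_on_monomials[OF kfun_mult_left[OF k \<gamma>c] k _ that]) (simp_all add: m' v \<gamma>)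
  have L0: "LE \<psi>0 (dw w) = prod_list (map (q j) w) \<odot>\<^sub>B bw w" for w
  proof (induction w)
    case (Cons i w)
    have "LE (\<lambda>y. \<psi>0 (bw [i] \<otimes>\<^sub>B y)) (dw w) = \<zero>\<^sub>B"
      using LE_cong[OF kfun_mult_left[OF k0], of "bw [i]" "\<lambda>y. 0" "dw w"] z0 by (simp add: LE_zero)
    moreover have "LE (\<lambda>y. \<psi>0 (bg (\<gamma> i) \<otimes>\<^sub>B y)) (dw w) = q j i \<odot>\<^sub>B LE \<psi>0 (dw w)"
    proof (rule TP.tensor_klin_eqI[OF B.k_alg LE(1)[OF kfun_mult_left[OF k0 \<gamma>c]] _ _ dw_closed])
      show "klin BB B (\<lambda>z. q j i \<odot>\<^sub>B LE \<psi>0 z)"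
        by (rule klin_comp[OF LE(1)[OF k0]]) (intro klinI, simp_all add: B.smult_r_distr smult_commute)
    qed (simp add: LE(2)[OF kfun_mult_left[OF k0 \<gamma>c]] LE(2)[OF k0] g0 B.smult_assoc)
    ultimately show ?case using Cons
      by (simp add: LE_dx[OF k0] B.smult_mult_r B.smult_assoc flip: bw_Cons)
  qed (simp add: TP.tens_one LE(2)[OF k0] b_one[symmetric] v0 chi_letter_one B.smult_one)
  have Lj: "LE \<psi> (dw w) = evw (dr q j w)" for w
  proof (induction w)
    case (Cons i w)
    have "LE (\<lambda>y. \<psi> (bw [i] \<otimes>\<^sub>B y)) (dw w) = (if i = j then prod_list (map (q j) w) \<odot>\<^sub>B bw w else \<zero>\<^sub>B)"
    proof (cases "i = j")
      case True
      then show ?thesis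
        using LE_cong[OF kfun_mult_left[OF k], of "bw [i]" "\<psi>0" "dw w"] zj by (simp add: L0)
    next
      case False
      then show ?thesis
        using LE_cong[OF kfun_mult_left[OF k], of "bw [i]" "\<lambda>y. 0" "dw w"] zj by (simp add: LE_zero)
    qed
    moreover have "LE (\<lambda>y. \<psi> (bg (\<gamma> i) \<otimes>\<^sub>B y)) (dw w) = LE \<psi> (dw w)"
      using LE_cong[OF kfun_mult_left[OF k \<gamma>c], of i \<psi> "dw w"] gj by simp
    ultimately show ?case using Cons by (simp add: LE_dx[OF k] bw_evw)
  qed (simp add: TP.tens_one LE(2)[OF k] b_one[symmetric] v)
  have f: "klin B B (\<lambda>y. LE \<psi> (\<Delta> y))" by (rule klin_comp[OF cop_klin LE(1)[OF k]])
  have "LE \<psi> (\<Delta> (evw s)) = evw (plin (dr q j) s)"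
    by (rule klin_evw[OF f]) (simp add: coproduct_word[OF cop] Lj)
  moreover have "LE \<psi> (\<Delta> (evw s)) = \<zero>\<^sub>B"
    using evw_ideal[OF assms] klin_zero[OF B.k_alg B.k_alg f] by simp
  ultimately show ?thesis by (metis evw_zero_iff)
qed

end

end

section \<open>A representation of the skew group algebra\<close>

lemma supp_plin_subset: "(\<And>k. k \<in> supp t \<Longrightarrow> supp (f k) \<subseteq> S) \<Longrightarrow> supp (plin f t) \<subseteq> S"
  using supp_plin[of f t] by blast

lemma supp_scl_subset: "supp t \<subseteq> S \<Longrightarrow> supp (scl c t) \<subseteq> S"
  using supp_scl[of c t] by blast

lemma plin_eq_on:
  assumes "supp t \<subseteq> S" "\<And>k. k \<in> S \<Longrightarrow> f k = g k"
  shows "plin f t = plin g t"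
  using assms by (intro plin_cong) auto

text \<open>The basis vector \<open>(a, h, b)\<close> stands for the product \<open>x\<^sup>-\<^sub>a h x\<^sub>b\<close>.\<close>

type_synonym ('k, 'n) tri = "'n list \<times> ('k, 'n) hgrp \<times> 'n list \<Rightarrow>\<^sub>0 'k"

context adm
begin

abbreviation "SK \<equiv> skew_alg p N"

lemma monoid_words: "Group.monoid (HH \<times>\<times> word_monoid)"
proof (rule DirProd_monoid)
  show "Group.monoid word_monoid" by (rule monoidI) (auto simp: word_monoid_def)
qed (rule H.is_monoid)

lemma words_simps [simp]: "carrier word_monoid = UNIV" "v \<otimes>\<^bsub>word_monoid\<^esub> w = v @ w" "\<one>\<^bsub>word_monoid\<^esub> = []"
  by (simp_all add: word_monoid_def)

sublocale SKt: twisted "HH \<times>\<times> word_monoid" "\<lambda>(h, v) (h', v'). chi_word v h'"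
proof (intro twisted.intro monoid_words twisted_axioms.intro)
qed (auto simp: chi_word_mult)

sublocale SK: k_algebra SK
  unfolding skew_alg_def by (rule SKt.k_algebra_twisted)

lemma SK_simps [simp]:
  "carrier SK = {a. supp a \<subseteq> carrier HH \<times> UNIV}" "\<one>\<^bsub>SK\<^esub> = bas (\<one>\<^sub>H, [])"
  "\<zero>\<^bsub>SK\<^esub> = 0" "add SK = (+)" "smult SK = scl"
  by (simp_all add: skew_alg_def)

lemma SK_mult: "a \<otimes>\<^bsub>SK\<^esub> b = plin (\<lambda>(h, v). plin (\<lambda>(h', v'). sgl (h \<otimes>\<^sub>H h', v @ v') (chi_word v h')) b) a"
  by (simp add: skew_alg_def twisted_alg_mult case_prod_unfold mult_DirProd')

lemma SK_minus: "supp a \<subseteq> carrier HH \<times> UNIV \<Longrightarrow> supp b \<subseteq> carrier HH \<times> UNIV \<Longrightarrow> a \<ominus>\<^bsub>SK\<^esub> b = a - b"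
  using SK.smult_minus_one[of b] by (simp add: a_minus_def)

text \<open>The scalar in g x^-_a = \<open>cm a g\<close> x^-_a g.\<close>

definition cm :: "'n list \<Rightarrow> ('k, 'n) hgrp \<Rightarrow> 'k" where
  "cm a g = inverse (chi_word (map Xm a) g)"

lemma cm_simps [simp]: "cm [] g = 1" "cm (j # a) g = chiH j g * cm a g"
  by (simp_all add: cm_def)

lemma cm_mult: "g \<in> carrier HH \<Longrightarrow> g' \<in> carrier HH \<Longrightarrow> cm a (g \<otimes>\<^sub>H g') = cm a g * cm a g'"
  by (simp add: cm_def chi_word_mult)

lemma cm_one [simp]: "cm a \<one>\<^sub>H = 1"
  by (simp add: cm_def)

lemma cm_nz: "g \<in> carrier HH \<Longrightarrow> cm a g \<noteq> 0"
  by (simp add: cm_def chi_word_nz)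

definition Oh :: "('k, 'n) hgrp \<Rightarrow> ('k, 'n) tri \<Rightarrow> ('k, 'n) tri" where
  "Oh g = plin (\<lambda>(a, h, b). sgl (a, g \<otimes>\<^sub>H h, b) (cm a g))"

definition Om :: "'n \<Rightarrow> ('k, 'n) tri \<Rightarrow> ('k, 'n) tri" where
  "Om j = plin (\<lambda>(a, h, b). bas (j # a, h, b))"

abbreviation "gf i \<equiv> gg i \<otimes>\<^sub>H ff i"

text \<open>x_i moves to the right through x^-_a by x_i x^-_j = p_ji x^-_j x_i + \<delta>_ij (1 -
  g_i f_i), and finally past h by x_i h = \<chi>^i(h) h x_i. The term g_i f_i arises in front of the
  remaining letters and is moved past them by \<open>Oh\<close>.\<close>

fun op :: "'n \<Rightarrow> 'n list \<Rightarrow> ('k, 'n) hgrp \<Rightarrow> 'n list \<Rightarrow> ('k, 'n) tri" where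
  "op i [] h b = sgl ([], h, i # b) (chiH i h)"
| "op i (j # a) h b = scl (p j i) (Om j (op i a h b)) +
     (if i = j then bas (a, h, b) - Oh (gf i) (bas (a, h, b)) else 0)"

definition Op :: "'n \<Rightarrow> ('k, 'n) tri \<Rightarrow> ('k, 'n) tri" where
  "Op i = plin (\<lambda>(a, h, b). op i a h b)"

primrec Ol :: "'n letter \<Rightarrow> ('k, 'n) tri \<Rightarrow> ('k, 'n) tri" where
  "Ol (Xp i) = Op i"
| "Ol (Xm j) = Om j"

definition V0 :: "('k, 'n) tri set" where
  "V0 = {t. supp t \<subseteq> UNIV \<times> carrier HH \<times> UNIV}"

lemma V0_single [simp]: "h \<in> carrier HH \<Longrightarrow> sgl (a, h, b) c \<in> V0"
  by (simp add: V0_def)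

lemma V0_subspace: "pm.subspace V0"
  unfolding V0_def by (rule pm_subspace_supp)

lemma V0_zero [simp]: "0 \<in> V0"
  by (rule pm.subspace_0[OF V0_subspace])

lemma V0_plin: "t \<in> V0 \<Longrightarrow> (\<And>a h b. h \<in> carrier HH \<Longrightarrow> f (a, h, b) \<in> V0) \<Longrightarrow> plin f t \<in> V0"
  unfolding V0_def mem_Collect_eq by (rule supp_plin_subset) blast

lemma O_linear [simp]:
  "Oh g (s + t) = Oh g s + Oh g t" "Oh g (s - t) = Oh g s - Oh g t" "Oh g (scl c t) = scl c (Oh g t)" "Oh g 0 = 0"
  "Om j (s + t) = Om j s + Om j t" "Om j (s - t) = Om j s - Om j t" "Om j (scl c t) = scl c (Om j t)" "Om j 0 = 0"
  "Op i (s + t) = Op i s + Op i t" "Op i (s - t) = Op i s - Op i t" "Op i (scl c t) = scl c (Op i t)" "Op i 0 = 0"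
  by (simp_all add: Oh_def Om_def Op_def plin_add plin_diff plin_scl)

lemma Ol_linear [simp]:
  "Ol x (s + t) = Ol x s + Ol x t" "Ol x (scl c t) = scl c (Ol x t)" "Ol x 0 = 0"
  by (cases x; simp)+

lemma O_single [simp]:
  "Oh g (sgl (a, h, b) c) = sgl (a, g \<otimes>\<^sub>H h, b) (c * cm a g)"
  "Om j (sgl (a, h, b) c) = sgl (j # a, h, b) c"
  "Op i (sgl (a, h, b) c) = scl c (op i a h b)"
  by (simp_all add: Oh_def Om_def Op_def)

lemma Oh_closed: "g \<in> carrier HH \<Longrightarrow> t \<in> V0 \<Longrightarrow> Oh g t \<in> V0"
  unfolding Oh_def by (rule V0_plin) auto

lemma Om_closed: "t \<in> V0 \<Longrightarrow> Om j t \<in> V0"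
  unfolding Om_def by (rule V0_plin) auto

lemma op_closed: "h \<in> carrier HH \<Longrightarrow> op i a h b \<in> V0"
proof (induction a)
  case (Cons j a)
  have "bas (a, h, b) - Oh (gf i) (bas (a, h, b)) \<in> V0"
    using Cons.prems by (intro pm.subspace_diff[OF V0_subspace] Oh_closed) auto
  then have "(if i = j then bas (a, h, b) - Oh (gf i) (bas (a, h, b)) else 0) \<in> V0"
    by (cases "i = j") (simp_all del: O_single)
  then show ?case
    unfolding op.simps using Cons
    by (intro pm.subspace_add[OF V0_subspace] pm.subspace_scale[OF V0_subspace] Om_closed)
qed auto

lemma Op_closed: "t \<in> V0 \<Longrightarrow> Op i t \<in> V0"
  unfolding Op_def by (rule V0_plin) (auto intro: op_closed)

lemma Ol_closed: "t \<in> V0 \<Longrightarrow> Ol x t \<in> V0"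
  by (cases x) (simp_all only: Ol.simps Op_closed Om_closed)

lemma V0_induct [consumes 1, case_names zero single add]:
  assumes "t \<in> V0" "P 0" "\<And>a h b c. h \<in> carrier HH \<Longrightarrow> P (sgl (a, h, b) c)"
    and "\<And>s t. s \<in> V0 \<Longrightarrow> t \<in> V0 \<Longrightarrow> P s \<Longrightarrow> P t \<Longrightarrow> P (s + t)"
  shows "P t"
proof -
  have "supp t \<subseteq> UNIV \<times> carrier HH \<times> UNIV" using assms(1) by (simp add: V0_def)
  then show ?thesis by (induction rule: pm_induct) (use assms(2-4) in \<open>auto simp: V0_def\<close>)
qed

lemma Oh_Oh: "t \<in> V0 \<Longrightarrow> g \<in> carrier HH \<Longrightarrow> g' \<in> carrier HH \<Longrightarrow> Oh g (Oh g' t) = Oh (g \<otimes>\<^sub>H g') t"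
  by (induction t rule: V0_induct) (simp_all add: cm_mult H.m_assoc mult.commute mult.left_commute)

lemma Oh_one: "t \<in> V0 \<Longrightarrow> Oh \<one>\<^sub>H t = t"
  by (induction t rule: V0_induct) simp_all

lemma Oh_Om: "Oh g (Om j t) = scl (chiH j g) (Om j (Oh g t))"
  unfolding Oh_def Om_def plin_plin plin_fun_scl[symmetric] by (rule plin_cong) (auto simp: mult.commute)

text \<open>The factor \<open>cm a g\<close> is the one that \<open>Oh g\<close> puts before a basis
  vector, so the equation is the commutation rule of x_i with g, for the operators.\<close>

lemma op_twist:
  assumes "g \<in> carrier HH" "h \<in> carrier HH"
  shows "scl (cm a g) (op i a (g \<otimes>\<^sub>H h) b) = scl (chiH i g) (Oh g (op i a h b))"
proof (induction a)
  case (Cons j a)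
  let ?e = "bas (a, h, b)"
  have 1: "scl (cm (j # a) g) (scl (p j i) (Om j (op i a (g \<otimes>\<^sub>H h) b))) =
      scl (chiH i g) (Oh g (scl (p j i) (Om j (op i a h b))))"
  proof -
    have "scl (cm (j # a) g) (scl (p j i) (Om j (op i a (g \<otimes>\<^sub>H h) b))) =
        scl (p j i * chiH j g) (Om j (scl (cm a g) (op i a (g \<otimes>\<^sub>H h) b)))"
      by (simp add: mult_ac)
    then show ?thesis unfolding Cons by (simp add: Oh_Om mult_ac)
  qed
  have 2: "scl (chiH i g) (Oh g (?e - Oh (gf i) ?e)) =
     scl (chiH i g * cm a g) (bas (a, g \<otimes>\<^sub>H h, b) - Oh (gf i) (bas (a, g \<otimes>\<^sub>H h, b)))"
    using assms by (simp add: pm.scale_right_diff_distrib mult_ac H.m_ac)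
  show ?case
    using 1 2 by (cases "i = j") (simp_all add: pm.scale_right_distrib)
qed (use assms in \<open>simp_all add: chiH_mult\<close>)

lemma Op_Oh: "t \<in> V0 \<Longrightarrow> g \<in> carrier HH \<Longrightarrow> Op i (Oh g t) = scl (chiH i g) (Oh g (Op i t))"
proof (induction t rule: V0_induct)
  case (single a h b c)
  have "Op i (Oh g (sgl (a, h, b) c)) = scl c (scl (cm a g) (op i a (g \<otimes>\<^sub>H h) b))" by simp
  also have "\<dots> = scl c (scl (chiH i g) (Oh g (op i a h b)))" using single by (simp only: op_twist)
  finally show ?case by (simp add: mult.commute)
qed (simp_all add: pm.scale_right_distrib)

lemma Ol_Oh:
  assumes "g \<in> carrier HH" "t \<in> V0"
  shows "Ol x (Oh g t) = scl (chi_letter x g) (Oh g (Ol x t))"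
  using Op_Oh[OF assms(2,1)] chiH_nz[OF assms(1)] by (cases x) (simp_all add: Oh_Om)

lemma Op_Om: "t \<in> V0 \<Longrightarrow> Op i (Om j t) = scl (p j i) (Om j (Op i t)) + (if i = j then t - Oh (gf i) t else 0)"
  by (induction t rule: V0_induct)
    (auto simp: pm.scale_right_distrib algebra_simps pm.scale_right_diff_distrib)

abbreviation Ow :: "'n letter list \<Rightarrow> ('k, 'n) tri \<Rightarrow> ('k, 'n) tri" where
  "Ow v t \<equiv> foldr Ol v t"

lemma Ow_closed: "t \<in> V0 \<Longrightarrow> Ow v t \<in> V0"
  by (induction v) (simp_all add: Ol_closed)

lemma Ow_linear [simp]: "Ow v (s + t) = Ow v s + Ow v t" "Ow v (scl c t) = scl c (Ow v t)" "Ow v 0 = 0"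
  by (induction v) simp_all

lemma Ow_Oh: "g \<in> carrier HH \<Longrightarrow> t \<in> V0 \<Longrightarrow> Ow v (Oh g t) = scl (chi_word v g) (Oh g (Ow v t))"
  by (induction v) (simp_all add: Ol_Oh Ow_closed mult.commute)

definition act :: "('k, 'n) sk \<Rightarrow> ('k, 'n) tri \<Rightarrow> ('k, 'n) tri" where
  "act s t = plin (\<lambda>(h, v). Oh h (Ow v t)) s"

lemma act_simps [simp]: "act (r + s) t = act r t + act s t" "act (r - s) t = act r t - act s t"
  "act (scl c s) t = scl c (act s t)" "act 0 t = 0" "act (sgl (h, v) c) t = scl c (Oh h (Ow v t))"
  by (simp_all add: act_def plin_add plin_diff plin_scl)

lemma act_linear: "act s (t + t') = act s t + act s t'" "act s (scl c t) = scl c (act s t)" "act s 0 = 0"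
  by (simp_all add: act_def plin_fun_add[symmetric] plin_fun_scl[symmetric] case_prod_unfold)

lemma SK_induct [consumes 1, case_names zero single add]:
  assumes "s \<in> carrier SK" "P 0" "\<And>h v c. h \<in> carrier HH \<Longrightarrow> P (sgl (h, v) c)"
    and "\<And>s t. s \<in> carrier SK \<Longrightarrow> t \<in> carrier SK \<Longrightarrow> P s \<Longrightarrow> P t \<Longrightarrow> P (s + t)"
  shows "P s"
proof -
  have "supp s \<subseteq> carrier HH \<times> UNIV" using assms(1) by simp
  then show ?thesis by (induction rule: pm_induct) (use assms(2-4) in auto)
qed

lemma act_subspace:
  assumes "pm.subspace J" "\<And>g t. g \<in> carrier HH \<Longrightarrow> t \<in> J \<Longrightarrow> Oh g t \<in> J" "\<And>x t. t \<in> J \<Longrightarrow> Ol x t \<in> J"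
    and "s \<in> carrier SK" "t \<in> J"
  shows "act s t \<in> J"
proof -
  have "Ow v t \<in> J" for v by (induction v) (use assms(3,5) in auto)
  with assms(4) show ?thesis
    by (induction rule: SK_induct)
      (simp_all add: pm.subspace_0[OF assms(1)] pm.subspace_add[OF assms(1)] pm.subspace_scale[OF assms(1)] assms(2))
qed

lemma act_closed: "s \<in> carrier SK \<Longrightarrow> t \<in> V0 \<Longrightarrow> act s t \<in> V0"
  by (rule act_subspace[OF V0_subspace Oh_closed Ol_closed])

text \<open>The scalar \<open>chi_word v h'\<close> in the multiplication of the skew group algebra
  is the one that \<open>Ow_Oh\<close> produces when a word of operators passes
  \<open>Oh h'\<close>.\<close>

lemma act_mult:
  assumes "r \<in> carrier SK" "s \<in> carrier SK" "t \<in> V0"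
  shows "act (r \<otimes>\<^bsub>SK\<^esub> s) t = act r (act s t)"
  using assms(1)
proof (induction rule: SK_induct)
  case (single h v c)
  from assms(2) have "act (plin (\<lambda>(h', v'). sgl (h \<otimes>\<^sub>H h', v @ v') (chi_word v h')) s) t = Oh h (Ow v (act s t))"
  proof (induction rule: SK_induct)
    case (single h' v' c')
    have "Oh h (Ow v (Oh h' (Ow v' t))) = scl (chi_word v h') (Oh (h \<otimes>\<^sub>H h') (Ow (v @ v') t))"
      using single \<open>h \<in> carrier HH\<close> assms(3) by (simp add: Ow_Oh Oh_Oh Ow_closed)
    then show ?case by (simp add: mult_ac)
  next
    case (add x y)
    then show ?case by (simp only: plin_add act_simps Ow_linear O_linear)
  qed simp
  then show ?case by (simp add: SK_mult)
qed (simp_all add: SK_mult plin_add)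

text \<open>The annihilator of the module V0/J. For J = {0} it contains the relations of F_n; for J
  the kernel of the normal form map \<open>nf\<close> it will be seen to contain those of A as
  well.\<close>

lemma act_ideal:
  assumes J: "pm.subspace J" "J \<subseteq> V0" "\<And>g t. g \<in> carrier HH \<Longrightarrow> t \<in> J \<Longrightarrow> Oh g t \<in> J"
    "\<And>x t. t \<in> J \<Longrightarrow> Ol x t \<in> J"
  shows "ideal {s \<in> carrier SK. \<forall>t\<in>V0. act s t \<in> J} SK" (is "ideal ?K SK")
proof -
  have "lin_subspace ?K SK"
    using J(1) SK.a_closed SK.smult_closed SK.zero_closed[unfolded SK_simps(3)]
    by (intro SK.lin_subspaceI) (auto simp: pm.subspace_0 pm.subspace_add pm.subspace_scale simp del: SK_simps(1))
  then show ?thesis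
    by (intro idealI)
      (auto simp: lin_subspace_def SK.ring_axioms act_mult act_closed act_subspace[OF J(1,3,4)]
        simp del: SK_simps(1) mem_Collect_eq simp: Collect_conj_eq)
qed

definition Fn_rels :: "('k, 'n) sk set" where
  "Fn_rels = {bas (\<one>\<^sub>H, [Xp i, Xm j]) - sgl (\<one>\<^sub>H, [Xm j, Xp i]) (p j i)
        - (if i = j then bas (\<one>\<^sub>H, []) - bas (gf i, []) else 0) | i j. True}"

lemma Fn_ideal_eq: "Fn_ideal p N = Idl\<^bsub>SK\<^esub> Fn_rels"
  unfolding Fn_ideal_def Fn_rels_def gg_def ff_def ..

lemma Fn_rels_closed: "Fn_rels \<subseteq> carrier SK"
  unfolding Fn_rels_def by (clarify, unfold SK_simps mem_Collect_eq) (intro supp_diff_subset, simp_all add: supp_diff_subset)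

lemma Fn_rels_act: "r \<in> Fn_rels \<Longrightarrow> t \<in> V0 \<Longrightarrow> act r t = 0"
  unfolding Fn_rels_def
  by (auto simp: Oh_one Op_Om Om_closed Op_closed Oh_closed)

lemma zero_subspace: "pm.subspace {0 :: ('k, 'n) tri}"
  by (rule pm.subspace_single_0)

lemma Fn_ideal_act:
  assumes "s \<in> Fn_ideal p N" "t \<in> V0"
  shows "act s t = 0"
proof -
  have "Fn_ideal p N \<subseteq> {s \<in> carrier SK. \<forall>t\<in>V0. act s t \<in> {0}}"
    unfolding Fn_ideal_eq
  proof (rule SK.genideal_minimal[OF act_ideal[OF zero_subspace]])
    show "Fn_rels \<subseteq> {s \<in> carrier SK. \<forall>t\<in>V0. act s t \<in> {0}}"
      using Fn_rels_closed Fn_rels_act by blast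
  qed auto
  then show ?thesis using assms by blast
qed

abbreviation "e0 \<equiv> bas ([], \<one>\<^sub>H, [])"

lemma Ow_plus: "h \<in> carrier HH \<Longrightarrow> Ow (map Xp v) (sgl ([], h, b) c) = sgl ([], h, v @ b) (c * prod_list (map (\<lambda>i. chiH i h) v))"
  by (induction v) (simp_all add: mult_ac)

lemma Ow_minus: "Ow (map Xm v) (sgl (a, h, b) c) = sgl (v @ a, h, b) c"
  by (induction v) simp_all

text \<open>The vector \<open>e0\<close> stands for 1. Different monomials h x_v send it to
  different basis vectors, so they are independent in F_n, and G<X> satisfies no relations beyond
  those of a skew group algebra. \<open>act_e0_minus\<close> does the same for F<X^->.\<close>

lemma act_e0_plus: "act (bas (h, map Xp v)) e0 = bas ([], h, v)" if "h \<in> carrier HH"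
proof -
  have "(\<Prod>i\<leftarrow>v. (1 :: 'k)) = 1" by (induction v) auto
  with that show ?thesis by (simp add: Ow_plus chiH_one)
qed

lemma act_e0_minus: "h \<in> carrier HH \<Longrightarrow> act (bas (h, map Xm v)) e0 = sgl (v, h, []) (cm v h)"
  by (simp add: Ow_minus)

end

section \<open>Straightening in an algebra with the commutation relations\<close>

locale rel_alg = malg p N B "carrier (H_grp p N)" "\<lambda>x. x" b \<gamma> Gen
  for p :: "'n::finite \<Rightarrow> 'n \<Rightarrow> 'k::field" and N :: "(('k, 'n) lin \<times> ('k, 'n) lin) set"
    and B :: "('k, 'a) module" and b :: "('k, 'n) hgrp \<Rightarrow> 'n letter list \<Rightarrow> 'a"
    and \<gamma> :: "'n letter \<Rightarrow> ('k, 'n) hgrp" and Gen :: "('k, 'n) hgrp set" +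
  assumes rel: "\<And>i j. b \<one>\<^bsub>H_grp p N\<^esub> [Xp i] \<otimes>\<^sub>B b \<one>\<^bsub>H_grp p N\<^esub> [Xm j] =
      p j i \<odot>\<^sub>B (b \<one>\<^bsub>H_grp p N\<^esub> [Xm j] \<otimes>\<^sub>B b \<one>\<^bsub>H_grp p N\<^esub> [Xp i]) \<oplus>\<^sub>B
      (if i = j then \<one>\<^sub>B \<ominus>\<^bsub>B\<^esub> b (gg i \<otimes>\<^bsub>H_grp p N\<^esub> ff i) [] else \<zero>\<^sub>B)"
begin

definition mon :: "'n list \<Rightarrow> ('k, 'n) hgrp \<Rightarrow> 'n list \<Rightarrow> 'a" where
  "mon a h c = bw (map Xm a) \<otimes>\<^sub>B bg h \<otimes>\<^sub>B bw (map Xp c)"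

definition ev :: "('k, 'n) tri \<Rightarrow> 'a" where
  "ev = lin_ext B (\<lambda>(a, h, c). mon a h c)"

lemma mon_closed [simp]: "h \<in> carrier HH \<Longrightarrow> mon a h c \<in> carrier B"
  by (simp add: mon_def)

lemma ev_closed: "t \<in> V0 \<Longrightarrow> ev t \<in> carrier B"
  unfolding ev_def V0_def by (rule B.lin_ext_closed) auto

lemma ev_add: "s \<in> V0 \<Longrightarrow> t \<in> V0 \<Longrightarrow> ev (s + t) = ev s \<oplus>\<^sub>B ev t"
  unfolding ev_def V0_def by (rule B.lin_ext_add) auto

lemma ev_diff: "s \<in> V0 \<Longrightarrow> t \<in> V0 \<Longrightarrow> ev (s - t) = ev s \<ominus>\<^bsub>B\<^esub> ev t"
  unfolding ev_def V0_def by (rule B.lin_ext_diff) auto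

lemma ev_scl: "t \<in> V0 \<Longrightarrow> ev (scl c t) = c \<odot>\<^sub>B ev t"
  unfolding ev_def V0_def by (rule B.lin_ext_scl) auto

lemma ev_zero [simp]: "ev 0 = \<zero>\<^sub>B"
  by (simp add: ev_def)

lemma ev_single: "h \<in> carrier HH \<Longrightarrow> ev (sgl (a, h, c) d) = d \<odot>\<^sub>B mon a h c"
  unfolding ev_def by (simp add: B.lin_ext_single)

lemma bw_letter_closed [simp]: "bw v \<in> carrier B"
  by simp

lemma ev_Oh:
  assumes "g \<in> carrier HH" "t \<in> V0"
  shows "ev (Oh g t) = bg g \<otimes>\<^sub>B ev t"
  using assms(2)
proof (induction rule: V0_induct)
  case (single a h c d)
  have "bw (map Xm a) \<otimes>\<^sub>B bg g = chi_word (map Xm a) g \<odot>\<^sub>B (bg g \<otimes>\<^sub>B bw (map Xm a))"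
    using bw_bg[OF assms(1), of "map Xm a"] by simp
  then have "cm a g \<odot>\<^sub>B (bw (map Xm a) \<otimes>\<^sub>B bg g) = bg g \<otimes>\<^sub>B bw (map Xm a)"
    using assms(1) by (simp add: cm_def chi_word_nz B.smult_one flip: B.smult_assoc)
  then have "bg g \<otimes>\<^sub>B mon a h c = (cm a g \<odot>\<^sub>B (bw (map Xm a) \<otimes>\<^sub>B bg g)) \<otimes>\<^sub>B bg h \<otimes>\<^sub>B bw (map Xp c)"
    using assms(1) single by (simp add: mon_def B.m_assoc)
  also have "\<dots> = cm a g \<odot>\<^sub>B mon a (g \<otimes>\<^sub>H h) c"
    using assms(1) single by (simp add: mon_def B.smult_mult_l B.m_assoc bg_mult[symmetric])
  finally show ?case using assms(1) single
    by (simp add: ev_single B.smult_mult_r B.smult_assoc)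
next
  case (add s t)
  then show ?case using assms(1) by (simp add: ev_add Oh_closed ev_closed B.r_distr)
qed (use assms(1) in simp)

lemma ev_Om: "t \<in> V0 \<Longrightarrow> ev (Om j t) = bw [Xm j] \<otimes>\<^sub>B ev t"
proof (induction rule: V0_induct)
  case (single a h c d)
  then show ?case
    using bw_Cons[of "Xm j" "map Xm a"] by (simp add: ev_single mon_def B.smult_mult_r B.m_assoc)
next
  case (add s t)
  then show ?case by (simp add: ev_add Om_closed ev_closed B.r_distr)
qed simp

text \<open>Induction along a: the second clause of \<open>op\<close> is the relation
  \<open>rel\<close>, read as a rewriting rule for x_i x^-_j, and the first is the rule for x_i
  h.\<close>

lemma ev_op: "h \<in> carrier HH \<Longrightarrow> ev (op i a h c) = bw [Xp i] \<otimes>\<^sub>B mon a h c"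
proof (induction a)
  case Nil
  have "bw [Xp i] \<otimes>\<^sub>B bg h = chiH i h \<odot>\<^sub>B (bg h \<otimes>\<^sub>B bw [Xp i])"
    using bw_bg[OF Nil, of "[Xp i]"] by simp
  then have "bw [Xp i] \<otimes>\<^sub>B bg h \<otimes>\<^sub>B bw (map Xp c) = chiH i h \<odot>\<^sub>B (bg h \<otimes>\<^sub>B bw (map Xp (i # c)))"
    using Nil bw_Cons[of "Xp i" "map Xp c"] by (simp add: B.smult_mult_l B.m_assoc)
  then show ?case using Nil by (simp add: ev_single mon_def b_one B.m_assoc)
next
  case (Cons j a)
  let ?m = "mon a h c"
  have m: "mon (j # a) h c = bw [Xm j] \<otimes>\<^sub>B ?m"
    using bw_Cons[of "Xm j" "map Xm a"] Cons.prems by (simp add: mon_def B.m_assoc)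
  have e: "bas (a, h, c) \<in> V0" "op i a h c \<in> V0" using Cons.prems op_closed by auto
  have D: "ev (bas (a, h, c) - Oh (gf i) (bas (a, h, c))) = (\<one>\<^sub>B \<ominus>\<^bsub>B\<^esub> bg (gf i)) \<otimes>\<^sub>B ?m"
  proof -
    have "ev (bas (a, h, c) - Oh (gf i) (bas (a, h, c))) = ?m \<ominus>\<^bsub>B\<^esub> bg (gf i) \<otimes>\<^sub>B ?m"
      using Cons.prems ev_diff[OF e(1) Oh_closed[OF _ e(1)], of "gf i"] ev_Oh[OF _ e(1), of "gf i"]
      by (simp add: ev_single B.smult_one)
    then show ?thesis using Cons.prems by (simp add: a_minus_def B.l_distr B.l_minus)
  qed
  have D': "bas (a, h, c) - Oh (gf i) (bas (a, h, c)) \<in> V0"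
    by (rule pm.subspace_diff[OF V0_subspace e(1) Oh_closed[OF _ e(1)]]) simp
  have "ev (op i (j # a) h c) = p j i \<odot>\<^sub>B (bw [Xm j] \<otimes>\<^sub>B (bw [Xp i] \<otimes>\<^sub>B ?m)) \<oplus>\<^sub>B
      (if i = j then (\<one>\<^sub>B \<ominus>\<^bsub>B\<^esub> bg (gf i)) \<otimes>\<^sub>B ?m else \<zero>\<^sub>B)"
    unfolding op.simps using Cons e D D'
    by (subst ev_add) (auto simp del: O_single
        simp: ev_scl ev_Om Om_closed pm.subspace_scale[OF V0_subspace] pm.subspace_0[OF V0_subspace])
  also have "\<dots> = (p j i \<odot>\<^sub>B (bw [Xm j] \<otimes>\<^sub>B bw [Xp i]) \<oplus>\<^sub>B
      (if i = j then \<one>\<^sub>B \<ominus>\<^bsub>B\<^esub> bg (gf i) else \<zero>\<^sub>B)) \<otimes>\<^sub>B ?m"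
    using Cons.prems by (simp add: B.l_distr B.smult_mult_l B.m_assoc)
  also have "\<dots> = (bw [Xp i] \<otimes>\<^sub>B bw [Xm j]) \<otimes>\<^sub>B ?m" unfolding rel ..
  also have "\<dots> = bw [Xp i] \<otimes>\<^sub>B mon (j # a) h c" using Cons.prems by (simp add: m B.m_assoc)
  finally show ?case .
qed

lemma ev_Op: "t \<in> V0 \<Longrightarrow> ev (Op i t) = bw [Xp i] \<otimes>\<^sub>B ev t"
proof (induction rule: V0_induct)
  case (single a h c d)
  then show ?case by (simp add: ev_scl op_closed ev_op ev_single B.smult_mult_r)
next
  case (add s t)
  then show ?case by (simp add: ev_add Op_closed ev_closed B.r_distr)
qed simp

lemma ev_Ow: "t \<in> V0 \<Longrightarrow> ev (Ow v t) = bw v \<otimes>\<^sub>B ev t"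
proof (induction v)
  case (Cons x v)
  have "ev (Ol x t) = bw [x] \<otimes>\<^sub>B ev t" if "t \<in> V0" for t
    using that by (cases x) (simp_all add: ev_Om ev_Op)
  then show ?case using Cons bw_Cons[of x v]
    by (simp add: Ow_closed ev_closed B.m_assoc)
qed (simp add: b_one ev_closed)

lemma e0_V0: "e0 \<in> V0" by simp

text \<open>\<open>ev\<close> turns the operators into left multiplications and \<open>e0\<close>
  into 1. So every monomial is a combination of triangular ones, computed by the
  representation.\<close>

lemma straighten: "h \<in> carrier HH \<Longrightarrow> b h v = ev (act (bas (h, v)) e0)"
proof -
  assume h: "h \<in> carrier HH"
  have "ev e0 = \<one>\<^sub>B" by (simp add: ev_single mon_def b_one B.smult_one)
  then show ?thesis using h e0_V0
    by (simp del: O_single add: ev_Oh Ow_closed ev_Ow b_split[of h v, symmetric])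
qed

end

section \<open>The quotient algebras\<close>

text \<open>As f is surjective, f(K) is an ideal, and it contains the ideal generated by f(S); since
  K contains the kernel of f, membership can be pulled back. Ideals of a quotient are thereby
  treated on the level of representatives.\<close>

lemma ideal_preimage_subset:
  assumes "k_algebra A" "k_algebra B" "f \<in> alg_hom A B" "f ` carrier A = carrier B"
    and K: "ideal K A" "\<And>x. x \<in> carrier A \<Longrightarrow> f x = \<zero>\<^bsub>B\<^esub> \<Longrightarrow> x \<in> K" "S \<subseteq> K"
    and a: "a \<in> carrier A" "f a \<in> Idl\<^bsub>B\<^esub> (f ` S)"
  shows "a \<in> K"
proof -
  interpret A: k_algebra A + B: k_algebra B using assms by auto
  interpret K: ideal K A by fact
  note f = alg_homD[OF assms(3)]
  have "Idl\<^bsub>B\<^esub> (f ` S) \<subseteq> f ` K"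
    by (rule B.genideal_minimal[OF ideal_hom_image[OF assms(1-5)]]) (use K(3) in auto)
  with a(2) obtain k where k: "k \<in> K" "f a = f k" by auto
  have kc: "k \<in> carrier A" using k K.Icarr by auto
  have "f (a \<ominus>\<^bsub>A\<^esub> k) = \<zero>\<^bsub>B\<^esub>"
    using k(2) f(2)[OF kc] klin_minus[OF assms(1,2) f(1) kc] f(3)[OF a(1) A.a_inv_closed[OF kc]]
    by (simp add: a_minus_def B.r_neg)
  then have "a \<ominus>\<^bsub>A\<^esub> k \<in> K" using K(2)[of "a \<ominus>\<^bsub>A\<^esub> k"] a(1) kc by simp
  then have "(a \<ominus>\<^bsub>A\<^esub> k) \<oplus>\<^bsub>A\<^esub> k \<in> K" using k(1) by (rule K.a_closed)
  then show ?thesis using a(1) kc by (simp add: a_minus_def A.a_assoc A.l_neg)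
qed

context adm
begin

lemma Fn_ideal_ideal: "ideal (Fn_ideal p N) SK"
  unfolding Fn_ideal_eq by (rule SK.genideal_ideal[OF Fn_rels_closed])

sublocale Fn: k_algebra "Fn p N"
  unfolding Fn_def by (rule SK.k_algebra_quot[OF Fn_ideal_ideal])

lemma Fn_cls_hom: "Fn_cls p N \<in> alg_hom SK (Fn p N)"
  using SK.proj_hom[OF Fn_ideal_ideal] by (simp add: Fn_cls_def[abs_def] Fn_def)

lemmas Fn_cls_simps = alg_homD(2-6)[OF Fn_cls_hom]

lemma Fn_cls_surj: "Fn_cls p N ` carrier SK = carrier (Fn p N)"
  unfolding Fn_def SK.quot_alg_carrier Fn_cls_def ..

lemma Fn_zero: "\<zero>\<^bsub>Fn p N\<^esub> = Fn_ideal p N"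
  by (simp add: Fn_def quot_alg_simps)

lemma Fn_cls_zero_iff: "a \<in> carrier SK \<Longrightarrow> Fn_cls p N a = \<zero>\<^bsub>Fn p N\<^esub> \<longleftrightarrow> a \<in> Fn_ideal p N"
  unfolding Fn_zero Fn_cls_def by (rule SK.quot_alg_eq_zero_iff[OF Fn_ideal_ideal])

definition emb :: "('n \<Rightarrow> 'n letter) \<Rightarrow> ('k, 'n) npoly \<Rightarrow> ('k, 'n) sk" where
  "emb X = plin (\<lambda>v. bas (\<one>\<^sub>H, map X v))"

lemma emb_closed: "emb X s \<in> carrier SK"
  unfolding emb_def SK_simps mem_Collect_eq by (rule supp_plin_subset) auto

lemma npoly_Fn_eq: "npoly_Fn p N X s = Fn_cls p N (emb X s)"
proof -
  have "supp s \<subseteq> UNIV" by simp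
  then show ?thesis unfolding npoly_Fn_def
  proof (induction rule: pm_induct)
    case zero
    have "Fn_cls p N 0 = \<zero>\<^bsub>Fn p N\<^esub>"
      using klin_zero[OF SK.k_alg Fn.k_alg alg_homD(1)[OF Fn_cls_hom]] by simp
    then show ?case by (simp add: emb_def)
  next
    case (single v c)
    have "bas (\<one>\<^sub>H, map X v) \<in> carrier SK" by simp
    from Fn_cls_simps(1)[OF this] Fn_cls_simps(3)[OF this, of c] show ?case
      by (simp add: emb_def Fn.lin_ext_single)
  next
    case (add s t)
    have c: "bas (\<one>\<^sub>H, map X v) \<in> carrier SK" for v by simp
    have "Fn_cls p N (emb X (s + t)) = Fn_cls p N (emb X s) \<oplus>\<^bsub>Fn p N\<^esub> Fn_cls p N (emb X t)"
      using Fn_cls_simps(2)[OF emb_closed[of X s] emb_closed[of X t]] by (simp add: emb_def plin_add)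
    then show ?case using add Fn_cls_simps(1)[OF c]
      by (subst Fn.lin_ext_add) auto
  qed
qed

end

text \<open>The common construction of \<open>A\<^sup>+\<close> (\<open>X = Xp\<close>, \<open>Ks = G\<close>) and \<open>A\<^sup>-\<close> (\<open>X = Xm\<close>, \<open>Ks = F\<close>).\<close>

locale half_data = adm p N
  for p :: "'n::finite \<Rightarrow> 'n \<Rightarrow> 'k::field" and N :: "(('k, 'n) lin \<times> ('k, 'n) lin) set" +
  fixes X :: "'n \<Rightarrow> 'n letter" and Ks :: "('k, 'n) hgrp set" and \<kappa> :: "'n \<Rightarrow> ('k, 'n) hgrp"
    and R :: "('k, 'n) npoly set"
  assumes \<kappa>: "range \<kappa> \<subseteq> carrier HH" and Ks: "Ks = generate HH (range \<kappa>)"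
    and inj: "\<And>t. supp t \<subseteq> Ks \<times> UNIV \<Longrightarrow> act (plin (\<lambda>(g, v). bas (g, map X v)) t) e0 = 0 \<Longrightarrow> t = 0"
    and R_hom: "\<And>q. q \<in> R \<Longrightarrow> homogeneous_npoly q"
    and R_len: "\<And>q v. q \<in> R \<Longrightarrow> v \<in> supp q \<Longrightarrow> length v > 1"
begin

definition "GXg = (Fn p N)\<lparr>carrier := gen_subalgebra (Fn p N)
     ({Fn_cls p N (bas (h, [])) | h. h \<in> Ks} \<union> {Fn_cls p N (bas (\<one>\<^sub>H, [X i])) | i. True})\<rparr>"
definition "Qi = Idl\<^bsub>GXg\<^esub> (npoly_Fn p N X ` R)"
definition "Q = quot_alg GXg Qi"
definition "Qcls a = Qi +>\<^bsub>GXg\<^esub> Fn_cls p N a"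

lemma Ks_sub: "subgroup Ks HH"
  unfolding Ks by (rule H.generate_is_subgroup[OF \<kappa>])

lemma Ks_carrier [simp]: "g \<in> Ks \<Longrightarrow> g \<in> carrier HH"
  using subgroup.subset[OF Ks_sub] by blast

abbreviation "MK \<equiv> (HH\<lparr>carrier := Ks\<rparr>) \<times>\<times> word_monoid"
abbreviation "TX \<equiv> twisted_alg MK (\<lambda>(h, v) (h', v'). chi_word (map X v) h')"

sublocale TXt: twisted MK "\<lambda>(h, v) (h', v'). chi_word (map X v) h'"
proof -
  have g: "Group.group (HH\<lparr>carrier := Ks\<rparr>)" by (rule subgroup.subgroup_is_group[OF Ks_sub H.is_group])
  have "Group.monoid word_monoid" by (rule monoidI) (auto simp: word_monoid_def)
  then have "Group.monoid MK" by (rule DirProd_monoid[OF group.is_monoid[OF g]])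
  then show "twisted MK (\<lambda>(h, v) (h', v'). chi_word (map X v) h')"
    by (intro twisted.intro twisted_axioms.intro) (auto simp: chi_word_mult)
qed

sublocale TX: k_algebra TX by (rule TXt.k_algebra_twisted)

lemma MK_simps [simp]: "carrier MK = Ks \<times> UNIV" "\<one>\<^bsub>MK\<^esub> = (\<one>\<^sub>H, [])"
  "(g, v) \<otimes>\<^bsub>MK\<^esub> (g', v') = (g \<otimes>\<^sub>H g', v @ v')"
  by (simp_all add: word_monoid_def)

definition E :: "(('k, 'n) hgrp \<times> 'n list \<Rightarrow>\<^sub>0 'k) \<Rightarrow> ('k, 'n) sk" where
  "E = plin (\<lambda>(g, v). bas (g, map X v))"

text \<open>Identifies the abstract skew algebra \<open>TX\<close>, in which ideals can be written
  down explicitly, with the subalgebra G<X> or F<X^-> of F_n (\<open>GXg_carrier\<close>,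
  \<open>\<theta>_inj\<close>).\<close>

definition \<theta> :: "(('k, 'n) hgrp \<times> 'n list \<Rightarrow>\<^sub>0 'k) \<Rightarrow> ('k, 'n) sk set" where
  "\<theta> = lin_ext (Fn p N) (\<lambda>(g, v). Fn_cls p N (bas (g, map X v)))"

lemma cls_bas_closed [simp]: "g \<in> carrier HH \<Longrightarrow> Fn_cls p N (bas (g, v)) \<in> carrier (Fn p N)"
  by (rule Fn_cls_simps(1)) simp

lemma cls_bas_mult:
  assumes "g \<in> carrier HH" "g' \<in> carrier HH"
  shows "Fn_cls p N (bas (g, v)) \<otimes>\<^bsub>Fn p N\<^esub> Fn_cls p N (bas (g', v')) = chi_word v g' \<odot>\<^bsub>Fn p N\<^esub> Fn_cls p N (bas (g \<otimes>\<^sub>H g', v @ v'))"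
proof -
  have c: "bas (g, v) \<in> carrier SK" "bas (g', v') \<in> carrier SK" "bas (g \<otimes>\<^sub>H g', v @ v') \<in> carrier SK"
    using assms by auto
  have "Fn_cls p N (bas (g, v) \<otimes>\<^bsub>SK\<^esub> bas (g', v')) = Fn_cls p N (scl (chi_word v g') (bas (g \<otimes>\<^sub>H g', v @ v')))"
    by (simp add: SK_mult)
  then show ?thesis using Fn_cls_simps(4)[OF c(1,2)] Fn_cls_simps(3)[OF c(3), of "chi_word v g'"] by simp
qed

lemma \<theta>_hom: "\<theta> \<in> alg_hom TX (Fn p N)"
  unfolding \<theta>_def
proof (rule TXt.lin_ext_hom[OF Fn.k_alg])
  have "Fn_cls p N (bas (\<one>\<^sub>H, [])) = \<one>\<^bsub>Fn p N\<^esub>" using Fn_cls_simps(5) by simp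
  then show "(\<lambda>(g, v). Fn_cls p N (bas (g, map X v))) \<one>\<^bsub>MK\<^esub> = \<one>\<^bsub>Fn p N\<^esub>" by simp
qed (auto simp: cls_bas_mult simp del: mult_DirProd)

lemmas \<theta> = alg_homD[OF \<theta>_hom]

lemma E_closed: "t \<in> carrier TX \<Longrightarrow> E t \<in> carrier SK"
  unfolding E_def SK_simps mem_Collect_eq by (rule supp_plin_subset) auto

lemma TX_induct [consumes 1, case_names zero single add]:
  assumes "t \<in> carrier TX" "P 0" "\<And>g v c. g \<in> Ks \<Longrightarrow> P (sgl (g, v) c)"
    and "\<And>s t. s \<in> carrier TX \<Longrightarrow> t \<in> carrier TX \<Longrightarrow> P s \<Longrightarrow> P t \<Longrightarrow> P (s + t)"
  shows "P t"
proof -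
  have "supp t \<subseteq> Ks \<times> UNIV" using assms(1) by simp
  then show ?thesis by (induction rule: pm_induct) (use assms(2-4) in auto)
qed

lemma \<theta>_single: "g \<in> Ks \<Longrightarrow> \<theta> (sgl (g, v) c) = c \<odot>\<^bsub>Fn p N\<^esub> Fn_cls p N (bas (g, map X v))"
  unfolding \<theta>_def by (simp add: Fn.lin_ext_single)

lemma \<theta>_bas: "g \<in> Ks \<Longrightarrow> \<theta> (bas (g, v)) = Fn_cls p N (bas (g, map X v))"
  by (simp add: \<theta>_single Fn.smult_one)

lemma \<theta>_E: "t \<in> carrier TX \<Longrightarrow> \<theta> t = Fn_cls p N (E t)"
proof (induction rule: TX_induct)
  case zero
  then show ?case using klin_zero[OF SK.k_alg Fn.k_alg alg_homD(1)[OF Fn_cls_hom]]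
    klin_zero[OF TX.k_alg Fn.k_alg \<theta>(1)] by (simp add: E_def)
next
  case (single g v c)
  have "bas (g, map X v) \<in> carrier SK" using single by simp
  from Fn_cls_simps(3)[OF this, of c] show ?case using single by (simp add: \<theta>_single E_def)
next
  case (add s t)
  have "Fn_cls p N (E (s + t)) = Fn_cls p N (E s) \<oplus>\<^bsub>Fn p N\<^esub> Fn_cls p N (E t)"
    using Fn_cls_simps(2)[OF E_closed[OF add(1)] E_closed[OF add(2)]] by (simp add: E_def plin_add)
  then show ?case using \<theta>(3)[OF add(1,2)] add.IH by simp
qed

text \<open>An element of \<open>Fn_ideal\<close> annihilates \<open>e0\<close>, and by the
  assumption \<open>inj\<close> only 0 does so among the elements of \<open>TX\<close>.\<close>

lemma \<theta>_inj: "t \<in> carrier TX \<Longrightarrow> \<theta> t = \<zero>\<^bsub>Fn p N\<^esub> \<Longrightarrow> t = 0"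
  using Fn_ideal_act[of "E t" e0] Fn_cls_zero_iff[OF E_closed[of t]] inj[of t]
  by (simp add: \<theta>_E E_def)

lemma gens_closed: "{Fn_cls p N (bas (h, [])) | h. h \<in> Ks} \<union> {Fn_cls p N (bas (\<one>\<^sub>H, [X i])) | i. True} \<subseteq> carrier (Fn p N)"
  by auto

lemma GXg_subalgebra: "k_subalgebra (carrier GXg) (Fn p N)"
  unfolding GXg_def using Fn.k_subalgebra_gen[OF gens_closed] by simp

sublocale GX: k_algebra GXg
  unfolding GXg_def by (rule Fn.k_algebra_subalgebra[OF Fn.k_subalgebra_gen[OF gens_closed]])

lemma GXg_ops [simp]: "mult GXg = mult (Fn p N)" "one GXg = one (Fn p N)" "zero GXg = zero (Fn p N)"
  "add GXg = add (Fn p N)" "smult GXg = smult (Fn p N)"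
  by (simp_all add: GXg_def)

lemma one_Ks [simp]: "\<one>\<^sub>H \<in> Ks"
  by (rule subgroup.one_closed[OF Ks_sub])

lemma GXg_carrier: "\<theta> ` carrier TX = carrier GXg"
proof
  have sub: "k_subalgebra (\<theta> ` carrier TX) (Fn p N)"
    by (rule k_subalgebra_image[OF TX.k_alg Fn.k_alg \<theta>_hom])
      (rule TX.k_subalgebraI, simp_all only: subset_refl TX.one_closed TX.m_closed TX.a_closed TX.smult_closed)
  show "carrier GXg \<subseteq> \<theta> ` carrier TX"
  proof -
    have 1: "Fn_cls p N (bas (h, [])) \<in> \<theta> ` carrier TX" if "h \<in> Ks" for h
      by (rule image_eqI[of _ \<theta> "bas (h, [])"]) (simp_all add: \<theta>_bas[OF that] that)
    have 2: "Fn_cls p N (bas (\<one>\<^sub>H, [X i])) \<in> \<theta> ` carrier TX" for i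
      by (rule image_eqI[of _ \<theta> "bas (\<one>\<^sub>H, [i])"]) (simp_all add: \<theta>_bas)
    have "gen_subalgebra (Fn p N)
       ({Fn_cls p N (bas (h, [])) | h. h \<in> Ks} \<union> {Fn_cls p N (bas (\<one>\<^sub>H, [X i])) | i. True}) \<subseteq> \<theta> ` carrier TX"
      by (rule gen_subalgebra_least[OF sub]) (use 1 2 in auto)
    then show ?thesis by (simp add: GXg_def)
  qed
  note G = Fn.k_subalgebraD[OF GXg_subalgebra]
  have gen: "Fn_cls p N (bas (h, [])) \<in> carrier GXg" if "h \<in> Ks" for h
    unfolding GXg_def using that by (auto intro!: subsetD[OF gen_subalgebra_superset])
  have gen': "Fn_cls p N (bas (\<one>\<^sub>H, [X i])) \<in> carrier GXg" for i
    unfolding GXg_def by (auto intro!: subsetD[OF gen_subalgebra_superset])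
  have word: "Fn_cls p N (bas (\<one>\<^sub>H, map X v)) \<in> carrier GXg" for v
  proof (induction v)
    case Nil
    then show ?case using gen[of "\<one>\<^sub>H"] by simp
  next
    case (Cons i v)
    have "Fn_cls p N (bas (\<one>\<^sub>H, [X i])) \<otimes>\<^bsub>Fn p N\<^esub> Fn_cls p N (bas (\<one>\<^sub>H, map X v)) = Fn_cls p N (bas (\<one>\<^sub>H, map X (i # v)))"
      by (simp add: cls_bas_mult Fn.smult_one)
    then show ?case using G(3)[OF gen'[of i] Cons] by simp
  qed
  have "\<theta> t \<in> carrier GXg" if "t \<in> carrier TX" for t
    using that
  proof (induction rule: TX_induct)
    case zero
    then show ?case using klin_zero[OF TX.k_alg Fn.k_alg \<theta>(1)] GX.zero_closed by simp
  next
    case (single g v c)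
    have "Fn_cls p N (bas (g, [])) \<otimes>\<^bsub>Fn p N\<^esub> Fn_cls p N (bas (\<one>\<^sub>H, map X v)) = Fn_cls p N (bas (g, map X v))"
      using single by (simp add: cls_bas_mult Fn.smult_one)
    then show ?case using G(3)[OF gen[OF single] word[of v]] G(5) single by (simp add: \<theta>_single)
  next
    case (add s t)
    then show ?case using \<theta>(3)[OF add(1,2)] G(4) by simp
  qed
  then show "\<theta> ` carrier TX \<subseteq> carrier GXg" by blast
qed

lemma \<theta>_GX_hom: "\<theta> \<in> alg_hom TX GXg"
  using \<theta> GXg_carrier by (intro alg_homI klinI) auto

text \<open>The ideal of \<open>TX\<close> generated by R, written as a span: group elements can be
  collected in front, because they pass a homogeneous relation q up to a scalar.\<close>

definition KI :: "(('k, 'n) hgrp \<times> 'n list \<Rightarrow>\<^sub>0 'k) set" where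
  "KI = pm.span {plin (\<lambda>w. bas (g, a @ w @ b)) q | g a b q. g \<in> Ks \<and> q \<in> R}"

lemma KI_gen: "g \<in> Ks \<Longrightarrow> q \<in> R \<Longrightarrow> plin (\<lambda>w. bas (g, a @ w @ b)) q \<in> KI"
  unfolding KI_def by (rule pm.span_base) blast

lemma KI_subspace: "pm.subspace KI"
  unfolding KI_def by (rule pm.subspace_span)

lemma KI_closed: "KI \<subseteq> carrier TX"
  unfolding KI_def twisted_alg_simps
proof (rule pm.span_minimal[OF _ pm_subspace_supp], rule subsetI)
  fix z assume "z \<in> {plin (\<lambda>w. bas (g, a @ w @ b)) q | g a b q. g \<in> Ks \<and> q \<in> R}"
  then obtain g a b q where "z = plin (\<lambda>w. bas (g, a @ w @ b)) q" "g \<in> Ks" by blast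
  then show "z \<in> {t. supp t \<subseteq> carrier MK}"
    using supp_plin_subset[of q "\<lambda>w. bas (g, a @ w @ b)" "Ks \<times> UNIV"] by simp
qed

lemma KI_ideal: "ideal KI TX"
proof -
  have sub: "lin_subspace KI TX"
    using KI_closed KI_subspace by (intro TX.lin_subspaceI) (auto simp: pm.subspace_def)
  have L: "plin (\<lambda>(g, v). sgl (g' \<otimes>\<^sub>H g, v' @ v) (chi_word (map X v') g)) r \<in> KI"
    if "g' \<in> Ks" "r \<in> KI" for g' v' r
  proof (rule plin_span_into[OF _ KI_subspace that(2)[unfolded KI_def]])
    fix z assume "z \<in> {plin (\<lambda>w. bas (g, a @ w @ b)) q | g a b q. g \<in> Ks \<and> q \<in> R}"
    then obtain g a b q where z: "z = plin (\<lambda>w. bas (g, a @ w @ b)) q" "g \<in> Ks" "q \<in> R" by blast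
    have "plin (\<lambda>(g, v). sgl (g' \<otimes>\<^sub>H g, v' @ v) (chi_word (map X v') g)) z =
        scl (chi_word (map X v') g) (plin (\<lambda>w. bas (g' \<otimes>\<^sub>H g, (v' @ a) @ w @ b)) q)"
      by (simp add: z(1) plin_plin plin_fun_scl[symmetric])
    then show "plin (\<lambda>(g, v). sgl (g' \<otimes>\<^sub>H g, v' @ v) (chi_word (map X v') g)) z \<in> KI"
      using KI_gen[OF _ z(3), of "g' \<otimes>\<^sub>H g" "v' @ a" b] z(2) that(1) subgroup.m_closed[OF Ks_sub]
      by (simp add: pm.subspace_scale[OF KI_subspace])
  qed
  have Rt: "plin (\<lambda>(g, v). sgl (g \<otimes>\<^sub>H g', v @ v') (chi_word (map X v) g')) r \<in> KI"
    if "g' \<in> Ks" "r \<in> KI" for g' v' r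
  proof (rule plin_span_into[OF _ KI_subspace that(2)[unfolded KI_def]])
    fix z assume "z \<in> {plin (\<lambda>w. bas (g, a @ w @ b)) q | g a b q. g \<in> Ks \<and> q \<in> R}"
    then obtain g a b q where z: "z = plin (\<lambda>w. bas (g, a @ w @ b)) q" "g \<in> Ks" "q \<in> R" by blast
    \<comment> \<open>All words of q have the same letter counts, so g' passes all of them with the
      same scalar c.\<close>
    have "\<exists>c. \<forall>w \<in> supp q. chi_word (map X (a @ w @ b)) g' = c"
    proof (cases "supp q = {}")
      case False
      then obtain w0 where w0: "w0 \<in> supp q" by blast
      have "chi_word (map X (a @ w @ b)) g' = chi_word (map X (a @ w0 @ b)) g'" if "w \<in> supp q" for w
      proof -
        have "count_list w i = count_list w0 i" for i
          using R_hom[OF z(3)] that w0 unfolding homogeneous_npoly_def by blast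
        then have "count_list (a @ w @ b) = count_list (a @ w0 @ b)" by (simp add: fun_eq_iff)
        then show ?thesis unfolding chi_word_def map_map by (rule prod_list_cong_count)
      qed
      then show ?thesis by blast
    qed auto
    then obtain c where c: "\<And>w. w \<in> supp q \<Longrightarrow> chi_word (map X (a @ w @ b)) g' = c" by blast
    have "plin (\<lambda>(g, v). sgl (g \<otimes>\<^sub>H g', v @ v') (chi_word (map X v) g')) z =
        plin (\<lambda>w. scl c (bas (g \<otimes>\<^sub>H g', a @ w @ (b @ v')))) q"
      unfolding z(1) plin_plin using c by (intro plin_cong) simp
    then show "plin (\<lambda>(g, v). sgl (g \<otimes>\<^sub>H g', v @ v') (chi_word (map X v) g')) z \<in> KI"
      using KI_gen[OF _ z(3), of "g \<otimes>\<^sub>H g'" a "b @ v'"] z(2) that(1) subgroup.m_closed[OF Ks_sub]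
      unfolding plin_fun_scl by (simp add: pm.subspace_scale[OF KI_subspace])
  qed
  have "x \<otimes>\<^bsub>TX\<^esub> r \<in> KI \<and> r \<otimes>\<^bsub>TX\<^esub> x \<in> KI" if "r \<in> KI" "x \<in> carrier TX" for r x
    using that(2)
  proof (induction rule: TX_induct)
    case zero
    then show ?case by (simp add: twisted_alg_mult pm.subspace_0[OF KI_subspace])
  next
    case (single g v c)
    have "sgl (g, v) c \<otimes>\<^bsub>TX\<^esub> r = scl c (plin (\<lambda>(g', v'). sgl (g \<otimes>\<^sub>H g', v @ v') (chi_word (map X v) g')) r)"
      "r \<otimes>\<^bsub>TX\<^esub> sgl (g, v) c = scl c (plin (\<lambda>(g', v'). sgl (g' \<otimes>\<^sub>H g, v' @ v) (chi_word (map X v') g)) r)"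
      by (simp_all add: twisted_alg_mult plin_fun_scl[symmetric] case_prod_unfold mult_DirProd' del: scl_single)
    then show ?case using L[OF single that(1)] Rt[OF single that(1)]
      by (simp add: pm.subspace_scale[OF KI_subspace])
  next
    case (add s t)
    then show ?case
      by (simp add: twisted_alg_mult plin_add plin_fun_add pm.subspace_add[OF KI_subspace])
  qed
  then show ?thesis
    by (intro idealI) (use sub TX.ring_axioms in \<open>auto simp: lin_subspace_def simp del: twisted_alg_simps(1)\<close>)
qed

lemma words_TX: "plin (\<lambda>w. bas (\<one>\<^sub>H, w)) s \<in> carrier TX"
  unfolding twisted_alg_simps mem_Collect_eq by (rule supp_plin_subset) simp

lemma npoly_\<theta>: "npoly_Fn p N X s = \<theta> (plin (\<lambda>w. bas (\<one>\<^sub>H, w)) s)"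
  using \<theta>_E[OF words_TX, of s] by (simp add: npoly_Fn_eq E_def emb_def plin_plin)

lemma npoly_GX: "npoly_Fn p N X ` R \<subseteq> carrier GXg"
  unfolding npoly_\<theta> GXg_carrier[symmetric] using words_TX by blast

lemma Qi_ideal: "ideal Qi GXg"
  unfolding Qi_def by (rule GX.genideal_ideal[OF npoly_GX])

sublocale Q: k_algebra Q
  unfolding Q_def by (rule GX.k_algebra_quot[OF Qi_ideal])

text \<open>The ideal of A^+ or A^- is generated inside F_n, but by injectivity of
  \<open>\<theta>\<close> it contains nothing beyond \<open>KI\<close>. Separating group elements
  then yields the assumption \<open>evm_kernel\<close> of the locale \<open>half\<close>.\<close>

lemma \<theta>_Qi:
  assumes "t \<in> carrier TX" "\<theta> t \<in> Qi"
  shows "t \<in> KI"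
proof (rule ideal_preimage_subset[OF TX.k_alg GX.k_alg \<theta>_GX_hom GXg_carrier KI_ideal _ _ assms(1)])
  show "\<theta> t \<in> Idl\<^bsub>GXg\<^esub> (\<theta> ` (plin (\<lambda>w. bas (\<one>\<^sub>H, w)) ` R))"
    using assms(2) unfolding Qi_def npoly_\<theta> image_image .
  show "x \<in> KI" if "x \<in> carrier TX" "\<theta> x = \<zero>\<^bsub>GXg\<^esub>" for x
    using \<theta>_inj[OF that(1)] that(2) pm.subspace_0[OF KI_subspace] by simp
  show "plin (\<lambda>w. bas (\<one>\<^sub>H, w)) ` R \<subseteq> KI"
    using KI_gen[of "\<one>\<^sub>H" _ "[]" "[]"] by auto
qed

definition \<omega> :: "(('k, 'n) hgrp \<times> 'n list \<Rightarrow>\<^sub>0 'k) \<Rightarrow> ('k, 'n) quo" where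
  "\<omega> t = Qi +>\<^bsub>GXg\<^esub> \<theta> t"

lemma \<omega>_hom: "\<omega> \<in> alg_hom TX Q"
  unfolding \<omega>_def[abs_def] Q_def by (rule alg_hom_comp[OF \<theta>_GX_hom GX.proj_hom[OF Qi_ideal]])

lemmas \<omega> = alg_homD[OF \<omega>_hom]

lemma \<omega>_surj: "\<omega> ` carrier TX = carrier Q"
  unfolding Q_def GX.quot_alg_carrier \<omega>_def[abs_def] GXg_carrier[symmetric] by (simp add: image_image)

abbreviation "bQ g v \<equiv> Qcls (bas (g, map X v))"

lemma \<omega>_bas: "g \<in> Ks \<Longrightarrow> \<omega> (bas (g, v)) = bQ g v"
  by (simp add: \<omega>_def Qcls_def \<theta>_bas)

lemma Q_zero: "\<zero>\<^bsub>Q\<^esub> = Qi"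
  by (simp add: Q_def quot_alg_simps)

sublocale malg p N Q Ks X bQ \<kappa> "range \<kappa>"
proof (unfold_locales, goal_cases)
  case 1 show ?case by (rule \<kappa>)
next
  case 2 show ?case by (rule Ks)
next
  case (3 x) show ?case unfolding Ks by (rule generate.incl) simp
next
  case (4 g v) then show ?case using \<omega>(2)[of "bas (g, v)"] by (simp add: \<omega>_bas)
next
  case (5 g g' v v')
  have c: "bas (g, v) \<in> carrier TX" "bas (g', v') \<in> carrier TX" "bas (g \<otimes>\<^sub>H g', v @ v') \<in> carrier TX"
    using 5 subgroup.m_closed[OF Ks_sub] by auto
  have "bas (g, v) \<otimes>\<^bsub>TX\<^esub> bas (g', v') = scl (chi_word (map X v) g') (bas (g \<otimes>\<^sub>H g', v @ v'))"
    by (simp add: TXt.mult_bas)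
  then show ?case
    using \<omega>(5)[OF c(1,2)] \<omega>(4)[OF c(3), of "chi_word (map X v) g'"] 5 subgroup.m_closed[OF Ks_sub]
    by (simp add: \<omega>_bas del: scl_single)
next
  case 6 show ?case using \<omega>(6) \<omega>_bas[of "\<one>\<^sub>H" "[]"] by simp
next
  case 7
  let ?S = "{bQ g v | g v. g \<in> Ks}"
  have S: "?S \<subseteq> carrier Q" using \<omega>(2)[of "bas (g, v)" for g v] by (auto simp: \<omega>_bas)
  note D = Q.lin_subspaceD[OF Q.lin_subspace_lin_span[OF S]]
  have "\<omega> t \<in> lin_span Q ?S" if "t \<in> carrier TX" for t
    using that
  proof (induction rule: TX_induct)
    case zero
    then show ?case using D(2) klin_zero[OF TX.k_alg Q.k_alg \<omega>(1)] by simp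
  next
    case (single g v c)
    have "bQ g v \<in> lin_span Q ?S" using Q.lin_span_superset[of ?S] single by blast
    then show ?case using \<omega>(4)[of "bas (g, v)" c] D(4) single by (simp add: \<omega>_bas)
  next
    case (add s t)
    then show ?case using \<omega>(3)[OF add(1,2)] D(3) by simp
  qed
  then have "\<omega> ` carrier TX \<subseteq> lin_span Q ?S" by (rule image_subsetI)
  then show ?case using D(1) unfolding \<omega>_surj by (rule equalityI)
qed

lemma evm_\<omega>: "t \<in> carrier TX \<Longrightarrow> evm t = \<omega> t"
proof (induction rule: TX_induct)
  case zero
  then show ?case using klin_zero[OF TX.k_alg Q.k_alg \<omega>(1)] by simp
next
  case (single g v c)
  then show ?case using \<omega>(4)[of "bas (g, v)" c] by (simp add: \<omega>_bas evm_single)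
next
  case (add s t)
  then show ?case using \<omega>(3)[OF add(1,2)] by (simp add: evm_add)
qed

sublocale half p N Q Ks X bQ \<kappa> R
proof (unfold_locales, goal_cases)
  case (1 q) then show ?case by (rule R_hom)
next
  case (2 q v) then show ?case by (rule R_len)
next
  case (3 s)
  have "pm.subspace {s. evw s = \<zero>\<^bsub>Q\<^esub>}" by (auto simp: pm.subspace_def)
  moreover have "plin (\<lambda>w. bas (a @ w @ b)) q \<in> {s. evw s = \<zero>\<^bsub>Q\<^esub>}" if "q \<in> R" for a b q
  proof -
    have ev: "evw (plin (\<lambda>w. bas (a @ w @ b)) s) = bw a \<otimes>\<^bsub>Q\<^esub> evw s \<otimes>\<^bsub>Q\<^esub> bw b" for s
    proof -
      have "supp s \<subseteq> UNIV" by simp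
      then show ?thesis
      proof (induction rule: pm_induct)
        case (single v c)
        have "bw (a @ v @ b) = bw a \<otimes>\<^bsub>Q\<^esub> bw v \<otimes>\<^bsub>Q\<^esub> bw b"
          by (simp only: bw_append Q.m_assoc b_closed one_Ks)
        then show ?case by (simp add: Q.smult_mult_l Q.smult_mult_r)
      qed (simp_all add: plin_add Q.l_distr Q.r_distr)
    qed
    note t = words_TX[of q]
    have "evw s = evm (plin (\<lambda>w. bas (\<one>\<^sub>H, w)) s)" for s
    proof -
      have sup: "supp (plin (\<lambda>w. bas (\<one>\<^sub>H, w)) s :: _ \<Rightarrow>\<^sub>0 'k) \<subseteq> Ks \<times> UNIV" for s
        by (rule supp_plin_subset) auto
      have "supp s \<subseteq> UNIV" by simp
      then show ?thesis
        by (induction rule: pm_induct) (simp_all add: evm_single plin_add evm_add sup)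
    qed
    then have "evw q = Qi +>\<^bsub>GXg\<^esub> npoly_Fn p N X q" using t by (simp add: evm_\<omega> \<omega>_def npoly_\<theta>)
    moreover have "npoly_Fn p N X q \<in> Qi" "npoly_Fn p N X q \<in> carrier GXg"
      unfolding Qi_def using GX.genideal_self[OF npoly_GX] npoly_GX that by auto
    ultimately have "evw q = \<zero>\<^bsub>Q\<^esub>" using GX.quot_alg_eq_zero_iff[OF Qi_ideal] by (simp add: Q_zero)
    then show ?thesis by (simp add: ev)
  qed
  ultimately show ?case using word_ideal_least[of "{s. evw s = \<zero>\<^bsub>Q\<^esub>}" R s] 3 by blast
next
  case (4 t g)
  then have t: "t \<in> carrier TX" by simp
  then have "\<omega> t = \<zero>\<^bsub>Q\<^esub>" using 4 evm_\<omega> by simp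
  then have "\<theta> t \<in> Qi"
    using GX.quot_alg_eq_zero_iff[OF Qi_ideal, of "\<theta> t"] GXg_carrier t by (auto simp: \<omega>_def Q_zero)
  then have "t \<in> KI" by (rule \<theta>_Qi[OF t])
  then show ?case unfolding KI_def
  proof (rule plin_span_into[rotated 2])
    fix z assume "z \<in> {plin (\<lambda>w. bas (g, a @ w @ b)) q | g a b q. g \<in> Ks \<and> q \<in> R}"
    then obtain g' a b q where z: "z = plin (\<lambda>w. bas (g', a @ w @ b)) q" "g' \<in> Ks" "q \<in> R" by blast
    then show "plin (\<lambda>(g', v). if g' = g then bas v else 0) z \<in> word_ideal R"
      using word_ideal_gen[OF z(3), of a b] pm.subspace_0[OF word_ideal_subspace]
      by (cases "g' = g") (simp_all add: plin_plin)
  qed (rule word_ideal_subspace)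
qed

context
  fixes C :: "('k, 'c) module" and \<Phi> \<tau>
  assumes C: "k_algebra C" and \<Phi>: "\<Phi> \<in> alg_hom SK C" and ball: "\<forall>t\<in>carrier TX. \<tau> (\<omega> t) = \<Phi> (E t)"
begin

lemmas \<tau> = bspec[OF ball]

lemma extend_bQ: "g \<in> Ks \<Longrightarrow> \<tau> (bQ g v) = \<Phi> (bas (g, map X v))"
  using \<tau>[of "bas (g, v)"] by (simp add: \<omega>_bas E_def)

text \<open>Meant for \<tau> = \<open>to_A\<close>, which is defined by adding the ideal of A to a
  coset: its linearity, and below its multiplicativity, follow from its agreement with the
  projection \<Phi> on representatives.\<close>

lemma extend_klin: "klin Q C \<tau>"
proof (rule klinI)
  fix x c assume "x \<in> carrier Q"
  then obtain s where s: "s \<in> carrier TX" "x = \<omega> s" unfolding \<omega>_surj[symmetric] by blast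
  note Es = E_closed[OF s(1)] and \<Phi>' = alg_homD[OF \<Phi>]
  show "\<tau> x \<in> carrier C" using \<Phi>'(2)[OF Es] by (simp add: s(2) \<tau>[OF s(1)])
  show "\<tau> (c \<odot>\<^bsub>Q\<^esub> x) = c \<odot>\<^bsub>C\<^esub> \<tau> x"
    using \<tau>[OF TX.smult_closed[OF s(1)], of c] \<omega>(4)[OF s(1), of c] \<Phi>'(4)[OF Es, of c]
    by (simp add: s(2) \<tau>[OF s(1)]) (simp add: E_def plin_scl)
  fix y assume "y \<in> carrier Q"
  then obtain t where t: "t \<in> carrier TX" "y = \<omega> t" unfolding \<omega>_surj[symmetric] by blast
  show "\<tau> (x \<oplus>\<^bsub>Q\<^esub> y) = \<tau> x \<oplus>\<^bsub>C\<^esub> \<tau> y"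
    using \<tau>[OF TX.a_closed[OF s(1) t(1)]] \<omega>(3)[OF s(1) t(1)] \<Phi>'(3)[OF Es E_closed[OF t(1)]]
    by (simp add: s(2) t(2) \<tau>[OF s(1)] \<tau>[OF t(1)]) (simp add: E_def plin_add)
qed

lemma extend_hom: "\<tau> \<in> alg_hom Q C"
proof (rule alg_hom_of_span[OF Q.k_alg C extend_klin monomials_closed b_span])
  note \<Phi>' = alg_homD[OF \<Phi>]
  fix s t assume "s \<in> {bQ g v | g v. g \<in> Ks}" "t \<in> {bQ g v | g v. g \<in> Ks}"
  then obtain g v g' v' where s: "s = bQ g v" "g \<in> Ks" and t: "t = bQ g' v'" "g' \<in> Ks" by blast
  have k: "g \<otimes>\<^sub>H g' \<in> Ks" by (rule Ks_closed(2)[OF s(2) t(2)])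
  have c: "bas (g, map X v) \<in> carrier SK" "bas (g', map X v') \<in> carrier SK" "bas (g \<otimes>\<^sub>H g', map X (v @ v')) \<in> carrier SK"
    using s(2) t(2) by auto
  have e: "bas (g, map X v) \<otimes>\<^bsub>SK\<^esub> bas (g', map X v') = scl (chi_word (map X v) g') (bas (g \<otimes>\<^sub>H g', map X (v @ v')))"
    by (simp add: SK_mult)
  have "\<Phi> (bas (g, map X v) \<otimes>\<^bsub>SK\<^esub> bas (g', map X v')) =
      chi_word (map X v) g' \<odot>\<^bsub>C\<^esub> \<Phi> (bas (g \<otimes>\<^sub>H g', map X (v @ v')))"
    unfolding e using \<Phi>'(4)[OF c(3), of "chi_word (map X v) g'"] by (simp only: SK_simps)
  then show "\<tau> (s \<otimes>\<^bsub>Q\<^esub> t) = \<tau> s \<otimes>\<^bsub>C\<^esub> \<tau> t"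
    unfolding s(1) t(1) b_mult[OF s(2) t(2)] klinD(3)[OF extend_klin b_closed[OF k]]
      extend_bQ[OF k] extend_bQ[OF s(2)] extend_bQ[OF t(2)] \<Phi>'(5)[OF c(1,2)] by (rule sym)
next
  show "\<tau> \<one>\<^bsub>Q\<^esub> = \<one>\<^bsub>C\<^esub>" using extend_bQ[of "\<one>\<^sub>H" "[]"] alg_homD(6)[OF \<Phi>] b_one by simp
qed

end

end

lemma act_plin: "adm p N \<Longrightarrow> adm.act p N (plin f t) x = plin (\<lambda>k. adm.act p N (f k) x) t"
  by (simp add: adm.act_def plin_plin)

lemma plin_injective:
  assumes "plin (\<lambda>k. sgl (f k) (c k)) t = 0" "inj f" "\<And>k. k \<in> supp t \<Longrightarrow> c k \<noteq> 0"
  shows "t = 0"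
proof (rule poly_mapping_eqI)
  fix k
  have "lookup (plin (\<lambda>k. sgl (f k) (c k)) t) (f k) = lookup t k * c k"
    using assms(2) by (intro lookup_plin_at) (auto simp: lookup_single inj_eq when_def)
  then show "lookup t k = lookup 0 k" using assms(1,3) by (cases "k \<in> supp t") (auto simp: in_keys_iff)
qed

lemma (in ring) minus_minus_zero:
  assumes "x \<ominus> y \<ominus> z = \<zero>" "x \<in> carrier R" "y \<in> carrier R" "z \<in> carrier R"
  shows "x = y \<oplus> z"
proof -
  have "x = (x \<ominus> y \<ominus> z) \<oplus> (y \<oplus> z)" using assms(2-4) by algebra
  then show ?thesis using assms by simp
qed

section \<open>The algebra A and its two halves\<close>

locale quo = adm p N
  for p :: "'n::finite \<Rightarrow> 'n \<Rightarrow> 'k::field" and N +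
  fixes u :: "'l \<Rightarrow> ('k, 'n) npoly" and L :: "'l set" and w :: "'t \<Rightarrow> ('k, 'n) npoly" and T :: "'t set"
  assumes u_hom: "\<And>l. l \<in> L \<Longrightarrow> homogeneous_npoly (u l)"
    and u_len: "\<And>l v. l \<in> L \<Longrightarrow> v \<in> supp (u l) \<Longrightarrow> length v > 1"
    and w_hom: "\<And>t. t \<in> T \<Longrightarrow> homogeneous_npoly (w t)"
    and w_len: "\<And>t v. t \<in> T \<Longrightarrow> v \<in> supp (w t) \<Longrightarrow> length v > 1"
    and Ap_hopf: "Ap_is_hopf p N u L" and Am_hopf: "Am_is_hopf p N w T"
begin

sublocale P: half_data p N Xp "G_in_H p N" gg "u ` L"
proof (unfold_locales, goal_cases)
  case 2 show ?case by (rule G_in_H_generate)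
next
  case (3 t)
  have "act (plin (\<lambda>(g, v). bas (g, map Xp v)) t) e0 = plin (\<lambda>(g, v). bas ([] :: 'n list, g, v)) t"
    unfolding act_plin[OF adm_axioms] using 3(1) subgroup.subset[OF G_sub]
    by (intro plin_eq_on[OF 3(1)]) (auto simp: act_e0_plus simp del: act_simps)
  then have "plin (\<lambda>k. sgl (case k of (g, v) \<Rightarrow> ([] :: 'n list, g, v)) 1) t = 0"
    using 3(2) by (simp add: case_prod_unfold)
  then show ?case by (rule plin_injective) (auto simp: inj_def)
qed (use u_hom u_len in auto)

sublocale M: half_data p N Xm "F_in_H p N" ff "w ` T"
proof (unfold_locales, goal_cases)
  case 2 show ?case by (rule F_in_H_generate)
next
  case (3 t)
  have "act (plin (\<lambda>(g, v). bas (g, map Xm v)) t) e0 = plin (\<lambda>(g, v). sgl (v, g, [] :: 'n list) (cm v g)) t"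
    unfolding act_plin[OF adm_axioms] using 3(1) subgroup.subset[OF F_sub]
    by (intro plin_eq_on[OF 3(1)]) (auto simp: act_e0_minus simp del: act_simps)
  then have "plin (\<lambda>k. sgl (case k of (g, v) \<Rightarrow> (v, g, [] :: 'n list)) (case k of (g, v) \<Rightarrow> cm v g)) t = 0"
    using 3(2) by (simp add: case_prod_unfold)
  then show ?case
    by (rule plin_injective) (use 3(1) subgroup.subset[OF F_sub] cm_nz in \<open>auto simp: inj_def\<close>)
qed (use w_hom w_len in auto)

abbreviation "AA \<equiv> A_alg p N u L w T"
abbreviation mult_A (infixl "\<otimes>\<^sub>A" 70) where "(\<otimes>\<^sub>A) \<equiv> mult AA"
abbreviation add_A (infixl "\<oplus>\<^sub>A" 65) where "(\<oplus>\<^sub>A) \<equiv> add AA"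
abbreviation smult_A (infixl "\<odot>\<^sub>A" 70) where "(\<odot>\<^sub>A) \<equiv> smult AA"
abbreviation one_A ("\<one>\<^sub>A") where "\<one>\<^sub>A \<equiv> one AA"
abbreviation zero_A ("\<zero>\<^sub>A") where "\<zero>\<^sub>A \<equiv> zero AA"
abbreviation "Acls \<equiv> A_cls p N u L w T"
abbreviation "Aid \<equiv> A_ideal p N u L w T"
abbreviation "toA \<equiv> to_A p N u L w T"

lemma Ap_ideal_eq: "Ap_ideal p N u L = P.Qi"
proof -
  have "{npoly_Fn p N Xp (u l) | l. l \<in> L} = npoly_Fn p N Xp ` u ` L" by auto
  then show ?thesis by (simp add: Ap_ideal_def P.Qi_def GX_alg_def P.GXg_def)
qed

lemma Am_ideal_eq: "Am_ideal p N w T = M.Qi"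
proof -
  have "{npoly_Fn p N Xm (w l) | l. l \<in> T} = npoly_Fn p N Xm ` w ` T" by auto
  then show ?thesis by (simp add: Am_ideal_def M.Qi_def FX_alg_def M.GXg_def)
qed

lemma Ap_eq: "Ap_alg p N u L = P.Q" "Ap_cls p N u L = P.Qcls"
  by (auto simp: Ap_alg_def Ap_cls_def fun_eq_iff P.Q_def P.Qcls_def Ap_ideal_eq GX_alg_def P.GXg_def)

lemma Am_eq: "Am_alg p N w T = M.Q" "Am_cls p N w T = M.Qcls"
  by (auto simp: Am_alg_def Am_cls_def fun_eq_iff M.Q_def M.Qcls_def Am_ideal_eq FX_alg_def M.GXg_def)

lemma Ap_generators: "Ap_grouplikes p N u L = P.gens_g" "Ap_skew_primitives p N u L = P.gens_x"
  by (auto simp: Ap_grouplikes_def Ap_skew_primitives_def Ap_eq gg_def)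

lemma Am_generators: "Am_grouplikes p N w T = M.gens_g" "Am_skew_primitives p N w T = M.gens_x"
  by (auto simp: Am_grouplikes_def Am_skew_primitives_def Am_eq ff_def)

lemma Ap_coproduct_is: "is_coproduct P.Q P.gens_g P.gens_x (Ap_coproduct p N u L)"
proof -
  obtain \<Delta> where \<Delta>: "is_coproduct P.Q P.gens_g P.gens_x \<Delta>"
    using Ap_hopf by (auto simp: Ap_is_hopf_def is_hopf_algebra_def Ap_eq Ap_generators)
  then show ?thesis unfolding Ap_coproduct_def Ap_eq Ap_generators P.coproduct_eq[OF \<Delta>] .
qed

lemma Am_coproduct_is: "is_coproduct M.Q M.gens_g M.gens_x (Am_coproduct p N w T)"
proof -
  obtain \<Delta> where \<Delta>: "is_coproduct M.Q M.gens_g M.gens_x \<Delta>"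
    using Am_hopf by (auto simp: Am_is_hopf_def is_hopf_algebra_def Am_eq Am_generators)
  then show ?thesis unfolding Am_coproduct_def Am_eq Am_generators M.coproduct_eq[OF \<Delta>] .
qed

abbreviation "qm i j \<equiv> inverse (p j i)"

text \<open>The matrix q is given by x_i \<gamma>_j = q_ij \<gamma>_j x_i. In A^+ this is x_i g_j =
  p_ij g_j x_i, and in A^- it is x^-_i f_j = p_ji^-1 f_j x^-_i.\<close>

lemma Pq: "P.q = p"
  by (auto simp: P.q_def fun_eq_iff)

lemma Mq: "M.q = qm"
  by (auto simp: M.q_def fun_eq_iff)

lemma Ip_deriv: "s \<in> P.I \<Longrightarrow> plin (dl p j) s \<in> P.I" "s \<in> P.I \<Longrightarrow> plin (dr p j) s \<in> P.I"
  using P.dl_ideal[OF Ap_coproduct_is] P.dr_ideal[OF Ap_coproduct_is] by (simp_all add: Pq)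

lemma Im_deriv: "s \<in> M.I \<Longrightarrow> plin (dl qm j) s \<in> M.I" "s \<in> M.I \<Longrightarrow> plin (dr qm j) s \<in> M.I"
  using M.dl_ideal[OF Am_coproduct_is] M.dr_ideal[OF Am_coproduct_is] by (simp_all add: Mq)

definition A_rels :: "('k, 'n) sk set" where
  "A_rels = emb Xp ` u ` L \<union> emb Xm ` w ` T"

lemma A_rels_closed: "A_rels \<subseteq> carrier SK"
  unfolding A_rels_def using emb_closed by blast

lemma A_ideal_eq: "Aid = Idl\<^bsub>Fn p N\<^esub> (Fn_cls p N ` A_rels)"
proof -
  have "{npoly_Fn p N Xp (u l) | l. l \<in> L} \<union> {npoly_Fn p N Xm (w t) | t. t \<in> T} = Fn_cls p N ` A_rels"
    by (auto simp: A_rels_def npoly_Fn_eq)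
  then show ?thesis by (simp add: A_ideal_def)
qed

lemma Fn_A_rels: "Fn_cls p N ` A_rels \<subseteq> carrier (Fn p N)"
  using A_rels_closed Fn_cls_surj by blast

lemma A_ideal_ideal: "ideal Aid (Fn p N)"
  unfolding A_ideal_eq by (rule Fn.genideal_ideal[OF Fn_A_rels])

sublocale A0: k_algebra AA
  unfolding A_alg_def by (rule Fn.k_algebra_quot[OF A_ideal_ideal])

lemma Acls_hom: "Acls \<in> alg_hom SK AA"
  unfolding A_cls_def[abs_def] A_alg_def
  by (rule alg_hom_comp[OF Fn_cls_hom Fn.proj_hom[OF A_ideal_ideal]])

lemmas Acls = alg_homD[OF Acls_hom]

lemma Acls_surj: "Acls ` carrier SK = carrier AA"
  unfolding A_alg_def Fn.quot_alg_carrier A_cls_def[abs_def] Fn_cls_surj[symmetric] by (simp add: image_image)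

lemma A_zero: "\<zero>\<^sub>A = Aid"
  by (simp add: A_alg_def quot_alg_simps)

lemma Acls_zero_iff: "a \<in> carrier SK \<Longrightarrow> Acls a = \<zero>\<^sub>A \<longleftrightarrow> Fn_cls p N a \<in> Aid"
  unfolding A_zero A_cls_def using Fn_cls_simps(1) by (intro Fn.quot_alg_eq_zero_iff[OF A_ideal_ideal])

lemma Acls_rels_zero:
  assumes "r \<in> Fn_rels \<union> A_rels"
  shows "Acls r = \<zero>\<^sub>A"
proof -
  have r: "r \<in> carrier SK" using assms Fn_rels_closed A_rels_closed by blast
  interpret I: ideal Aid "Fn p N" by (rule A_ideal_ideal)
  from assms show ?thesis
  proof
    assume "r \<in> Fn_rels"
    then have "r \<in> Fn_ideal p N" unfolding Fn_ideal_eq using SK.genideal_self[OF Fn_rels_closed] by blast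
    then have "Fn_cls p N r = \<zero>\<^bsub>Fn p N\<^esub>" using Fn_cls_zero_iff[OF r] by simp
    then show ?thesis using Acls_zero_iff[OF r] I.zero_closed by simp
  next
    assume "r \<in> A_rels"
    then have "Fn_cls p N r \<in> Aid" unfolding A_ideal_eq using Fn.genideal_self[OF Fn_A_rels] by blast
    then show ?thesis using Acls_zero_iff[OF r] by simp
  qed
qed

text \<open>A is a quotient of a quotient of the skew group algebra. An ideal of the latter that
  contains both kinds of relations contains everything that vanishes in A. It is applied to the
  annihilator of V0/J, for the coordinates, and to the kernel of \<open>\<phi>\<close>, for the
  coproduct.\<close>

lemma Acls_kernel:
  assumes "ideal K SK" "Fn_rels \<subseteq> K" "A_rels \<subseteq> K" "a \<in> carrier SK" "Acls a = \<zero>\<^sub>A"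
  shows "a \<in> K"
proof (rule ideal_preimage_subset[OF SK.k_alg Fn.k_alg Fn_cls_hom Fn_cls_surj assms(1) _ assms(3,4)])
  show "Fn_cls p N a \<in> Idl\<^bsub>Fn p N\<^esub> (Fn_cls p N ` A_rels)"
    using assms(5) Acls_zero_iff[OF assms(4)] A_ideal_eq by simp
  have "Fn_ideal p N \<subseteq> K" unfolding Fn_ideal_eq by (rule SK.genideal_minimal[OF assms(1,2)])
  then show "x \<in> K" if "x \<in> carrier SK" "Fn_cls p N x = \<zero>\<^bsub>Fn p N\<^esub>" for x
    using that Fn_cls_zero_iff by blast
qed

abbreviation "bA h v \<equiv> Acls (bas (h, v))"

primrec \<gamma>A :: "'n letter \<Rightarrow> ('k, 'n) hgrp" where
  "\<gamma>A (Xp i) = gg i" | "\<gamma>A (Xm i) = ff i"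

lemma bA_mult:
  assumes "g \<in> carrier HH" "g' \<in> carrier HH"
  shows "bA g v \<otimes>\<^sub>A bA g' v' = chi_word v g' \<odot>\<^sub>A bA (g \<otimes>\<^sub>H g') (v @ v')"
proof -
  have c: "bas (g, v) \<in> carrier SK" "bas (g', v') \<in> carrier SK" "bas (g \<otimes>\<^sub>H g', v @ v') \<in> carrier SK"
    using assms by auto
  have "bas (g, v) \<otimes>\<^bsub>SK\<^esub> bas (g', v') = scl (chi_word v g') (bas (g \<otimes>\<^sub>H g', v @ v'))"
    by (simp add: SK_mult)
  then show ?thesis using Acls(5)[OF c(1,2)] Acls(4)[OF c(3), of "chi_word v g'"] by simp
qed

lemma bA_closed: "g \<in> carrier HH \<Longrightarrow> bA g v \<in> carrier AA"
  by (rule Acls(2)) simp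

sublocale A: malg p N AA "carrier HH" "\<lambda>x. x" bA \<gamma>A "range gg \<union> range ff"
proof (unfold_locales, goal_cases)
  case 1 show ?case by auto
next
  case 2 show ?case by (rule H_generate)
next
  case (3 x) show ?case by (cases x) auto
next
  case (4 g v) then show ?case by (rule bA_closed)
next
  case (5 g g' v v') then show ?case using bA_mult by simp
next
  case 6 show ?case using Acls(6) by simp
next
  case 7
  let ?S = "{bA g v | g v. g \<in> carrier HH}"
  have S: "?S \<subseteq> carrier AA" using bA_closed by blast
  note D = A0.lin_subspaceD[OF A0.lin_subspace_lin_span[OF S]]
  have "Acls t \<in> lin_span AA ?S" if "t \<in> carrier SK" for t
    using that
  proof (induction rule: SK_induct)
    case zero
    then show ?case using D(2) klin_zero[OF SK.k_alg A0.k_alg Acls(1)] by simp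
  next
    case (single g v c)
    have "bA g v \<in> lin_span AA ?S" using A0.lin_span_superset[of ?S] single by blast
    then show ?case using Acls(4)[of "bas (g, v)" c] D(4) single by simp
  next
    case (add s t)
    then show ?case using Acls(3)[OF add(1,2)] D(3) by simp
  qed
  then have "Acls ` carrier SK \<subseteq> lin_span AA ?S" by (rule image_subsetI)
  then show ?case using D(1) unfolding Acls_surj by (rule equalityI)
qed

lemma Acls_diff: "a \<in> carrier SK \<Longrightarrow> b \<in> carrier SK \<Longrightarrow> Acls (a - b) = Acls a \<ominus>\<^bsub>AA\<^esub> Acls b"
proof -
  assume ab: "a \<in> carrier SK" "b \<in> carrier SK"
  have "a - b = a \<ominus>\<^bsub>SK\<^esub> b" using SK_minus ab by simp
  then show ?thesis
    using Acls(3)[OF ab(1) SK.a_inv_closed[OF ab(2)]] klin_minus[OF SK.k_alg A0.k_alg Acls(1) ab(2)]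
    by (simp only: a_minus_def SK_simps)
qed

sublocale A: rel_alg p N AA bA \<gamma>A "range gg \<union> range ff"
proof (unfold_locales, goal_cases)
  case (1 i j)
  let ?x = "bas (\<one>\<^sub>H, [Xp i, Xm j]) :: ('k, 'n) sk" and ?y = "sgl (\<one>\<^sub>H, [Xm j, Xp i]) (p j i) :: ('k, 'n) sk"
  let ?d = "bas (\<one>\<^sub>H, []) - bas (gf i, []) :: ('k, 'n) sk"
  have c: "?x \<in> carrier SK" "?y \<in> carrier SK" "bas (\<one>\<^sub>H, []) \<in> carrier SK" "bas (gf i, []) \<in> carrier SK" by auto
  have d: "?d \<in> carrier SK" unfolding SK_simps mem_Collect_eq by (rule supp_diff_subset) auto
  have z: "Acls 0 = \<zero>\<^sub>A" using klin_zero[OF SK.k_alg A0.k_alg Acls(1)] by simp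
  let ?e = "if i = j then ?d else 0"
  have e: "?e \<in> carrier SK"
  proof (cases "i = j")
    case True
    then have "?e = ?d" by (rule if_P)
    then show ?thesis using d by (simp only:)
  next
    case False
    then have "?e = 0" by (rule if_not_P)
    then show ?thesis using SK.zero_closed by (simp only: SK_simps(3))
  qed
  have Ae: "Acls ?e = (if i = j then \<one>\<^sub>A \<ominus>\<^bsub>AA\<^esub> bA (gf i) [] else \<zero>\<^sub>A)"
    using Acls_diff[OF c(3,4)] z Acls(6) by (auto simp del: supp_diff_subset)
  have Ay: "Acls ?y = p j i \<odot>\<^sub>A (bA \<one>\<^sub>H [Xm j] \<otimes>\<^sub>A bA \<one>\<^sub>H [Xp i])"
    using Acls(4)[of "bas (\<one>\<^sub>H, [Xm j, Xp i])" "p j i"] bA_closed[of "\<one>\<^sub>H" "[Xm j, Xp i]"]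
    by (simp add: bA_mult A0.smult_one)
  have Ax: "Acls ?x = bA \<one>\<^sub>H [Xp i] \<otimes>\<^sub>A bA \<one>\<^sub>H [Xm j]"
    using bA_closed[of "\<one>\<^sub>H" "[Xp i, Xm j]"] by (simp add: bA_mult A0.smult_one)
  have "?x - ?y - ?e \<in> Fn_rels" unfolding Fn_rels_def by blast
  then have "Acls (?x - ?y - ?e) = \<zero>\<^sub>A" using Acls_rels_zero by blast
  moreover have xy: "?x - ?y \<in> carrier SK" unfolding SK_simps mem_Collect_eq by (rule supp_diff_subset) auto
  ultimately have "(Acls ?x \<ominus>\<^bsub>AA\<^esub> Acls ?y) \<ominus>\<^bsub>AA\<^esub> Acls ?e = \<zero>\<^sub>A"
    using Acls_diff[OF xy e] Acls_diff[OF c(1,2)] by simp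
  moreover have "Acls ?x \<in> carrier AA" "Acls ?y \<in> carrier AA" "Acls ?e \<in> carrier AA"
    using Acls(2) c e by blast+
  ultimately have "Acls ?x = Acls ?y \<oplus>\<^sub>A Acls ?e" by (intro A0.minus_minus_zero)
  then show ?case unfolding Ax Ay Ae .
qed

lemma P_Qi_Aid: "P.Qi \<subseteq> Aid" and M_Qi_Aid: "M.Qi \<subseteq> Aid"
proof -
  note self = Fn.genideal_self[OF Fn_A_rels, folded A_ideal_eq]
  have hom: "(\<lambda>x. x) \<in> alg_hom P.GXg (Fn p N)" "(\<lambda>x. x) \<in> alg_hom M.GXg (Fn p N)"
    using Fn.k_subalgebraD(1)[OF P.GXg_subalgebra] Fn.k_subalgebraD(1)[OF M.GXg_subalgebra]
    by (simp_all add: alg_hom_def ring_hom_def Pi_iff subset_iff)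
  have "P.Qi \<subseteq> {x \<in> carrier P.GXg. x \<in> Aid}"
    unfolding P.Qi_def
    by (rule P.GX.genideal_minimal[OF ideal_hom_vimage[OF P.GX.k_alg Fn.k_alg hom(1) A_ideal_ideal]])
      (use self P.npoly_GX in \<open>auto simp: A_rels_def npoly_Fn_eq\<close>)
  then show "P.Qi \<subseteq> Aid" by blast
  have "M.Qi \<subseteq> {x \<in> carrier M.GXg. x \<in> Aid}"
    unfolding M.Qi_def
    by (rule M.GX.genideal_minimal[OF ideal_hom_vimage[OF M.GX.k_alg Fn.k_alg hom(2) A_ideal_ideal]])
      (use self M.npoly_GX in \<open>auto simp: A_rels_def npoly_Fn_eq\<close>)
  then show "M.Qi \<subseteq> Aid" by blast
qed

lemma toA_coset:
  assumes "x \<in> carrier (Fn p N)" "Z \<subseteq> Aid" "\<zero>\<^bsub>Fn p N\<^esub> \<in> Z"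
  shows "toA (Z +>\<^bsub>Fn p N\<^esub> x) = Aid +>\<^bsub>Fn p N\<^esub> x"
proof -
  interpret I: ideal Aid "Fn p N" by (rule A_ideal_ideal)
  have c: "Z +>\<^bsub>Fn p N\<^esub> x = (\<lambda>i. i \<oplus>\<^bsub>Fn p N\<^esub> x) ` Z" for Z by (auto simp: a_r_coset_def r_coset_def)
  have s: "toA C = {i \<oplus>\<^bsub>Fn p N\<^esub> y | i y. i \<in> Aid \<and> y \<in> C}" for C
    by (auto simp: to_A_def set_add_def set_mult_def)
  show ?thesis unfolding c s
  proof (intro equalityI subsetI)
    fix y assume "y \<in> {i \<oplus>\<^bsub>Fn p N\<^esub> y | i y. i \<in> Aid \<and> y \<in> (\<lambda>i. i \<oplus>\<^bsub>Fn p N\<^esub> x) ` Z}"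
    then obtain i j where ij: "i \<in> Aid" "j \<in> Z" "y = i \<oplus>\<^bsub>Fn p N\<^esub> (j \<oplus>\<^bsub>Fn p N\<^esub> x)" by blast
    have j: "j \<in> Aid" using ij(2) assms(2) by blast
    then have "y = (i \<oplus>\<^bsub>Fn p N\<^esub> j) \<oplus>\<^bsub>Fn p N\<^esub> x"
      using ij assms(1) by (simp add: Fn.a_assoc I.Icarr)
    then show "y \<in> (\<lambda>i. i \<oplus>\<^bsub>Fn p N\<^esub> x) ` Aid" using I.a_closed[OF ij(1) j] by blast
  next
    fix y assume "y \<in> (\<lambda>i. i \<oplus>\<^bsub>Fn p N\<^esub> x) ` Aid"
    then obtain i where i: "i \<in> Aid" "y = i \<oplus>\<^bsub>Fn p N\<^esub> x" by blast
    then have "y = i \<oplus>\<^bsub>Fn p N\<^esub> (\<zero>\<^bsub>Fn p N\<^esub> \<oplus>\<^bsub>Fn p N\<^esub> x)" using assms(1) by simp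
    with i(1) assms(3) show "y \<in> {i \<oplus>\<^bsub>Fn p N\<^esub> y | i y. i \<in> Aid \<and> y \<in> (\<lambda>i. i \<oplus>\<^bsub>Fn p N\<^esub> x) ` Z}" by blast
  qed
qed

lemma toA_P: "t \<in> carrier P.TX \<Longrightarrow> toA (P.\<omega> t) = Acls (P.E t)"
proof -
  assume t: "t \<in> carrier P.TX"
  have "P.\<theta> t \<in> carrier (Fn p N)" using P.\<theta>(2) t by blast
  moreover have "\<zero>\<^bsub>Fn p N\<^esub> \<in> P.Qi"
    using additive_subgroup.zero_closed[OF ideal.axioms(1)[OF P.Qi_ideal]] by simp
  moreover have "P.\<omega> t = P.Qi +>\<^bsub>Fn p N\<^esub> P.\<theta> t"
    by (simp add: P.\<omega>_def a_r_coset_def r_coset_def)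
  ultimately show ?thesis
    using toA_coset[OF _ P_Qi_Aid] by (simp add: A_cls_def P.\<theta>_E[OF t])
qed

lemma toA_M: "t \<in> carrier M.TX \<Longrightarrow> toA (M.\<omega> t) = Acls (M.E t)"
proof -
  assume t: "t \<in> carrier M.TX"
  have "M.\<theta> t \<in> carrier (Fn p N)" using M.\<theta>(2) t by blast
  moreover have "\<zero>\<^bsub>Fn p N\<^esub> \<in> M.Qi"
    using additive_subgroup.zero_closed[OF ideal.axioms(1)[OF M.Qi_ideal]] by simp
  moreover have "M.\<omega> t = M.Qi +>\<^bsub>Fn p N\<^esub> M.\<theta> t"
    by (simp add: M.\<omega>_def a_r_coset_def r_coset_def)
  ultimately show ?thesis
    using toA_coset[OF _ M_Qi_Aid] by (simp add: A_cls_def M.\<theta>_E[OF t])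
qed

end

section \<open>Triangular coordinates\<close>

text \<open>A graded ideal is spanned by homogeneous elements, and on these the characters occurring
  in the operators are constant.\<close>

lemma plin_of_homogeneous:
  fixes I :: "('k::field, 'n::finite) npoly set"
  assumes J: "pm.subspace J" and graded: "\<And>d s. s \<in> I \<Longrightarrow> comp d s \<in> I"
    and hom: "\<And>s d. s \<in> I \<Longrightarrow> (\<And>v. v \<in> supp s \<Longrightarrow> count_list v = d) \<Longrightarrow> plin f s \<in> J" and s: "s \<in> I"
  shows "plin f s \<in> J"
proof -
  let ?D = "count_list ` supp s"
  have "s = (\<Sum>d\<in>?D. comp d s)" by (simp only: sum_rst_fibres)
  then have "plin f s = (\<Sum>d\<in>?D. plin f (comp d s))" using plin_sum by metis
  moreover have "plin f (comp d s) \<in> J" for d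
    by (rule hom[OF graded[OF s], of d d]) (auto simp: in_keys_iff lookup_rst split: if_splits)
  ultimately show ?thesis by (simp add: pm.subspace_sum[OF J])
qed

text \<open>The pure tensor s \<otimes> h \<otimes> t in triangular coordinates; its value in A is
  the product of s in the x^-_i, of h, and of t in the x_i (\<open>ev_T3\<close>).\<close>

definition T3 :: "('k::field, 'n) npoly \<Rightarrow> ('k, 'n) hgrp \<Rightarrow> ('k, 'n) npoly \<Rightarrow> ('k, 'n) tri" where
  "T3 s h t = plin (\<lambda>a. plin (\<lambda>c. bas (a, h, c)) t) s"

lemma T3_simps [simp]:
  "T3 0 h t = 0" "T3 s h 0 = 0" "T3 (s + s') h t = T3 s h t + T3 s' h t" "T3 s h (t + t') = T3 s h t + T3 s h t'"
  "T3 (s - s') h t = T3 s h t - T3 s' h t" "T3 s h (t - t') = T3 s h t - T3 s h t'"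
  "T3 (scl c s) h t = scl c (T3 s h t)" "T3 s h (scl c t) = scl c (T3 s h t)"
  "T3 (sgl a c) h (sgl b d) = sgl (a, h, b) (c * d)"
  by (simp_all add: T3_def plin_add plin_fun_add plin_diff plin_fun_diff plin_scl plin_fun_scl mult.commute)

lemma T3_plin_left: "T3 (plin f s) h t = plin (\<lambda>a. T3 (f a) h t) s"
  by (simp add: T3_def plin_plin)

lemma T3_plin_right: "T3 s h (plin f t) = plin (\<lambda>c. T3 s h (f c)) t"
proof -
  have "T3 s h (plin f t) = plin (\<lambda>c. plin (\<lambda>a. plin (\<lambda>c. bas (a, h, c)) (f c)) s) t"
    unfolding T3_def plin_plin by (rule plin_commute)
  then show ?thesis by (simp add: T3_def)
qed

lemma lookup_T3: "lookup (T3 s h t) (a, g, c) = (if g = h then lookup s a * lookup t c else 0)"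
proof -
  have "lookup (plin (\<lambda>c. bas (a', h, c)) t) (a, g, c) = lookup t c * (if a' = a \<and> g = h then 1 else 0)" for a'
    by (rule lookup_plin_at) (auto simp: lookup_single when_def)
  then have "lookup (T3 s h t) (a, g, c) = lookup s a * (if g = h then lookup t c else 0)"
    unfolding T3_def by (intro lookup_plin_at) auto
  then show ?thesis by simp
qed

context quo
begin

lemma T3_V0: "h \<in> carrier HH \<Longrightarrow> T3 s h t \<in> V0"
  unfolding T3_def V0_def mem_Collect_eq by (intro supp_plin_subset) auto

lemma Ip_comp: "s \<in> P.I \<Longrightarrow> comp d s \<in> P.I"
  by (rule word_ideal_comp) (use u_hom in auto)

abbreviation "pl i a \<equiv> prod_list (map (\<lambda>j. p j i) a)"
abbreviation "pr i a \<equiv> prod_list (map (\<lambda>j. p i j) a)"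

lemma pl_nz [simp]: "pl i a \<noteq> 0" and pr_nz [simp]: "pr i a \<noteq> 0"
  by (induction a) auto

lemma cm_gf: "cm a (gf i) = pl i a * pr i a"
  by (induction a) (simp_all add: chiH_mult mult_ac)

lemma prod_list_inverse: "prod_list (map (\<lambda>j. inverse (p j i)) a) = inverse (pl i a)"
  by (induction a) simp_all

text \<open>When x_i passes x^-_a, every letter x^-_i of a contributes 1 - g_i f_i in its place. The
  terms with 1 form the derivative \<open>dr\<close> of a; in the others g_i f_i travels to the
  right past the rest of the word, which turns the weights into those of \<open>dl\<close>. The
  products \<open>pl\<close> and \<open>pr\<close> depend only on the letters of a, and each
  division by p_ii takes out the deleted letter.\<close>

lemma op_formula:
  "h \<in> carrier HH \<Longrightarrow> op i a h c = sgl (a, h, i # c) (pl i a * chiH i h) +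
     scl (pl i a / p i i) (T3 (dr qm i a) h (bas c)) -
     scl (pl i a * pr i a / (p i i * p i i)) (T3 (dl qm i a) (gf i \<otimes>\<^sub>H h) (bas c))"
proof (induction a)
  case (Cons j a)
  have pre: "T3 (pre j s) g (bas c) = Om j (T3 s g (bas c))" for s g
    unfolding T3_plin_left T3_def Om_def plin_plin by simp
  have e1: "scl (p j i) (Om j (op i a h c)) = sgl (j # a, h, i # c) (p j i * (pl i a * chiH i h)) +
      scl (p j i * (pl i a / p i i)) (T3 (pre j (dr qm i a)) h (bas c)) -
      scl (p j i * (pl i a * pr i a / (p i i * p i i))) (T3 (pre j (dl qm i a)) (gf i \<otimes>\<^sub>H h) (bas c))"
    unfolding Cons(1)[OF Cons.prems] by (simp add: pre pm.scale_right_distrib pm.scale_right_diff_distrib)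
  have e2: "scl (pl i (j # a) / p i i) (T3 (dr qm i (j # a)) h (bas c)) =
      scl (p j i * (pl i a / p i i)) (T3 (pre j (dr qm i a)) h (bas c)) + (if i = j then bas (a, h, c) else 0)"
    by (cases "i = j") (simp_all add: pm.scale_right_distrib prod_list_inverse)
  have e3: "scl (pl i (j # a) * pr i (j # a) / (p i i * p i i)) (T3 (dl qm i (j # a)) (gf i \<otimes>\<^sub>H h) (bas c)) =
      scl (p j i * (pl i a * pr i a / (p i i * p i i))) (T3 (pre j (dl qm i a)) (gf i \<otimes>\<^sub>H h) (bas c)) +
      (if i = j then sgl (a, gf i \<otimes>\<^sub>H h, c) (cm a (gf i)) else 0)"
    by (auto simp: pm.scale_right_distrib field_simps cm_gf)
  show ?case
    unfolding op.simps e1 e2 e3 by (cases "i = j") (simp_all add: mult.assoc)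
qed simp

end

section \<open>Normal forms of triangular monomials and the submodule J\<close>

locale coords = quo p N u L w T
  for p :: "'n::finite \<Rightarrow> 'n \<Rightarrow> 'k::field" and N u L w T +
  fixes Wm Wp :: "'n list set" and rm rp :: "'n list \<Rightarrow> ('k, 'n) npoly"
  assumes rm_supp: "\<And>v. supp (rm v) \<subseteq> {x \<in> Wm. count_list x = count_list v}"
    and rm_diff: "\<And>v. bas v - rm v \<in> word_ideal (w ` T)"
    and rm_zero: "\<And>s. s \<in> word_ideal (w ` T) \<Longrightarrow> plin rm s = 0"
    and rm_W: "\<And>v. v \<in> Wm \<Longrightarrow> rm v = bas v"
    and rp_supp: "\<And>v. supp (rp v) \<subseteq> {x \<in> Wp. count_list x = count_list v}"
    and rp_diff: "\<And>v. bas v - rp v \<in> word_ideal (u ` L)"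
    and rp_zero: "\<And>s. s \<in> word_ideal (u ` L) \<Longrightarrow> plin rp s = 0"
    and rp_W: "\<And>v. v \<in> Wp \<Longrightarrow> rp v = bas v"
begin

definition nf :: "('k, 'n) tri \<Rightarrow> ('k, 'n) tri" where
  "nf = plin (\<lambda>(a, h, c). T3 (rm a) h (rp c))"

lemma nf_linear [simp]: "nf (s + t) = nf s + nf t" "nf (s - t) = nf s - nf t" "nf (scl c t) = scl c (nf t)" "nf 0 = 0"
  by (simp_all add: nf_def plin_add plin_diff plin_scl)

lemma nf_single [simp]: "nf (sgl (a, h, c) d) = scl d (T3 (rm a) h (rp c))"
  by (simp add: nf_def)

lemma nf_T3: "nf (T3 s h t) = T3 (plin rm s) h (plin rp t)"
  unfolding T3_plin_left T3_plin_right nf_def T3_def[of s] plin_plin by (simp, rule plin_commute)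

definition J :: "('k, 'n) tri set" where
  "J = {t \<in> V0. nf t = 0}"

lemma J_subspace: "pm.subspace J"
  using V0_subspace by (auto simp: J_def pm.subspace_def)

lemma J_V0: "J \<subseteq> V0" by (auto simp: J_def)

lemma J_T3: "h \<in> carrier HH \<Longrightarrow> s \<in> M.I \<or> t \<in> P.I \<Longrightarrow> T3 s h t \<in> J"
  using rm_zero rp_zero by (auto simp: J_def nf_T3 T3_V0)

text \<open>J is spanned by tensors with left factor in I^- or right factor in I^+, because a
  \<otimes> c - rm(a) \<otimes> rp(c) = (a - rm(a)) \<otimes> c + rm(a) \<otimes> (c - rp(c)). The
  left factors a - rm(a) are homogeneous, since \<open>rm\<close> preserves degrees; the scalars in
  the operators are then constant on them.\<close>

lemma J_induct:
  assumes W: "pm.subspace W"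
    and 1: "\<And>s h c d. s \<in> M.I \<Longrightarrow> (\<And>v. v \<in> supp s \<Longrightarrow> count_list v = d) \<Longrightarrow> h \<in> carrier HH \<Longrightarrow> T3 s h (bas c) \<in> W"
    and 2: "\<And>a h t. t \<in> P.I \<Longrightarrow> h \<in> carrier HH \<Longrightarrow> T3 (bas a) h t \<in> W"
    and t: "t \<in> J"
  shows "t \<in> W"
proof (rule bas_diff_span[OF _ _ _ W])
  show "plin (\<lambda>(a, h, c). T3 (rm a) h (rp c)) t = 0" using t by (simp add: J_def nf_def)
  show "supp t \<subseteq> UNIV \<times> carrier HH \<times> UNIV" using t by (simp add: J_def V0_def)
  fix k :: "'n list \<times> ('k, 'n) hgrp \<times> 'n list" assume "k \<in> UNIV \<times> carrier HH \<times> UNIV"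
  then obtain a h c where k: "k = (a, h, c)" "h \<in> carrier HH" by auto
  have e: "bas (a, h, c) - T3 (rm a) h (rp c) = T3 (bas a - rm a) h (bas c) + T3 (rm a) h (bas c - rp c)"
    by simp
  have e1: "T3 (bas a - rm a) h (bas c) \<in> W"
  proof (rule 1[OF rm_diff _ k(2)])
    fix v assume "v \<in> supp (bas a - rm a)"
    then show "count_list v = count_list a" using supp_diff[of "bas a" "rm a"] rm_supp[of a] by auto
  qed
  have e2: "T3 (rm a) h (bas c - rp c) \<in> W"
  proof -
    have "plin (\<lambda>a. T3 (bas a) h (bas c - rp c)) (rm a) \<in> W"
      unfolding plin_def by (intro pm.subspace_sum[OF W] pm.subspace_scale[OF W] 2[OF rp_diff k(2)])
    then show ?thesis using T3_plin_left[of bas "rm a" h "bas c - rp c"] by simp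
  qed
  show "bas k - (case k of (a, h, c) \<Rightarrow> T3 (rm a) h (rp c)) \<in> W"
    unfolding k prod.case e by (rule pm.subspace_add[OF W e1 e2])
qed

lemma homogeneous_scalar:
  fixes f :: "'n list \<Rightarrow> 'k"
  assumes "\<And>v. v \<in> supp s \<Longrightarrow> count_list v = d" "\<And>v v'. count_list v = count_list v' \<Longrightarrow> f v = f v'"
  obtains c where "\<And>v. v \<in> supp s \<Longrightarrow> f v = c"
proof (cases "supp s = {}")
  case False
  then obtain v0 where "v0 \<in> supp s" by blast
  then have "f v = f v0" if "v \<in> supp s" for v
    using assms(1)[OF that] assms(1)[of v0] by (intro assms(2)) simp
  then show ?thesis by (rule that)
qed (rule that, simp)

lemma cm_count: "count_list v = count_list v' \<Longrightarrow> cm v g = cm v' g"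
  unfolding cm_def chi_word_def map_map by (rule arg_cong[where f = inverse], rule prod_list_cong_count)

lemma J_Oh:
  assumes "g \<in> carrier HH" "t \<in> J"
  shows "Oh g t \<in> J"
proof -
  have "t \<in> {t. Oh g t \<in> J}"
  proof (rule J_induct[OF _ _ _ assms(2)])
    show "pm.subspace {t. Oh g t \<in> J}" using J_subspace by (auto simp: pm.subspace_def)
  next
    fix s h c d assume s: "s \<in> M.I" "\<And>v. v \<in> supp s \<Longrightarrow> count_list v = d" "h \<in> carrier HH"
    obtain k where k: "\<And>v. v \<in> supp s \<Longrightarrow> cm v g = k" by (rule homogeneous_scalar[where f = "\<lambda>v. cm v g", OF s(2)]) (assumption, erule cm_count, blast)
    have "Oh g (T3 s h (bas c)) = plin (\<lambda>a. sgl (a, g \<otimes>\<^sub>H h, c) (cm a g)) s"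
      by (simp add: Oh_def T3_def plin_plin)
    also have "\<dots> = plin (\<lambda>a. scl k (bas (a, g \<otimes>\<^sub>H h, c))) s" by (rule plin_cong) (simp add: k)
    also have "\<dots> = scl k (T3 s (g \<otimes>\<^sub>H h) (bas c))" unfolding plin_fun_scl by (simp add: T3_def)
    finally show "T3 s h (bas c) \<in> {t. Oh g t \<in> J}"
      using J_T3[of "g \<otimes>\<^sub>H h" s] s assms(1) by (simp add: pm.subspace_scale[OF J_subspace])
  next
    fix a h t assume t: "t \<in> P.I" "h \<in> carrier HH"
    have "Oh g (T3 (bas a) h t) = scl (cm a g) (T3 (bas a) (g \<otimes>\<^sub>H h) t)"
      by (simp add: Oh_def T3_def plin_plin flip: plin_fun_scl)
    then show "T3 (bas a) h t \<in> {t. Oh g t \<in> J}"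
      using J_T3[of "g \<otimes>\<^sub>H h" _ t] t assms(1) by (simp add: pm.subspace_scale[OF J_subspace])
  qed
  then show ?thesis by simp
qed

lemma Om_T3: "Om j (T3 s h t) = T3 (pre j s) h t"
  by (simp add: Om_def T3_def plin_plin)

lemma J_Om:
  assumes "t \<in> J"
  shows "Om j t \<in> J"
proof -
  have "t \<in> {t. Om j t \<in> J}"
  proof (rule J_induct[OF _ _ _ assms])
    show "pm.subspace {t. Om j t \<in> J}" using J_subspace by (auto simp: pm.subspace_def)
  next
    fix s h c d assume "s \<in> M.I" "h \<in> carrier HH"
    then show "T3 s h (bas c) \<in> {t. Om j t \<in> J}" using J_T3[of h "pre j s"] word_ideal_pre[of s] by (simp add: Om_T3)
  next
    fix a h t assume "t \<in> P.I" "h \<in> carrier HH"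
    then show "T3 (bas a) h t \<in> {t. Om j t \<in> J}" using J_T3[of h _ t] by (simp add: Om_T3)
  qed
  then show ?thesis by simp
qed

text \<open>For s in I^- the formula for \<open>op\<close> yields s and its two derivatives, all in
  I^-, with scalars that can be pulled out because s is homogeneous. For t in I^+ either x_i is
  prefixed to t, or t is kept and only the left factor changes.\<close>

lemma J_Op:
  assumes "t \<in> J"
  shows "Op i t \<in> J"
proof -
  note sub = pm.subspace_add[OF J_subspace] pm.subspace_diff[OF J_subspace] pm.subspace_scale[OF J_subspace]
  have "t \<in> {t. Op i t \<in> J}"
  proof (rule J_induct[OF _ _ _ assms])
    show "pm.subspace {t. Op i t \<in> J}" using J_subspace by (auto simp: pm.subspace_def)
  next
    fix s h c d assume s: "s \<in> M.I" "\<And>v. v \<in> supp s \<Longrightarrow> count_list v = d" "h \<in> carrier HH"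
    obtain k where k: "\<And>v. v \<in> supp s \<Longrightarrow> pl i v = k"
      by (rule homogeneous_scalar[where f = "\<lambda>v. pl i v", OF s(2)]) (assumption, erule prod_list_cong_count, blast)
    obtain k' where k': "\<And>v. v \<in> supp s \<Longrightarrow> pr i v = k'"
      by (rule homogeneous_scalar[where f = "\<lambda>v. pr i v", OF s(2)]) (assumption, erule prod_list_cong_count, blast)
    have "Op i (T3 s h (bas c)) = plin (\<lambda>a. op i a h c) s"
      by (simp add: Op_def T3_def plin_plin)
    also have "\<dots> = plin (\<lambda>a. scl (k * chiH i h) (bas (a, h, i # c)) +
        scl (k / p i i) (T3 (dr qm i a) h (bas c)) -
        scl (k * k' / (p i i * p i i)) (T3 (dl qm i a) (gf i \<otimes>\<^sub>H h) (bas c))) s"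
      by (rule plin_cong) (simp add: op_formula s(3) k k')
    also have "\<dots> = scl (k * chiH i h) (T3 s h (bas (i # c))) +
        scl (k / p i i) (T3 (plin (dr qm i) s) h (bas c)) -
        scl (k * k' / (p i i * p i i)) (T3 (plin (dl qm i) s) (gf i \<otimes>\<^sub>H h) (bas c))"
      unfolding plin_fun_add plin_fun_diff plin_fun_scl T3_plin_left by (simp add: T3_def)
    finally show "T3 s h (bas c) \<in> {t. Op i t \<in> J}"
      using s Im_deriv[OF s(1)] by (auto intro!: sub J_T3)
  next
    fix a h t assume t: "t \<in> P.I" "h \<in> carrier HH"
    have "Op i (T3 (bas a) h t) = plin (\<lambda>c. op i a h c) t"
      by (simp add: Op_def T3_def plin_plin)
    also have "\<dots> = scl (pl i a * chiH i h) (T3 (bas a) h (pre i t)) +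
     scl (pl i a / p i i) (T3 (dr qm i a) h (plin bas t)) -
     scl (pl i a * pr i a / (p i i * p i i)) (T3 (dl qm i a) (gf i \<otimes>\<^sub>H h) (plin bas t))"
      unfolding op_formula[OF t(2)] plin_fun_add plin_fun_diff T3_plin_right
      by (simp flip: plin_fun_scl)
    finally show "T3 (bas a) h t \<in> {t. Op i t \<in> J}"
      using t word_ideal_pre[OF t(1), of i] by (auto intro!: sub J_T3)
  qed
  then show ?thesis by simp
qed

lemma J_Ol: "t \<in> J \<Longrightarrow> Ol x t \<in> J"
  by (cases x) (simp_all add: J_Op J_Om)

abbreviation OP :: "('k, 'n) npoly \<Rightarrow> ('k, 'n) tri \<Rightarrow> ('k, 'n) tri" where
  "OP r t \<equiv> plin (\<lambda>v. Ow (map Xp v) t) r"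

text \<open>The mirror image of \<open>op_formula\<close>: the word x_v passes one letter x^-_j, and
  each letter x_j of v contributes 1 - g_j f_j. Here g_j f_j moves to the left, out of the
  word.\<close>

lemma Ow_Om:
  assumes "t \<in> V0"
  shows "Ow (map Xp v) (Om j t) = scl (pr j v) (Om j (Ow (map Xp v) t)) + OP (dr p j v) t -
     scl (pr j v / p j j) (Oh (gf j) (OP (dl p j v) t))"
proof (induction v)
  case (Cons i v)
  note c = Ow_closed[OF assms]
  have OPc: "OP r t \<in> V0" for r
    unfolding plin_def by (intro pm.subspace_sum[OF V0_subspace] pm.subspace_scale[OF V0_subspace] c)
  have OPpre: "OP (pre i r) t = Op i (OP r t)" for r
  proof -
    have "supp r \<subseteq> UNIV" by simp
    then show ?thesis by (induction rule: pm_induct) (simp_all add: plin_add)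
  qed
  have "Ow (map Xp (i # v)) (Om j t) = Op i (Ow (map Xp v) (Om j t))" by simp
  also have "\<dots> = scl (pr j v) (Op i (Om j (Ow (map Xp v) t))) + OP (pre i (dr p j v)) t -
     scl (pr j v / p j j) (Op i (Oh (gf j) (OP (dl p j v) t)))"
    unfolding Cons by (simp add: OPpre)
  also have "Op i (Om j (Ow (map Xp v) t)) = scl (p j i) (Om j (Ow (map Xp (i # v)) t)) +
     (if i = j then Ow (map Xp v) t - Oh (gf i) (Ow (map Xp v) t) else 0)"
    by (simp add: Op_Om c)
  also have "Op i (Oh (gf j) (OP (dl p j v) t)) = scl (p i j * p j i) (Oh (gf j) (OP (pre i (dl p j v)) t))"
    by (simp add: Op_Oh OPc chiH_mult OPpre)
  finally have e: "Ow (map Xp (i # v)) (Om j t) =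
     scl (pr j v) (scl (p j i) (Om j (Ow (map Xp (i # v)) t)) +
       (if i = j then Ow (map Xp v) t - Oh (gf i) (Ow (map Xp v) t) else 0)) + OP (pre i (dr p j v)) t -
     scl (pr j v / p j j) (scl (p i j * p j i) (Oh (gf j) (OP (pre i (dl p j v)) t)))" .
  have d: "OP (dr p j (i # v)) t = (if i = j then scl (pr j v) (Ow (map Xp v) t) else 0) + OP (pre i (dr p j v)) t"
    "OP (dl p j (i # v)) t = scl (p i j) (OP (pre i (dl p j v)) t) + (if i = j then Ow (map Xp v) t else 0)"
    by (simp_all add: plin_add plin_scl)
  show ?case
    unfolding e d by (cases "i = j")
      (simp_all add: pm.scale_right_distrib pm.scale_right_diff_distrib mult_ac)
qed simp

text \<open>Induction on the word a that the relation has to pass. By \<open>Ow_Om\<close> each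
  letter of a replaces r by r and its two derivatives, which are in I^+ again; hence the statement
  is about all r in I^+ and not just the defining relations.\<close>

lemma OP_J:
  assumes "r \<in> P.I" "h \<in> carrier HH"
  shows "OP r (bas (a, h, c)) \<in> J"
  using assms(1)
proof (induction a arbitrary: r)
  case Nil
  show ?case
  proof (rule plin_of_homogeneous[OF J_subspace Ip_comp _ Nil])
    fix s d assume s: "s \<in> P.I" "\<And>v. v \<in> supp s \<Longrightarrow> count_list v = d"
    obtain k where k: "\<And>v. v \<in> supp s \<Longrightarrow> prod_list (map (\<lambda>i. chiH i h) v) = k"
      by (rule homogeneous_scalar[where f = "\<lambda>v. prod_list (map (\<lambda>i. chiH i h) v)", OF s(2)]) (assumption, erule prod_list_cong_count, blast)
    have "OP s (bas ([], h, c)) = plin (\<lambda>v. scl k (bas ([], h, v @ c))) s"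
      by (rule plin_cong) (simp add: Ow_plus assms(2) k)
    also have "\<dots> = scl k (T3 (bas []) h (plin (\<lambda>v. bas (v @ c)) s))"
      unfolding plin_fun_scl T3_plin_right by simp
    finally show "OP s (bas ([], h, c)) \<in> J"
      using J_T3[OF assms(2)] word_ideal_right[OF s(1)] by (simp add: pm.subspace_scale[OF J_subspace])
  qed
next
  case (Cons j a)
  let ?e = "bas (a, h, c)"
  have e: "?e \<in> V0" using assms(2) by simp
  show ?case
  proof (rule plin_of_homogeneous[OF J_subspace Ip_comp _ Cons.prems])
    fix s d assume s: "s \<in> P.I" "\<And>v. v \<in> supp s \<Longrightarrow> count_list v = d"
    obtain k where k: "\<And>v. v \<in> supp s \<Longrightarrow> pr j v = k"
      by (rule homogeneous_scalar[where f = "\<lambda>v. pr j v", OF s(2)]) (assumption, erule prod_list_cong_count, blast)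
    have "OP s (bas (j # a, h, c)) = plin (\<lambda>v. Ow (map Xp v) (Om j ?e)) s" by simp
    also have "\<dots> = plin (\<lambda>v. scl k (Om j (Ow (map Xp v) ?e)) + OP (dr p j v) ?e -
        scl (k / p j j) (Oh (gf j) (OP (dl p j v) ?e))) s"
      by (rule plin_cong) (simp only: Ow_Om[OF e] k)
    also have "\<dots> = scl k (Om j (OP s ?e)) + OP (plin (dr p j) s) ?e -
        scl (k / p j j) (Oh (gf j) (OP (plin (dl p j) s) ?e))"
      unfolding plin_fun_add plin_fun_diff plin_fun_scl by (simp add: plin_plin Om_def Oh_def)
    finally show "OP s (bas (j # a, h, c)) \<in> J"
      using Cons.IH[OF s(1)] Cons.IH[OF Ip_deriv(1)[OF s(1)]] Cons.IH[OF Ip_deriv(2)[OF s(1)]]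
      by (auto intro!: pm.subspace_add[OF J_subspace] pm.subspace_diff[OF J_subspace] pm.subspace_scale[OF J_subspace] J_Om J_Oh)
  qed
qed

lemma act_emb: "act (emb X r) t = plin (\<lambda>v. Ow (map X v) t) r" if "t \<in> V0"
  using that by (simp add: emb_def act_plin[OF adm_axioms] Oh_one Ow_closed)

text \<open>A relation in the x^-_i is merely multiplied onto the left word. A relation in the x_i
  has to pass the left word first, which is \<open>OP_J\<close>.\<close>

lemma A_rels_act:
  assumes "r \<in> A_rels" "t \<in> V0"
  shows "act r t \<in> J"
  using assms(2)
proof (induction rule: V0_induct)
  case (single a h c d)
  have "act r (bas (a, h, c)) \<in> J"
    using assms(1) unfolding A_rels_def
  proof
    assume "r \<in> emb Xp ` u ` L"
    then obtain q where "q \<in> u ` L" "r = emb Xp q" by blast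
    then show ?thesis using OP_J[OF word_ideal_superset single] single by (simp add: act_emb)
  next
    assume "r \<in> emb Xm ` w ` T"
    then obtain q where q: "q \<in> w ` T" "r = emb Xm q" by blast
    have "act r (bas (a, h, c)) = T3 (plin (\<lambda>v. bas (v @ a)) q) h (bas c)"
      using single by (simp add: q(2) act_emb Ow_minus T3_plin_left)
    then show ?thesis using J_T3[OF single] word_ideal_right[OF word_ideal_superset[OF q(1)]] by simp
  qed
  then have "act r (scl d (bas (a, h, c))) \<in> J"
    unfolding act_linear by (rule pm.subspace_scale[OF J_subspace])
  then show ?case by simp
next
  case (add s t)
  then show ?case by (simp add: act_linear pm.subspace_add[OF J_subspace])
qed (simp add: act_linear pm.subspace_0[OF J_subspace])

lemma Acls_zero_act:
  assumes "a \<in> carrier SK" "Acls a = \<zero>\<^sub>A"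
  shows "act a e0 \<in> J"
proof -
  have "a \<in> {s \<in> carrier SK. \<forall>t\<in>V0. act s t \<in> J}"
  proof (rule Acls_kernel[OF act_ideal[OF J_subspace J_V0 J_Oh J_Ol] _ _ assms])
    show "Fn_rels \<subseteq> {s \<in> carrier SK. \<forall>t\<in>V0. act s t \<in> J}"
      using Fn_rels_closed Fn_rels_act pm.subspace_0[OF J_subspace] by fastforce
    show "A_rels \<subseteq> {s \<in> carrier SK. \<forall>t\<in>V0. act s t \<in> J}"
      using A_rels_closed A_rels_act by blast
  qed
  then show ?thesis by simp
qed

text \<open>The triangular coordinates on A: a representative acts on \<open>e0\<close>, and the
  result is brought to normal form. The choice does not matter, because a difference of two
  representatives acts into J (\<open>crd_Acls\<close>).\<close>

definition crd :: "('k, 'n) quo \<Rightarrow> ('k, 'n) tri" where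
  "crd y = nf (act (SOME a. a \<in> carrier SK \<and> Acls a = y) e0)"

lemma crd_Acls:
  assumes "a \<in> carrier SK"
  shows "crd (Acls a) = nf (act a e0)"
proof -
  let ?b = "SOME b. b \<in> carrier SK \<and> Acls b = Acls a"
  have b: "?b \<in> carrier SK \<and> Acls ?b = Acls a" by (rule someI[of _ a], rule conjI[OF assms refl])
  have c: "?b - a \<in> carrier SK"
  proof -
    have "supp ?b \<subseteq> carrier HH \<times> UNIV" "supp a \<subseteq> carrier HH \<times> UNIV" using b assms by simp_all
    then show ?thesis by (simp only: SK_simps mem_Collect_eq supp_diff_subset)
  qed
  have "Acls (?b - a) = Acls ?b \<ominus>\<^bsub>AA\<^esub> Acls a" by (rule Acls_diff[OF conjunct1[OF b] assms])
  also have "\<dots> = \<zero>\<^sub>A" unfolding conjunct2[OF b] using Acls(2)[OF assms] by (simp only: a_minus_def A0.r_neg)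
  finally have "Acls (?b - a) = \<zero>\<^sub>A" .
  then have "act (?b - a) e0 \<in> J" by (rule Acls_zero_act[OF c])
  then show ?thesis by (simp add: crd_def J_def)
qed

lemma AA_obtain:
  assumes "y \<in> carrier AA"
  obtains a where "a \<in> carrier SK" "y = Acls a"
  using assms unfolding Acls_surj[symmetric] by blast

lemma crd_add: "x \<in> carrier AA \<Longrightarrow> y \<in> carrier AA \<Longrightarrow> crd (x \<oplus>\<^sub>A y) = crd x + crd y"
proof -
  assume x: "x \<in> carrier AA" and y: "y \<in> carrier AA"
  obtain a where a: "a \<in> carrier SK" "x = Acls a" by (rule AA_obtain[OF x])
  obtain b where b: "b \<in> carrier SK" "y = Acls b" by (rule AA_obtain[OF y])
  show ?thesis
    using crd_Acls[OF SK.a_closed[OF a(1) b(1)]] Acls(3)[OF a(1) b(1)]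
    by (simp add: a(2) b(2) crd_Acls[OF a(1)] crd_Acls[OF b(1)])
qed

lemma crd_smult: "x \<in> carrier AA \<Longrightarrow> crd (c \<odot>\<^sub>A x) = scl c (crd x)"
proof -
  assume x: "x \<in> carrier AA"
  obtain a where a: "a \<in> carrier SK" "x = Acls a" by (rule AA_obtain[OF x])
  show ?thesis
    using crd_Acls[OF SK.smult_closed[OF a(1)], of c] Acls(4)[OF a(1), of c]
    by (simp add: a(2) crd_Acls[OF a(1)])
qed

lemma mon_Acls:
  assumes "h \<in> carrier HH"
  shows "A.mon a h c = Acls (bas (\<one>\<^sub>H, map Xm a) \<otimes>\<^bsub>SK\<^esub> bas (h, []) \<otimes>\<^bsub>SK\<^esub> bas (\<one>\<^sub>H, map Xp c))"
proof -
  have c: "bas (\<one>\<^sub>H, map Xm a) \<in> carrier SK" "bas (h, []) \<in> carrier SK" "bas (\<one>\<^sub>H, map Xp c) \<in> carrier SK"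
    using assms by auto
  show ?thesis unfolding A.mon_def
    by (simp only: Acls(5)[OF SK.m_closed[OF c(1,2)] c(3)] Acls(5)[OF c(1,2)])
qed

lemma crd_mon:
  assumes "h \<in> carrier HH"
  shows "crd (A.mon a h c) = T3 (rm a) h (rp c)"
proof -
  let ?x = "bas (\<one>\<^sub>H, map Xm a) :: ('k, 'n) sk" and ?h = "bas (h, []) :: ('k, 'n) sk"
    and ?y = "bas (\<one>\<^sub>H, map Xp c) :: ('k, 'n) sk"
  have c: "?x \<in> carrier SK" "?h \<in> carrier SK" "?y \<in> carrier SK" using assms by auto
  have y: "act ?y e0 = bas ([], \<one>\<^sub>H, c)" by (simp only: act_e0_plus H.one_closed)
  have h: "act ?h (bas ([], \<one>\<^sub>H, c)) = bas ([], h, c)" using assms by simp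
  have x: "act ?x (bas ([], h, c)) = bas (a, h, c)" using assms by (simp add: Ow_minus)
  have V: "bas ([], \<one>\<^sub>H, c) \<in> V0" "e0 \<in> V0" by simp_all
  have "act (?x \<otimes>\<^bsub>SK\<^esub> ?h \<otimes>\<^bsub>SK\<^esub> ?y) e0 = bas (a, h, c)"
    by (simp only: act_mult[OF SK.m_closed[OF c(1,2)] c(3) V(2)] y act_mult[OF c(1,2) V(1)] h x)
  then show ?thesis
    using crd_Acls[OF SK.m_closed[OF SK.m_closed[OF c(1,2)] c(3)]] mon_Acls[OF assms, of a c] by simp
qed

lemma Acls_ev: "a \<in> carrier SK \<Longrightarrow> Acls a = A.ev (act a e0)"
proof (induction rule: SK_induct)
  case zero
  then show ?case using klin_zero[OF SK.k_alg A0.k_alg Acls(1)] by simp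
next
  case (single h v c)
  have k: "bas (h, v) \<in> carrier SK" using single by simp
  have "act (scl c (bas (h, v))) e0 = scl c (act (bas (h, v)) e0)" by (simp only: act_simps)
  moreover have "act (bas (h, v)) e0 \<in> V0" by (rule act_closed[OF k]) simp
  ultimately show ?case
    using Acls(4)[OF k, of c] A.straighten[OF single, of v] A.ev_scl[of "act (bas (h, v)) e0" c] by simp
next
  case (add s t)
  have "e0 \<in> V0" by simp
  then show ?case
    using Acls(3)[OF add(1,2)] A.ev_add[OF act_closed[OF add(1)] act_closed[OF add(2)]] add.IH by simp
qed

end

section \<open>The coproduct of \<open>A\<close>\<close>

lemma (in ring) add_minus_minus:
  "x \<in> carrier R \<Longrightarrow> y \<in> carrier R \<Longrightarrow> x \<oplus> y \<ominus> x \<ominus> y = \<zero>"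
  by algebra

context malg
begin

lemma dx_twist:
  assumes "g \<in> Ks"
  shows "dx x \<otimes>\<^bsub>BB\<^esub> tens B B (bg g) (bg g) = chi_letter (l x) g \<odot>\<^bsub>BB\<^esub> (tens B B (bg g) (bg g) \<otimes>\<^bsub>BB\<^esub> dx x)"
proof -
  have 1: "bw [x] \<otimes>\<^bsub>B\<^esub> bg g = chi_letter (l x) g \<odot>\<^bsub>B\<^esub> (bg g \<otimes>\<^bsub>B\<^esub> bw [x])"
    using bw_bg[OF assms, of "[x]"] by simp
  have 2: "bg (\<gamma> x) \<otimes>\<^bsub>B\<^esub> bg g = bg g \<otimes>\<^bsub>B\<^esub> bg (\<gamma> x)"
    using assms \<gamma> by (simp add: bg_mult H.m_comm)
  show ?thesis using assms \<gamma>
    by (simp add: dx_def TP.TT.l_distr TP.TT.r_distr TP.tens_mult 1 2 TP.tens_smult TP.TT.smult_r_distr)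
qed

lemma dw_twist:
  assumes "g \<in> Ks"
  shows "dw v \<otimes>\<^bsub>BB\<^esub> tens B B (bg g) (bg g) = chi_word (map l v) g \<odot>\<^bsub>BB\<^esub> (tens B B (bg g) (bg g) \<otimes>\<^bsub>BB\<^esub> dw v)"
proof (induction v)
  case (Cons x v)
  let ?g = "tens B B (bg g) (bg g)"
  have g: "?g \<in> carrier BB" using assms by simp
  have "dw (x # v) \<otimes>\<^bsub>BB\<^esub> ?g = dx x \<otimes>\<^bsub>BB\<^esub> (chi_word (map l v) g \<odot>\<^bsub>BB\<^esub> (?g \<otimes>\<^bsub>BB\<^esub> dw v))"
    using g Cons by (simp add: TP.TT.m_assoc)
  also have "\<dots> = chi_word (map l v) g \<odot>\<^bsub>BB\<^esub> ((dx x \<otimes>\<^bsub>BB\<^esub> ?g) \<otimes>\<^bsub>BB\<^esub> dw v)"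
    using g by (simp add: TP.TT.smult_mult_r TP.TT.m_assoc)
  also have "\<dots> = chi_word (map l v) g \<odot>\<^bsub>BB\<^esub> (chi_letter (l x) g \<odot>\<^bsub>BB\<^esub> (?g \<otimes>\<^bsub>BB\<^esub> dw (x # v)))"
    unfolding dx_twist[OF assms] using g by (simp add: TP.TT.smult_mult_l TP.TT.m_assoc)
  finally show ?case using g by (simp add: mult.commute flip: TP.TT.smult_assoc)
qed (use assms in \<open>simp add: TP.TT.smult_one\<close>)

lemma dw_append: "dw (v @ v') = dw v \<otimes>\<^bsub>BB\<^esub> dw v'"
  by (induction v) (simp_all add: TP.TT.m_assoc)

end

context quo
begin

lemma toA_ball: "\<forall>t\<in>carrier P.TX. toA (P.\<omega> t) = Acls (P.E t)" "\<forall>t\<in>carrier M.TX. toA (M.\<omega> t) = Acls (M.E t)"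
  using toA_P toA_M by blast+

lemmas toA_P_bQ = P.extend_bQ[OF A0.k_alg Acls_hom toA_ball(1)]
lemmas toA_M_bQ = M.extend_bQ[OF A0.k_alg Acls_hom toA_ball(2)]
lemmas toA_P_klin = P.extend_klin[OF A0.k_alg Acls_hom toA_ball(1)]
lemmas toA_M_klin = M.extend_klin[OF A0.k_alg Acls_hom toA_ball(2)]
lemmas toA_P_hom = P.extend_hom[OF A0.k_alg Acls_hom toA_ball(1)]
lemmas toA_M_hom = M.extend_hom[OF A0.k_alg Acls_hom toA_ball(2)]

abbreviation "A2 \<equiv> tensor AA AA"
abbreviation mult_T (infixl "\<otimes>\<^sub>T" 70) where "(\<otimes>\<^sub>T) \<equiv> mult A2"
abbreviation add_T (infixl "\<oplus>\<^sub>T" 65) where "(\<oplus>\<^sub>T) \<equiv> add A2"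
abbreviation smult_T (infixl "\<odot>\<^sub>T" 70) where "(\<odot>\<^sub>T) \<equiv> smult A2"
abbreviation one_T ("\<one>\<^sub>T") where "\<one>\<^sub>T \<equiv> one A2"
abbreviation zero_T ("\<zero>\<^sub>T") where "\<zero>\<^sub>T \<equiv> zero A2"
definition "toAA = tlift A2 (\<lambda>a b. tens AA AA (toA a) (toA b))"

lemma toAA_P: "toAA \<in> alg_hom (tensor P.Q P.Q) A2"
    "a \<in> carrier P.Q \<Longrightarrow> b \<in> carrier P.Q \<Longrightarrow> toAA (tens P.Q P.Q a b) = tens AA AA (toA a) (toA b)"
  unfolding toAA_def using tensor_square_hom[OF P.Q.k_alg A0.k_alg toA_P_hom] by blast+

lemma toAA_M: "toAA \<in> alg_hom (tensor M.Q M.Q) A2"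
    "a \<in> carrier M.Q \<Longrightarrow> b \<in> carrier M.Q \<Longrightarrow> toAA (tens M.Q M.Q a b) = tens AA AA (toA a) (toA b)"
  unfolding toAA_def using tensor_square_hom[OF M.Q.k_alg A0.k_alg toA_M_hom] by blast+

lemma toA_one: "toA \<one>\<^bsub>P.Q\<^esub> = \<one>\<^sub>A" "toA \<one>\<^bsub>M.Q\<^esub> = \<one>\<^sub>A"
  using alg_homD(6)[OF toA_P_hom] alg_homD(6)[OF toA_M_hom] .

lemma toAA_dw_P: "toAA (P.dw v) = A.dw (map Xp v)"
proof (induction v)
  case Nil
  then show ?case using alg_homD(6)[OF toAA_P(1)] by simp
next
  case (Cons i v)
  have c: "P.bw [i] \<in> carrier P.Q" "P.bg (gg i) \<in> carrier P.Q" "\<one>\<^bsub>P.Q\<^esub> \<in> carrier P.Q"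
    by (rule P.b_closed, rule P.one_Ks, rule P.b_closed, rule P.\<gamma>, rule P.Q.one_closed)
  have b: "toA (P.bw [i]) = A.bw [Xp i]" "toA (P.bg (gg i)) = A.bg (gg i)"
    using toA_P_bQ[OF P.one_Ks, of "[i]"] toA_P_bQ[OF P.\<gamma>, of i "[]"] by simp_all
  have "toAA (P.dx i) = A.dx (Xp i)"
    using alg_homD(3)[OF toAA_P(1) P.TP.tens_closed[OF c(1,3)] P.TP.tens_closed[OF c(2,1)]]
      toAA_P(2)[OF c(1,3)] toAA_P(2)[OF c(2,1)]
    by (simp add: P.dx_def A.dx_def b[unfolded list.map] toA_one)
  then show ?case using alg_homD(5)[OF toAA_P(1) P.dx_closed P.dw_closed] Cons by simp
qed

lemma toAA_dw_M: "toAA (M.dw v) = A.dw (map Xm v)"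
proof (induction v)
  case Nil
  then show ?case using alg_homD(6)[OF toAA_M(1)] by simp
next
  case (Cons i v)
  have c: "M.bw [i] \<in> carrier M.Q" "M.bg (ff i) \<in> carrier M.Q" "\<one>\<^bsub>M.Q\<^esub> \<in> carrier M.Q"
    by (rule M.b_closed, rule M.one_Ks, rule M.b_closed, rule M.\<gamma>, rule M.Q.one_closed)
  have b: "toA (M.bw [i]) = A.bw [Xm i]" "toA (M.bg (ff i)) = A.bg (ff i)"
    using toA_M_bQ[OF M.one_Ks, of "[i]"] toA_M_bQ[OF M.\<gamma>, of i "[]"] by simp_all
  have "toAA (M.dx i) = A.dx (Xm i)"
    using alg_homD(3)[OF toAA_M(1) M.TP.tens_closed[OF c(1,3)] M.TP.tens_closed[OF c(2,1)]]
      toAA_M(2)[OF c(1,3)] toAA_M(2)[OF c(2,1)]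
    by (simp add: M.dx_def A.dx_def b[unfolded list.map] toA_one)
  then show ?case using alg_homD(5)[OF toAA_M(1) M.dx_closed M.dw_closed] Cons by simp
qed

abbreviation "A2g g \<equiv> tens AA AA (A.bg g) (A.bg g)"

text \<open>The coproduct on the level of the skew group algebra. \<open>A_coproduct\<close> is
  given by a description operator, so existence has to be established: \<open>\<phi>\<close> must
  vanish on the commutation relations (\<open>\<phi>_Fn_rels\<close>) and on the relations of both
  halves (\<open>\<phi>_A_rels\<close>).\<close>

definition "\<phi> = lin_ext A2 (\<lambda>(h, v). A2g h \<otimes>\<^sub>T A.dw v)"

lemma \<phi>_hom: "\<phi> \<in> alg_hom SK A2"
  unfolding \<phi>_def skew_alg_def
proof (rule SKt.lin_ext_hom[OF A.TP.TT.k_alg])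
  show "(\<lambda>(h, v). A2g h \<otimes>\<^sub>T A.dw v) \<in> carrier (HH \<times>\<times> word_monoid) \<rightarrow> carrier A2" by auto
  show "(\<lambda>(h, v). A2g h \<otimes>\<^sub>T A.dw v) \<one>\<^bsub>HH \<times>\<times> word_monoid\<^esub> = \<one>\<^sub>T"
    by (simp add: A.b_one A.TP.tens_one[symmetric])
next
  fix s t :: "('k, 'n) hgrp \<times> 'n letter list" assume "s \<in> carrier (HH \<times>\<times> word_monoid)" "t \<in> carrier (HH \<times>\<times> word_monoid)"
  then obtain g v g' v' where s: "s = (g, v)" "g \<in> carrier HH" and t: "t = (g', v')" "g' \<in> carrier HH" by auto
  have c: "A2g g \<in> carrier A2" "A2g g' \<in> carrier A2" using s t by auto
  have "A2g g \<otimes>\<^sub>T A.dw v \<otimes>\<^sub>T (A2g g' \<otimes>\<^sub>T A.dw v') = A2g g \<otimes>\<^sub>T (A.dw v \<otimes>\<^sub>T A2g g') \<otimes>\<^sub>T A.dw v'"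
    using c by (simp add: A.TP.TT.m_assoc)
  also have "\<dots> = chi_word v g' \<odot>\<^sub>T (A2g g \<otimes>\<^sub>T A2g g' \<otimes>\<^sub>T (A.dw v \<otimes>\<^sub>T A.dw v'))"
    unfolding A.dw_twist[OF t(2)] using c
    by (simp add: A.TP.TT.m_assoc A.TP.TT.smult_mult_l A.TP.TT.smult_mult_r)
  also have "A2g g \<otimes>\<^sub>T A2g g' = A2g (g \<otimes>\<^sub>H g')"
    using s t by (simp add: A.TP.tens_mult A.bg_mult)
  finally show "(\<lambda>(h, v). A2g h \<otimes>\<^sub>T A.dw v) s \<otimes>\<^sub>T (\<lambda>(h, v). A2g h \<otimes>\<^sub>T A.dw v) t =
      (\<lambda>(h, v) (h', v'). chi_word v h') s t \<odot>\<^sub>T (\<lambda>(h, v). A2g h \<otimes>\<^sub>T A.dw v) (s \<otimes>\<^bsub>HH \<times>\<times> word_monoid\<^esub> t)"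
    by (simp add: s(1) t(1) A.dw_append)
qed

lemmas \<phi> = alg_homD[OF \<phi>_hom]

lemma \<phi>_single: "h \<in> carrier HH \<Longrightarrow> \<phi> (sgl (h, v) c) = c \<odot>\<^sub>T (A2g h \<otimes>\<^sub>T A.dw v)"
  unfolding \<phi>_def by (simp add: A.TP.TT.lin_ext_single)

lemma A2g_one: "A2g \<one>\<^sub>H = \<one>\<^sub>T"
  by (simp add: A.b_one A.TP.tens_one)

lemma \<phi>_word: "\<phi> (sgl (\<one>\<^sub>H, v) c) = c \<odot>\<^sub>T A.dw v"
  by (simp add: \<phi>_single A2g_one)

lemma \<phi>_diff: "a \<in> carrier SK \<Longrightarrow> b \<in> carrier SK \<Longrightarrow> \<phi> (a - b) = \<phi> a \<ominus>\<^bsub>A2\<^esub> \<phi> b"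
proof -
  assume ab: "a \<in> carrier SK" "b \<in> carrier SK"
  have "a - b = a \<ominus>\<^bsub>SK\<^esub> b" using SK_minus ab by simp
  then show ?thesis
    using \<phi>(3)[OF ab(1) SK.a_inv_closed[OF ab(2)]] klin_minus[OF SK.k_alg A.TP.TT.k_alg \<phi>(1) ab(2)]
    by (simp only: a_minus_def SK_simps)
qed

text \<open>Of the four products on each side, the mixed ones match because x_i f_j = p_ji f_j x_i
  and g_i x^-_j = p_ji x^-_j g_i; the other two reproduce the relation of A in one tensor
  factor.\<close>

lemma dx_rel: "A.dx (Xp i) \<otimes>\<^sub>T A.dx (Xm j) = p j i \<odot>\<^sub>T (A.dx (Xm j) \<otimes>\<^sub>T A.dx (Xp i)) \<oplus>\<^sub>T
    (if i = j then \<one>\<^sub>T \<ominus>\<^bsub>A2\<^esub> A2g (gf i) else \<zero>\<^sub>T)"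
proof -
  let ?x = "A.bw [Xp i]" let ?y = "A.bw [Xm j]" let ?g = "A.bg (gg i)" let ?f = "A.bg (ff j)"
  let ?t = "tens AA AA" let ?c = "p j i"
  let ?d = "if i = j then \<one>\<^sub>A \<ominus>\<^bsub>AA\<^esub> A.bg (gf i) else \<zero>\<^sub>A"
  have cl: "?x \<in> carrier AA" "?y \<in> carrier AA" "?g \<in> carrier AA" "?f \<in> carrier AA" "?d \<in> carrier AA"
    "\<one>\<^sub>A \<in> carrier AA" "A.bg (gf i) \<in> carrier AA" by auto
  have xf: "?x \<otimes>\<^sub>A ?f = ?c \<odot>\<^sub>A (?f \<otimes>\<^sub>A ?x)" using A.bw_bg[of "ff j" "[Xp i]"] by simp
  have "?y \<otimes>\<^sub>A ?g = inverse ?c \<odot>\<^sub>A (?g \<otimes>\<^sub>A ?y)" using A.bw_bg[of "gg i" "[Xm j]"] by simp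
  then have "?c \<odot>\<^sub>A (?y \<otimes>\<^sub>A ?g) = ?g \<otimes>\<^sub>A ?y"
    using cl by (simp add: A0.smult_one flip: A0.smult_assoc)
  then have gy: "?g \<otimes>\<^sub>A ?y = ?c \<odot>\<^sub>A (?y \<otimes>\<^sub>A ?g)" by simp
  have gfc: "?g \<otimes>\<^sub>A ?f = ?f \<otimes>\<^sub>A ?g" by (simp add: A.bg_mult H.m_comm)
  have xy: "?x \<otimes>\<^sub>A ?y = ?c \<odot>\<^sub>A (?y \<otimes>\<^sub>A ?x) \<oplus>\<^sub>A ?d" by (rule A.rel)
  \<comment> \<open>With k = g_i f_i the two contributions telescope: (1 - k) \<otimes> 1 + k
    \<otimes> (1 - k) = 1 \<otimes> 1 - k \<otimes> k.\<close>
  have d: "?t ?d \<one>\<^sub>A \<oplus>\<^sub>T ?t (?f \<otimes>\<^sub>A ?g) ?d = (if i = j then \<one>\<^sub>T \<ominus>\<^bsub>A2\<^esub> A2g (gf i) else \<zero>\<^sub>T)"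
  proof (cases "i = j")
    case True
    let ?k = "A.bg (gf i)"
    have k: "?f \<otimes>\<^sub>A ?g = ?k" using True by (simp add: A.bg_mult H.m_comm)
    have kl: "klin AA A2 (\<lambda>a. ?t a \<one>\<^sub>A)" "klin AA A2 (?t ?k)"
      using A.TP.kbilin_tens by (simp_all add: kbilin_def)
    note m = klin_minus[OF A0.k_alg A.TP.TT.k_alg kl(1) cl(7)]
      klin_minus[OF A0.k_alg A.TP.TT.k_alg kl(2) cl(7)]
    have "?t (\<one>\<^sub>A \<ominus>\<^bsub>AA\<^esub> ?k) \<one>\<^sub>A = \<one>\<^sub>T \<ominus>\<^bsub>A2\<^esub> ?t ?k \<one>\<^sub>A"
      "?t ?k (\<one>\<^sub>A \<ominus>\<^bsub>AA\<^esub> ?k) = ?t ?k \<one>\<^sub>A \<ominus>\<^bsub>A2\<^esub> ?t ?k ?k"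
      using cl by (simp_all add: a_minus_def A.TP.tens_add_left A.TP.tens_add_right m A.TP.tens_one)
    moreover have "(a \<ominus>\<^bsub>A2\<^esub> b) \<oplus>\<^sub>T (b \<ominus>\<^bsub>A2\<^esub> c) = a \<ominus>\<^bsub>A2\<^esub> c"
      if "a \<in> carrier A2" "b \<in> carrier A2" "c \<in> carrier A2" for a b c
      using that by (simp add: a_minus_def A.TP.TT.a_assoc A.TP.TT.r_neg1)
    ultimately show ?thesis using True k cl by simp
  next
    case False
    have "?t \<zero>\<^sub>A \<one>\<^sub>A = \<zero>\<^sub>T" "?t (?f \<otimes>\<^sub>A ?g) \<zero>\<^sub>A = \<zero>\<^sub>T"
      using A.TP.tens_smult(1)[of "\<zero>\<^sub>A" "\<one>\<^sub>A" 0] A.TP.tens_smult(2)[of "?f \<otimes>\<^sub>A ?g" "\<zero>\<^sub>A" 0] cl by simp_all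
    then show ?thesis using False by simp
  qed
  have "A.dx (Xp i) \<otimes>\<^sub>T A.dx (Xm j) = ?t (?x \<otimes>\<^sub>A ?y) \<one>\<^sub>A \<oplus>\<^sub>T ?t (?g \<otimes>\<^sub>A ?y) ?x \<oplus>\<^sub>T
      (?t (?x \<otimes>\<^sub>A ?f) ?y \<oplus>\<^sub>T ?t (?g \<otimes>\<^sub>A ?f) (?x \<otimes>\<^sub>A ?y))"
    using cl by (simp add: A.dx_def A.TP.TT.l_distr A.TP.TT.r_distr A.TP.tens_mult del: A.b_closed)
  also have "\<dots> = ?c \<odot>\<^sub>T ?t (?y \<otimes>\<^sub>A ?x) \<one>\<^sub>A \<oplus>\<^sub>T ?t ?d \<one>\<^sub>A \<oplus>\<^sub>T ?c \<odot>\<^sub>T ?t (?y \<otimes>\<^sub>A ?g) ?x \<oplus>\<^sub>T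
      (?c \<odot>\<^sub>T ?t (?f \<otimes>\<^sub>A ?x) ?y \<oplus>\<^sub>T (?c \<odot>\<^sub>T ?t (?f \<otimes>\<^sub>A ?g) (?y \<otimes>\<^sub>A ?x) \<oplus>\<^sub>T ?t (?f \<otimes>\<^sub>A ?g) ?d))"
    unfolding xy gy xf gfc using cl
    by (simp only: A.TP.tens_add_left A.TP.tens_add_right A.TP.tens_smult A0.m_closed A0.smult_closed)
  also have "\<dots> = (?c \<odot>\<^sub>T ?t (?y \<otimes>\<^sub>A ?x) \<one>\<^sub>A \<oplus>\<^sub>T ?c \<odot>\<^sub>T ?t (?f \<otimes>\<^sub>A ?x) ?y \<oplus>\<^sub>T
      (?c \<odot>\<^sub>T ?t (?y \<otimes>\<^sub>A ?g) ?x \<oplus>\<^sub>T ?c \<odot>\<^sub>T ?t (?f \<otimes>\<^sub>A ?g) (?y \<otimes>\<^sub>A ?x))) \<oplus>\<^sub>T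
      (?t ?d \<one>\<^sub>A \<oplus>\<^sub>T ?t (?f \<otimes>\<^sub>A ?g) ?d)"
  proof -
    have "a \<oplus>\<^sub>T d \<oplus>\<^sub>T b \<oplus>\<^sub>T (c \<oplus>\<^sub>T (e \<oplus>\<^sub>T f)) = (a \<oplus>\<^sub>T c \<oplus>\<^sub>T (b \<oplus>\<^sub>T e)) \<oplus>\<^sub>T (d \<oplus>\<^sub>T f)"
      if "a \<in> carrier A2" "b \<in> carrier A2" "c \<in> carrier A2" "d \<in> carrier A2" "e \<in> carrier A2" "f \<in> carrier A2" for a b c d e f
      using that by (simp add: A.TP.TT.a_ac)
    then show ?thesis using cl
      by (simp only: A.TP.TT.smult_closed A.TP.tens_closed A0.m_closed)
  qed
  also have "\<dots> = ?c \<odot>\<^sub>T (A.dx (Xm j) \<otimes>\<^sub>T A.dx (Xp i)) \<oplus>\<^sub>T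
      (?t ?d \<one>\<^sub>A \<oplus>\<^sub>T ?t (?f \<otimes>\<^sub>A ?g) ?d)"
    using cl by (simp add: A.dx_def A.TP.TT.l_distr A.TP.TT.r_distr A.TP.tens_mult A.TP.TT.smult_r_distr del: A.b_closed)
  finally show ?thesis unfolding d .
qed

lemma \<phi>_Fn_rels:
  assumes "r \<in> Fn_rels"
  shows "\<phi> r = \<zero>\<^sub>T"
proof -
  obtain i j where r: "r = bas (\<one>\<^sub>H, [Xp i, Xm j]) - sgl (\<one>\<^sub>H, [Xm j, Xp i]) (p j i)
        - (if i = j then bas (\<one>\<^sub>H, []) - bas (gf i, []) else 0)"
    using assms unfolding Fn_rels_def by blast
  let ?x = "bas (\<one>\<^sub>H, [Xp i, Xm j]) :: ('k, 'n) sk" and ?y = "sgl (\<one>\<^sub>H, [Xm j, Xp i]) (p j i) :: ('k, 'n) sk"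
  let ?d = "bas (\<one>\<^sub>H, []) - bas (gf i, []) :: ('k, 'n) sk"
  have c: "?x \<in> carrier SK" "?y \<in> carrier SK" "bas (\<one>\<^sub>H, []) \<in> carrier SK" "bas (gf i, []) \<in> carrier SK" by auto
  have d: "?d \<in> carrier SK" "?x - ?y \<in> carrier SK"
    unfolding SK_simps mem_Collect_eq by (rule supp_diff_subset; auto)+
  have z: "\<phi> 0 = \<zero>\<^sub>T" using klin_zero[OF SK.k_alg A.TP.TT.k_alg \<phi>(1)] by simp
  have z': "0 \<in> carrier SK" using SK.zero_closed by simp
  have gfd: "\<phi> ?d = \<one>\<^sub>T \<ominus>\<^bsub>A2\<^esub> A2g (gf i)"
    using \<phi>_diff[OF c(3,4)] \<phi>_single[of "gf i" "[]" 1] by (simp add: \<phi>_word A.TP.TT.smult_one)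
  have e: "\<phi> (if i = j then ?d else 0) = (if i = j then \<one>\<^sub>T \<ominus>\<^bsub>A2\<^esub> A2g (gf i) else \<zero>\<^sub>T)" (is "\<phi> ?D = ?E")
    using gfd z by auto
  have Dc: "?D \<in> carrier SK" 
  proof (cases "i = j")
    case True
    then have "?D = ?d" by (rule if_P)
    then show ?thesis using d(1) by (simp only:)
  next
    case False
    then have "?D = 0" by (rule if_not_P)
    then show ?thesis using z' by (simp only:)
  qed
  have Ec: "?E \<in> carrier A2" by simp
  have x: "\<phi> ?x = A.dx (Xp i) \<otimes>\<^sub>T A.dx (Xm j)" and y: "\<phi> ?y = p j i \<odot>\<^sub>T (A.dx (Xm j) \<otimes>\<^sub>T A.dx (Xp i))"
    by (simp_all add: \<phi>_word A.TP.TT.smult_one)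
  have "\<phi> r = (\<phi> ?x \<ominus>\<^bsub>A2\<^esub> \<phi> ?y) \<ominus>\<^bsub>A2\<^esub> ?E"
    unfolding r \<phi>_diff[OF d(2) Dc] \<phi>_diff[OF c(1,2)] e ..
  also have "\<dots> = \<zero>\<^sub>T"
  proof -
    have "(a \<oplus>\<^sub>T b) \<ominus>\<^bsub>A2\<^esub> a \<ominus>\<^bsub>A2\<^esub> b = \<zero>\<^sub>T" if "a \<in> carrier A2" "b \<in> carrier A2" for a b
      using that by (rule A.TP.TT.add_minus_minus)
    then show ?thesis unfolding x dx_rel y using Ec by (simp del: if_cancel)
  qed
  finally show ?thesis .
qed

text \<open>A relation u_l is 0 in A^+, so factoring \<open>\<phi>\<close> on polynomials in the x_i
  through the coproduct of A^+ makes it vanish on u_l without any computation.\<close>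

lemma \<phi>_emb_P: "\<phi> (emb Xp s) = toAA (Ap_coproduct p N u L (P.evw s))"
proof -
  note D = P.cop_klin[OF Ap_coproduct_is]
  note F = klin_comp[OF D alg_homD(1)[OF toAA_P(1)]]
  have "supp s \<subseteq> UNIV" by simp
  then show ?thesis
  proof (induction rule: pm_induct)
    case zero
    then show ?case
      using klin_zero[OF P.Q.k_alg A.TP.TT.k_alg F]
        klin_zero[OF SK.k_alg A.TP.TT.k_alg \<phi>(1)] by (simp add: emb_def)
  next
    case (single v c)
    have "toAA (Ap_coproduct p N u L (c \<odot>\<^bsub>P.Q\<^esub> P.bw v)) = c \<odot>\<^sub>T A.dw (map Xp v)"
      using klinD(3)[OF F P.b_closed[OF P.one_Ks], of c v]
      unfolding P.coproduct_word[OF Ap_coproduct_is] toAA_dw_P .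
    then show ?case by (simp add: emb_def \<phi>_word)
  next
    case (add s t)
    have "\<phi> (emb Xp (s + t)) = \<phi> (emb Xp s) \<oplus>\<^sub>T \<phi> (emb Xp t)"
      using \<phi>(3)[OF emb_closed[of Xp s] emb_closed[of Xp t]] by (simp add: emb_def plin_add)
    then show ?case using klinD(2)[OF F P.evw_closed P.evw_closed, of s t] add.IH
      unfolding P.evw_simps(2) by simp
  qed
qed

lemma \<phi>_emb_M: "\<phi> (emb Xm s) = toAA (Am_coproduct p N w T (M.evw s))"
proof -
  note D = M.cop_klin[OF Am_coproduct_is]
  note F = klin_comp[OF D alg_homD(1)[OF toAA_M(1)]]
  have "supp s \<subseteq> UNIV" by simp
  then show ?thesis
  proof (induction rule: pm_induct)
    case zero
    then show ?case
      using klin_zero[OF M.Q.k_alg A.TP.TT.k_alg F]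
        klin_zero[OF SK.k_alg A.TP.TT.k_alg \<phi>(1)] by (simp add: emb_def)
  next
    case (single v c)
    have "toAA (Am_coproduct p N w T (c \<odot>\<^bsub>M.Q\<^esub> M.bw v)) = c \<odot>\<^sub>T A.dw (map Xm v)"
      using klinD(3)[OF F M.b_closed[OF M.one_Ks], of c v]
      unfolding M.coproduct_word[OF Am_coproduct_is] toAA_dw_M .
    then show ?case by (simp add: emb_def \<phi>_word)
  next
    case (add s t)
    have "\<phi> (emb Xm (s + t)) = \<phi> (emb Xm s) \<oplus>\<^sub>T \<phi> (emb Xm t)"
      using \<phi>(3)[OF emb_closed[of Xm s] emb_closed[of Xm t]] by (simp add: emb_def plin_add)
    then show ?case using klinD(2)[OF F M.evw_closed M.evw_closed, of s t] add.IH
      unfolding M.evw_simps(2) by simp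
  qed
qed

lemma \<phi>_A_rels:
  assumes "r \<in> A_rels"
  shows "\<phi> r = \<zero>\<^sub>T"
  using assms unfolding A_rels_def
proof
  assume "r \<in> emb Xp ` u ` L"
  then obtain q where q: "q \<in> u ` L" "r = emb Xp q" by blast
  note F = klin_comp[OF P.cop_klin[OF Ap_coproduct_is] alg_homD(1)[OF toAA_P(1)]]
  show ?thesis
    using klin_zero[OF P.Q.k_alg A.TP.TT.k_alg F]
      P.evw_ideal[OF word_ideal_superset[OF q(1)]] by (simp only: q(2) \<phi>_emb_P)
next
  assume "r \<in> emb Xm ` w ` T"
  then obtain q where q: "q \<in> w ` T" "r = emb Xm q" by blast
  note F = klin_comp[OF M.cop_klin[OF Am_coproduct_is] alg_homD(1)[OF toAA_M(1)]]
  show ?thesis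
    using klin_zero[OF M.Q.k_alg A.TP.TT.k_alg F]
      M.evw_ideal[OF word_ideal_superset[OF q(1)]] by (simp only: q(2) \<phi>_emb_M)
qed

definition \<Delta>A :: "('k, 'n) quo \<Rightarrow> (('k, 'n) quo \<times> ('k, 'n) quo \<Rightarrow>\<^sub>0 'k) set" where
  "\<Delta>A = restrict (\<lambda>y. \<phi> (SOME a. a \<in> carrier SK \<and> Acls a = y)) (carrier AA)"

lemma \<Delta>A_Acls:
  assumes "a \<in> carrier SK"
  shows "\<Delta>A (Acls a) = \<phi> a"
proof -
  let ?b = "SOME b. b \<in> carrier SK \<and> Acls b = Acls a"
  have b: "?b \<in> carrier SK \<and> Acls ?b = Acls a" by (rule someI[of _ a], rule conjI[OF assms refl])
  have c: "?b - a \<in> carrier SK"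
  proof -
    have "supp ?b \<subseteq> carrier HH \<times> UNIV" "supp a \<subseteq> carrier HH \<times> UNIV" using b assms by simp_all
    then show ?thesis by (simp only: SK_simps mem_Collect_eq supp_diff_subset)
  qed
  have "Acls (?b - a) = Acls ?b \<ominus>\<^bsub>AA\<^esub> Acls a" by (rule Acls_diff[OF conjunct1[OF b] assms])
  also have "\<dots> = \<zero>\<^sub>A" unfolding conjunct2[OF b] using Acls(2)[OF assms] by (simp only: a_minus_def A0.r_neg)
  finally have z: "Acls (?b - a) = \<zero>\<^sub>A" .
  have "?b - a \<in> {x \<in> carrier SK. \<phi> x = \<zero>\<^sub>T}"
  proof (rule Acls_kernel[OF zero_ideal_vimage[OF SK.k_alg A.TP.TT.k_alg \<phi>_hom] _ _ c z])
    show "Fn_rels \<subseteq> {x \<in> carrier SK. \<phi> x = \<zero>\<^sub>T}" using Fn_rels_closed \<phi>_Fn_rels by blast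
    show "A_rels \<subseteq> {x \<in> carrier SK. \<phi> x = \<zero>\<^sub>T}" using A_rels_closed \<phi>_A_rels by blast
  qed
  then have "\<phi> ?b \<ominus>\<^bsub>A2\<^esub> \<phi> a = \<zero>\<^sub>T" using \<phi>_diff[OF conjunct1[OF b] assms] by simp
  then have "\<phi> ?b = \<phi> a"
    using A.TP.TT.r_right_minus_eq[OF \<phi>(2)[OF conjunct1[OF b]] \<phi>(2)[OF assms]] by simp
  then show ?thesis using Acls(2)[OF assms] by (simp add: \<Delta>A_def)
qed

lemma \<Delta>A_hom: "\<Delta>A \<in> alg_hom AA A2"
proof (rule alg_homI)
  have ob: "\<exists>a. a \<in> carrier SK \<and> x = Acls a" if "x \<in> carrier AA" for x
    using that unfolding Acls_surj[symmetric] by blast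
  show "klin AA A2 \<Delta>A"
  proof (rule klinI)
    fix x c assume "x \<in> carrier AA"
    then obtain a where a: "a \<in> carrier SK" "x = Acls a" using ob by blast
    show "\<Delta>A x \<in> carrier A2" using \<Delta>A_Acls[OF a(1)] \<phi>(2)[OF a(1)] a(2) by simp
    show "\<Delta>A (c \<odot>\<^sub>A x) = c \<odot>\<^sub>T \<Delta>A x"
      using \<Delta>A_Acls[OF SK.smult_closed[OF a(1)], of c] unfolding a(2) Acls(4)[OF a(1)] \<phi>(4)[OF a(1)] \<Delta>A_Acls[OF a(1)] .
    fix y assume "y \<in> carrier AA"
    then obtain b where b: "b \<in> carrier SK" "y = Acls b" using ob by blast
    show "\<Delta>A (x \<oplus>\<^sub>A y) = \<Delta>A x \<oplus>\<^sub>T \<Delta>A y"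
      using \<Delta>A_Acls[OF SK.a_closed[OF a(1) b(1)]]
      unfolding a(2) b(2) Acls(3)[OF a(1) b(1)] \<phi>(3)[OF a(1) b(1)] \<Delta>A_Acls[OF a(1)] \<Delta>A_Acls[OF b(1)] .
  qed
  show "\<Delta>A \<one>\<^sub>A = \<one>\<^sub>T" using \<Delta>A_Acls[OF SK.one_closed] unfolding Acls(6) \<phi>(6) .
  fix x y assume "x \<in> carrier AA" "y \<in> carrier AA"
  then obtain a b where a: "a \<in> carrier SK" "x = Acls a" and b: "b \<in> carrier SK" "y = Acls b" using ob by metis
  show "\<Delta>A (x \<otimes>\<^sub>A y) = \<Delta>A x \<otimes>\<^sub>T \<Delta>A y"
    using \<Delta>A_Acls[OF SK.m_closed[OF a(1) b(1)]]
    unfolding a(2) b(2) Acls(5)[OF a(1) b(1)] \<phi>(5)[OF a(1) b(1)] \<Delta>A_Acls[OF a(1)] \<Delta>A_Acls[OF b(1)] .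
qed

lemma \<Delta>A_is_coproduct: "is_coproduct AA A.gens_g A.gens_x \<Delta>A"
  unfolding is_coproduct_def
proof (intro conjI)
  show "\<Delta>A \<in> extensional (carrier AA)" by (simp add: \<Delta>A_def)
  show "\<forall>g\<in>A.gens_g. \<Delta>A g = tens AA AA g g"
  proof
    fix g assume "g \<in> A.gens_g"
    then obtain h where h: "g = A.bg h" "h \<in> carrier HH" by auto
    show "\<Delta>A g = tens AA AA g g"
      using \<Delta>A_Acls[of "bas (h, [])"] h(2) by (simp add: h(1) \<phi>_single A.TP.TT.smult_one)
  qed
  have "\<Delta>A (A.bw [x]) = A.dx x" for x
    using \<Delta>A_Acls[of "bas (\<one>\<^sub>H, [x])"] by (simp add: \<phi>_word A.TP.TT.smult_one)
  then show "\<forall>(x, g)\<in>A.gens_x. \<Delta>A x = tens AA AA x \<one>\<^sub>A \<oplus>\<^sub>T tens AA AA g x"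
    unfolding A.dx_def by blast
qed (rule \<Delta>A_hom)

lemma A_generators: "A_grouplikes p N u L w T = A.gens_g" "A_skew_primitives p N u L w T = A.gens_x"
proof -
  show "A_grouplikes p N u L w T = A.gens_g"
    unfolding A_grouplikes_def gg_def[symmetric] ff_def[symmetric] by blast
  show "A_skew_primitives p N u L w T = A.gens_x"
    unfolding A_skew_primitives_def gg_def[symmetric] ff_def[symmetric]
  proof (intro equalityI subsetI)
    fix z assume "z \<in> {(A.bw [Xp i], A.bg (gg i)) | i. True} \<union> {(A.bw [Xm i], A.bg (ff i)) | i. True}"
    then show "z \<in> A.gens_x"
    proof
      assume "z \<in> {(A.bw [Xp i], A.bg (gg i)) | i. True}"
      then obtain i where "z = (A.bw [Xp i], A.bg (\<gamma>A (Xp i)))" by auto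
      then show ?thesis by blast
    next
      assume "z \<in> {(A.bw [Xm i], A.bg (ff i)) | i. True}"
      then obtain i where "z = (A.bw [Xm i], A.bg (\<gamma>A (Xm i)))" by auto
      then show ?thesis by blast
    qed
  next
    fix z assume "z \<in> A.gens_x"
    then obtain x where z: "z = (A.bw [x], A.bg (\<gamma>A x))" by blast
    show "z \<in> {(A.bw [Xp i], A.bg (gg i)) | i. True} \<union> {(A.bw [Xm i], A.bg (ff i)) | i. True}"
      by (cases x) (auto simp: z)
  qed
qed

lemma A_coproduct_is: "is_coproduct AA A.gens_g A.gens_x (A_coproduct p N u L w T)"
  unfolding A_coproduct_def A_generators A.coproduct_eq[OF \<Delta>A_is_coproduct] by (rule \<Delta>A_is_coproduct)

end

section \<open>Coordinates on \<open>A\<^sup>\<plusminus>\<close>\<close>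

locale half_nf = half p N B Ks l b \<gamma> R
  for p :: "'n::finite \<Rightarrow> 'n \<Rightarrow> 'k::field" and N :: "(('k, 'n) lin \<times> ('k, 'n) lin) set"
    and B :: "('k, 'a) module" and Ks :: "('k, 'n) hgrp set" and l :: "'n \<Rightarrow> 'n letter"
    and b :: "('k, 'n) hgrp \<Rightarrow> 'n list \<Rightarrow> 'a" and \<gamma> :: "'n \<Rightarrow> ('k, 'n) hgrp"
    and R :: "('k, 'n) npoly set" +
  fixes W :: "'n list set" and r :: "'n list \<Rightarrow> ('k, 'n) npoly"
  assumes r_supp: "\<And>v. supp (r v) \<subseteq> {x \<in> W. count_list x = count_list v}"
    and r_diff: "\<And>v. bas v - r v \<in> word_ideal R"
    and r_zero: "\<And>s. s \<in> word_ideal R \<Longrightarrow> plin r s = 0"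
    and r_W: "\<And>v. v \<in> W \<Longrightarrow> r v = bas v"
begin

definition lift :: "('k, 'n) hgrp \<Rightarrow> ('k, 'n) npoly \<Rightarrow> (('k, 'n) hgrp \<times> 'n list \<Rightarrow>\<^sub>0 'k)" where
  "lift g = plin (\<lambda>v. bas (g, v))"

lemma lift_simps [simp]: "lift g 0 = 0" "lift g (s + t) = lift g s + lift g t" "lift g (s - t) = lift g s - lift g t"
  "lift g (scl c s) = scl c (lift g s)" "lift g (sgl v c) = sgl (g, v) c"
  by (simp_all add: lift_def plin_add plin_diff plin_scl)

lemma lookup_lift: "lookup (lift g s) (g', v) = (if g' = g then lookup s v else 0)"
  unfolding lift_def
  by (subst lookup_plin_at[where j = v and c = "if g' = g then 1 else 0"]) (auto simp: lookup_single when_def)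

lemma supp_lift: "g \<in> Ks \<Longrightarrow> supp (lift g s) \<subseteq> Ks \<times> UNIV"
  unfolding lift_def by (rule supp_plin_subset) auto

lemma evm_lift: "g \<in> Ks \<Longrightarrow> evm (lift g s) = bg g \<otimes>\<^sub>B evw s"
proof -
  assume g: "g \<in> Ks"
  have "supp s \<subseteq> UNIV" by simp
  then show ?thesis
    by (induction rule: pm_induct)
      (use g in \<open>simp_all add: evm_add supp_lift evm_single B.r_distr B.smult_mult_r b_split[of g, symmetric]\<close>)
qed

lemma evw_r: "evw (r v) = bw v"
proof -
  have "evw (bas v - r v) = \<zero>\<^sub>B" by (rule evw_ideal[OF r_diff])
  then show ?thesis by (simp add: B.smult_one B.r_right_minus_eq)
qed

definition hr :: "(('k, 'n) hgrp \<times> 'n list \<Rightarrow>\<^sub>0 'k) \<Rightarrow> (('k, 'n) hgrp \<times> 'n list \<Rightarrow>\<^sub>0 'k)" where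
  "hr = plin (\<lambda>(g, v). lift g (r v))"

lemma hr_simps [simp]: "hr 0 = 0" "hr (s + t) = hr s + hr t" "hr (s - t) = hr s - hr t"
  "hr (scl c s) = scl c (hr s)" "hr (sgl (g, v) c) = scl c (lift g (r v))"
  by (simp_all add: hr_def plin_add plin_diff plin_scl)

lemma supp_hr: "supp t \<subseteq> Ks \<times> UNIV \<Longrightarrow> supp (hr t) \<subseteq> Ks \<times> W"
proof -
  assume t: "supp t \<subseteq> Ks \<times> UNIV"
  have "supp (lift g (r v)) \<subseteq> {g} \<times> W" for g v
    unfolding lift_def using r_supp[of v] by (intro supp_plin_subset) auto
  then show ?thesis unfolding hr_def using t by (intro supp_plin_subset) fastforce
qed

lemma evm_hr: "supp t \<subseteq> Ks \<times> UNIV \<Longrightarrow> evm (hr t) = evm t"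
proof (induction rule: pm_induct)
  case (single k c)
  then obtain g v where k: "k = (g, v)" "g \<in> Ks" by auto
  then show ?case
    by (simp add: evm_scl supp_lift evm_lift evw_r evm_single b_split[of g v, symmetric])
next
  case (add s t)
  have "supp (hr s) \<subseteq> Ks \<times> UNIV" "supp (hr t) \<subseteq> Ks \<times> UNIV" using supp_hr add(1,2) by fastforce+
  then show ?case using add by (simp add: evm_add)
qed simp

lemma hr_kernel:
  assumes "supp t \<subseteq> Ks \<times> UNIV" "evm t = \<zero>\<^sub>B"
  shows "hr t = 0"
proof (rule poly_mapping_eqI)
  fix k :: "('k, 'n) hgrp \<times> 'n list"
  obtain g v where k: "k = (g, v)" by (cases k)
  have "lookup (hr t) (g, v) = lookup (plin r (plin (\<lambda>(g', v). if g' = g then bas v else 0) t)) v"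
    unfolding hr_def plin_plin
    by (auto simp: lookup_plin lookup_lift case_prod_unfold intro!: sum.cong)
  also have "\<dots> = 0" using r_zero[OF evm_kernel[OF assms]] by simp
  finally show "lookup (hr t) k = lookup 0 k" by (simp add: k)
qed

lemma hr_id: "supp t \<subseteq> Ks \<times> W \<Longrightarrow> hr t = t"
  by (induction rule: pm_induct) (auto simp: r_W)

text \<open>Coordinates of A^+ or A^- for the monomials g x_v with v a normal word. The group
  element stands in front here for both halves, unlike in the triangular coordinates of A^- (see
  \<open>embM\<close>).\<close>

definition hcrd :: "'a \<Rightarrow> (('k, 'n) hgrp \<times> 'n list \<Rightarrow>\<^sub>0 'k)" where
  "hcrd y = hr (SOME t. supp t \<subseteq> Ks \<times> UNIV \<and> y = evm t)"

lemma hcrd_evm: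
  assumes "supp t \<subseteq> Ks \<times> UNIV"
  shows "hcrd (evm t) = hr t"
proof -
  let ?s = "SOME s. supp s \<subseteq> Ks \<times> UNIV \<and> evm t = evm s"
  have s: "supp ?s \<subseteq> Ks \<times> UNIV \<and> evm t = evm ?s" by (rule someI[of _ t]) (simp add: assms)
  then have "evm (?s - t) = \<zero>\<^sub>B" using assms by (simp add: evm_diff B.r_right_minus_eq)
  moreover have "supp (?s - t) \<subseteq> Ks \<times> UNIV" using s assms by (intro supp_diff_subset) auto
  ultimately have "hr (?s - t) = 0" by (intro hr_kernel)
  then show ?thesis by (simp add: hcrd_def)
qed

lemma hcrd:
  assumes "y \<in> carrier B"
  shows "evm (hcrd y) = y" "supp (hcrd y) \<subseteq> Ks \<times> W"
proof -
  obtain t where "supp t \<subseteq> Ks \<times> UNIV" "y = evm t" by (rule evm_surj[OF assms])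
  then show "evm (hcrd y) = y" "supp (hcrd y) \<subseteq> Ks \<times> W"
    by (simp_all add: hcrd_evm evm_hr supp_hr)
qed

lemma Ks_W: "supp t \<subseteq> Ks \<times> W \<Longrightarrow> supp t \<subseteq> Ks \<times> UNIV" by blast

lemma hcrd_add: "x \<in> carrier B \<Longrightarrow> y \<in> carrier B \<Longrightarrow> hcrd (x \<oplus>\<^sub>B y) = hcrd x + hcrd y"
proof -
  assume x: "x \<in> carrier B" and y: "y \<in> carrier B"
  note sx = Ks_W[OF hcrd(2)[OF x]] and sy = Ks_W[OF hcrd(2)[OF y]]
  have "x \<oplus>\<^sub>B y = evm (hcrd x + hcrd y)" by (simp add: evm_add sx sy hcrd(1) x y)
  then show ?thesis
    using hcrd_evm[OF supp_add_subset[OF sx sy]] hr_id[OF supp_add_subset[OF hcrd(2)[OF x] hcrd(2)[OF y]]] by simp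
qed

lemma hcrd_smult: "x \<in> carrier B \<Longrightarrow> hcrd (c \<odot>\<^sub>B x) = scl c (hcrd x)"
proof -
  assume x: "x \<in> carrier B"
  note sx = Ks_W[OF hcrd(2)[OF x]]
  have "c \<odot>\<^sub>B x = evm (scl c (hcrd x))" by (simp add: evm_scl sx hcrd(1) x)
  then show ?thesis
    using hcrd_evm[OF supp_scl_subset[OF sx]] hr_id[OF supp_scl_subset[OF hcrd(2)[OF x]]] by simp
qed

lemma hcrd_kfun: "kfun B (\<lambda>y. lookup (hcrd y) k)"
  by (simp add: kfun_def hcrd_add hcrd_smult lookup_add)

text \<open>By \<open>coideal_of_slices\<close> it suffices to slice \<Delta> x with the coordinates
  of B. Each coordinate is the pullback of a functional on C (\<open>ext\<close>), so \<theta> maps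
  the slice to a slice of \<Delta>C(\<theta> x), which lies in U.\<close>

lemma coideal_pullback:
  assumes cop: "is_coproduct B gens_g gens_x \<Delta>"
    and C: "k_algebra C" and \<theta>: "\<theta> \<in> alg_hom B C" and U: "lin_subspace U C"
    and inter: "\<And>y. y \<in> carrier B \<Longrightarrow> tlift (tensor C C) (\<lambda>a b. tens C C (\<theta> a) (\<theta> b)) (\<Delta> y) = \<Delta>C (\<theta> y)"
    and slices: "\<And>\<psi> y. kfun C \<psi> \<Longrightarrow> y \<in> U \<Longrightarrow> square.RE C \<psi> (\<Delta>C y) \<in> U"
    and ext: "\<And>g v. g \<in> Ks \<Longrightarrow> \<exists>\<psi>. kfun C \<psi> \<and> (\<forall>y\<in>carrier B. \<psi> (\<theta> y) = lookup (hcrd y) (g, v))"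
    and x: "x \<in> carrier B" "\<theta> x \<in> U"
  shows "\<Delta> x \<in> lin_span BB {tens B B a c | a c. a \<in> {y \<in> carrier B. \<theta> y \<in> U} \<and> c \<in> carrier B}"
proof -
  interpret C: square C using C by (simp add: square_def)
  let ?U = "{y \<in> carrier B. \<theta> y \<in> U}"
  note Fh = tensor_square_hom[OF B.k_alg C \<theta>]
  note \<theta>k = alg_homD(1)[OF \<theta>]
  have U': "lin_subspace ?U B" by (rule klin_vimage[OF B.k_alg C \<theta>k U])
  \<comment> \<open>Indices with g outside \<open>Ks\<close> get the functional 0 and the vector 0,
    so that \<open>coideal_of_slices\<close> can range over the whole index type.\<close>
  define \<psi> where "\<psi> (j :: ('k, 'n) hgrp \<times> 'n list) y = (if fst j \<in> Ks then lookup (hcrd y) j else 0)" for j y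
  define \<beta> where "\<beta> j = (case j of (g, v) \<Rightarrow> if g \<in> Ks then b g v else \<zero>\<^sub>B)" for j
  have \<psi>: "kfun B (\<psi> j)" for j
    using hcrd_kfun[of j] by (auto simp: \<psi>_def kfun_def)
  have \<beta>: "\<beta> j \<in> carrier B" for j by (cases j) (simp add: \<beta>_def)
  have dx: "\<Delta> x \<in> carrier BB" using klinD(1)[OF cop_klin[OF cop] x(1)] .
  show ?thesis
  proof (rule coideal_of_slices[OF U' \<psi> \<beta> _ dx])
    fix y assume y: "y \<in> carrier B"
    have "y = finsum B (\<lambda>j. \<psi> j y \<odot>\<^sub>B \<beta> j) J'" if J': "finite J'" "supp (hcrd y) \<subseteq> J'" for J'
    proof -
      have "y = lin_ext B (\<lambda>(g, v). b g v) (hcrd y)" using hcrd(1)[OF y] by (simp add: evm_def)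
      also have "\<dots> = lin_ext B \<beta> (hcrd y)"
        using hcrd(2)[OF y] \<beta> by (intro B.lin_ext_cong) (auto simp: \<beta>_def)
      also have "\<dots> = finsum B (\<lambda>j. lookup (hcrd y) j \<odot>\<^sub>B \<beta> j) J'"
        using J' \<beta> by (intro B.lin_ext_superset) auto
      also have "\<dots> = finsum B (\<lambda>j. \<psi> j y \<odot>\<^sub>B \<beta> j) J'"
        using \<beta> hcrd(2)[OF y] by (intro B.finsum_cong') (auto simp: \<psi>_def in_keys_iff \<beta>_def subset_iff)
      finally show ?thesis .
    qed
    then show "\<exists>J. finite J \<and> (\<forall>J'. finite J' \<longrightarrow> J \<subseteq> J' \<longrightarrow> y = finsum B (\<lambda>j. \<psi> j y \<odot>\<^sub>B \<beta> j) J')"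
      by (intro exI[of _ "supp (hcrd y)"]) simp
  next
    fix j :: "('k, 'n) hgrp \<times> 'n list"
    obtain g v where j: "j = (g, v)" by (cases j)
    show "RE (\<psi> j) (\<Delta> x) \<in> ?U"
    proof (cases "g \<in> Ks")
      case True
      then obtain \<chi> where \<chi>: "kfun C \<chi>" "\<And>y. y \<in> carrier B \<Longrightarrow> \<chi> (\<theta> y) = \<psi> j y"
        using ext[of g v] by (auto simp: \<psi>_def j)
      have "\<theta> (RE (\<psi> j) z) = C.RE \<chi> (tlift (tensor C C) (\<lambda>a b. tens C C (\<theta> a) (\<theta> b)) z)" if "z \<in> carrier BB" for z
      proof (rule TP.tensor_klin_eqI[OF C klin_comp[OF RE(1)[OF \<psi>] \<theta>k] klin_comp[OF alg_homD(1)[OF Fh(1)] C.RE(1)[OF \<chi>(1)]] _ that])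
        fix a c assume "a \<in> carrier B" "c \<in> carrier B"
        then show "\<theta> (RE (\<psi> j) (tens B B a c)) = C.RE \<chi> (tlift (tensor C C) (\<lambda>a b. tens C C (\<theta> a) (\<theta> b)) (tens B B a c))"
          by (simp add: RE(2)[OF \<psi>] Fh(2) C.RE(2)[OF \<chi>(1)] alg_homD(2,4)[OF \<theta>] \<chi>(2))
      qed
      from this[OF dx] inter[OF x(1)] slices[OF \<chi>(1) x(2)] show ?thesis
        using RE_closed[OF \<psi> dx] by simp
    next
      case False
      then have "RE (\<psi> j) (\<Delta> x) = \<zero>\<^sub>B" using RE_zero[OF dx] by (simp add: \<psi>_def[abs_def] j)
      then show ?thesis using B.lin_subspaceD(2)[OF U'] by simp
    qed
  qed
qed

abbreviation "hd_part d \<equiv> rst (\<lambda>k. count_list (snd k) = d)"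

lemma spanned_by_parts:
  assumes U: "lin_subspace U B" and part: "\<And>x d. x \<in> U \<Longrightarrow> evm (hd_part d (hcrd x)) \<in> U"
    and C: "\<And>t d. supp t \<subseteq> Ks \<times> {v. count_list v = d} \<Longrightarrow> evm t \<in> C d"
  shows "spanned_by_homogeneous B C U"
  unfolding spanned_by_homogeneous_def
proof
  show "lin_span B (\<Union>d. U \<inter> C d) \<subseteq> U" by (rule B.lin_span_least[OF U]) blast
  show "U \<subseteq> lin_span B (\<Union>d. U \<inter> C d)"
  proof
    fix x assume x: "x \<in> U"
    then have xc: "x \<in> carrier B" using B.lin_subspaceD(1)[OF U] by blast
    let ?S = "lin_span B (\<Union>d. U \<inter> C d)" and ?t = "hcrd x"
    have S: "lin_subspace ?S B" using B.lin_subspaceD(1)[OF U] by (intro B.lin_subspace_lin_span) blast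
    note D = B.lin_subspaceD[OF S]
    let ?V = "{t. supp t \<subseteq> Ks \<times> UNIV \<and> evm t \<in> ?S}"
    have V: "pm.subspace ?V"
      using D by (auto simp: pm.subspace_def evm_add evm_scl supp_add_subset supp_scl_subset)
    have parts: "hd_part d ?t \<in> ?V" for d
    proof -
      have sup: "supp (hd_part d ?t) \<subseteq> Ks \<times> {v. count_list v = d}"
        unfolding rst_def using hcrd(2)[OF xc] by (intro supp_plin_subset) auto
      then have "evm (hd_part d ?t) \<in> U \<inter> C d" using part[OF x] C by blast
      then have "evm (hd_part d ?t) \<in> ?S" using B.lin_span_superset[of "\<Union>d. U \<inter> C d"] by blast
      then show ?thesis using sup by blast
    qed
    have "?t = (\<Sum>d\<in>(\<lambda>k. count_list (snd k)) ` supp ?t. hd_part d ?t)" by (simp only: sum_rst_fibres)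
    moreover have "(\<Sum>d\<in>(\<lambda>k. count_list (snd k)) ` supp ?t. hd_part d ?t) \<in> ?V"
      by (rule pm.subspace_sum[OF V parts])
    ultimately have "?t \<in> ?V" by simp
    then show "x \<in> ?S" using hcrd(1)[OF xc] by simp
  qed
qed

end

text \<open>The \<Gamma>-degree of the triangular monomial x^-_a h x_c.\<close>

definition tdeg :: "'n list \<times> ('k, 'n) hgrp \<times> 'n list \<Rightarrow> 'n \<Rightarrow> int" where
  "tdeg = (\<lambda>(a, h, c) i. int (count_list c i) - int (count_list a i))"

section \<open>Evaluation and coordinates as mutually inverse maps\<close>

context coords
begin

sublocale PN: half_nf p N P.Q "G_in_H p N" Xp P.bQ gg "u ` L" Wp rp
  by unfold_locales (rule rp_supp rp_diff rp_zero rp_W, assumption?)+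

sublocale MN: half_nf p N M.Q "F_in_H p N" Xm M.bQ ff "w ` T" Wm rm
  by unfold_locales (rule rm_supp rm_diff rm_zero rm_W, assumption?)+

text \<open>By degree, s is a multiple of the empty word, and elements of the ideal have no constant
  term, so the factor is 1.\<close>

lemma nf_empty:
  assumes "\<And>q v. q \<in> R \<Longrightarrow> v \<in> supp q \<Longrightarrow> length v > 1" "supp (s :: ('k, 'n) npoly) \<subseteq> {x. count_list x = count_list []}"
    "bas [] - s \<in> word_ideal R"
  shows "s = bas []"
proof (rule poly_mapping_eqI)
  fix v
  have len: "length v = 0" if "v \<in> supp s"
    using that assms(2) by (auto simp: length_eq_count)
  have "supp (bas [] - s) \<subseteq> {v. length v > 1}" by (rule word_ideal_length[OF assms(1,3)])
  then have "lookup (bas [] - s) [] = 0" by (auto simp: in_keys_iff)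
  then show "lookup s v = lookup (bas []) v"
    using len by (cases "v = []") (auto simp: lookup_minus in_keys_iff lookup_single)
qed

lemma rm_Nil [simp]: "rm [] = bas []"
  by (rule nf_empty[OF _ _ rm_diff]) (use w_len rm_supp in auto)

lemma rp_Nil [simp]: "rp [] = bas []"
  by (rule nf_empty[OF _ _ rp_diff]) (use u_len rp_supp in auto)

lemma toA_evw_simps:
  "toA (M.evw (s + s')) = toA (M.evw s) \<oplus>\<^sub>A toA (M.evw s')"
  "toA (P.evw (t + t')) = toA (P.evw t) \<oplus>\<^sub>A toA (P.evw t')"
  "toA (M.evw (sgl a d)) = d \<odot>\<^sub>A A.bw (map Xm a)"
  "toA (P.evw (sgl c d)) = d \<odot>\<^sub>A A.bw (map Xp c)"
  "toA (M.evw 0) = \<zero>\<^sub>A" "toA (P.evw 0) = \<zero>\<^sub>A"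
  using klinD(2)[OF toA_M_klin M.evw_closed M.evw_closed] klinD(2)[OF toA_P_klin P.evw_closed P.evw_closed]
    klinD(3)[OF toA_M_klin M.b_closed[OF M.one_Ks]] klinD(3)[OF toA_P_klin P.b_closed[OF P.one_Ks]]
    toA_M_bQ[OF M.one_Ks] toA_P_bQ[OF P.one_Ks]
    klin_zero[OF M.Q.k_alg A0.k_alg toA_M_klin]
    klin_zero[OF P.Q.k_alg A0.k_alg toA_P_klin]
  by simp_all

lemma toA_evw_closed [simp]: "toA (M.evw s) \<in> carrier AA" "toA (P.evw t) \<in> carrier AA"
  by (rule klinD(1)[OF toA_M_klin M.evw_closed], rule klinD(1)[OF toA_P_klin P.evw_closed])

lemma T3_V [simp]: "h \<in> carrier HH \<Longrightarrow> T3 s h t \<in> V0"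
  by (rule T3_V0)

lemma ev_T3:
  assumes h: "h \<in> carrier HH"
  shows "A.ev (T3 s h t) = toA (M.evw s) \<otimes>\<^sub>A A.bg h \<otimes>\<^sub>A toA (P.evw t)"
proof -
  have 1: "A.ev (T3 (sgl a d) h t) = toA (M.evw (sgl a d)) \<otimes>\<^sub>A A.bg h \<otimes>\<^sub>A toA (P.evw t)" for a d
  proof -
    have "supp t \<subseteq> UNIV" by simp
    then show ?thesis
    proof (induction rule: pm_induct)
      case zero
      show ?case using h by (simp only: T3_simps toA_evw_simps A.ev_zero) simp
    next
      case (single c e)
      show ?case using h
        by (simp add: toA_evw_simps A.ev_single A.mon_def A0.smult_mult_l A0.smult_mult_r A0.smult_assoc[symmetric] mult.commute
            del: M.evw_simps P.evw_simps)
    next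
      case (add t t')
      then show ?case using h by (simp add: toA_evw_simps A.ev_add A0.r_distr del: M.evw_simps P.evw_simps)
    qed
  qed
  have "supp s \<subseteq> UNIV" by simp
  then show ?thesis
  proof (induction rule: pm_induct)
    case zero
    show ?case using h by (simp only: T3_simps toA_evw_simps A.ev_zero) simp
  next
    case (single a d)
    show ?case by (rule 1)
  next
    case (add s s')
    then show ?case using h by (simp add: toA_evw_simps A.ev_add A0.l_distr del: M.evw_simps P.evw_simps)
  qed
qed

lemma nf_closed: "t \<in> V0 \<Longrightarrow> nf t \<in> V0"
  unfolding nf_def V0_def mem_Collect_eq
  by (rule supp_plin_subset) (auto simp: in_keys_iff lookup_T3 subset_iff split: if_splits, blast)

lemma crd_ev: "t \<in> V0 \<Longrightarrow> crd (A.ev t) = nf t"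
proof (induction rule: V0_induct)
  case zero
  have "crd (\<zero>\<^sub>A) = 0" using crd_smult[OF A0.zero_closed, of 0] by simp
  then show ?case by simp
next
  case (single a h c d)
  then show ?case by (simp add: A.ev_single crd_smult crd_mon)
next
  case (add s t)
  then show ?case by (simp add: A.ev_add crd_add A.ev_closed)
qed

lemma toA_rm: "toA (M.evw (rm a)) = A.bw (map Xm a)"
  using MN.evw_r[of a] toA_M_bQ[OF M.one_Ks, of a] by simp

lemma toA_rp: "toA (P.evw (rp c)) = A.bw (map Xp c)"
  using PN.evw_r[of c] toA_P_bQ[OF P.one_Ks, of c] by simp

lemma ev_nf: "t \<in> V0 \<Longrightarrow> A.ev (nf t) = A.ev t"
proof (induction rule: V0_induct)
  case (single a h c d)
  then show ?case by (simp add: A.ev_single A.ev_scl ev_T3 toA_rm toA_rp A.mon_def)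
next
  case (add s t)
  then show ?case by (simp add: A.ev_add nf_closed)
qed simp

lemma e0_V0': "e0 \<in> V0" by simp

lemma ev_crd: "y \<in> carrier AA \<Longrightarrow> A.ev (crd y) = y"
proof -
  assume "y \<in> carrier AA"
  then obtain a where a: "a \<in> carrier SK" "y = Acls a" by (rule AA_obtain)
  have "A.ev (crd (Acls a)) = Acls a"
    unfolding crd_Acls[OF a(1)] ev_nf[OF act_closed[OF a(1) e0_V0']] by (rule Acls_ev[OF a(1), symmetric])
  then show ?thesis by (simp only: a(2))
qed

abbreviation "WW \<equiv> Wm \<times> carrier HH \<times> Wp"

lemma WW_V0: "supp t \<subseteq> WW \<Longrightarrow> t \<in> V0"
  unfolding V0_def by blast

lemma supp_nf: "t \<in> V0 \<Longrightarrow> supp (nf t) \<subseteq> WW"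
  unfolding nf_def
proof (rule supp_plin_subset)
  fix k assume "t \<in> V0" "k \<in> supp t"
  then obtain a h c where k: "k = (a, h, c)" "h \<in> carrier HH" unfolding V0_def by auto
  have "supp (T3 (rm a) h (rp c)) \<subseteq> WW"
    using rm_supp[of a] rp_supp[of c] k(2) by (auto simp: in_keys_iff lookup_T3 subset_iff split: if_splits)
  then show "supp (case k of (a, h, c) \<Rightarrow> T3 (rm a) h (rp c)) \<subseteq> WW" by (simp add: k)
qed

lemma supp_crd: "y \<in> carrier AA \<Longrightarrow> supp (crd y) \<subseteq> WW"
proof -
  assume "y \<in> carrier AA"
  then obtain a where a: "a \<in> carrier SK" "y = Acls a" by (rule AA_obtain)
  show ?thesis using supp_nf[OF act_closed[OF a(1) e0_V0']] by (simp add: a(2) crd_Acls[OF a(1)])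
qed

lemma nf_id: "supp t \<subseteq> WW \<Longrightarrow> nf t = t"
  by (induction rule: pm_induct) (auto simp: rm_W rp_W)

lemma crd_ev_WW: "supp t \<subseteq> WW \<Longrightarrow> crd (A.ev t) = t"
  by (simp add: crd_ev WW_V0 nf_id)

lemma crd_V0: "y \<in> carrier AA \<Longrightarrow> crd y \<in> V0"
  by (rule WW_V0[OF supp_crd])

definition "cf a h c y = lookup (crd y) (a, h, c)"

lemma cf_kfun: "kfun AA (cf a h c)"
  by (simp add: kfun_def cf_def crd_add crd_smult lookup_add)

lemma cf_mon:
  "h \<in> carrier HH \<Longrightarrow> cf a0 h0 c0 (A.bw (map Xm a) \<otimes>\<^sub>A A.bg h \<otimes>\<^sub>A A.bw (map Xp c)) =
    (if h = h0 then lookup (rm a) a0 * lookup (rp c) c0 else 0)"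
  using crd_mon[of h a c] by (auto simp: cf_def A.mon_def lookup_T3)

lemma rm_count: "lookup (rm a) a' \<noteq> 0 \<Longrightarrow> count_list a' = count_list a"
  using rm_supp[of a] by (auto simp: in_keys_iff subset_iff)

lemma rp_count: "lookup (rp c) c' \<noteq> 0 \<Longrightarrow> count_list c' = count_list c"
  using rp_supp[of c] by (auto simp: in_keys_iff subset_iff)

lemma rm_length: "length a' \<noteq> length a \<Longrightarrow> lookup (rm a) a' = 0"
  using rm_count[of a a'] by (metis length_eq_count)

lemma rp_length: "length c' \<noteq> length c \<Longrightarrow> lookup (rp c) c' = 0"
  using rp_count[of c c'] by (metis length_eq_count)

subsection \<open>The grading in coordinates\<close>

abbreviation "Dg d \<equiv> {t :: ('k, 'n) tri. supp t \<subseteq> {k. tdeg k = d}}"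

lemma Dg_subspace: "pm.subspace (Dg d)"
  by (rule pm_subspace_supp)

lemma nf_Dg: "t \<in> Dg d \<Longrightarrow> nf t \<in> Dg d"
  unfolding nf_def mem_Collect_eq
proof (rule supp_plin_subset)
  fix k assume t: "supp t \<subseteq> {k. tdeg k = d}" "k \<in> supp t"
  obtain a h c where k: "k = (a, h, c)" by (cases k)
  have "tdeg (a, h, c) = d" using t k by auto
  then have "supp (T3 (rm a) h (rp c)) \<subseteq> {k. tdeg k = d}"
    using rm_count[of a] rp_count[of c] by (auto simp: in_keys_iff lookup_T3 tdeg_def split: if_splits)
  then show "supp (case k of (a, h, c) \<Rightarrow> T3 (rm a) h (rp c)) \<subseteq> {k. tdeg k = d}" by (simp add: k)
qed

abbreviation "e1 i \<equiv> (\<lambda>j. if j = i then 1 else 0 :: int)"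

lemma Oh_Dg: "t \<in> Dg d \<Longrightarrow> Oh g t \<in> Dg d"
  unfolding Oh_def mem_Collect_eq by (rule supp_plin_subset) (auto simp: tdeg_def split: if_splits)

lemma Om_Dg: "t \<in> Dg d \<Longrightarrow> Om j t \<in> Dg (\<lambda>i. d i - e1 j i)"
  unfolding Om_def mem_Collect_eq by (rule supp_plin_subset) (auto simp: tdeg_def fun_eq_iff)

lemma op_Dg: "op i a h c \<in> Dg (\<lambda>j. tdeg (a, h, c) j + e1 i j)"
proof (induction a)
  case Nil
  show ?case by (auto simp: tdeg_def fun_eq_iff)
next
  case (Cons j a)
  note sub = pm.subspace_add[OF Dg_subspace] pm.subspace_diff[OF Dg_subspace] pm.subspace_scale[OF Dg_subspace] pm.subspace_0[OF Dg_subspace]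
  let ?D = "Dg (\<lambda>k. tdeg (j # a, h, c) k + e1 i k)"
  have d: "(\<lambda>k. tdeg (a, h, c) k + e1 i k - e1 j k) = (\<lambda>k. tdeg (j # a, h, c) k + e1 i k)"
    by (auto simp: tdeg_def fun_eq_iff)
  have 1: "scl (p j i) (Om j (op i a h c)) \<in> ?D"
    using Om_Dg[OF Cons, of j] unfolding d by (rule sub(3))
  have "bas (a, h, c) - Oh (gf i) (bas (a, h, c)) \<in> ?D" if "i = j"
  proof -
    have b: "bas (a, h, c) \<in> ?D" using that by (auto simp: tdeg_def fun_eq_iff)
    show ?thesis by (rule sub(2)[OF b Oh_Dg[OF b]])
  qed
  then have 2: "(if i = j then bas (a, h, c) - Oh (gf i) (bas (a, h, c)) else 0) \<in> ?D"
    using sub(4) by (cases "i = j") (simp_all only: if_True if_False refl simp_thms)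
  show ?case unfolding op.simps by (rule sub(1)[OF 1 2])
qed

lemma Op_Dg: "t \<in> Dg d \<Longrightarrow> Op i t \<in> Dg (\<lambda>j. d j + e1 i j)"
  unfolding Op_def mem_Collect_eq
proof (rule supp_plin_subset)
  fix k assume t: "supp t \<subseteq> {k. tdeg k = d}" "k \<in> supp t"
  obtain a h c where k: "k = (a, h, c)" by (cases k)
  have "tdeg (a, h, c) = d" using t k by auto
  then show "supp (case k of (a, h, c) \<Rightarrow> op i a h c) \<subseteq> {k. tdeg k = (\<lambda>j. d j + e1 i j)}"
    using op_Dg[of i a h c] by (simp add: k)
qed

lemma Ow_Dg: "t \<in> Dg d \<Longrightarrow> Ow v t \<in> Dg (\<lambda>j. d j + Gamma_deg v j)"
proof (induction v)
  case Nil
  then show ?case by (simp add: Gamma_deg_def)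
next
  case (Cons x v)
  have IH: "Ow v t \<in> Dg (\<lambda>j. d j + Gamma_deg v j)" by (rule Cons.IH[OF Cons.prems])
  show ?case
  proof (cases x)
    case (Xp i)
    have "(\<lambda>j. d j + Gamma_deg v j + e1 i j) = (\<lambda>j. d j + Gamma_deg (x # v) j)"
      by (auto simp: Gamma_deg_def fun_eq_iff Xp)
    then show ?thesis using Op_Dg[OF IH, of i] by (simp only: foldr.simps o_apply Xp Ol.simps)
  next
    case (Xm i)
    have "(\<lambda>j. d j + Gamma_deg v j - e1 i j) = (\<lambda>j. d j + Gamma_deg (x # v) j)"
      by (auto simp: Gamma_deg_def fun_eq_iff Xm)
    then show ?thesis using Om_Dg[OF IH, of i] by (simp only: foldr.simps o_apply Xm Ol.simps)
  qed
qed

text \<open>The operators of the letters shift \<open>tdeg\<close> by the \<Gamma>-degree of the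
  letter, while \<open>Oh\<close> and \<open>nf\<close> preserve it; and \<open>e0\<close> has
  degree 0.\<close>

lemma crd_component:
  assumes "y \<in> A_component p N u L w T d"
  shows "crd y \<in> Dg d"
proof -
  obtain a where a: "y = Acls a" "supp a \<subseteq> carrier HH \<times> {v. Gamma_deg v = d}"
    using assms unfolding A_component_def by blast
  have e: "e0 \<in> Dg (\<lambda>j. 0)" by (auto simp: tdeg_def)
  have "act a e0 \<in> Dg d"
    unfolding act_def mem_Collect_eq
  proof (rule supp_plin_subset)
    fix k assume "k \<in> supp a"
    then obtain h v where k: "k = (h, v)" "Gamma_deg v = d" using a(2) by (cases k) auto
    show "supp (case k of (h, v) \<Rightarrow> Oh h (Ow v e0)) \<subseteq> {k. tdeg k = d}"
      using Oh_Dg[OF Ow_Dg[OF e, of v], of h] by (simp only: k prod.case mem_Collect_eq add_0)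
  qed
  moreover have "a \<in> carrier SK" using a(2) by auto
  ultimately show ?thesis unfolding a(1) by (simp only: crd_Acls nf_Dg)
qed

end

section \<open>Slices of a right coideal subalgebra\<close>

context coords
begin

abbreviation "DA \<equiv> A_coproduct p N u L w T"

lemma DA_hom: "DA \<in> alg_hom AA A2"
  using A_coproduct_is unfolding is_coproduct_def by blast

lemma DA_mon:
  "h \<in> carrier HH \<Longrightarrow> DA (A.mon a h c) = A.dw (map Xm a) \<otimes>\<^sub>T A2g h \<otimes>\<^sub>T A.dw (map Xp c)"
proof -
  assume h: "h \<in> carrier HH"
  have c: "A.bw (map Xm a) \<in> carrier AA" "A.bg h \<in> carrier AA" "A.bw (map Xp c) \<in> carrier AA"
    using h by auto
  show ?thesis
    unfolding A.mon_def alg_homD(5)[OF DA_hom A0.m_closed[OF c(1,2)] c(3)] alg_homD(5)[OF DA_hom c(1,2)]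
      A.coproduct_word[OF A_coproduct_is] A.coproduct_group[OF A_coproduct_is h] ..
qed

text \<open>To the coordinate a0 in the second factor, the coproduct of the word a looks like the
  single term x \<otimes> s: the remaining terms have second factors whose normal form has
  coefficient 0 at a0.\<close>

definition lead :: "('n \<Rightarrow> 'n letter) \<Rightarrow> ('n list \<Rightarrow> ('k, 'n) npoly) \<Rightarrow> 'n list \<Rightarrow> ('k, 'n) quo \<Rightarrow> 'n list \<Rightarrow> 'n list \<Rightarrow> bool" where
  "lead f r a x s a0 \<longleftrightarrow> x \<in> carrier AA \<and> (\<exists>v P. A.dw (map f a) = tens AA AA x (A.bw (map f s)) \<oplus>\<^sub>T v \<and>
    v \<in> A.RS (A.words P) \<and> (\<forall>v. P v \<longrightarrow> (\<exists>a'. v = map f a' \<and> lookup (r a') a0 = 0)))"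

lemma RE_mon:
  assumes h: "h \<in> carrier HH" and leads: "lead Xm rm a x s a0" "lead Xp rp c y t c0"
  shows "A.RE (cf a0 h0 c0) (DA (A.mon a h c)) =
    (if h = h0 then lookup (rm s) a0 * lookup (rp t) c0 else 0) \<odot>\<^sub>A (x \<otimes>\<^sub>A A.bg h \<otimes>\<^sub>A y)"
proof -
  obtain v P where m: "A.dw (map Xm a) = tens AA AA x (A.bw (map Xm s)) \<oplus>\<^sub>T v" "v \<in> A.RS (A.words P)" "x \<in> carrier AA"
    and P: "\<And>v. P v \<Longrightarrow> \<exists>a'. v = map Xm a' \<and> lookup (rm a') a0 = 0"
    using leads(1) unfolding lead_def by blast
  obtain v' Q where q: "A.dw (map Xp c) = tens AA AA y (A.bw (map Xp t)) \<oplus>\<^sub>T v'" "v' \<in> A.RS (A.words Q)" "y \<in> carrier AA"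
    and Q: "\<And>v. Q v \<Longrightarrow> \<exists>c'. v = map Xp c' \<and> lookup (rp c') c0 = 0"
    using leads(2) unfolding lead_def by blast
  have 1: "cf a0 h0 c0 (A.bw (map Xm s) \<otimes>\<^sub>A A.bg h \<otimes>\<^sub>A e) = 0" if "e \<in> A.words Q" for e s
  proof -
    from that Q obtain c' where "e = A.bw (map Xp c')" "lookup (rp c') c0 = 0" unfolding A.words_def by blast
    then show ?thesis using cf_mon[OF h, of a0 h0 c0 s c'] by simp
  qed
  have 2: "cf a0 h0 c0 (d \<otimes>\<^sub>A A.bg h \<otimes>\<^sub>A e) = 0"
    if "d \<in> A.words P" "e \<in> insert (A.bw (map Xp t)) (A.words Q)" for d e
  proof -
    from that(1) P obtain a' where a: "d = A.bw (map Xm a')" "lookup (rm a') a0 = 0" unfolding A.words_def by blast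
    from that(2) Q obtain c' where "e = A.bw (map Xp c')" unfolding A.words_def by blast
    then show ?thesis using cf_mon[OF h, of a0 h0 c0 a' c'] a by simp
  qed
  have c: "A.bg h \<in> carrier AA" "A.bw (map Xm s) \<in> carrier AA" "A.bw (map Xp t) \<in> carrier AA" using h by auto
  show ?thesis
    unfolding DA_mon[OF h] m(1) q(1) cf_mon[OF h, of a0 h0 c0 s t, symmetric]
    by (rule A.RE_prod[OF cf_kfun A.words_closed A.words_closed c(1) m(3) c(2) q(3) c(3) 2 1 m(2) q(2)])
qed

lemma map_words: "set v \<subseteq> set (map f a) \<Longrightarrow> \<exists>a'. v = map f a'"
  unfolding ex_map_conv by auto

lemma lead_left:
  assumes "\<And>a a'. length a' \<noteq> length a \<Longrightarrow> lookup (r a) a' = 0"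
  shows "lead f r a (A.bw (map f a)) [] []"
proof -
  obtain v where v: "v \<in> A.RS (A.words (\<lambda>v'. v' \<noteq> [] \<and> set v' \<subseteq> set (map f a)))"
    "A.dw (map f a) = tens AA AA (A.bw (map f a)) \<one>\<^sub>A \<oplus>\<^sub>T v"
    using A.dw_left[of "map f a"] by blast
  have "\<exists>a'. v = map f a' \<and> lookup (r a') [] = 0" if "v \<noteq> [] \<and> set v \<subseteq> set (map f a)" for v
    using map_words[of v f a] that assms[of "[]"] by auto
  moreover have "A.dw (map f a) = tens AA AA (A.bw (map f a)) (A.bw (map f [])) \<oplus>\<^sub>T v"
    unfolding list.map(1) A.b_one by (rule v(2))
  ultimately show ?thesis unfolding lead_def using v(1) A.bw_letter_closed by blast
qed

text \<open>The second words left over by \<open>dw_right\<close> are shorter than a and so than a0;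
  as normal forms preserve length, they have no coordinate at a0. In \<open>lead_left\<close> the
  words left over are nonempty, and a0 is the empty word.\<close>

lemma lead_right:
  assumes "\<And>a a'. length a' \<noteq> length a \<Longrightarrow> lookup (r a) a' = 0" "length a \<le> length a0"
  shows "lead f r a (A.bg (A.\<gamma>w (map f a))) a a0"
proof -
  obtain v where v: "v \<in> A.RS (A.words (\<lambda>v'. length v' < length (map f a) \<and> set v' \<subseteq> set (map f a)))"
    "A.dw (map f a) = tens AA AA (A.bg (A.\<gamma>w (map f a))) (A.bw (map f a)) \<oplus>\<^sub>T v"
    using A.dw_right[of "map f a"] by blast
  have "\<exists>a'. v = map f a' \<and> lookup (r a') a0 = 0" if "length v < length (map f a) \<and> set v \<subseteq> set (map f a)" for v
    using map_words[of v f a] that assms(2) assms(1)[of a0] by auto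
  then show ?thesis unfolding lead_def using v A.b_closed[OF A.\<gamma>w_closed] by blast
qed

lemma lead_rm: "lead Xm rm a (A.bw (map Xm a)) [] []" and lead_rp: "lead Xp rp c (A.bw (map Xp c)) [] []"
  by (rule lead_left, erule rm_length, rule lead_left, erule rp_length)

lemma slice_middle:
  assumes h: "h \<in> carrier HH"
  shows "A.RE (cf [] h0 []) (DA (A.mon a h c)) = A.ev (if h = h0 then bas (a, h, c) else 0)"
  using RE_mon[OF h lead_rm lead_rp, of h0] h by (cases "h = h0") (simp_all add: A.ev_single A.mon_def)

lemma \<gamma>w_H [simp]: "A.\<gamma>w v \<in> carrier HH" by (rule A.\<gamma>w_closed)

text \<open>The left word is read off by \<open>lead_right\<close> and leaves its group element
  \<open>A.\<gamma>w (map Xm a)\<close> behind; the right word is kept by \<open>lead_left\<close>,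
  with the coordinate at the empty word. In \<open>slice_right\<close> the roles are
  exchanged.\<close>

lemma slice_left:
  assumes h: "h \<in> carrier HH" and len: "length a \<le> length a0"
  shows "A.RE (cf a0 h0 []) (DA (A.mon a h c)) =
    A.ev (if h = h0 then sgl ([], A.\<gamma>w (map Xm a) \<otimes>\<^sub>H h, c) (lookup (rm a) a0) else 0)"
proof -
  have "A.bg (A.\<gamma>w (map Xm a)) \<otimes>\<^sub>A A.bg h \<otimes>\<^sub>A A.bw (map Xp c) = A.mon [] (A.\<gamma>w (map Xm a) \<otimes>\<^sub>H h) c"
    using h by (simp add: A.mon_def A.b_one A.bg_mult)
  moreover have l: "lead Xm rm a (A.bg (A.\<gamma>w (map Xm a))) a a0" by (rule lead_right[OF _ len], erule rm_length)
  ultimately show ?thesis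
    using RE_mon[OF h l lead_rp, of h0] h
    by (cases "h = h0") (simp_all add: A.ev_single)
qed

lemma slice_right:
  assumes h: "h \<in> carrier HH" and len: "length c \<le> length c0"
  shows "A.RE (cf [] h0 c0) (DA (A.mon a h c)) =
    A.ev (if h = h0 then sgl (a, h \<otimes>\<^sub>H A.\<gamma>w (map Xp c), []) (lookup (rp c) c0) else 0)"
proof -
  have "A.bw (map Xm a) \<otimes>\<^sub>A A.bg h \<otimes>\<^sub>A A.bg (A.\<gamma>w (map Xp c)) = A.mon a (h \<otimes>\<^sub>H A.\<gamma>w (map Xp c)) []"
    using h by (simp add: A.mon_def A.b_one A.bg_mult[symmetric] A0.m_assoc)
  moreover have l: "lead Xp rp c (A.bg (A.\<gamma>w (map Xp c))) c c0" by (rule lead_right[OF _ len], erule rp_length)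
  ultimately show ?thesis
    using RE_mon[OF h lead_rm l, of h0] h
    by (cases "h = h0") (simp_all add: A.ev_single)
qed

lemma slice_ev:
  assumes \<psi>: "kfun AA \<psi>" and S: "S \<subseteq> UNIV \<times> carrier HH \<times> UNIV"
    and E: "\<And>a h c. (a, h, c) \<in> S \<Longrightarrow> E a h c \<in> V0" "\<And>a h c. (a, h, c) \<in> S \<Longrightarrow> A.RE \<psi> (DA (A.mon a h c)) = A.ev (E a h c)"
    and t: "supp t \<subseteq> S"
  shows "A.RE \<psi> (DA (A.ev t)) = A.ev (plin (\<lambda>(a, h, c). E a h c) t)"
proof -
  let ?f = "\<lambda>y. A.RE \<psi> (DA y)"
  have f: "klin AA AA ?f" by (rule klin_comp[OF alg_homD(1)[OF DA_hom] A.RE(1)[OF \<psi>]])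
  note V = pm.subspace_scale[OF V0_subspace]
  have "A.RE \<psi> (DA (A.ev t)) = A.ev (plin (\<lambda>(a, h, c). E a h c) t) \<and> t \<in> V0 \<and> plin (\<lambda>(a, h, c). E a h c) t \<in> V0"
    using t
  proof (induction rule: pm_induct)
    case zero
    then show ?case using klin_zero[OF A0.k_alg A0.k_alg f] pm.subspace_0[OF V0_subspace] by simp
  next
    case (single k d)
    obtain a h c where k: "k = (a, h, c)" by (cases k)
    have h: "h \<in> carrier HH" using single S k by auto
    have "?f (d \<odot>\<^sub>A A.mon a h c) = d \<odot>\<^sub>A A.ev (E a h c)"
      using klinD(3)[OF f A.mon_closed[OF h]] E(2)[of a h c] single k by simp
    moreover have "E a h c \<in> V0" using E(1) single k by simp
    ultimately show ?case using h by (simp add: k A.ev_single A.ev_scl V)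
  next
    case (add s t)
    then show ?case using klinD(2)[OF f] A.ev_closed
      by (simp add: plin_add A.ev_add pm.subspace_add[OF V0_subspace])
  qed
  then show ?thesis by simp
qed

text \<open>For fixed h0 the coordinates form a matrix indexed by the words a and c. These are its
  rows and columns, as polynomials in the x_i and in the x^-_i.\<close>

definition row :: "'n list \<Rightarrow> ('k, 'n) hgrp \<Rightarrow> ('k, 'n) tri \<Rightarrow> ('k, 'n) npoly" where
  "row a0 h0 = plin (\<lambda>(a, h, c). if a = a0 \<and> h = h0 then bas c else 0)"

definition col :: "('k, 'n) hgrp \<Rightarrow> 'n list \<Rightarrow> ('k, 'n) tri \<Rightarrow> ('k, 'n) npoly" where
  "col h0 c0 = plin (\<lambda>(a, h, c). if c = c0 \<and> h = h0 then bas a else 0)"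

lemma lookup_row: "lookup (row a0 h0 t) c = lookup t (a0, h0, c)"
  unfolding row_def by (subst lookup_plin_at[where j = "(a0, h0, c)" and c = 1]) (auto simp: lookup_single when_def split: if_splits)

lemma lookup_col: "lookup (col h0 c0 t) a = lookup t (a, h0, c0)"
  unfolding col_def by (subst lookup_plin_at[where j = "(a, h0, c0)" and c = 1]) (auto simp: lookup_single when_def split: if_splits)

end

section \<open>Slices of elements of U\<close>

locale coid = coords p N u L w T Wm Wp rm rp
  for p :: "'n::finite \<Rightarrow> 'n \<Rightarrow> 'k::field" and N u L w T Wm Wp rm rp +
  fixes U :: "('k, 'n) quo set"
  assumes U_coideal: "right_coideal_subalgebra (A_alg p N u L w T) (A_coproduct p N u L w T) U"
    and U_hom: "spanned_by_homogeneous (A_alg p N u L w T) (A_component p N u L w T) U"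
    and U_H: "H_in_A p N u L w T \<subseteq> U"
begin

lemma U_subalgebra: "k_subalgebra U AA"
  using U_coideal unfolding right_coideal_subalgebra_def by blast

lemmas U_mult = A0.k_subalgebraD(3)[OF U_subalgebra]
lemmas U_subspace = A0.k_subalgebra_lin_subspace[OF U_subalgebra]
lemmas UD = A0.lin_subspaceD[OF U_subspace]

lemma U_carrier: "y \<in> U \<Longrightarrow> y \<in> carrier AA"
  using UD(1) by blast

lemma bg_U: "h \<in> carrier HH \<Longrightarrow> A.bg h \<in> U"
  using U_H unfolding H_in_A_def by blast

lemma slice_U: "kfun AA \<psi> \<Longrightarrow> y \<in> U \<Longrightarrow> A.RE \<psi> (DA y) \<in> U"
  using U_coideal unfolding right_coideal_subalgebra_def by (intro A.RE_coideal[OF _ U_subspace]) blast+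

text \<open>With coordinates at the empty word on both sides, the slice leaves x^-_a h x_c unchanged
  for h = h0 and kills it otherwise.\<close>

lemma h_part_U:
  assumes "t \<in> V0" "A.ev t \<in> U"
  shows "A.ev (rst (\<lambda>k. fst (snd k) = h0) t) \<in> U"
proof -
  have "A.RE (cf [] h0 []) (DA (A.ev t)) = A.ev (plin (\<lambda>(a, h, c). if h = h0 then bas (a, h, c) else 0) t)"
  proof (rule slice_ev[OF cf_kfun subset_refl])
    show "supp t \<subseteq> UNIV \<times> carrier HH \<times> UNIV" using assms(1) by (simp add: V0_def)
  next
    fix a :: "'n list" and h :: "('k, 'n) hgrp" and c :: "'n list"
    assume "(a, h, c) \<in> UNIV \<times> carrier HH \<times> UNIV"
    then have h: "h \<in> carrier HH" by simp
    show "(if h = h0 then bas (a, h, c) else 0) \<in> V0" using h pm.subspace_0[OF V0_subspace] by (cases "h = h0") simp_all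
    show "A.RE (cf [] h0 []) (DA (A.mon a h c)) = A.ev (if h = h0 then bas (a, h, c) else 0)" by (rule slice_middle[OF h])
  qed
  moreover have "(\<lambda>(a, h, c). if h = h0 then bas (a, h, c) else 0) =
      (\<lambda>k :: 'n list \<times> ('k, 'n) hgrp \<times> 'n list. if fst (snd k) = h0 then bas k else (0 :: ('k, 'n) tri))"
    by (auto simp: fun_eq_iff)
  ultimately show ?thesis using slice_U[OF cf_kfun assms(2), of "[]" h0 "[]"] unfolding rst_def by (simp only:)
qed

text \<open>All left words in t are normal and no longer than a0, so the slice at (a0, h0, []) is
  the row of a0, multiplied on the left by one group element. The inverse of that element lies in U
  because U contains H.\<close>

lemma row_U:
  assumes t: "supp t \<subseteq> WW" "A.ev t \<in> U" "\<And>k. k \<in> supp t \<Longrightarrow> length (fst k) \<le> length a0" and h0: "h0 \<in> carrier HH"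
  shows "toA (P.evw (row a0 h0 t)) \<in> U"
proof -
  let ?g = "A.\<gamma>w (map Xm a0) \<otimes>\<^sub>H h0" and ?z = "toA (P.evw (row a0 h0 t))"
  let ?E = "\<lambda>a h c. if h = h0 then sgl ([], A.\<gamma>w (map Xm a) \<otimes>\<^sub>H h, c) (lookup (rm a) a0) else (0 :: ('k, 'n) tri)"
  have "A.RE (cf a0 h0 []) (DA (A.ev t)) = A.ev (plin (\<lambda>(a, h, c). ?E a h c) t)"
  proof (rule slice_ev[OF cf_kfun, where S = "{(a, h, c). h \<in> carrier HH \<and> length a \<le> length a0}"])
    show "supp t \<subseteq> {(a, h, c). h \<in> carrier HH \<and> length a \<le> length a0}" using t by fastforce
  next
    fix a :: "'n list" and h :: "('k, 'n) hgrp" and c :: "'n list"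
    assume "(a, h, c) \<in> {(a, h, c). h \<in> carrier HH \<and> length a \<le> length a0}"
    then have *: "h \<in> carrier HH" "length a \<le> length a0" by auto
    show "?E a h c \<in> V0" using * pm.subspace_0[OF V0_subspace] by (cases "h = h0") simp_all
    show "A.RE (cf a0 h0 []) (DA (A.mon a h c)) = A.ev (?E a h c)" by (rule slice_left[OF *])
  qed auto
  also have "plin (\<lambda>(a, h, c). ?E a h c) t = plin (\<lambda>k. T3 (bas []) ?g (case k of (a, h, c) \<Rightarrow> if a = a0 \<and> h = h0 then bas c else 0)) t"
  proof (rule plin_cong)
    fix k assume "k \<in> supp t"
    then obtain a h c where k: "k = (a, h, c)" "rm a = bas a" using rm_W[of "fst k"] t(1) by (cases k) auto
    show "(case k of (a, h, c) \<Rightarrow> ?E a h c) = T3 (bas []) ?g (case k of (a, h, c) \<Rightarrow> if a = a0 \<and> h = h0 then bas c else 0)"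
      by (cases "a = a0"; cases "h = h0") (use k(2) in \<open>auto simp: k(1) lookup_single when_def\<close>)
  qed
  also have "\<dots> = T3 (bas []) ?g (row a0 h0 t)" unfolding row_def T3_plin_right ..
  also have "A.ev \<dots> = A.bg ?g \<otimes>\<^sub>A ?z"
    using h0 ev_T3[of ?g "bas []" "row a0 h0 t"] by (simp add: toA_evw_simps A.b_one A0.smult_one del: M.evw_simps P.evw_simps)
  finally have U: "A.bg ?g \<otimes>\<^sub>A ?z \<in> U" using slice_U[OF cf_kfun t(2), of a0 h0 "[]"] by simp
  have g: "?g \<in> carrier HH" using h0 by simp
  have "A.bg (inv\<^bsub>HH\<^esub> ?g) \<otimes>\<^sub>A (A.bg ?g \<otimes>\<^sub>A ?z) \<in> U"
    by (rule U_mult[OF bg_U[OF H.inv_closed[OF g]] U])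
  also have "A.bg (inv\<^bsub>HH\<^esub> ?g) \<otimes>\<^sub>A (A.bg ?g \<otimes>\<^sub>A ?z) = (A.bg (inv\<^bsub>HH\<^esub> ?g) \<otimes>\<^sub>A A.bg ?g) \<otimes>\<^sub>A ?z"
    by (rule A0.m_assoc[OF A.b_closed[OF H.inv_closed[OF g]] A.b_closed[OF g] toA_evw_closed(2), symmetric])
  also have "\<dots> = ?z" unfolding A.bg_inv(2)[OF g] by simp
  finally show ?thesis .
qed

lemma col_U:
  assumes t: "supp t \<subseteq> WW" "A.ev t \<in> U" "\<And>k. k \<in> supp t \<Longrightarrow> length (snd (snd k)) \<le> length c0" and h0: "h0 \<in> carrier HH"
  shows "toA (M.evw (col h0 c0 t)) \<in> U"
proof -
  let ?g = "h0 \<otimes>\<^sub>H A.\<gamma>w (map Xp c0)" and ?z = "toA (M.evw (col h0 c0 t))"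
  let ?E = "\<lambda>a h c. if h = h0 then sgl (a, h \<otimes>\<^sub>H A.\<gamma>w (map Xp c), []) (lookup (rp c) c0) else (0 :: ('k, 'n) tri)"
  have "A.RE (cf [] h0 c0) (DA (A.ev t)) = A.ev (plin (\<lambda>(a, h, c). ?E a h c) t)"
  proof (rule slice_ev[OF cf_kfun, where S = "{(a, h, c). h \<in> carrier HH \<and> length c \<le> length c0}"])
    show "supp t \<subseteq> {(a, h, c). h \<in> carrier HH \<and> length c \<le> length c0}" using t by fastforce
  next
    fix a :: "'n list" and h :: "('k, 'n) hgrp" and c :: "'n list"
    assume "(a, h, c) \<in> {(a, h, c). h \<in> carrier HH \<and> length c \<le> length c0}"
    then have *: "h \<in> carrier HH" "length c \<le> length c0" by auto
    show "?E a h c \<in> V0" using * pm.subspace_0[OF V0_subspace] by (cases "h = h0") simp_all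
    show "A.RE (cf [] h0 c0) (DA (A.mon a h c)) = A.ev (?E a h c)" by (rule slice_right[OF *])
  qed auto
  also have "plin (\<lambda>(a, h, c). ?E a h c) t = plin (\<lambda>k. T3 (case k of (a, h, c) \<Rightarrow> if c = c0 \<and> h = h0 then bas a else 0) ?g (bas [])) t"
  proof (rule plin_cong)
    fix k assume "k \<in> supp t"
    then obtain a h c where k: "k = (a, h, c)" "rp c = bas c" using rp_W[of "snd (snd k)"] t(1) by (cases k) auto
    show "(case k of (a, h, c) \<Rightarrow> ?E a h c) = T3 (case k of (a, h, c) \<Rightarrow> if c = c0 \<and> h = h0 then bas a else 0) ?g (bas [])"
      by (cases "c = c0"; cases "h = h0") (use k(2) in \<open>auto simp: k(1) lookup_single when_def\<close>)
  qed
  also have "\<dots> = T3 (col h0 c0 t) ?g (bas [])" unfolding col_def T3_plin_left ..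
  also have "A.ev \<dots> = ?z \<otimes>\<^sub>A A.bg ?g"
    using h0 ev_T3[of ?g "col h0 c0 t" "bas []"] by (simp add: toA_evw_simps A.b_one A0.smult_one del: M.evw_simps P.evw_simps)
  finally have U: "?z \<otimes>\<^sub>A A.bg ?g \<in> U" using slice_U[OF cf_kfun t(2), of "[]" h0 c0] by simp
  have g: "?g \<in> carrier HH" using h0 by simp
  have "?z \<otimes>\<^sub>A A.bg ?g \<otimes>\<^sub>A A.bg (inv\<^bsub>HH\<^esub> ?g) \<in> U"
    by (rule U_mult[OF U bg_U[OF H.inv_closed[OF g]]])
  also have "?z \<otimes>\<^sub>A A.bg ?g \<otimes>\<^sub>A A.bg (inv\<^bsub>HH\<^esub> ?g) = ?z \<otimes>\<^sub>A (A.bg ?g \<otimes>\<^sub>A A.bg (inv\<^bsub>HH\<^esub> ?g))"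
    by (rule A0.m_assoc[OF toA_evw_closed(1) A.b_closed[OF g] A.b_closed[OF H.inv_closed[OF g]]])
  also have "\<dots> = ?z" unfolding A.bg_inv(1)[OF g] by simp
  finally show ?thesis .
qed

text \<open>The projection to degree d is linear and maps each homogeneous element of U to itself or
  to 0, and U is spanned by such elements.\<close>

lemma degree_part_U:
  assumes "t \<in> V0" "supp t \<subseteq> WW" "A.ev t \<in> U"
  shows "A.ev (rst (\<lambda>k. tdeg k = d) t) \<in> U"
proof -
  let ?g = "\<lambda>y. A.ev (rst (\<lambda>k. tdeg k = d) (crd y))"
  have V: "rst (\<lambda>k. tdeg k = d) (crd y) \<in> V0" if "y \<in> carrier AA" for y
    using crd_V0[OF that] by (auto simp: V0_def supp_rst)
  have g: "klin AA AA ?g"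
    by (intro klinI) (simp_all add: V A.ev_closed crd_add crd_smult rst_linear A.ev_add A.ev_scl)
  have "A.ev t \<in> lin_span AA (\<Union>d. U \<inter> A_component p N u L w T d)"
    using U_hom assms(3) unfolding spanned_by_homogeneous_def by simp
  then have "?g (A.ev t) \<in> U"
  proof (rule klin_span_into[OF A0.k_alg A0.k_alg g U_subspace _ _, rotated -1])
    show "(\<Union>d. U \<inter> A_component p N u L w T d) \<subseteq> carrier AA" using UD(1) by blast
  next
    fix y assume "y \<in> (\<Union>d. U \<inter> A_component p N u L w T d)"
    then obtain d' where y: "y \<in> U" "y \<in> A_component p N u L w T d'" by blast
    have D: "supp (crd y) \<subseteq> {k. tdeg k = d'}" using crd_component[OF y(2)] by simp
    show "?g y \<in> U"
    proof (cases "d' = d")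
      case True
      then have "rst (\<lambda>k. tdeg k = d) (crd y) = crd y" using D by (intro rst_all) auto
      then show ?thesis using ev_crd[OF U_carrier[OF y(1)]] y(1) by simp
    next
      case False
      then have "rst (\<lambda>k. tdeg k = d) (crd y) = 0" using D by (intro rst_none) auto
      then show ?thesis using UD(2) by simp
    qed
  qed
  then show ?thesis by (simp add: crd_ev_WW[OF assms(2)])
qed

end

section \<open>The subalgebras \<open>U\<^sup>-\<close> and \<open>U\<^sup>+\<close>\<close>

context coords
begin

definition embP :: "(('k, 'n) hgrp \<times> 'n list \<Rightarrow>\<^sub>0 'k) \<Rightarrow> ('k, 'n) tri" where
  "embP = plin (\<lambda>(g, v). bas ([], g, v))"

text \<open>Monomials of A^- are written f x^-_v, the triangular ones x^-_v f; \<open>cm v f\<close>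
  is the factor of the exchange.\<close>

definition embM :: "(('k, 'n) hgrp \<times> 'n list \<Rightarrow>\<^sub>0 'k) \<Rightarrow> ('k, 'n) tri" where
  "embM = plin (\<lambda>(g, v). sgl (v, g, []) (cm v g))"

lemma G_carrier: "g \<in> G_in_H p N \<Longrightarrow> g \<in> carrier HH" and F_carrier: "g \<in> F_in_H p N \<Longrightarrow> g \<in> carrier HH"
  using P.Ks_carrier M.Ks_carrier by auto

lemma toA_bQ_mon:
  "g \<in> G_in_H p N \<Longrightarrow> toA (P.bQ g v) = A.mon [] g v"
  "g \<in> F_in_H p N \<Longrightarrow> toA (M.bQ g v) = cm v g \<odot>\<^sub>A A.mon v g []"
proof -
  assume g: "g \<in> G_in_H p N"
  show "toA (P.bQ g v) = A.mon [] g v"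
    using G_carrier[OF g] A.b_split[of g "map Xp v"] by (simp add: toA_P_bQ[OF g] A.mon_def A.b_one)
next
  assume g: "g \<in> F_in_H p N"
  note h = F_carrier[OF g]
  have "A.mon v g [] = chi_word (map Xm v) g \<odot>\<^sub>A bA g (map Xm v)"
    using h A.b_split[of g "map Xm v"] A.bw_bg[of g "map Xm v"] by (simp add: A.mon_def A.b_one)
  then show "toA (M.bQ g v) = cm v g \<odot>\<^sub>A A.mon v g []"
    using h by (simp add: toA_M_bQ[OF g] cm_def chi_word_nz A0.smult_one flip: A0.smult_assoc)
qed

lemma embP_V0: "supp t \<subseteq> G_in_H p N \<times> UNIV \<Longrightarrow> embP t \<in> V0"
  unfolding embP_def V0_def mem_Collect_eq by (rule supp_plin_subset) (auto simp: G_carrier)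

lemma embM_V0: "supp t \<subseteq> F_in_H p N \<times> UNIV \<Longrightarrow> embM t \<in> V0"
  unfolding embM_def V0_def mem_Collect_eq
  by (rule supp_plin_subset) (auto simp: F_carrier split: if_splits)

lemma toA_evm_P: "supp t \<subseteq> G_in_H p N \<times> UNIV \<Longrightarrow> toA (P.evm t) = A.ev (embP t)"
proof -
  assume "supp t \<subseteq> G_in_H p N \<times> UNIV"
  then show ?thesis
  proof (induction rule: pm_induct)
    case zero
    show ?case using klin_zero[OF P.Q.k_alg A0.k_alg toA_P_klin] by (simp add: embP_def)
  next
    case (single k c)
    then obtain g v where k: "k = (g, v)" "g \<in> G_in_H p N" by (cases k) auto
    show ?case
      using klinD(3)[OF toA_P_klin P.b_closed[OF k(2)]] G_carrier[OF k(2)] toA_bQ_mon(1)[OF k(2)]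
      by (simp add: k(1) P.evm_single[OF k(2)] embP_def A.ev_single)
  next
    case (add s t)
    then show ?case
      using klinD(2)[OF toA_P_klin P.evm_closed[OF add(1)] P.evm_closed[OF add(2)]] embP_V0[OF add(1)] embP_V0[OF add(2)]
      by (simp add: P.evm_add A.ev_add embP_def plin_add)
  qed
qed

lemma toA_evm_M: "supp t \<subseteq> F_in_H p N \<times> UNIV \<Longrightarrow> toA (M.evm t) = A.ev (embM t)"
proof -
  assume "supp t \<subseteq> F_in_H p N \<times> UNIV"
  then show ?thesis
  proof (induction rule: pm_induct)
    case zero
    show ?case using klin_zero[OF M.Q.k_alg A0.k_alg toA_M_klin] by (simp add: embM_def)
  next
    case (single k c)
    then obtain g v where k: "k = (g, v)" "g \<in> F_in_H p N" by (cases k) auto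
    show ?case
      using klinD(3)[OF toA_M_klin M.b_closed[OF k(2)]] F_carrier[OF k(2)] toA_bQ_mon(2)[OF k(2)]
      by (simp add: k(1) M.evm_single[OF k(2)] embM_def A.ev_single A0.smult_assoc)
  next
    case (add s t)
    then show ?case
      using klinD(2)[OF toA_M_klin M.evm_closed[OF add(1)] M.evm_closed[OF add(2)]] embM_V0[OF add(1)] embM_V0[OF add(2)]
      by (simp add: M.evm_add A.ev_add embM_def plin_add)
  qed
qed

lemma Nil_W: "[] \<in> Wm" "[] \<in> Wp"
  using rm_supp[of "[]"] rp_supp[of "[]"] by auto

lemma embP_WW: "supp t \<subseteq> G_in_H p N \<times> Wp \<Longrightarrow> supp (embP t) \<subseteq> WW"
  unfolding embP_def by (rule supp_plin_subset) (auto simp: G_carrier Nil_W)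

lemma embM_WW: "supp t \<subseteq> F_in_H p N \<times> Wm \<Longrightarrow> supp (embM t) \<subseteq> WW"
  unfolding embM_def by (rule supp_plin_subset) (auto simp: F_carrier Nil_W split: if_splits)

lemma crd_toA_P:
  assumes "x \<in> carrier P.Q"
  shows "crd (toA x) = embP (PN.hcrd x)"
proof -
  note h = PN.hcrd[OF assms]
  have "toA x = A.ev (embP (PN.hcrd x))" using toA_evm_P[OF PN.Ks_W[OF h(2)]] h(1) by simp
  then show ?thesis using crd_ev_WW[OF embP_WW[OF h(2)]] by simp
qed

lemma crd_toA_M:
  assumes "x \<in> carrier M.Q"
  shows "crd (toA x) = embM (MN.hcrd x)"
proof -
  note h = MN.hcrd[OF assms]
  have "toA x = A.ev (embM (MN.hcrd x))" using toA_evm_M[OF MN.Ks_W[OF h(2)]] h(1) by simp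
  then show ?thesis using crd_ev_WW[OF embM_WW[OF h(2)]] by simp
qed

lemma lookup_embP: "lookup (embP t) ([], g, v) = lookup t (g, v)"
  unfolding embP_def by (subst lookup_plin_at[where j = "(g, v)" and c = 1]) (auto simp: lookup_single when_def split: if_splits)

lemma lookup_embM: "lookup (embM t) (v, g, []) = cm v g * lookup t (g, v)"
  unfolding embM_def by (subst lookup_plin_at[where j = "(g, v)" and c = "cm v g"]) (auto simp: lookup_single when_def split: if_splits)

text \<open>The intertwining hypothesis of \<open>coideal_pullback\<close> for A^+. On monomials
  both coproducts are products of the same prescribed values.\<close>

lemma toAA_Delta_P:
  assumes x: "x \<in> carrier P.Q"
  shows "toAA (Ap_coproduct p N u L x) = DA (toA x)"
proof (rule P.klin_eq_on_monomials[OF A.TP.TT.k_alg _ _ _ x])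
  show "klin P.Q A2 (\<lambda>x. toAA (Ap_coproduct p N u L x))"
    by (rule klin_comp[OF P.cop_klin[OF Ap_coproduct_is] alg_homD(1)[OF toAA_P(1)]])
  show "klin P.Q A2 (\<lambda>x. DA (toA x))"
    by (rule klin_comp[OF toA_P_klin alg_homD(1)[OF DA_hom]])
next
  fix g v assume g: "g \<in> G_in_H p N"
  note c = P.b_closed[OF g, of "[]"]
  show "toAA (Ap_coproduct p N u L (P.bQ g v)) = DA (toA (P.bQ g v))"
    unfolding P.coproduct_monomial[OF Ap_coproduct_is g] alg_homD(5)[OF toAA_P(1) P.TP.tens_closed[OF c c] P.dw_closed]
      toAA_P(2)[OF c c] toAA_dw_P toA_P_bQ[OF g] A.coproduct_monomial[OF A_coproduct_is G_carrier[OF g]] by simp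
qed

lemma toAA_Delta_M:
  assumes x: "x \<in> carrier M.Q"
  shows "toAA (Am_coproduct p N w T x) = DA (toA x)"
proof (rule M.klin_eq_on_monomials[OF A.TP.TT.k_alg _ _ _ x])
  show "klin M.Q A2 (\<lambda>x. toAA (Am_coproduct p N w T x))"
    by (rule klin_comp[OF M.cop_klin[OF Am_coproduct_is] alg_homD(1)[OF toAA_M(1)]])
  show "klin M.Q A2 (\<lambda>x. DA (toA x))"
    by (rule klin_comp[OF toA_M_klin alg_homD(1)[OF DA_hom]])
next
  fix g v assume g: "g \<in> F_in_H p N"
  note c = M.b_closed[OF g, of "[]"]
  show "toAA (Am_coproduct p N w T (M.bQ g v)) = DA (toA (M.bQ g v))"
    unfolding M.coproduct_monomial[OF Am_coproduct_is g] alg_homD(5)[OF toAA_M(1) M.TP.tens_closed[OF c c] M.dw_closed]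
      toAA_M(2)[OF c c] toAA_dw_M toA_M_bQ[OF g] A.coproduct_monomial[OF A_coproduct_is F_carrier[OF g]] by simp
qed

end

section \<open>The right coideal subalgebras of the two halves\<close>

context coid
begin

text \<open>A^- and A^+ are quotients in their own right and not subsets of A, so their
  intersections with U are formed as preimages under the canonical maps.\<close>

definition "Um = {m \<in> carrier M.Q. toA m \<in> U}"
definition "Up = {x \<in> carrier P.Q. toA x \<in> U}"

lemma Um_subalgebra: "k_subalgebra Um M.Q"
  unfolding Um_def by (rule k_subalgebra_vimage[OF M.Q.k_alg A0.k_alg toA_M_hom U_subalgebra])

lemma Up_subalgebra: "k_subalgebra Up P.Q"
  unfolding Up_def by (rule k_subalgebra_vimage[OF P.Q.k_alg A0.k_alg toA_P_hom U_subalgebra])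

lemmas Um_subspace = M.Q.k_subalgebra_lin_subspace[OF Um_subalgebra]
lemmas Up_subspace = P.Q.k_subalgebra_lin_subspace[OF Up_subalgebra]

lemma bg_Um: "f \<in> F_in_H p N \<Longrightarrow> M.bg f \<in> Um"
  using bg_U[OF F_carrier] toA_M_bQ[of f "[]"] M.b_closed[of f "[]"] by (simp add: Um_def)

lemma bg_Up: "g \<in> G_in_H p N \<Longrightarrow> P.bg g \<in> Up"
  using bg_U[OF G_carrier] toA_P_bQ[of g "[]"] P.b_closed[of g "[]"] by (simp add: Up_def)

lemma F_in_Um: "F_in_Am p N w T \<subseteq> Um"
  using bg_Um unfolding F_in_Am_def Am_eq(2) by auto

lemma G_in_Up: "G_in_Ap p N u L \<subseteq> Up"
  using bg_Up unfolding G_in_Ap_def Ap_eq(2) by auto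

lemma Up_coideal: "right_coideal_subalgebra (Ap_alg p N u L) (Ap_coproduct p N u L) Up"
  unfolding right_coideal_subalgebra_def Ap_eq
proof (intro conjI ballI)
  show "k_subalgebra Up P.Q" by (rule Up_subalgebra)
  fix x assume "x \<in> Up"
  then have x: "x \<in> carrier P.Q" "toA x \<in> U" by (simp_all add: Up_def)
  show "Ap_coproduct p N u L x \<in> lin_span (tensor P.Q P.Q) {tens P.Q P.Q a b |a b. a \<in> Up \<and> b \<in> carrier P.Q}"
    unfolding Up_def
  proof (rule PN.coideal_pullback[OF Ap_coproduct_is A0.k_alg toA_P_hom U_subspace _ slice_U _ x])
    fix y assume "y \<in> carrier P.Q"
    then show "tlift A2 (\<lambda>a b. tens AA AA (toA a) (toA b)) (Ap_coproduct p N u L y) = DA (toA y)"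
      using toAA_Delta_P unfolding toAA_def by blast
  next
    fix g v assume "g \<in> G_in_H p N"
    show "\<exists>\<psi>. kfun AA \<psi> \<and> (\<forall>y\<in>carrier P.Q. \<psi> (toA y) = lookup (PN.hcrd y) (g, v))"
      using cf_kfun by (intro exI[of _ "cf [] g v"]) (simp add: cf_def crd_toA_P lookup_embP)
  qed
qed

lemma Um_coideal: "right_coideal_subalgebra (Am_alg p N w T) (Am_coproduct p N w T) Um"
  unfolding right_coideal_subalgebra_def Am_eq
proof (intro conjI ballI)
  show "k_subalgebra Um M.Q" by (rule Um_subalgebra)
  fix x assume "x \<in> Um"
  then have x: "x \<in> carrier M.Q" "toA x \<in> U" by (simp_all add: Um_def)
  show "Am_coproduct p N w T x \<in> lin_span (tensor M.Q M.Q) {tens M.Q M.Q a b |a b. a \<in> Um \<and> b \<in> carrier M.Q}"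
    unfolding Um_def
  proof (rule MN.coideal_pullback[OF Am_coproduct_is A0.k_alg toA_M_hom U_subspace _ slice_U _ x])
    fix y assume "y \<in> carrier M.Q"
    then show "tlift A2 (\<lambda>a b. tens AA AA (toA a) (toA b)) (Am_coproduct p N w T y) = DA (toA y)"
      using toAA_Delta_M unfolding toAA_def by blast
  next
    fix g v assume g: "g \<in> F_in_H p N"
    \<comment> \<open>The factor undoes the \<open>cm v g\<close> that \<open>embM\<close>
      introduces, so that this functional pulls back to the coordinate of A^- at (g, v).\<close>
    have "kfun AA (\<lambda>y. inverse (cm v g) * cf v g [] y)"
      using cf_kfun[of v g "[]"] by (auto simp: kfun_def algebra_simps)
    moreover have "inverse (cm v g) * cf v g [] (toA y) = lookup (MN.hcrd y) (g, v)" if "y \<in> carrier M.Q" for y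
      using cm_nz[OF F_carrier[OF g]] by (simp add: cf_def crd_toA_M[OF that] lookup_embM)
    ultimately show "\<exists>\<psi>. kfun AA \<psi> \<and> (\<forall>y\<in>carrier M.Q. \<psi> (toA y) = lookup (MN.hcrd y) (g, v))" by blast
  qed
qed

lemma toA_part_U:
  assumes "y \<in> carrier AA" "y \<in> U"
  shows "A.ev (rst (\<lambda>k. tdeg k = d) (crd y)) \<in> U"
  using degree_part_U[OF crd_V0[OF assms(1)] supp_crd[OF assms(1)]] assms by (simp add: ev_crd)

text \<open>On A^+ the \<Gamma>-degree is the degree in each variable, so the parts of U by
  \<Gamma>-degree give the required components. On A^- the same holds with the opposite
  sign.\<close>

lemma Up_homogeneous: "spanned_by_homogeneous (Ap_alg p N u L) (Ap_component p N u L) Up"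
  unfolding Ap_eq
proof (rule PN.spanned_by_parts[OF Up_subspace])
  fix x d assume "x \<in> Up"
  then have x: "x \<in> carrier P.Q" "toA x \<in> U" by (simp_all add: Up_def)
  let ?t = "PN.hcrd x"
  have s: "supp (PN.hd_part d ?t) \<subseteq> G_in_H p N \<times> UNIV"
    unfolding rst_def using PN.hcrd(2)[OF x(1)] by (intro supp_plin_subset) auto
  have "rst (\<lambda>k. tdeg k = (\<lambda>i. int (d i))) (embP ?t) = embP (PN.hd_part d ?t)"
    unfolding rst_def embP_def plin_plin
    by (rule plin_cong) (auto simp: tdeg_def fun_eq_iff)
  then have "toA (P.evm (PN.hd_part d ?t)) = A.ev (rst (\<lambda>k. tdeg k = (\<lambda>i. int (d i))) (crd (toA x)))"
    by (simp add: toA_evm_P[OF s] crd_toA_P[OF x(1)])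
  also have "\<dots> \<in> U" by (rule toA_part_U[OF U_carrier[OF x(2)] x(2)])
  finally show "P.evm (PN.hd_part d ?t) \<in> Up" using P.evm_closed[OF s] by (simp add: Up_def)
next
  fix t :: "('k, 'n) hgrp \<times> 'n list \<Rightarrow>\<^sub>0 'k" and d assume t: "supp t \<subseteq> G_in_H p N \<times> {v. count_list v = d}"
  then have tc: "t \<in> carrier P.TX" by auto
  have "supp (P.E t) \<subseteq> G_in_H p N \<times> {map Xp v | v. count_list v = d}"
    unfolding P.E_def using t by (intro supp_plin_subset) auto
  moreover have "P.evm t = Ap_cls p N u L (P.E t)"
    using P.evm_\<omega>[OF tc] P.\<theta>_E[OF tc] by (simp add: Ap_eq P.\<omega>_def P.Qcls_def)
  ultimately show "P.evm t \<in> Ap_component p N u L d" unfolding Ap_component_def by blast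
qed

lemma Um_homogeneous: "spanned_by_homogeneous (Am_alg p N w T) (Am_component p N w T) Um"
  unfolding Am_eq
proof (rule MN.spanned_by_parts[OF Um_subspace])
  fix x d assume "x \<in> Um"
  then have x: "x \<in> carrier M.Q" "toA x \<in> U" by (simp_all add: Um_def)
  let ?t = "MN.hcrd x"
  have s: "supp (MN.hd_part d ?t) \<subseteq> F_in_H p N \<times> UNIV"
    unfolding rst_def using MN.hcrd(2)[OF x(1)] by (intro supp_plin_subset) auto
  have "rst (\<lambda>k. tdeg k = (\<lambda>i. - int (d i))) (embM ?t) = embM (MN.hd_part d ?t)"
    unfolding rst_def embM_def plin_plin
    by (rule plin_cong) (auto simp: tdeg_def fun_eq_iff)
  then have "toA (M.evm (MN.hd_part d ?t)) = A.ev (rst (\<lambda>k. tdeg k = (\<lambda>i. - int (d i))) (crd (toA x)))"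
    by (simp add: toA_evm_M[OF s] crd_toA_M[OF x(1)])
  also have "\<dots> \<in> U" by (rule toA_part_U[OF U_carrier[OF x(2)] x(2)])
  finally show "M.evm (MN.hd_part d ?t) \<in> Um" using M.evm_closed[OF s] by (simp add: Um_def)
next
  fix t :: "('k, 'n) hgrp \<times> 'n list \<Rightarrow>\<^sub>0 'k" and d assume t: "supp t \<subseteq> F_in_H p N \<times> {v. count_list v = d}"
  then have tc: "t \<in> carrier M.TX" by auto
  have "supp (M.E t) \<subseteq> F_in_H p N \<times> {map Xm v | v. count_list v = d}"
    unfolding M.E_def using t by (intro supp_plin_subset) auto
  moreover have "M.evm t = Am_cls p N w T (M.E t)"
    using M.evm_\<omega>[OF tc] M.\<theta>_E[OF tc] by (simp add: Am_eq M.\<omega>_def M.Qcls_def)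
  ultimately show "M.evm t \<in> Am_component p N w T d" unfolding Am_component_def by blast
qed

subsection \<open>\<open>U\<close> is spanned by products\<close>

abbreviation "UU \<equiv> lin_span AA {toA m \<otimes>\<^sub>A A.bg h \<otimes>\<^sub>A toA x | m h x. m \<in> Um \<and> h \<in> carrier HH \<and> x \<in> Up}"

lemma toA_Um: "m \<in> Um \<Longrightarrow> toA m \<in> U" and toA_Up: "x \<in> Up \<Longrightarrow> toA x \<in> U"
  by (simp_all add: Um_def Up_def)

lemma UU_gens: "{toA m \<otimes>\<^sub>A A.bg h \<otimes>\<^sub>A toA x | m h x. m \<in> Um \<and> h \<in> carrier HH \<and> x \<in> Up} \<subseteq> carrier AA"
  using U_carrier[OF U_mult[OF U_mult[OF toA_Um bg_U] toA_Up]] by blast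

lemmas UU_subspace = A0.lin_subspace_lin_span[OF UU_gens]
lemmas UUD = A0.lin_subspaceD[OF UU_subspace]

lemma UU_base:
  assumes "m \<in> Um" "h \<in> carrier HH" "x \<in> Up"
  shows "toA m \<otimes>\<^sub>A A.bg h \<otimes>\<^sub>A toA x \<in> UU"
  by (rule subsetD[OF A0.lin_span_superset]) (use assms in blast)

text \<open>
  In the coordinates of an element of fixed \<open>h\<^sub>0\<close> and degree, the words \<open>a\<^sub>0\<close> and \<open>c\<^sub>0\<close> of an entry have
  maximal length simultaneously.  The row and the column of such an entry are then slices of the
  element, and subtracting a multiple of their product removes \<open>a\<^sub>0\<close> from the support.
\<close>

lemma homogeneous_in_UU:
  assumes "supp t \<subseteq> WW" "\<And>k. k \<in> supp t \<Longrightarrow> fst (snd k) = h0 \<and> tdeg k = d" "A.ev t \<in> U" "h0 \<in> carrier HH"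
  shows "A.ev t \<in> UU"
  using assms(1-3)
proof (induction "card (fst ` supp t)" arbitrary: t rule: less_induct)
  case less
  show ?case
  proof (cases "t = 0")
    case True
    then show ?thesis using UUD(2) by simp
  next
    case False
    have fin: "finite (fst ` supp t)" by simp
    have ne: "fst ` supp t \<noteq> {}" using False by simp
    define l where "l = Max (length ` fst ` supp t)"
    have "l \<in> length ` fst ` supp t" unfolding l_def using fin ne by (intro Max_in) auto
    then obtain k0 where k0: "k0 \<in> supp t" "length (fst k0) = l" by auto
    obtain a0 h1 c0 where k0': "k0 = (a0, h1, c0)" by (cases k0)
    have h1: "h1 = h0" using less.prems(2)[OF k0(1)] by (simp add: k0')
    have a0: "length (fst k) \<le> length a0" if "k \<in> supp t" for k
      using k0(2) that fin unfolding l_def k0' by (auto intro!: Max_ge)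
    \<comment> \<open>Summing the \<Gamma>-degree over all variables gives the difference of the two
      lengths, which is therefore the same for all entries.\<close>
    have diff: "int (length (snd (snd k))) - int (length (fst k)) = (\<Sum>i\<in>UNIV. d i)" if "k \<in> supp t" for k
    proof -
      obtain a h c where k: "k = (a, h, c)" by (cases k)
      have "(\<Sum>i\<in>UNIV. d i) = (\<Sum>i\<in>UNIV. int (count_list c i) - int (count_list a i))"
        using less.prems(2)[OF that] by (auto simp: k tdeg_def)
      also have "\<dots> = int (length c) - int (length a)"
        by (simp add: sum_subtractf length_eq_count)
      finally show ?thesis by (simp add: k)
    qed
    have c0: "length (snd (snd k)) \<le> length c0" if "k \<in> supp t" for k
      using diff[OF that] diff[OF k0(1)] a0[OF that] by (simp add: k0')
    let ?s = "col h0 c0 t" and ?r = "row a0 h0 t" and ?z = "lookup t (a0, h0, c0)"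
    \<comment> \<open>The rank one matrix that agrees with t in the row a0 and in the column c0;
      \<open>?z\<close> is the pivot.\<close>
    let ?q = "scl (inverse ?z) (T3 ?s h0 ?r)"
    have m: "M.evw ?s \<in> Um" using col_U[OF less.prems(1,3) c0 assms(4)] by (simp add: Um_def)
    have x: "P.evw ?r \<in> Up" using row_U[OF less.prems(1,3) a0 assms(4)] by (simp add: Up_def)
    have \<lambda>: "?z \<noteq> 0" using k0(1) by (simp add: k0' h1 in_keys_iff)
    have qV: "?q \<in> V0" "t \<in> V0" using WW_V0[OF less.prems(1)] assms(4) pm.subspace_scale[OF V0_subspace] by auto
    have evq: "A.ev ?q = inverse ?z \<odot>\<^sub>A (toA (M.evw ?s) \<otimes>\<^sub>A A.bg h0 \<otimes>\<^sub>A toA (P.evw ?r))"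
      using assms(4) by (simp add: A.ev_scl ev_T3)
    have qUU: "A.ev ?q \<in> UU" unfolding evq by (rule UUD(4)[OF UU_base[OF m assms(4) x]])
    have qU: "A.ev ?q \<in> U" unfolding evq by (rule UD(4)[OF U_mult[OF U_mult[OF toA_Um[OF m] bg_U[OF assms(4)]] toA_Up[OF x]]])
    have lk: "lookup (t - ?q) (a, h, c) = lookup t (a, h, c) - (if h = h0 then inverse ?z * (lookup t (a, h0, c0) * lookup t (a0, h0, c)) else 0)" for a h c
      by (simp add: lookup_minus lookup_T3 lookup_col lookup_row)
    have keys: "(a, h, c) \<in> supp t \<or> h = h0 \<and> (a, h0, c0) \<in> supp t \<and> (a0, h0, c) \<in> supp t" if "(a, h, c) \<in> supp (t - ?q)" for a h c
      using that lk[of a h c] by (auto simp: in_keys_iff split: if_splits)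
    have mem: "k \<in> WW \<and> fst (snd k) = h0 \<and> tdeg k = d \<and> fst k \<in> fst ` supp t \<and> fst k \<noteq> a0" if kk: "k \<in> supp (t - ?q)" for k
    proof -
      obtain a h c where k: "k = (a, h, c)" by (cases k)
      have "a \<noteq> a0"
      proof
        assume "a = a0"
        then have "lookup (t - ?q) k = 0"
          using lk[of a h c] \<lambda> less.prems(2)[of k] by (auto simp: k in_keys_iff)
        then show False using kk by (simp add: in_keys_iff)
      qed
      from keys[OF kk[unfolded k]] show ?thesis
      proof
        assume "(a, h, c) \<in> supp t"
        then show ?thesis using less.prems(1,2) \<open>a \<noteq> a0\<close> unfolding k by (auto intro!: image_eqI[of a fst "(a, h, c)"])
      next
        assume "h = h0 \<and> (a, h0, c0) \<in> supp t \<and> (a0, h0, c) \<in> supp t"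
        then have hh: "h = h0" and 1: "(a, h0, c0) \<in> supp t" and 2: "(a0, h0, c) \<in> supp t" by auto
        have 0: "(a0, h0, c0) \<in> supp t" using \<lambda> by (simp add: in_keys_iff)
        \<comment> \<open>A new entry at (a, h0, c) arises from entries at (a, h0, c0) and (a0, h0,
          c). Its degree is the sum of theirs minus that of the pivot, hence d.\<close>
        have "tdeg (a, h0, c0) = d" "tdeg (a0, h0, c) = d" "tdeg (a0, h0, c0) = d"
          using less.prems(2)[OF 1] less.prems(2)[OF 2] less.prems(2)[OF 0] by auto
        then have "tdeg (a, h, c) = d" by (simp add: tdeg_def fun_eq_iff) (metis add_diff_cancel_left' diff_add_eq diff_eq_eq)
        moreover have "a \<in> Wm" "c \<in> Wp" using less.prems(1) 1 2 by auto
        moreover have "a \<in> fst ` supp t" by (rule image_eqI[of _ fst "(a, h0, c0)"]) (use 1 in auto)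
        ultimately show ?thesis using hh assms(4) \<open>a \<noteq> a0\<close> by (simp add: k)
      qed
    qed
    have "A.ev (t - ?q) \<in> UU"
    proof (rule less.hyps)
      have "fst ` supp (t - ?q) \<subseteq> fst ` supp t - {a0}" using mem by auto
      then have "card (fst ` supp (t - ?q)) \<le> card (fst ` supp t - {a0})" by (intro card_mono) auto
      also have "\<dots> < card (fst ` supp t)"
        by (rule card_Diff1_less[OF fin]) (rule image_eqI[OF _ k0(1)], simp add: k0')
      finally show "card (fst ` supp (t - ?q)) < card (fst ` supp t)" .
      show "supp (t - ?q) \<subseteq> WW" using mem by blast
      show "fst (snd k) = h0 \<and> tdeg k = d" if "k \<in> supp (t - ?q)" for k using mem[OF that] by blast
      have "A.ev (t - ?q) = A.ev t \<oplus>\<^sub>A (\<ominus>\<^bsub>AA\<^esub> A.ev ?q)" unfolding A.ev_diff[OF qV(2,1)] a_minus_def ..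
      then show "A.ev (t - ?q) \<in> U" using UD(3)[OF less.prems(3) UD(5)[OF qU]] by simp
    qed
    then have "A.ev (t - ?q) \<oplus>\<^sub>A A.ev ?q \<in> UU" by (rule UUD(3)[OF _ qUU])
    moreover have "A.ev (t - ?q) \<oplus>\<^sub>A A.ev ?q = A.ev t"
      using A.ev_add[OF pm.subspace_diff[OF V0_subspace qV(2,1)] qV(1)] by simp
    ultimately show ?thesis by simp
  qed
qed

text \<open>\<open>h_part_U\<close> and \<open>degree_part_U\<close> cut an element of U, inside U,
  into pieces with one group element and one degree; \<open>homogeneous_in_UU\<close> applies to
  each of them.\<close>

lemma U_eq_UU: "U = UU"
proof
  show "UU \<subseteq> U"
    by (rule A0.lin_span_least[OF U_subspace]) (use U_mult[OF U_mult[OF toA_Um bg_U] toA_Up] in blast)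
  show "U \<subseteq> UU"
  proof
    fix y assume y: "y \<in> U"
    note yc = U_carrier[OF y]
    let ?t = "crd y" and ?S = "{t \<in> V0. A.ev t \<in> UU}"
    have S: "pm.subspace ?S"
      using V0_subspace UUD(2-4) by (auto simp: pm.subspace_def A.ev_add A.ev_scl)
    let ?f = "\<lambda>k :: 'n list \<times> ('k, 'n) hgrp \<times> 'n list. fst (snd k)"
    let ?D = "\<lambda>h. rst (\<lambda>k. ?f k = h) ?t"
    have part: "rst (\<lambda>k. tdeg k = d) (?D h) \<in> ?S" if "h \<in> carrier HH" for h d
    proof -
      have s: "supp (?D h) \<subseteq> WW" using supp_crd[OF yc] by (auto simp: supp_rst)
      have 1: "A.ev (?D h) \<in> U" using h_part_U[OF crd_V0[OF yc]] y by (simp add: ev_crd[OF yc])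
      have s2: "supp (rst (\<lambda>k. tdeg k = d) (?D h)) \<subseteq> WW" using s by (auto simp: supp_rst)
      have "A.ev (rst (\<lambda>k. tdeg k = d) (?D h)) \<in> UU"
        by (rule homogeneous_in_UU[OF s2 _ degree_part_U[OF WW_V0[OF s] s 1] that]) (auto simp: supp_rst)
      then show ?thesis using WW_V0[OF s2] by simp
    qed
    have "?D h \<in> ?S" if "h \<in> carrier HH" for h
    proof -
      have "(\<Sum>d\<in>tdeg ` supp (?D h). rst (\<lambda>k. tdeg k = d) (?D h)) \<in> ?S"
        by (rule pm.subspace_sum[OF S part[OF that]])
      then show ?thesis by (simp only: sum_rst_fibres)
    qed
    then have "(\<Sum>h\<in>?f ` supp ?t. ?D h) \<in> ?S"
      using supp_crd[OF yc] by (intro pm.subspace_sum[OF S]) auto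
    then have "?t \<in> ?S" by (simp only: sum_rst_fibres)
    then show "y \<in> UU" using ev_crd[OF yc] by simp
  qed
qed

end

section \<open>Balanced tensor products of three factors\<close>

locale tensor_triple = M: k_algebra M + P: k_algebra P + Q: k_algebra Q
  for M :: "('k::field, 'a) module" and P :: "('k, 'p) module" and Q :: "('k, 'b) module" +
  fixes \<rho> :: "'p \<Rightarrow> 'a" and R S :: "'p set" and \<sigma> :: "'p \<Rightarrow> 'b"
  assumes R: "R \<subseteq> carrier P" and S: "S \<subseteq> carrier P"
    and \<rho>: "\<And>r. r \<in> R \<Longrightarrow> \<rho> r \<in> carrier M" and \<sigma>: "\<And>s. s \<in> S \<Longrightarrow> \<sigma> s \<in> carrier Q"
begin

abbreviation "MPQ \<equiv> M \<times>\<times> P \<times>\<times> Q"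
abbreviation "rel3 \<equiv> tensor3_rel M \<rho> R P S \<sigma> Q"

lemma monoid_triple: "Group.monoid MPQ"
  by (intro DirProd_monoid M.monoid_axioms P.monoid_axioms Q.monoid_axioms)

text \<open>The families of \<open>tensor3_rel\<close> in their order: additivity in each of the
  three factors, scalars in each factor, balancing over R and over S. As \<open>rel3_rules\<close>
  they are later addressed by their number.\<close>

inductive_set gens3 where
  "m \<in> carrier M \<Longrightarrow> m' \<in> carrier M \<Longrightarrow> x \<in> carrier P \<Longrightarrow> y \<in> carrier Q \<Longrightarrow>
    bas (m \<oplus>\<^bsub>M\<^esub> m', x, y) - bas (m, x, y) - bas (m', x, y) \<in> gens3"
| "m \<in> carrier M \<Longrightarrow> x \<in> carrier P \<Longrightarrow> x' \<in> carrier P \<Longrightarrow> y \<in> carrier Q \<Longrightarrow>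
    bas (m, x \<oplus>\<^bsub>P\<^esub> x', y) - bas (m, x, y) - bas (m, x', y) \<in> gens3"
| "m \<in> carrier M \<Longrightarrow> x \<in> carrier P \<Longrightarrow> y \<in> carrier Q \<Longrightarrow> y' \<in> carrier Q \<Longrightarrow>
    bas (m, x, y \<oplus>\<^bsub>Q\<^esub> y') - bas (m, x, y) - bas (m, x, y') \<in> gens3"
| "m \<in> carrier M \<Longrightarrow> x \<in> carrier P \<Longrightarrow> y \<in> carrier Q \<Longrightarrow> bas (c \<odot>\<^bsub>M\<^esub> m, x, y) - sgl (m, x, y) c \<in> gens3"
| "m \<in> carrier M \<Longrightarrow> x \<in> carrier P \<Longrightarrow> y \<in> carrier Q \<Longrightarrow> bas (m, c \<odot>\<^bsub>P\<^esub> x, y) - sgl (m, x, y) c \<in> gens3"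
| "m \<in> carrier M \<Longrightarrow> x \<in> carrier P \<Longrightarrow> y \<in> carrier Q \<Longrightarrow> bas (m, x, c \<odot>\<^bsub>Q\<^esub> y) - sgl (m, x, y) c \<in> gens3"
| "m \<in> carrier M \<Longrightarrow> r \<in> R \<Longrightarrow> x \<in> carrier P \<Longrightarrow> y \<in> carrier Q \<Longrightarrow>
    bas (m \<otimes>\<^bsub>M\<^esub> \<rho> r, x, y) - bas (m, r \<otimes>\<^bsub>P\<^esub> x, y) \<in> gens3"
| "m \<in> carrier M \<Longrightarrow> x \<in> carrier P \<Longrightarrow> s \<in> S \<Longrightarrow> y \<in> carrier Q \<Longrightarrow>
    bas (m, x \<otimes>\<^bsub>P\<^esub> s, y) - bas (m, x, \<sigma> s \<otimes>\<^bsub>Q\<^esub> y) \<in> gens3"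

lemma rel3_gens: "rel3 = lin_span (monoid_alg MPQ) gens3"
  unfolding tensor3_rel_def
  apply (intro arg_cong[where f = "lin_span (monoid_alg MPQ)"] subset_antisym subsetI)
   apply (elim UnE CollectE exE conjE; simp only:; intro gens3.intros; assumption)
  apply (erule gens3.cases; (((rule UnI2)?, rule CollectI, intro exI conjI, assumption+) | rule UnI1)+)
  done

lemma carrier_R: "r \<in> R \<Longrightarrow> r \<in> carrier P" and carrier_S: "s \<in> S \<Longrightarrow> s \<in> carrier P"
  using R S by auto

lemma supp_gens3:
  assumes "g \<in> gens3"
  shows "supp g \<subseteq> carrier MPQ"
  using assms
  by (induction rule: gens3.induct)
    (intro supp_diff_subset; simp add: \<rho> \<sigma> carrier_R carrier_S M.smult_closed P.smult_closed Q.smult_closed)+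

lemma rel3_span: "rel3 = pm.span gens3"
  unfolding rel3_gens by (rule lin_span_monoid_alg[OF monoid_triple supp_gens3])

lemma rel3_subspace: "pm.subspace rel3" and gens3_rel3: "g \<in> gens3 \<Longrightarrow> g \<in> rel3"
  unfolding rel3_span by (auto intro: pm.span_base)

lemma rel3_lin_subspace: "lin_subspace rel3 (monoid_alg MPQ)"
proof -
  have "rel3 \<subseteq> {t. supp t \<subseteq> carrier MPQ}"
    unfolding rel3_span using supp_gens3 by (intro pm.span_minimal pm_subspace_supp) auto
  then show ?thesis using rel3_subspace by (auto simp: lin_subspace_monoid_alg[OF monoid_triple])
qed

text \<open>The universal property of the balanced tensor product: linearity in each factor deals
  with the first six families, \<open>bal\<close> with the last two.\<close>

lemma rel3_kernel:
  assumes B: "k_algebra B"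
    and f: "\<And>m x y. m \<in> carrier M \<Longrightarrow> x \<in> carrier P \<Longrightarrow> y \<in> carrier Q \<Longrightarrow> f (m, x, y) \<in> carrier B"
    and klin: "\<And>x y. x \<in> carrier P \<Longrightarrow> y \<in> carrier Q \<Longrightarrow> klin M B (\<lambda>m. f (m, x, y))"
      "\<And>m y. m \<in> carrier M \<Longrightarrow> y \<in> carrier Q \<Longrightarrow> klin P B (\<lambda>x. f (m, x, y))"
      "\<And>m x. m \<in> carrier M \<Longrightarrow> x \<in> carrier P \<Longrightarrow> klin Q B (\<lambda>y. f (m, x, y))"
    and bal: "\<And>m r x y. m \<in> carrier M \<Longrightarrow> r \<in> R \<Longrightarrow> x \<in> carrier P \<Longrightarrow> y \<in> carrier Q \<Longrightarrow>
        f (m \<otimes>\<^bsub>M\<^esub> \<rho> r, x, y) = f (m, r \<otimes>\<^bsub>P\<^esub> x, y)"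
      "\<And>m x s y. m \<in> carrier M \<Longrightarrow> x \<in> carrier P \<Longrightarrow> s \<in> S \<Longrightarrow> y \<in> carrier Q \<Longrightarrow>
        f (m, x \<otimes>\<^bsub>P\<^esub> s, y) = f (m, x, \<sigma> s \<otimes>\<^bsub>Q\<^esub> y)"
    and r: "r \<in> rel3"
  shows "lin_ext B f r = \<zero>\<^bsub>B\<^esub>"
proof -
  interpret B: k_algebra B by fact
  have fc: "f \<in> carrier MPQ \<rightarrow> carrier B" using f by auto
  note F = klin_lin_ext_monoid_alg[OF monoid_triple B fc]
  have bas: "lin_ext B f (sgl k c) = c \<odot>\<^bsub>B\<^esub> f k" if "k \<in> carrier MPQ" for k c
    using fc that by (intro B.lin_ext_single) auto
  have diff: "lin_ext B f (s - t) = lin_ext B f s \<ominus>\<^bsub>B\<^esub> lin_ext B f t"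
    if "supp s \<subseteq> carrier MPQ" "supp t \<subseteq> carrier MPQ" for s t
    by (rule B.lin_ext_diff) (use fc that in blast)
  have diff1: "lin_ext B f (bas k - sgl k' c) = f k \<ominus>\<^bsub>B\<^esub> c \<odot>\<^bsub>B\<^esub> f k'"
    if "k \<in> carrier MPQ" "k' \<in> carrier MPQ" for k k' c
  proof -
    have "f k \<in> carrier B" using fc that by blast
    then show ?thesis using diff[of "bas k" "sgl k' c"] that by (simp add: bas B.smult_one)
  qed
  have diff2: "lin_ext B f (bas k - bas k' - bas k'') = f k \<ominus>\<^bsub>B\<^esub> f k' \<ominus>\<^bsub>B\<^esub> f k''"
    if "k \<in> carrier MPQ" "k' \<in> carrier MPQ" "k'' \<in> carrier MPQ" for k k' k''
  proof -
    have "f k \<in> carrier B" "f k' \<in> carrier B" "f k'' \<in> carrier B" using fc that by auto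
    moreover have "supp (bas k - bas k') \<subseteq> carrier MPQ" by (rule supp_diff_subset) (use that in auto)
    moreover have "supp (bas k'') \<subseteq> carrier MPQ" using that by simp
    ultimately show ?thesis using diff[of "bas k - bas k'" "bas k''"] diff1[OF that(1,2), of 1] that by (simp add: bas B.smult_one)
  qed
  have 1: "lin_ext B f g = \<zero>\<^bsub>B\<^esub>" if "g \<in> gens3" for g
  using that
  proof (induction rule: gens3.induct)
    fix m m' x y assume "m \<in> carrier M" "m' \<in> carrier M" "x \<in> carrier P" "y \<in> carrier Q"
    then show "lin_ext B f (bas (m \<oplus>\<^bsub>M\<^esub> m', x, y) - bas (m, x, y) - bas (m', x, y)) = \<zero>\<^bsub>B\<^esub>"
      by (subst diff2) (simp_all add: klinD(2)[OF klin(1)] f B.add_minus_minus)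
  next
    fix m x x' y assume "m \<in> carrier M" "x \<in> carrier P" "x' \<in> carrier P" "y \<in> carrier Q"
    then show "lin_ext B f (bas (m, x \<oplus>\<^bsub>P\<^esub> x', y) - bas (m, x, y) - bas (m, x', y)) = \<zero>\<^bsub>B\<^esub>"
      by (subst diff2) (simp_all add: klinD(2)[OF klin(2)] f B.add_minus_minus)
  next
    fix m x y y' assume "m \<in> carrier M" "x \<in> carrier P" "y \<in> carrier Q" "y' \<in> carrier Q"
    then show "lin_ext B f (bas (m, x, y \<oplus>\<^bsub>Q\<^esub> y') - bas (m, x, y) - bas (m, x, y')) = \<zero>\<^bsub>B\<^esub>"
      by (subst diff2) (simp_all add: klinD(2)[OF klin(3)] f B.add_minus_minus)
  next
    fix c m x y assume "m \<in> carrier M" "x \<in> carrier P" "y \<in> carrier Q"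
    then show "lin_ext B f (bas (c \<odot>\<^bsub>M\<^esub> m, x, y) - sgl (m, x, y) c) = \<zero>\<^bsub>B\<^esub>"
      by (subst diff1) (simp_all add: klinD(3)[OF klin(1)] f B.smult_closed M.smult_closed B.r_right_minus_eq)
  next
    fix c m x y assume "m \<in> carrier M" "x \<in> carrier P" "y \<in> carrier Q"
    then show "lin_ext B f (bas (m, c \<odot>\<^bsub>P\<^esub> x, y) - sgl (m, x, y) c) = \<zero>\<^bsub>B\<^esub>"
      by (subst diff1) (simp_all add: klinD(3)[OF klin(2)] f B.smult_closed P.smult_closed B.r_right_minus_eq)
  next
    fix c m x y assume "m \<in> carrier M" "x \<in> carrier P" "y \<in> carrier Q"
    then show "lin_ext B f (bas (m, x, c \<odot>\<^bsub>Q\<^esub> y) - sgl (m, x, y) c) = \<zero>\<^bsub>B\<^esub>"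
      by (subst diff1) (simp_all add: klinD(3)[OF klin(3)] f B.smult_closed Q.smult_closed B.r_right_minus_eq)
  next
    fix m r x y assume "m \<in> carrier M" "r \<in> R" "x \<in> carrier P" "y \<in> carrier Q"
    then show "lin_ext B f (bas (m \<otimes>\<^bsub>M\<^esub> \<rho> r, x, y) - bas (m, r \<otimes>\<^bsub>P\<^esub> x, y)) = \<zero>\<^bsub>B\<^esub>"
      by (subst diff1) (simp_all add: bal(1) f B.smult_one carrier_R \<rho> B.r_right_minus_eq)
  next
    fix m x s y assume "m \<in> carrier M" "x \<in> carrier P" "s \<in> S" "y \<in> carrier Q"
    then show "lin_ext B f (bas (m, x \<otimes>\<^bsub>P\<^esub> s, y) - bas (m, x, \<sigma> s \<otimes>\<^bsub>Q\<^esub> y)) = \<zero>\<^bsub>B\<^esub>"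
      by (subst diff1) (simp_all add: bal(2) f B.smult_one carrier_S \<sigma> B.r_right_minus_eq)
  qed
  have zero: "lin_subspace {\<zero>\<^bsub>B\<^esub>} B" by (rule B.lin_subspaceI) auto
  have "lin_ext B f r \<in> {\<zero>\<^bsub>B\<^esub>}"
    by (rule klin_span_into[OF k_algebra_monoid_alg[OF monoid_triple] B F zero _ _ r[unfolded rel3_gens]])
      (use supp_gens3 1 in \<open>auto simp del: carrier_DirProd\<close>)
  then show ?thesis by simp
qed

end

lemma lookup_sum_list: "lookup (\<Sum>x\<leftarrow>xs. f x) k = (\<Sum>x\<leftarrow>xs. lookup (f x) k)"
  by (induction xs) (simp_all add: lookup_add)

text \<open>If \<open>\<Sum> s\<^sub>i \<otimes> t\<^sub>i = 0\<close> and \<open>s\<^sub>1 \<noteq> 0\<close>, then comparing the coefficients at a word of \<open>s\<^sub>1\<close> expresses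
  \<open>t\<^sub>1\<close> by the other \<open>t\<^sub>i\<close>; substituting this shortens the sum.\<close>

lemma tensor_elimination:
  fixes \<beta> :: "('k::field, 'n::finite) hgrp \<Rightarrow> ('k, 'n) npoly \<Rightarrow> ('k, 'n) npoly \<Rightarrow> ('z \<Rightarrow>\<^sub>0 'k)"
  assumes R: "pm.subspace R" and Sm: "pm.subspace Sm" and Sp: "pm.subspace Sp"
    and add: "\<And>h s s' t. h \<in> K \<Longrightarrow> s \<in> Sm \<Longrightarrow> s' \<in> Sm \<Longrightarrow> t \<in> Sp \<Longrightarrow> \<beta> h (s + s') t - \<beta> h s t - \<beta> h s' t \<in> R"
      "\<And>h s t t'. h \<in> K \<Longrightarrow> s \<in> Sm \<Longrightarrow> t \<in> Sp \<Longrightarrow> t' \<in> Sp \<Longrightarrow> \<beta> h s (t + t') - \<beta> h s t - \<beta> h s t' \<in> R"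
    and scl: "\<And>h s t c. h \<in> K \<Longrightarrow> s \<in> Sm \<Longrightarrow> t \<in> Sp \<Longrightarrow> \<beta> h (scl c s) t - scl c (\<beta> h s t) \<in> R"
      "\<And>h s t c. h \<in> K \<Longrightarrow> s \<in> Sm \<Longrightarrow> t \<in> Sp \<Longrightarrow> \<beta> h s (scl c t) - scl c (\<beta> h s t) \<in> R"
    and zs: "set zs \<subseteq> K \<times> Sm \<times> Sp" "(\<Sum>(h, s, t)\<leftarrow>zs. T3 s h t) = 0"
  shows "(\<Sum>(h, s, t)\<leftarrow>zs. \<beta> h s t) \<in> R"
  using zs
proof (induction "length zs" arbitrary: zs)
  case 0
  then show ?case using pm.subspace_0[OF R] by simp
next
  case (Suc n)
  obtain h s t zs' where zs: "zs = (h, s, t) # zs'" using Suc.hyps(2) by (cases zs) auto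
  note Rr = pm.subspace_add[OF R] pm.subspace_diff[OF R] pm.subspace_scale[OF R] pm.subspace_0[OF R]
  note Smr = pm.subspace_add[OF Sm] pm.subspace_diff[OF Sm] pm.subspace_scale[OF Sm]
  have mem: "h \<in> K" "s \<in> Sm" "t \<in> Sp" "set zs' \<subseteq> K \<times> Sm \<times> Sp" using Suc.prems(1) zs by auto
  show ?case
  proof (cases "s = 0")
    case True
    have "\<beta> h 0 t \<in> R" using scl(1)[OF mem(1-3), of 0] by simp
    moreover have "(\<Sum>(h, s, t)\<leftarrow>zs'. \<beta> h s t) \<in> R"
      using Suc.prems Suc.hyps(2) by (intro Suc.hyps(1)) (auto simp: zs True)
    ultimately show ?thesis by (simp add: zs True Rr)
  next
    case False
    then obtain a0 where a0: "lookup s a0 \<noteq> 0" by (metis poly_mapping_eqI lookup_zero)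
    \<comment> \<open>Only summands with the same group element h interact with the first one. For
      these, \<open>\<mu>\<close> is the multiple of s that removes the word a0 from s'.\<close>
    define \<mu> where "\<mu> h' s' = (if h' = h then lookup s' a0 / lookup s a0 else 0)" for h' s'
    define g where "g = (\<lambda>(h', s', t'). (h', s' - scl (\<mu> h' s') s, t' :: ('k, 'n) npoly))"
    let ?T = "\<lambda>zs. \<Sum>(h', s', t')\<leftarrow>zs. scl (\<mu> h' s') t'"
    let ?B = "\<lambda>zs. \<Sum>(h', s', t')\<leftarrow>zs. scl (\<mu> h' s') (\<beta> h s t')"
    have T: "t = - ?T zs'"
    proof (rule poly_mapping_eqI)
      fix c
      have l: "lookup (\<Sum>(h', s', t')\<leftarrow>zs. T3 s' h' t') (a0, h, c) = lookup s a0 * lookup (?T zs) c" for zs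
        unfolding lookup_sum_list
        using a0 by (induction zs) (auto simp: lookup_T3 \<mu>_def lookup_add algebra_simps)
      have "lookup s a0 * lookup (?T zs) c = 0" unfolding l[symmetric] Suc.prems(2) by simp
      then have "lookup (?T zs) c = 0" using a0 by simp
      then have "lookup t c + lookup (?T zs') c = 0" using a0 by (simp add: zs lookup_add \<mu>_def)
      then show "lookup t c = lookup (- ?T zs') c" by (simp add: add_eq_0_iff2)
    qed
    have g0: "(\<Sum>(h, s, t)\<leftarrow>map g zs. T3 s h t) = (\<Sum>(h, s, t)\<leftarrow>zs. T3 s h t) - T3 s h (?T zs)" for zs
    proof (induction zs)
      case (Cons z zs)
      obtain h' s' t' where z: "z = (h', s', t')" by (cases z)
      have "T3 (s' - scl (\<mu> h' s') s) h' t' = T3 s' h' t' - T3 s h (scl (\<mu> h' s') t')"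
        by (cases "h' = h") (simp_all add: \<mu>_def)
      then show ?case using Cons by (simp add: z g_def)
    qed simp
    have "T3 s h (- ?T zs') = - T3 s h (?T zs')" using T3_simps(6)[of s h 0 "?T zs'"] by simp
    then have "(\<Sum>(h, s, t)\<leftarrow>map g zs'. T3 s h t) = (\<Sum>(h, s, t)\<leftarrow>zs. T3 s h t)"
      unfolding g0 zs T by simp
    then have gz: "(\<Sum>(h, s, t)\<leftarrow>map g zs'. T3 s h t) = 0" using Suc.prems(2) by simp
    have gm: "set (map g zs') \<subseteq> K \<times> Sm \<times> Sp"
      using mem(2,4) by (auto simp: g_def intro!: Smr)
    have "length zs' = n" using Suc.hyps(2) zs by simp
    then have IH: "(\<Sum>(h, s, t)\<leftarrow>map g zs'. \<beta> h s t) \<in> R"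
      by (intro Suc.hyps(1)[OF _ gm gz]) simp
    \<comment> \<open>Bilinearity of \<beta> is available only modulo R and one summand at a time. A
      transfers the change of the left factors to \<beta> along the list, and B the expansion of the
      sum in the right factor.\<close>
    have A: "(\<Sum>(h, s, t)\<leftarrow>map g zs. \<beta> h s t) - ((\<Sum>(h, s, t)\<leftarrow>zs. \<beta> h s t) - ?B zs) \<in> R"
      if "set zs \<subseteq> K \<times> Sm \<times> Sp" for zs
      using that
    proof (induction zs)
      case Nil
      show ?case using Rr(4) by simp
    next
      case (Cons z zs)
      obtain h' s' t' where z: "z = (h', s', t')" by (cases z)
      have m: "h' \<in> K" "s' \<in> Sm" "t' \<in> Sp" using Cons.prems by (auto simp: z)
      let ?m = "\<mu> h' s'"
      have d: "\<beta> h' (s' - scl ?m s) t' - (\<beta> h' s' t' - scl ?m (\<beta> h s t')) \<in> R"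
      proof (cases "h' = h")
        case True
        let ?n = "- ?m"
        have e: "s' - scl ?m s = s' + scl ?n s" by (simp add: pm.scale_minus_left)
        have "(\<beta> h' (s' + scl ?n s) t' - \<beta> h' s' t' - \<beta> h' (scl ?n s) t') + (\<beta> h' (scl ?n s) t' - scl ?n (\<beta> h' s t')) \<in> R"
          by (rule Rr(1)[OF add(1)[OF m(1,2) Smr(3)[OF mem(2)] m(3)] scl(1)[OF m(1) mem(2) m(3)]])
        then show ?thesis unfolding e by (simp add: True pm.scale_minus_left algebra_simps)
      qed (simp add: \<mu>_def Rr(4))
      have "(\<Sum>(h, s, t)\<leftarrow>map g (z # zs). \<beta> h s t) - ((\<Sum>(h, s, t)\<leftarrow>z # zs. \<beta> h s t) - ?B (z # zs)) =
        (\<beta> h' (s' - scl ?m s) t' - (\<beta> h' s' t' - scl ?m (\<beta> h s t'))) +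
        ((\<Sum>(h, s, t)\<leftarrow>map g zs. \<beta> h s t) - ((\<Sum>(h, s, t)\<leftarrow>zs. \<beta> h s t) - ?B zs))"
        by (simp add: z g_def)
      also have "\<dots> \<in> R" using Cons.prems by (intro Rr(1)[OF d Cons.IH]) simp
      finally show ?case .
    qed
    have B: "\<beta> h s (?T zs) - ?B zs \<in> R \<and> ?T zs \<in> Sp" if "set zs \<subseteq> K \<times> Sm \<times> Sp" for zs
      using that
    proof (induction zs)
      case Nil
      have "\<beta> h s 0 \<in> R" using scl(2)[OF mem(1-3), of 0] by simp
      then show ?case using pm.subspace_0[OF Sp] by simp
    next
      case (Cons z zs)
      obtain h' s' t' where z: "z = (h', s', t')" by (cases z)
      have m: "t' \<in> Sp" using Cons.prems by (auto simp: z)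
      let ?m = "\<mu> h' s'"
      have IH: "\<beta> h s (?T zs) - ?B zs \<in> R" "?T zs \<in> Sp" using Cons by auto
      have st: "scl ?m t' \<in> Sp" by (rule pm.subspace_scale[OF Sp m])
      have "(\<beta> h s (scl ?m t' + ?T zs) - \<beta> h s (scl ?m t') - \<beta> h s (?T zs)) +
          ((\<beta> h s (scl ?m t') - scl ?m (\<beta> h s t')) + (\<beta> h s (?T zs) - ?B zs)) \<in> R"
        by (rule Rr(1)[OF add(2)[OF mem(1,2) st IH(2)] Rr(1)[OF scl(2)[OF mem(1,2) m] IH(1)]])
      then show ?case using pm.subspace_add[OF Sp st IH(2)] by (simp add: z algebra_simps)
    qed
    let ?S = "\<Sum>(h, s, t)\<leftarrow>zs'. \<beta> h s t" and ?G = "\<Sum>(h, s, t)\<leftarrow>map g zs'. \<beta> h s t"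
    \<comment> \<open>As t is minus the sum of the \<mu> t', the first summand accounts, modulo R,
      for what the substitution subtracts from the others.\<close>
    have "\<beta> h s t - scl (- 1) (\<beta> h s (?T zs')) \<in> R"
      using scl(2)[OF mem(1,2), of "?T zs'" "- 1"] B[OF mem(4)] T by (simp add: pm.scale_minus_left)
    then have C: "\<beta> h s t + \<beta> h s (?T zs') \<in> R" by (simp add: pm.scale_minus_left)
    have "(\<beta> h s t + \<beta> h s (?T zs')) - (\<beta> h s (?T zs') - ?B zs') + (?G - (?G - (?S - ?B zs'))) \<in> R"
      using C B[OF mem(4)] A[OF mem(4)] IH by (blast intro: Rr)
    then show ?thesis by (simp add: zs)
  qed
qed

section \<open>The triangular decomposition\<close>

context coid
begin

text \<open>The combinations of normal words, without group elements, whose values lie in U;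
  \<open>Sp\<close> likewise on the right. To these factors all tensors will be reduced.\<close>

definition "Sm = {s. supp s \<subseteq> Wm \<and> toA (M.evw s) \<in> U}"
definition "Sp = {t. supp t \<subseteq> Wp \<and> toA (P.evw t) \<in> U}"

lemma toA_evw_scl:
  "toA (M.evw (scl c s)) = c \<odot>\<^sub>A toA (M.evw s)" "toA (P.evw (scl c s)) = c \<odot>\<^sub>A toA (P.evw s)"
  using klinD(3)[OF toA_M_klin M.evw_closed] klinD(3)[OF toA_P_klin P.evw_closed] by simp_all

lemma Sm_subspace: "pm.subspace Sm"
  using UD(2-4) by (auto simp: pm.subspace_def Sm_def toA_evw_simps toA_evw_scl supp_add_subset supp_scl_subset
      simp del: M.evw_simps)

lemma Sp_subspace: "pm.subspace Sp"
  using UD(2-4) by (auto simp: pm.subspace_def Sp_def toA_evw_simps toA_evw_scl supp_add_subset supp_scl_subset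
      simp del: P.evw_simps)

lemma evw_Sm: "s \<in> Sm \<Longrightarrow> M.evw s \<in> Um" and evw_Sp: "t \<in> Sp \<Longrightarrow> P.evw t \<in> Up"
  by (simp_all add: Sm_def Um_def Sp_def Up_def)

lemma col_Sm:
  assumes "m \<in> Um" "f \<in> carrier HH"
  shows "col f [] (crd (toA m)) \<in> Sm"
proof -
  have m: "m \<in> carrier M.Q" "toA m \<in> U" using assms(1) by (simp_all add: Um_def)
  note yc = U_carrier[OF m(2)]
  have "supp (crd (toA m)) \<subseteq> {k. snd (snd k) = []}"
    unfolding crd_toA_M[OF m(1)] embM_def by (rule supp_plin_subset) (auto split: if_splits)
  then have "toA (M.evw (col f [] (crd (toA m)))) \<in> U"
    using supp_crd[OF yc] m(2) assms(2) by (intro col_U) (auto simp: ev_crd[OF yc])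
  moreover have "supp (col f [] (crd (toA m))) \<subseteq> Wm"
    unfolding col_def using supp_crd[OF yc] by (intro supp_plin_subset) (auto split: if_splits)
  ultimately show ?thesis by (simp add: Sm_def)
qed

lemma row_Sp:
  assumes "y \<in> Up" "g \<in> carrier HH"
  shows "row [] g (crd (toA y)) \<in> Sp"
proof -
  have y: "y \<in> carrier P.Q" "toA y \<in> U" using assms(1) by (simp_all add: Up_def)
  note yc = U_carrier[OF y(2)]
  have "supp (crd (toA y)) \<subseteq> {k. fst k = []}"
    unfolding crd_toA_P[OF y(1)] embP_def by (rule supp_plin_subset) auto
  then have "toA (P.evw (row [] g (crd (toA y)))) \<in> U"
    using supp_crd[OF yc] y(2) assms(2) by (intro row_U) (auto simp: ev_crd[OF yc])
  moreover have "supp (row [] g (crd (toA y))) \<subseteq> Wp"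
    unfolding row_def using supp_crd[OF yc] by (intro supp_plin_subset) (auto split: if_splits)
  ultimately show ?thesis by (simp add: Sp_def)
qed

text \<open>In triangular order an element of U^- only involves the empty right word. Its columns at
  the various f therefore lie in \<open>Sm\<close> by \<open>col_U\<close>, and the element is the
  sum of these columns, each multiplied by its f on the right.\<close>

lemma Um_span: "Um \<subseteq> lin_span M.Q {M.evw s \<otimes>\<^bsub>M.Q\<^esub> M.bg f | s f. s \<in> Sm \<and> f \<in> F_in_H p N}"
proof
  let ?G = "{M.evw s \<otimes>\<^bsub>M.Q\<^esub> M.bg f | s f. s \<in> Sm \<and> f \<in> F_in_H p N}"
  fix m assume m: "m \<in> Um"
  then have mc: "m \<in> carrier M.Q" by (simp add: Um_def)
  have "?G \<subseteq> carrier M.Q" using M.Q.m_closed[OF M.evw_closed M.b_closed] by blast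
  note D = M.Q.lin_subspaceD[OF M.Q.lin_subspace_lin_span[OF this]]
  let ?V = "{t. supp t \<subseteq> F_in_H p N \<times> UNIV \<and> M.evm t \<in> lin_span M.Q ?G}"
  have V: "pm.subspace ?V"
    using D by (auto simp: pm.subspace_def M.evm_add M.evm_scl supp_add_subset supp_scl_subset)
  let ?t = "MN.hcrd m"
  have e: "M.evm t = M.evw (plin (\<lambda>(g, v). sgl v (cm v g)) t) \<otimes>\<^bsub>M.Q\<^esub> M.bg f"
    if "supp t \<subseteq> {f} \<times> UNIV" "f \<in> F_in_H p N" for t f
    using that(1)
  proof (induction rule: pm_induct)
    case zero
    show ?case using M.Q.l_null[OF M.b_closed[OF that(2), of "[]"]] by simp
  next
    case (single k c)
    then obtain v where k: "k = (f, v)" by auto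
    have "M.bw v \<otimes>\<^bsub>M.Q\<^esub> M.bg f = chi_word (map Xm v) f \<odot>\<^bsub>M.Q\<^esub> M.bQ f v"
      using M.bw_bg[OF that(2), of v] M.b_split[OF that(2), of v] by simp
    then have "cm v f \<odot>\<^bsub>M.Q\<^esub> (M.bw v \<otimes>\<^bsub>M.Q\<^esub> M.bg f) = M.bQ f v"
      using that(2) F_carrier[OF that(2)]
      by (simp add: cm_def chi_word_nz M.Q.smult_one flip: M.Q.smult_assoc)
    then show ?case
      using that(2) M.b_closed[OF that(2), of "[]"] M.b_closed[OF M.one_Ks, of v]
      by (simp add: k M.evm_single M.Q.smult_mult_l M.Q.smult_assoc M.Q.smult_closed)
  next
    case (add s t)
    have "supp s \<subseteq> F_in_H p N \<times> UNIV" "supp t \<subseteq> F_in_H p N \<times> UNIV" using add(1,2) that(2) by auto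
    then show ?case using add M.b_closed[OF that(2), of "[]"] by (simp add: M.evm_add plin_add M.Q.l_distr)
  qed
  have part: "rst (\<lambda>k. fst k = f) ?t \<in> ?V" if f: "f \<in> F_in_H p N" for f
  proof -
    let ?r = "rst (\<lambda>k. fst k = f) ?t"
    have "plin (\<lambda>(g, v). sgl v (cm v g)) ?r = col f [] (crd (toA m))"
      unfolding crd_toA_M[OF mc] rst_def col_def embM_def plin_plin by (rule plin_cong) (auto split: if_splits)
    moreover have "M.evm ?r = M.evw (plin (\<lambda>(g, v). sgl v (cm v g)) ?r) \<otimes>\<^bsub>M.Q\<^esub> M.bg f"
      by (rule e[OF _ f]) (auto simp: supp_rst)
    ultimately have "M.evm ?r \<in> ?G" using col_Sm[OF m F_carrier[OF f]] f by auto
    then show ?thesis using M.Q.lin_span_superset[of ?G] f by (auto simp: supp_rst)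
  qed
  have "(\<Sum>f\<in>fst ` supp ?t. rst (\<lambda>k. fst k = f) ?t) \<in> ?V"
    using MN.hcrd(2)[OF mc] by (intro pm.subspace_sum[OF V] part) auto
  then have "?t \<in> ?V" by (simp only: sum_rst_fibres)
  then show "m \<in> lin_span M.Q ?G" using MN.hcrd(1)[OF mc] by simp
qed

lemma Up_span: "Up \<subseteq> lin_span P.Q {P.bg g \<otimes>\<^bsub>P.Q\<^esub> P.evw t | g t. g \<in> G_in_H p N \<and> t \<in> Sp}"
proof
  let ?G = "{P.bg g \<otimes>\<^bsub>P.Q\<^esub> P.evw t | g t. g \<in> G_in_H p N \<and> t \<in> Sp}"
  fix y assume y: "y \<in> Up"
  then have yc: "y \<in> carrier P.Q" by (simp add: Up_def)
  have "?G \<subseteq> carrier P.Q" using P.Q.m_closed[OF P.b_closed P.evw_closed] by blast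
  note D = P.Q.lin_subspaceD[OF P.Q.lin_subspace_lin_span[OF this]]
  let ?V = "{t. supp t \<subseteq> G_in_H p N \<times> UNIV \<and> P.evm t \<in> lin_span P.Q ?G}"
  have V: "pm.subspace ?V"
    using D by (auto simp: pm.subspace_def P.evm_add P.evm_scl supp_add_subset supp_scl_subset)
  let ?t = "PN.hcrd y"
  have part: "rst (\<lambda>k. fst k = g) ?t \<in> ?V" if g: "g \<in> G_in_H p N" for g
  proof -
    let ?r = "row [] g (crd (toA y))"
    have "rst (\<lambda>k. fst k = g) ?t = PN.lift g ?r"
      by (rule poly_mapping_eqI)
        (auto simp: crd_toA_P[OF yc] lookup_rst PN.lookup_lift lookup_row lookup_embP split: if_splits)
    then have "P.evm (rst (\<lambda>k. fst k = g) ?t) \<in> ?G" using PN.evm_lift[OF g] row_Sp[OF y G_carrier[OF g]] g by auto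
    then show ?thesis using P.Q.lin_span_superset[of ?G] g by (auto simp: supp_rst)
  qed
  have "(\<Sum>g\<in>fst ` supp ?t. rst (\<lambda>k. fst k = g) ?t) \<in> ?V"
    using PN.hcrd(2)[OF yc] by (intro pm.subspace_sum[OF V] part) auto
  then have "?t \<in> ?V" by (simp only: sum_rst_fibres)
  then show "y \<in> lin_span P.Q ?G" using PN.hcrd(1)[OF yc] by simp
qed

section \<open>The balanced tensor product over k[F] and k[G], and its multiplication map\<close>

abbreviation "UmA \<equiv> M.Q\<lparr>carrier := Um\<rparr>"
abbreviation "UpA \<equiv> P.Q\<lparr>carrier := Up\<rparr>"
abbreviation "kHA \<equiv> kH p N"

definition "fR = kF_to_Am p N w T"
definition "gR = kG_to_Ap p N u L"
definition "\<kappa> = kH_to_A p N u L w T"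

lemma kH_simps [simp]: "carrier kHA = {x. supp x \<subseteq> carrier HH}" "add kHA = (+)" "smult kHA = scl" "zero kHA = 0"
  by (simp_all add: kH_def)

lemma kH_mult: "sgl g c \<otimes>\<^bsub>kHA\<^esub> sgl h d = sgl (g \<otimes>\<^sub>H h) (c * d)"
  unfolding kH_def by (rule monoid_alg_mult_bas[OF H.monoid_axioms])

lemma kH_algebra: "k_algebra kHA"
  unfolding kH_def by (rule k_algebra_monoid_alg[OF H.monoid_axioms])

lemma \<kappa>_hom: "\<kappa> \<in> alg_hom kHA AA"
  unfolding \<kappa>_def kH_to_A_def kH_def monoid_alg_def
  by (rule twisted.lin_ext_hom[OF twisted_one[OF H.monoid_axioms] A0.k_alg])
    (auto simp: A.b_one A.bg_mult A0.smult_one)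

lemma \<kappa>_single: "h \<in> carrier HH \<Longrightarrow> \<kappa> (sgl h c) = c \<odot>\<^sub>A A.bg h"
  unfolding \<kappa>_def kH_to_A_def by (rule A0.lin_ext_single) simp

lemma fR_eq: "fR = lin_ext M.Q M.bg" and gR_eq: "gR = lin_ext P.Q P.bg"
  by (simp_all add: fR_def gR_def kF_to_Am_def kG_to_Ap_def Am_eq Ap_eq)

lemma \<kappa>_eq: "\<kappa> = lin_ext AA A.bg"
  by (simp add: \<kappa>_def kH_to_A_def)

lemma fR:
  assumes "supp r \<subseteq> F_in_H p N"
  shows "fR r \<in> Um" "toA (fR r) = \<kappa> r"
proof -
  show "fR r \<in> Um" unfolding fR_eq using assms bg_Um by (intro M.Q.lin_ext_subspace[OF Um_subspace]) blast
  have "toA (fR r) = lin_ext AA (\<lambda>h. toA (M.bg h)) r"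
    unfolding fR_eq using assms M.b_closed by (intro klin_lin_ext[OF M.Q.k_alg A0.k_alg toA_M_klin]) blast
  also have "\<dots> = \<kappa> r"
    unfolding \<kappa>_eq using assms F_carrier toA_M_bQ[of _ "[]"] by (intro A0.lin_ext_cong) auto
  finally show "toA (fR r) = \<kappa> r" .
qed

lemma gR:
  assumes "supp r \<subseteq> G_in_H p N"
  shows "gR r \<in> Up" "toA (gR r) = \<kappa> r"
proof -
  show "gR r \<in> Up" unfolding gR_eq using assms bg_Up by (intro P.Q.lin_ext_subspace[OF Up_subspace]) blast
  have "toA (gR r) = lin_ext AA (\<lambda>h. toA (P.bg h)) r"
    unfolding gR_eq using assms P.b_closed by (intro klin_lin_ext[OF P.Q.k_alg A0.k_alg toA_P_klin]) blast
  also have "\<dots> = \<kappa> r"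
    unfolding \<kappa>_eq using assms G_carrier toA_P_bQ[of _ "[]"] by (intro A0.lin_ext_cong) auto
  finally show "toA (gR r) = \<kappa> r" .
qed

sublocale TR: tensor_triple UmA kHA UpA fR "kF p N" "kG p N" gR
proof -
  interpret UM: k_algebra UmA by (rule M.Q.k_algebra_subalgebra[OF Um_subalgebra])
  interpret UP: k_algebra UpA by (rule P.Q.k_algebra_subalgebra[OF Up_subalgebra])
  interpret KH: k_algebra kHA by (rule kH_algebra)
  show "tensor_triple UmA kHA UpA fR (kF p N) (kG p N) gR"
    by unfold_locales (use fR gR F_carrier G_carrier in \<open>auto simp: kF_def kG_def\<close>)
qed

abbreviation "f3 \<equiv> \<lambda>(a, x, b). toA a \<otimes>\<^sub>A \<kappa> x \<otimes>\<^sub>A toA b"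

lemma \<kappa>_closed: "supp x \<subseteq> carrier HH \<Longrightarrow> \<kappa> x \<in> carrier AA"
  using alg_homD(2)[OF \<kappa>_hom, of x] by simp

lemma \<kappa>_U: "supp x \<subseteq> carrier HH \<Longrightarrow> \<kappa> x \<in> U"
  unfolding \<kappa>_def kH_to_A_def by (rule A0.lin_ext_subspace[OF U_subspace]) (use bg_U in blast)

lemma f3_U: "a \<in> Um \<Longrightarrow> supp x \<subseteq> carrier HH \<Longrightarrow> b \<in> Up \<Longrightarrow> f3 (a, x, b) \<in> U"
  using U_mult[OF U_mult[OF toA_Um \<kappa>_U] toA_Up] by simp

lemma klin_sub: "k_algebra A \<Longrightarrow> klin A B f \<Longrightarrow> V \<subseteq> carrier A \<Longrightarrow> klin (A\<lparr>carrier := V\<rparr>) B f"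
  by (auto simp: klin_def Pi_iff subset_iff)

lemma Um_Q: "Um \<subseteq> carrier M.Q" and Up_Q: "Up \<subseteq> carrier P.Q"
  by (auto simp: Um_def Up_def)

text \<open>After passage to A, \<open>fR\<close> and \<open>gR\<close> agree with
  \<open>\<kappa>\<close> on k[F] and k[G], so both balancing relations become associativity in
  A.\<close>

lemma rel3_f3: "r \<in> TR.rel3 \<Longrightarrow> lin_ext AA f3 r = \<zero>\<^sub>A"
proof (rule TR.rel3_kernel[OF A0.k_alg])
  note tc = klinD(1)[OF toA_M_klin] klinD(1)[OF toA_P_klin]
  fix m x y assume "m \<in> carrier UmA" "x \<in> carrier kHA" "y \<in> carrier UpA"
  then show "f3 (m, x, y) \<in> carrier AA" using U_carrier[OF f3_U] by simp
next
  fix x y assume "x \<in> carrier kHA" "y \<in> carrier UpA"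
  then have c: "\<kappa> x \<in> carrier AA" "toA y \<in> carrier AA" using \<kappa>_closed U_carrier[OF toA_Up] by auto
  show "klin UmA AA (\<lambda>m. f3 (m, x, y))"
    unfolding prod.case
    by (rule klin_sub[OF M.Q.k_alg klin_comp[OF klin_comp[OF toA_M_klin
          klin_mult_right[OF A0.k_alg c(1)]] klin_mult_right[OF A0.k_alg c(2)]] Um_Q])
next
  fix m y assume "m \<in> carrier UmA" "y \<in> carrier UpA"
  then have c: "toA m \<in> carrier AA" "toA y \<in> carrier AA" using U_carrier[OF toA_Um] U_carrier[OF toA_Up] by auto
  show "klin kHA AA (\<lambda>x. f3 (m, x, y))"
    unfolding prod.case
    by (rule klin_comp[OF klin_comp[OF alg_homD(1)[OF \<kappa>_hom]
          klin_mult_left[OF A0.k_alg c(1)]] klin_mult_right[OF A0.k_alg c(2)]])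
next
  fix m x assume "m \<in> carrier UmA" "x \<in> carrier kHA"
  then have c: "toA m \<otimes>\<^sub>A \<kappa> x \<in> carrier AA" using \<kappa>_closed U_carrier[OF toA_Um] by auto
  show "klin UpA AA (\<lambda>y. f3 (m, x, y))"
    unfolding prod.case
    by (rule klin_sub[OF P.Q.k_alg klin_comp[OF toA_P_klin
          klin_mult_left[OF A0.k_alg c]] Up_Q])
next
  fix m r x y assume a: "m \<in> carrier UmA" "r \<in> kF p N" "x \<in> carrier kHA" "y \<in> carrier UpA"
  have r: "fR r \<in> Um" "toA (fR r) = \<kappa> r" "r \<in> carrier kHA" using fR[of r] a(2) F_carrier by (auto simp: kF_def)
  have c: "m \<in> carrier M.Q" "fR r \<in> carrier M.Q" "toA m \<in> carrier AA" "\<kappa> r \<in> carrier AA" "\<kappa> x \<in> carrier AA" "toA y \<in> carrier AA"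
    using a(1,3,4) r Um_Q U_carrier[OF toA_Um] U_carrier[OF toA_Up] \<kappa>_closed by auto
  show "f3 (m \<otimes>\<^bsub>UmA\<^esub> fR r, x, y) = f3 (m, r \<otimes>\<^bsub>kHA\<^esub> x, y)"
    using alg_homD(5)[OF toA_M_hom c(1,2)] alg_homD(5)[OF \<kappa>_hom r(3) a(3)] c by (simp add: r(2) A0.m_assoc)
next
  fix m x r y assume a: "m \<in> carrier UmA" "x \<in> carrier kHA" "r \<in> kG p N" "y \<in> carrier UpA"
  have r: "gR r \<in> Up" "toA (gR r) = \<kappa> r" "r \<in> carrier kHA" using gR[of r] a(3) G_carrier by (auto simp: kG_def)
  have c: "y \<in> carrier P.Q" "gR r \<in> carrier P.Q" "toA m \<in> carrier AA" "\<kappa> r \<in> carrier AA" "\<kappa> x \<in> carrier AA" "toA y \<in> carrier AA"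
    using a(1,2,4) r Up_Q U_carrier[OF toA_Um] U_carrier[OF toA_Up] \<kappa>_closed by auto
  show "f3 (m, x \<otimes>\<^bsub>kHA\<^esub> r, y) = f3 (m, x, gR r \<otimes>\<^bsub>UpA\<^esub> y)"
    using alg_homD(5)[OF toA_P_hom c(2,1)] alg_homD(5)[OF \<kappa>_hom a(2) r(3)] c by (simp add: r(2) A0.m_assoc)
qed

definition \<beta> :: "('k, 'n) hgrp \<Rightarrow> ('k, 'n) npoly \<Rightarrow> ('k, 'n) npoly \<Rightarrow> (('k, 'n) quo \<times> (('k, 'n) hgrp \<Rightarrow>\<^sub>0 'k) \<times> ('k, 'n) quo \<Rightarrow>\<^sub>0 'k)" where
  "\<beta> h s t = bas (M.evw s, bas h, P.evw t)"

lemmas rel3_rules = TR.gens3.intros[THEN TR.gens3_rel3, simplified]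

lemma \<beta>_bilinear:
  assumes "h \<in> carrier HH" "s \<in> Sm" "t \<in> Sp"
  shows "s' \<in> Sm \<Longrightarrow> \<beta> h (s + s') t - \<beta> h s t - \<beta> h s' t \<in> TR.rel3"
    "t' \<in> Sp \<Longrightarrow> \<beta> h s (t + t') - \<beta> h s t - \<beta> h s t' \<in> TR.rel3"
    "\<beta> h (scl c s) t - scl c (\<beta> h s t) \<in> TR.rel3" "\<beta> h s (scl c t) - scl c (\<beta> h s t) \<in> TR.rel3"
proof -
  have c: "M.evw s \<in> Um" "supp (bas h :: ('k, 'n) hgrp \<Rightarrow>\<^sub>0 'k) \<subseteq> carrier HH" "P.evw t \<in> Up"
    using assms evw_Sm evw_Sp by auto
  show "s' \<in> Sm \<Longrightarrow> \<beta> h (s + s') t - \<beta> h s t - \<beta> h s' t \<in> TR.rel3" using rel3_rules(1)[OF c(1) evw_Sm c(2,3)] by (simp add: \<beta>_def)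
  show "t' \<in> Sp \<Longrightarrow> \<beta> h s (t + t') - \<beta> h s t - \<beta> h s t' \<in> TR.rel3" using rel3_rules(3)[OF c evw_Sp] by (simp add: \<beta>_def)
  show "\<beta> h (scl c s) t - scl c (\<beta> h s t) \<in> TR.rel3" using rel3_rules(4)[OF c] by (simp add: \<beta>_def)
  show "\<beta> h s (scl c t) - scl c (\<beta> h s t) \<in> TR.rel3" using rel3_rules(6)[OF c] by (simp add: \<beta>_def)
qed

abbreviation "\<Sigma>\<beta> zs \<equiv> \<Sum>(h, s, t)\<leftarrow>zs. \<beta> h s t"
abbreviation "KSS \<equiv> carrier HH \<times> Sm \<times> Sp"

text \<open>The elements congruent, modulo the tensor relations, to a finite sum of s \<otimes> h
  \<otimes> t with s in \<open>Sm\<close> and t in \<open>Sp\<close>; \<open>all_E\<close> shows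
  that these are all. Lists serve because \<open>tensor_elimination\<close> removes summands one by
  one.\<close>

definition "E = {x. \<exists>zs. set zs \<subseteq> KSS \<and> x - \<Sigma>\<beta> zs \<in> TR.rel3}"

lemmas Rr = pm.subspace_add[OF TR.rel3_subspace] pm.subspace_diff[OF TR.rel3_subspace]
  pm.subspace_scale[OF TR.rel3_subspace] pm.subspace_0[OF TR.rel3_subspace]

lemma rel3_E: "x \<in> TR.rel3 \<Longrightarrow> x \<in> E"
  unfolding E_def by (intro CollectI exI[of _ "[]"]) simp

lemma \<beta>_E: "h \<in> carrier HH \<Longrightarrow> s \<in> Sm \<Longrightarrow> t \<in> Sp \<Longrightarrow> \<beta> h s t \<in> E"
  unfolding E_def by (intro CollectI exI[of _ "[(h, s, t)]"]) (simp add: Rr)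

lemma E_subspace: "pm.subspace E"
proof (rule pm.subspaceI)
  show "0 \<in> E" by (rule rel3_E[OF Rr(4)])
next
  fix x y assume "x \<in> E" "y \<in> E"
  then obtain zs zs' where z: "set zs \<subseteq> KSS" "x - \<Sigma>\<beta> zs \<in> TR.rel3" "set zs' \<subseteq> KSS" "y - \<Sigma>\<beta> zs' \<in> TR.rel3"
    unfolding E_def by blast
  have e: "(x + y) - \<Sigma>\<beta> (zs @ zs') = (x - \<Sigma>\<beta> zs) + (y - \<Sigma>\<beta> zs')" by simp
  then have "(x + y) - \<Sigma>\<beta> (zs @ zs') \<in> TR.rel3" using Rr(1)[OF z(2,4)] by (simp only: e)
  then show "x + y \<in> E" unfolding E_def using z(1,3) by (intro CollectI exI[of _ "zs @ zs'"]) simp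
next
  fix c x assume "x \<in> E"
  then obtain zs where z: "set zs \<subseteq> KSS" "x - \<Sigma>\<beta> zs \<in> TR.rel3" unfolding E_def by blast
  let ?g = "\<lambda>(h, s :: ('k, 'n) npoly, t :: ('k, 'n) npoly). (h, scl c s, t)"
  have *: "\<Sigma>\<beta> (map ?g zs) - scl c (\<Sigma>\<beta> zs) \<in> TR.rel3 \<and> set (map ?g zs) \<subseteq> KSS"
    using z(1)
  proof (induction zs)
    case Nil
    show ?case using Rr(4) by simp
  next
    case (Cons z zs)
    obtain h s t where zz: "z = (h, s, t)" by (cases z)
    have m: "h \<in> carrier HH" "s \<in> Sm" "t \<in> Sp" using Cons.prems by (auto simp: zz)
    have IH: "\<Sigma>\<beta> (map ?g zs) - scl c (\<Sigma>\<beta> zs) \<in> TR.rel3" "set (map ?g zs) \<subseteq> KSS" using Cons by auto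
    have "(\<beta> h (scl c s) t - scl c (\<beta> h s t)) + (\<Sigma>\<beta> (map ?g zs) - scl c (\<Sigma>\<beta> zs)) \<in> TR.rel3"
      by (rule Rr(1)[OF \<beta>_bilinear(3)[OF m] IH(1)])
    moreover have e: "\<Sigma>\<beta> (map ?g (z # zs)) - scl c (\<Sigma>\<beta> (z # zs)) =
        (\<beta> h (scl c s) t - scl c (\<beta> h s t)) + (\<Sigma>\<beta> (map ?g zs) - scl c (\<Sigma>\<beta> zs))"
      by (simp add: zz pm.scale_right_distrib)
    ultimately have "\<Sigma>\<beta> (map ?g (z # zs)) - scl c (\<Sigma>\<beta> (z # zs)) \<in> TR.rel3" by (simp only: e)
    moreover have "set (map ?g (z # zs)) \<subseteq> KSS" using IH(2) m pm.subspace_scale[OF Sm_subspace m(2)] by (simp add: zz)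
    ultimately show ?case by (rule conjI)
  qed
  have "scl c (x - \<Sigma>\<beta> zs) - (\<Sigma>\<beta> (map ?g zs) - scl c (\<Sigma>\<beta> zs)) \<in> TR.rel3"
    by (rule Rr(2)[OF Rr(3)[OF z(2)] conjunct1[OF *]])
  then have "scl c x - \<Sigma>\<beta> (map ?g zs) \<in> TR.rel3" by (simp add: pm.scale_right_diff_distrib)
  then show "scl c x \<in> E" unfolding E_def using * by blast
qed

lemmas Er = pm.subspace_add[OF E_subspace] pm.subspace_diff[OF E_subspace] pm.subspace_scale[OF E_subspace]

lemma E_cong: "x - y \<in> TR.rel3 \<Longrightarrow> y \<in> E \<Longrightarrow> x \<in> E"
  using Er(1)[OF rel3_E, of "x - y" y] by simp

lemma E_add: "x - y - z \<in> TR.rel3 \<Longrightarrow> y \<in> E \<Longrightarrow> z \<in> E \<Longrightarrow> x \<in> E"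
  using Er(1)[OF Er(1)[OF rel3_E, of "x - y - z" y], of z] by simp

text \<open>By \<open>Up_span\<close> the right factor is a combination of products g t with t in
  \<open>Sp\<close>, and balancing moves g into the middle: s \<otimes> h \<otimes> g t = s
  \<otimes> h g \<otimes> t.\<close>

lemma E_right:
  assumes "s \<in> Sm" "h \<in> carrier HH" "y \<in> Up"
  shows "bas (M.evw s, bas h, y) \<in> E"
proof -
  let ?G = "{P.bg g \<otimes>\<^bsub>P.Q\<^esub> P.evw t | g t. g \<in> G_in_H p N \<and> t \<in> Sp}"
  let ?Y = "{y \<in> Up. bas (M.evw s, bas h, y) \<in> E}"
  note m = evw_Sm[OF assms(1)]
  have hh: "supp (bas h :: ('k, 'n) hgrp \<Rightarrow>\<^sub>0 'k) \<subseteq> carrier HH" using assms(2) by simp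
  note UpD = P.Q.lin_subspaceD[OF Up_subspace]
  have sc: "c \<odot>\<^bsub>P.Q\<^esub> y \<in> ?Y" if "y \<in> ?Y" for c y
  proof -
    have "scl c (bas (M.evw s, bas h, y)) \<in> E" using that Er(3) by blast
    then have "sgl (M.evw s, bas h, y) c \<in> E" by simp
    then show ?thesis using that E_cong[OF rel3_rules(6)[OF m hh, of y c]] UpD(4) by simp
  qed
  have "lin_subspace ?Y P.Q"
  proof (rule P.Q.lin_subspaceI)
    show "?Y \<subseteq> carrier P.Q" using Up_Q by blast
    show "x \<oplus>\<^bsub>P.Q\<^esub> y \<in> ?Y" if "x \<in> ?Y" "y \<in> ?Y" for x y
      using that E_add[OF rel3_rules(3)[OF m hh]] UpD(3) by simp
    have "\<zero>\<^bsub>P.Q\<^esub> = P.evw 0" by simp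
    then show "\<zero>\<^bsub>P.Q\<^esub> \<in> ?Y"
      using \<beta>_E[OF assms(2,1) pm.subspace_0[OF Sp_subspace]] UpD(2) by (simp add: \<beta>_def)
  qed (rule sc)
  moreover have "?G \<subseteq> ?Y"
  proof
    fix x assume "x \<in> ?G"
    then obtain g t where x: "x = P.bg g \<otimes>\<^bsub>P.Q\<^esub> P.evw t" "g \<in> G_in_H p N" "t \<in> Sp" by blast
    have g: "(bas g :: ('k, 'n) hgrp \<Rightarrow>\<^sub>0 'k) \<in> kG p N" using x(2) by (simp add: kG_def)
    have gb: "gR (bas g) = P.bg g" unfolding gR_eq P.Q.lin_ext_single[where \<beta> = P.bg, OF P.b_closed[OF x(2)]] by (rule P.Q.smult_one[OF P.b_closed[OF x(2)]])
    have "bas (M.evw s, bas h \<otimes>\<^bsub>kHA\<^esub> bas g, P.evw t) - bas (M.evw s, bas h, x) \<in> TR.rel3"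
      using rel3_rules(8)[OF m hh g evw_Sp[OF x(3)]] by (simp add: gb x(1))
    moreover have "bas (M.evw s, bas h \<otimes>\<^bsub>kHA\<^esub> bas g, P.evw t) \<in> E"
      using \<beta>_E[OF _ assms(1) x(3), of "h \<otimes>\<^sub>H g"] assms(2) G_carrier[OF x(2)] by (simp add: kH_mult \<beta>_def)
    ultimately have "bas (M.evw s, bas h, x) \<in> E"
      using Er(2)[OF _ rel3_E] by fastforce
    moreover have "x \<in> Up"
      unfolding x(1) by (rule P.Q.k_subalgebraD(3)[OF Up_subalgebra bg_Up[OF x(2)] evw_Sp[OF x(3)]])
    ultimately show "x \<in> ?Y" by simp
  qed
  ultimately have "lin_span P.Q ?G \<subseteq> ?Y" by (rule P.Q.lin_span_least)
  then show ?thesis using Up_span assms(3) by blast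
qed

text \<open>With \<open>E_right\<close> at hand only the left factor needs care, and
  \<open>Um_span\<close> supplies it in the form s f: balancing over k[F] gives s f \<otimes> h
  \<otimes> y = s \<otimes> f h \<otimes> y.\<close>

lemma E_left:
  assumes "m \<in> Um" "h \<in> carrier HH" "y \<in> Up"
  shows "bas (m, bas h, y) \<in> E"
proof -
  let ?G = "{M.evw s \<otimes>\<^bsub>M.Q\<^esub> M.bg f | s f. s \<in> Sm \<and> f \<in> F_in_H p N}"
  let ?X = "{m \<in> Um. bas (m, bas h, y) \<in> E}"
  have hh: "supp (bas h :: ('k, 'n) hgrp \<Rightarrow>\<^sub>0 'k) \<subseteq> carrier HH" using assms(2) by simp
  note UmD = M.Q.lin_subspaceD[OF Um_subspace]
  have sc: "c \<odot>\<^bsub>M.Q\<^esub> m \<in> ?X" if "m \<in> ?X" for c m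
  proof -
    have "scl c (bas (m, bas h, y)) \<in> E" using that Er(3) by blast
    then have "sgl (m, bas h, y) c \<in> E" by simp
    then show ?thesis using that E_cong[OF rel3_rules(4)[OF _ hh assms(3), of m c]] UmD(4) by simp
  qed
  have "lin_subspace ?X M.Q"
  proof (rule M.Q.lin_subspaceI)
    show "?X \<subseteq> carrier M.Q" using Um_Q by blast
    show "x \<oplus>\<^bsub>M.Q\<^esub> y \<in> ?X" if "x \<in> ?X" "y \<in> ?X" for x y
      using that E_add[OF rel3_rules(1)[OF _ _ hh assms(3)]] UmD(3) by simp
    have "\<zero>\<^bsub>M.Q\<^esub> = M.evw 0" by simp
    then show "\<zero>\<^bsub>M.Q\<^esub> \<in> ?X"
      using E_right[OF pm.subspace_0[OF Sm_subspace] assms(2,3)] UmD(2) by simp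
  qed (rule sc)
  moreover have "?G \<subseteq> ?X"
  proof
    fix x assume "x \<in> ?G"
    then obtain s f where x: "x = M.evw s \<otimes>\<^bsub>M.Q\<^esub> M.bg f" "s \<in> Sm" "f \<in> F_in_H p N" by blast
    have f: "(bas f :: ('k, 'n) hgrp \<Rightarrow>\<^sub>0 'k) \<in> kF p N" using x(3) by (simp add: kF_def)
    have fb: "fR (bas f) = M.bg f" unfolding fR_eq M.Q.lin_ext_single[where \<beta> = M.bg, OF M.b_closed[OF x(3)]] by (rule M.Q.smult_one[OF M.b_closed[OF x(3)]])
    have "bas (x, bas h, y) - bas (M.evw s, bas f \<otimes>\<^bsub>kHA\<^esub> bas h, y) \<in> TR.rel3"
      using rel3_rules(7)[OF evw_Sm[OF x(2)] f hh assms(3)] by (simp add: fb x(1))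
    moreover have "bas (M.evw s, bas f \<otimes>\<^bsub>kHA\<^esub> bas h, y) \<in> E"
      using E_right[OF x(2) _ assms(3), of "f \<otimes>\<^sub>H h"] assms(2) F_carrier[OF x(3)] by (simp add: kH_mult)
    ultimately have "bas (x, bas h, y) \<in> E" by (rule E_cong)
    moreover have "x \<in> Um"
      unfolding x(1) by (rule M.Q.k_subalgebraD(3)[OF Um_subalgebra evw_Sm[OF x(2)] bg_Um[OF x(3)]])
    ultimately show "x \<in> ?X" by simp
  qed
  ultimately have "lin_span M.Q ?G \<subseteq> ?X" by (rule M.Q.lin_span_least)
  then show ?thesis using Um_span assms(1) by blast
qed

lemma E_middle:
  assumes "m \<in> Um" "supp x \<subseteq> carrier HH" "y \<in> Up"
  shows "bas (m, x, y) \<in> E"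
  using assms(2)
proof (induction rule: pm_induct)
  case zero
  have "bas (m, 0, y) \<in> TR.rel3" using rel3_rules(5)[OF assms(1) _ assms(3), of 0 0] by simp
  then show ?case by (rule rel3_E)
next
  case (single h c)
  have "bas (m, sgl h c, y) - sgl (m, bas h, y) c \<in> TR.rel3"
    using rel3_rules(5)[OF assms(1) _ assms(3), of "bas h" c] single by simp
  moreover have "sgl (m, bas h, y) c \<in> E" using Er(3)[OF E_left[OF assms(1) single assms(3)], of c] by simp
  ultimately show ?case by (rule E_cong)
next
  case (add s t)
  show ?case using rel3_rules(2)[OF assms(1) add(1,2) assms(3)] add(3,4) by (rule E_add)
qed

lemma all_E: "supp \<xi> \<subseteq> carrier TR.MPQ \<Longrightarrow> \<xi> \<in> E"
proof (induction rule: pm_induct)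
  case zero
  show ?case by (rule pm.subspace_0[OF E_subspace])
next
  case (single k c)
  then obtain m x y where k: "k = (m, x, y)" "m \<in> Um" "supp x \<subseteq> carrier HH" "y \<in> Up" by auto
  have "scl c (bas (m, x, y)) \<in> E" by (rule Er(3)[OF E_middle[OF k(2-4)]])
  then show ?case by (simp add: k(1))
next
  case (add s t)
  show ?case by (rule Er(1)[OF add(3,4)])
qed

lemma f3_carrier: "f3 \<in> carrier TR.MPQ \<rightarrow> carrier AA"
  using U_carrier[OF f3_U] by auto

lemmas lin_f3 = klin_lin_ext_monoid_alg[OF TR.monoid_triple A0.k_alg f3_carrier]

lemma \<beta>_supp: "h \<in> carrier HH \<Longrightarrow> s \<in> Sm \<Longrightarrow> t \<in> Sp \<Longrightarrow> supp (\<beta> h s t) \<subseteq> carrier TR.MPQ"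
  by (simp add: \<beta>_def evw_Sm evw_Sp)

lemma lin_f3_\<beta>: "h \<in> carrier HH \<Longrightarrow> s \<in> Sm \<Longrightarrow> t \<in> Sp \<Longrightarrow> lin_ext AA f3 (\<beta> h s t) = A.ev (T3 s h t)"
  unfolding \<beta>_def by (subst A0.lin_ext_single) (simp_all add: \<kappa>_single \<kappa>_closed A0.smult_one ev_T3)

lemma lin_f3_list:
  "set zs \<subseteq> KSS \<Longrightarrow> supp (\<Sigma>\<beta> zs) \<subseteq> carrier TR.MPQ \<and> supp (\<Sum>(h, s, t)\<leftarrow>zs. T3 s h t) \<subseteq> WW \<and>
    lin_ext AA f3 (\<Sigma>\<beta> zs) = A.ev (\<Sum>(h, s, t)\<leftarrow>zs. T3 s h t)"
proof (induction zs)
  case (Cons z zs)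
  obtain h s t where z: "z = (h, s, t)" by (cases z)
  have m: "h \<in> carrier HH" "s \<in> Sm" "t \<in> Sp" using Cons.prems by (auto simp: z)
  let ?T = "\<Sum>(h, s, t)\<leftarrow>zs. T3 s h t"
  have IH: "supp (\<Sigma>\<beta> zs) \<subseteq> carrier TR.MPQ" "supp ?T \<subseteq> WW" "lin_ext AA f3 (\<Sigma>\<beta> zs) = A.ev ?T"
    using Cons by auto
  have W: "supp (T3 s h t) \<subseteq> WW"
    using m by (auto simp: Sm_def Sp_def in_keys_iff lookup_T3 subset_iff split: if_splits)
  have F: "lin_ext AA f3 (\<beta> h s t + \<Sigma>\<beta> zs) = lin_ext AA f3 (\<beta> h s t) \<oplus>\<^sub>A lin_ext AA f3 (\<Sigma>\<beta> zs)"
    using klinD(2)[OF lin_f3, of "\<beta> h s t" "\<Sigma>\<beta> zs"] \<beta>_supp[OF m] IH(1) unfolding monoid_alg_simps by blast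
  have "A.ev (T3 s h t + ?T) = A.ev (T3 s h t) \<oplus>\<^sub>A A.ev ?T" by (rule A.ev_add[OF WW_V0[OF W] WW_V0[OF IH(2)]])
  then have "lin_ext AA f3 (\<beta> h s t + \<Sigma>\<beta> zs) = A.ev (T3 s h t + ?T)" unfolding F lin_f3_\<beta>[OF m] IH(3) by simp
  then show ?case using supp_add_subset[OF \<beta>_supp[OF m] IH(1)] supp_add_subset[OF W IH(2)]
    by (simp only: z list.map sum_list.Cons prod.case)
qed simp

text \<open>Modulo the relations, \<xi> is a sum of terms s \<otimes> h \<otimes> t. Its value in A
  is 0, and as all words are normal its coordinate vector, the sum of the \<open>T3 s h t\<close>,
  is 0 too; by \<open>tensor_elimination\<close> the terms then cancel in the balanced tensor
  product.\<close>

lemma lin_f3_injective: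
  assumes "supp \<xi> \<subseteq> carrier TR.MPQ" "lin_ext AA f3 \<xi> = \<zero>\<^sub>A"
  shows "\<xi> \<in> TR.rel3"
proof -
  obtain zs where zs: "set zs \<subseteq> KSS" "\<xi> - \<Sigma>\<beta> zs \<in> TR.rel3" using all_E[OF assms(1)] unfolding E_def by blast
  note L = lin_f3_list[OF zs(1)]
  let ?T = "\<Sum>(h, s, t)\<leftarrow>zs. T3 s h t"
  have "lin_ext AA f3 (\<xi> - \<Sigma>\<beta> zs) = lin_ext AA f3 \<xi> \<ominus>\<^bsub>AA\<^esub> lin_ext AA f3 (\<Sigma>\<beta> zs)"
    by (rule A0.lin_ext_diff) (use f3_carrier assms(1) L in blast)
  then have "\<zero>\<^sub>A = \<zero>\<^sub>A \<ominus>\<^bsub>AA\<^esub> A.ev ?T" using rel3_f3[OF zs(2)] L assms(2) by simp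
  moreover have ec: "A.ev ?T \<in> carrier AA" using A.ev_closed WW_V0 L by blast
  ultimately have "A.ev ?T = \<zero>\<^sub>A" using A0.r_right_minus_eq[OF A0.zero_closed ec] by simp
  then have "A.ev ?T = A.ev 0" by simp
  then have "?T = 0" using crd_ev_WW[of ?T] crd_ev_WW[of 0] L by simp
  then have "\<Sigma>\<beta> zs \<in> TR.rel3"
    by (intro tensor_elimination[OF TR.rel3_subspace Sm_subspace Sp_subspace _ _ _ _ zs(1)] \<beta>_bilinear)
  then show ?thesis using Rr(1)[OF zs(2)] by fastforce
qed

lemma triangular_decomposition_U: "triangular_decomposition p N u L w T U Um Up"
proof -
  let ?R = TR.rel3 and ?C = "{t. supp t \<subseteq> carrier TR.MPQ}" and ?F = "lin_ext AA f3"
  \<comment> \<open>On cosets the multiplication map is \<open>?F\<close>, so the bijection amounts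
    to \<open>?F\<close> having image U and identifying only elements that are congruent modulo the
    relations.\<close>
  have m: "triangular_mult p N u L w T (?R +>\<^bsub>monoid_alg TR.MPQ\<^esub> t) = ?F t" if "t \<in> ?C" for t
    using coset_lift_eq[OF TR.monoid_triple A0.k_alg f3_carrier TR.rel3_lin_subspace rel3_f3] that
    unfolding triangular_mult_def \<kappa>_def by simp
  have T: "triangular_tensor p N u L w T Um Up = (\<lambda>t. ?R +>\<^bsub>monoid_alg TR.MPQ\<^esub> t) ` ?C"
    unfolding triangular_tensor_def tensor3_def Am_eq Ap_eq fR_def gR_def A_RCOSETS_def' by auto
  have image: "?F ` ?C = U"
  proof
    have "?F t \<in> U" if t: "t \<in> ?C" for t
      by (rule A0.lin_ext_subspace[OF U_subspace]) (use t f3_U in fastforce)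
    then show "?F ` ?C \<subseteq> U" by blast
    have sub: "lin_subspace (?F ` ?C) AA"
    proof (rule A0.lin_subspaceI)
      show "?F ` ?C \<subseteq> carrier AA" using klinD(1)[OF lin_f3] by auto
      show "\<zero>\<^sub>A \<in> ?F ` ?C" by (rule image_eqI[of _ ?F 0]) simp_all
    next
      fix x y assume "x \<in> ?F ` ?C" "y \<in> ?F ` ?C"
      then obtain s t where "s \<in> ?C" "t \<in> ?C" "x = ?F s" "y = ?F t" by blast
      then show "x \<oplus>\<^sub>A y \<in> ?F ` ?C"
        using klinD(2)[OF lin_f3, of s t] supp_add_subset[of s _ t]
        by (intro image_eqI[of _ ?F "s + t"]) (simp_all only: monoid_alg_simps mem_Collect_eq)
    next
      fix c x assume "x \<in> ?F ` ?C"
      then obtain s where "s \<in> ?C" "x = ?F s" by blast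
      then show "c \<odot>\<^sub>A x \<in> ?F ` ?C"
        using klinD(3)[OF lin_f3, of s c] supp_scl_subset[of s]
        by (intro image_eqI[of _ ?F "scl c s"]) (simp_all only: monoid_alg_simps mem_Collect_eq)
    qed
    show "U \<subseteq> ?F ` ?C"
    proof (rule ord_eq_le_trans[OF U_eq_UU], rule A0.lin_span_least[OF sub], rule subsetI)
      fix z assume "z \<in> {toA m \<otimes>\<^sub>A A.bg h \<otimes>\<^sub>A toA x | m h x. m \<in> Um \<and> h \<in> carrier HH \<and> x \<in> Up}"
      then obtain m h x where z: "z = toA m \<otimes>\<^sub>A A.bg h \<otimes>\<^sub>A toA x" "m \<in> Um" "h \<in> carrier HH" "x \<in> Up" by blast
      have k: "\<kappa> (bas h) = A.bg h" using z(3) by (simp add: \<kappa>_single A0.smult_one)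
      have c: "f3 (m, bas h, x) \<in> carrier AA"
        using U_carrier[OF f3_U[OF z(2) _ z(4), of "bas h"]] z(3) by simp
      have "?F (bas (m, bas h, x)) = z"
        unfolding A0.lin_ext_single[where \<beta> = f3, OF c] A0.smult_one[OF c] by (simp add: z(1) k)
      then show "z \<in> ?F ` ?C" using z by (intro image_eqI[of _ ?F "bas (m, bas h, x)"]) simp_all
    qed
  qed
  have inj: "?R +>\<^bsub>monoid_alg TR.MPQ\<^esub> s = ?R +>\<^bsub>monoid_alg TR.MPQ\<^esub> t"
    if "s \<in> ?C" "t \<in> ?C" "?F s = ?F t" for s t
  proof -
    have d: "?F (s - t) = ?F s \<ominus>\<^bsub>AA\<^esub> ?F t"
      by (rule A0.lin_ext_diff) (use f3_carrier that(1,2) in blast)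
    have c: "?F t \<in> carrier AA" using klinD(1)[OF lin_f3] that(2) by simp
    have "?F (s - t) = \<zero>\<^sub>A" unfolding d that(3) using A0.r_right_minus_eq[OF c c] by simp
    moreover have "supp (s - t) \<subseteq> carrier TR.MPQ"
      using that(1,2) by (intro supp_diff_subset) (simp_all only: mem_Collect_eq)
    ultimately have st: "s - t \<in> ?R" by (intro lin_f3_injective)
    show ?thesis
      unfolding monoid_alg_coset
    proof (intro equalityI subsetI)
      fix z assume "z \<in> (\<lambda>r. r + s) ` ?R"
      then obtain r where "r \<in> ?R" "z = r + s" by blast
      then show "z \<in> (\<lambda>r. r + t) ` ?R" using Rr(1)[OF _ st] by (intro image_eqI[of _ _ "r + (s - t)"]) simp_all
    next
      fix z assume "z \<in> (\<lambda>r. r + t) ` ?R"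
      then obtain r where "r \<in> ?R" "z = r + t" by blast
      then show "z \<in> (\<lambda>r. r + s) ` ?R" using Rr(2)[OF _ st] by (intro image_eqI[of _ _ "r - (s - t)"]) simp_all
    qed
  qed
  show ?thesis
    unfolding triangular_decomposition_def bij_betw_def T
  proof
    show "inj_on (triangular_mult p N u L w T) ((\<lambda>t. ?R +>\<^bsub>monoid_alg TR.MPQ\<^esub> t) ` ?C)"
    proof (rule inj_onI)
      fix x y assume "x \<in> (\<lambda>t. ?R +>\<^bsub>monoid_alg TR.MPQ\<^esub> t) ` ?C" "y \<in> (\<lambda>t. ?R +>\<^bsub>monoid_alg TR.MPQ\<^esub> t) ` ?C"
        and e: "triangular_mult p N u L w T x = triangular_mult p N u L w T y"
      then obtain s t where st: "s \<in> ?C" "x = ?R +>\<^bsub>monoid_alg TR.MPQ\<^esub> s" "t \<in> ?C" "y = ?R +>\<^bsub>monoid_alg TR.MPQ\<^esub> t" by blast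
      have "?F s = ?F t" using e unfolding st(2,4) m[OF st(1)] m[OF st(3)] .
      then show "x = y" unfolding st(2,4) by (rule inj[OF st(1,3)])
    qed
    show "triangular_mult p N u L w T ` (\<lambda>t. ?R +>\<^bsub>monoid_alg TR.MPQ\<^esub> t) ` ?C = U"
    proof -
      have "(\<lambda>t. triangular_mult p N u L w T (?R +>\<^bsub>monoid_alg TR.MPQ\<^esub> t)) ` ?C = ?F ` ?C"
        by (rule image_cong[OF refl m])
      then show ?thesis unfolding image_image image .
    qed
  qed
qed

end

theorem theorem3p2:
  fixes p :: "'n::finite \<Rightarrow> 'n \<Rightarrow> 'k::field"
    and N :: "(('k, 'n) lin \<times> ('k, 'n) lin) set"
    and u :: "'l \<Rightarrow> ('k, 'n) npoly" and L :: "'l set"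
    and w :: "'t \<Rightarrow> ('k, 'n) npoly" and T :: "'t set"
    and U :: "('k, 'n) quo set"
  assumes "admissible p N"
    and "\<And>l. l \<in> L \<Longrightarrow> homogeneous_npoly (u l)"
    and "\<And>l v. l \<in> L \<Longrightarrow> v \<in> Poly_Mapping.keys (u l) \<Longrightarrow> length v > 1"
    and "\<And>t. t \<in> T \<Longrightarrow> homogeneous_npoly (w t)"
    and "\<And>t v. t \<in> T \<Longrightarrow> v \<in> Poly_Mapping.keys (w t) \<Longrightarrow> length v > 1"
    and "Ap_is_hopf p N u L"
    and "Am_is_hopf p N w T"
    and "right_coideal_subalgebra (A_alg p N u L w T) (A_coproduct p N u L w T) U"
    and "spanned_by_homogeneous (A_alg p N u L w T) (A_component p N u L w T) U"
    and "H_in_A p N u L w T \<subseteq> U"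
  shows "\<exists>Um Up.
      F_in_Am p N w T \<subseteq> Um \<and>
      right_coideal_subalgebra (Am_alg p N w T) (Am_coproduct p N w T) Um \<and>
      spanned_by_homogeneous (Am_alg p N w T) (Am_component p N w T) Um \<and>
      G_in_Ap p N u L \<subseteq> Up \<and>
      right_coideal_subalgebra (Ap_alg p N u L) (Ap_coproduct p N u L) Up \<and>
      spanned_by_homogeneous (Ap_alg p N u L) (Ap_component p N u L) Up \<and>
      triangular_decomposition p N u L w T U Um Up"
proof -
  \<comment> \<open>Both ideals are generated by homogeneous relations, so
    \<open>normal_form_exists\<close> supplies the normal words and reductions that the locale
    \<open>coid\<close> fixes.\<close>
  have "\<exists>Wm rm. (\<forall>v. supp (rm v) \<subseteq> {x \<in> Wm. count_list x = count_list v}) \<and> (\<forall>v. bas v - rm v \<in> word_ideal (w ` T)) \<and>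
      (\<forall>s\<in>word_ideal (w ` T). plin rm s = 0) \<and> (\<forall>v\<in>Wm. rm v = bas v)"
  proof (rule normal_form_exists[OF word_ideal_subspace[of "w ` T"] word_ideal_comp[of "w ` T"]])
    fix q assume "q \<in> w ` T"
    then show "homogeneous_npoly q" using assms(4) by blast
  qed (assumption, blast)
  then obtain Wm rm where m: "\<And>v. supp (rm v) \<subseteq> {x \<in> Wm. count_list x = count_list v}"
    "\<And>v. bas v - rm v \<in> word_ideal (w ` T)" "\<And>s. s \<in> word_ideal (w ` T) \<Longrightarrow> plin rm s = 0"
    "\<And>v. v \<in> Wm \<Longrightarrow> rm v = bas v" by blast
  have "\<exists>Wp rp. (\<forall>v. supp (rp v) \<subseteq> {x \<in> Wp. count_list x = count_list v}) \<and> (\<forall>v. bas v - rp v \<in> word_ideal (u ` L)) \<and>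
      (\<forall>s\<in>word_ideal (u ` L). plin rp s = 0) \<and> (\<forall>v\<in>Wp. rp v = bas v)"
  proof (rule normal_form_exists[OF word_ideal_subspace[of "u ` L"] word_ideal_comp[of "u ` L"]])
    fix q assume "q \<in> u ` L"
    then show "homogeneous_npoly q" using assms(2) by blast
  qed (assumption, blast)
  then obtain Wp rp where r: "\<And>v. supp (rp v) \<subseteq> {x \<in> Wp. count_list x = count_list v}"
    "\<And>v. bas v - rp v \<in> word_ideal (u ` L)" "\<And>s. s \<in> word_ideal (u ` L) \<Longrightarrow> plin rp s = 0"
    "\<And>v. v \<in> Wp \<Longrightarrow> rp v = bas v" by blast
  interpret coid p N u L w T Wm Wp rm rp U
  proof (unfold_locales, goal_cases)
    case 1 show ?case by (rule assms(1))
  next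
    case (2 l) then show ?case by (rule assms(2))
  next
    case (3 l v) then show ?case by (rule assms(3))
  next
    case (4 t) then show ?case by (rule assms(4))
  next
    case (5 t v) then show ?case by (rule assms(5))
  next
    case 6 show ?case by (rule assms(6))
  next
    case 7 show ?case by (rule assms(7))
  next
    case 8 show ?case by (rule m(1))
  next
    case 9 show ?case by (rule m(2))
  next
    case 10 then show ?case by (rule m(3))
  next
    case 11 then show ?case by (rule m(4))
  next
    case 12 show ?case by (rule r(1))
  next
    case 13 show ?case by (rule r(2))
  next
    case 14 then show ?case by (rule r(3))
  next
    case 15 then show ?case by (rule r(4))
  next
    case 16 show ?case by (rule assms(8))
  next
    case 17 show ?case by (rule assms(9))
  next
    case 18 show ?case by (rule assms(10))
  qed
  show ?thesis
    using F_in_Um Um_coideal Um_homogeneous G_in_Up Up_coideal Up_homogeneous triangular_decomposition_U by blast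
qed

end
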